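(* Let $I$ be a small category. For every functor $\mathcal{C}:I^{\mathrm{op}}\to\mathbf{Bicat}$ there exists a natural weak homotopy equivalence of simplicial sets $$\eta:\ \mathrm{hocolim}_I\,\Delta\mathcal{C}\longrightarrow \Delta\!\int_I\!\mathcal{C},$$ where $\Delta\mathcal{C}:I^{\mathrm{op}}\to\mathbf{Simpl.Set}$ is the diagram of simplicial sets obtained by composing $\mathcal{C}$ with the geometric nerve functor $\Delta:\mathbf{Bicat}\to\mathbf{Simpl.Set}$, and $\int_I\mathcal{C}$ is the bicategorical Grothendieck construction on $\mathcal{C}$.
   Context: **Bicategories.** Small bicategories have horizontal composition $\circ$, vertical composition of deformations (2-cells) $\cdot$, identities $1_x$, and invertible natural constraints $\boldsymbol a:u\circ(v\circ w)\Rightarrow(u\circ v)\circ w$, $\boldsymbol l_u:1_x\circ u\Rightarrow u$, $\boldsymbol r_u:u\circ1_y\Rightarrow u$ (for $u:y\to x$) satisfying the usual coherence axioms. A lax functor $F=(F,\widehat F)$ has structure deformations $\widehat F_{u,v}:Fu\circ Fv\Rightarrow F(u\circ v)$ and $\widehat F_x:1_{Fx}\Rightarrow F1_x$, natural and subject to the usual associativity and unit axioms; it is a homomorphism if all of these are invertible. $\mathbf{Bicat}$ is the category of small bicategories and homomorphisms. A category is regarded as a bicategory with only identity deformations. **Geometric nerve.** $[n]=\{0,\dots,n\}$ is regarded as the category with exactly one arrow $j\to i$ whenever $i\le j$. The geometric nerve of a bicategory $\mathcal{B}$ is the simplicial set $\Delta\mathcal{B}:[p]\mapsto\mathrm{LaxFunc}([p],\mathcal{B})$,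 whose $p$-simplices are all lax functors $[p]\rightsquigarrow\mathcal{B}$, simplicial operators being given by precomposition; it is functorial on lax functors (in particular on homomorphisms) by composition. **Diagram notation.** For a functor $\mathcal{C}:I^{\mathrm{op}}\to\mathbf{Bicat}$, write $\mathcal{C}_i$ for the bicategory at $i$ and $a^*:\mathcal{C}_i\rightsquigarrow\mathcal{C}_j$ for the homomorphism at $a:j\to i$; thus $b^*a^*=(ab)^*$ and $1_i^*=1_{\mathcal{C}_i}$. The structure constraints of $a^*$ are denoted $\widehat{a}^*$. **Homotopy colimit.** $\mathrm{hocolim}_I\Delta\mathcal{C}$ is the Bousfield–Kan homotopy colimit, i.e. the diagonal of the bisimplicial set $S_{p,q}=\bigsqcup_{G:[q]\to I}\mathrm{LaxFunc}([p],\mathcal{C}_{G0})$, with $(p,q)$-simplices the pairs $(F,G)$, $G:[q]\to I$ a functor and $F:[p]\rightsquigarrow\mathcal{C}_{G0}$ a lax functor; a map $\alpha:[p']\to[p]$ acts by $(F,G)\mapsto(F\alpha,G)$, and a map $\beta:[q']\to[q]$ acts by $(F,G)\mapsto(G_{0,\beta0}^*F,G\beta)$, where $G_{0,\beta 0}:G\beta0\to G0$ is the image under $G$ of the arrow $\beta0\to0$. **Grothendieck construction.** $\int_I\mathcal{C}$ is the bicategory whose objects are pairs $(x,i)$ with $i\in\mathrm{Ob}\,I$, $x\in\mathrm{Ob}\,\mathcal{C}_i$, and whose hom-categories are $$\textstyle\int_I\mathcal{C}\big((y,j),(x,i)\big)=\bigsqcup_{a:j\to i}\mathcal{C}_j(y,a^*x).$$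 So a morphism is a pair $(u,a):(y,j)\to(x,i)$ with $a:j\to i$ in $I$ and $u:y\to a^*x$ in $\mathcal{C}_j$; a deformation $(\phi,a):(u,a)\Rightarrow(u',a)$ is a deformation $\phi:u\Rightarrow u'$ in $\mathcal{C}_j$. Horizontal composition is $(u,a)\circ(v,b)=(b^*u\circ v,\,ab)$, $(\phi,a)\circ(\psi,b)=(b^*\phi\circ\psi,\,ab)$. For composable $(w,c),(v,b),(u,a)$, with $(w,c):(t,\ell)\to(z,k)$, the associativity constraint $(u,a)\circ((v,b)\circ(w,c))\cong((u,a)\circ(v,b))\circ(w,c)$ is the composite in $\mathcal{C}_\ell$ $$c^*b^*u\circ(c^*v\circ w)\xRightarrow{\ \boldsymbol a\ }(c^*b^*u\circ c^*v)\circ w\xRightarrow{\ \widehat c^*\circ1\ }c^*(b^*u\circ v)\circ w.$$ The identity of $(x,i)$ is $(1_x,1_i)$; for $(u,a):(y,j)\to(x,i)$ the left unit constraint $(1_x,1_i)\circ(u,a)=(a^*1_x\circ u,a)\cong(u,a)$ is the composite of the inverse of the unit constraint $\widehat a^*:1_{a^*x}\Rightarrow a^*1_x$ (whiskered with $u$) and $\boldsymbol l_u$; the right unit constraint $(u,a)\circ(1_y,1_j)=(u\circ1_y,a)\cong(u,a)$ is $\boldsymbol r_u$. "Natural" means natural in the diagram $\mathcal{C}$: a natural transformation of functors $I^{\mathrm{op}}\to\mathbf{Bicat}$ with components homomorphisms $F_i:\mathcal{C}_i\rightsquigarrow\mathcal{C}'_i$ induces maps on both sides, on the right by $(x,i)\mapsto(F_ix,i)$,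 $(u,a)\mapsto(F_ju,a)$, $(\phi,a)\mapsto(F_j\phi,a)$. *)

theory Defs
  imports "HOL-Homology.Homology"
begin

section \<open>Small categories and functors\<close>

record ('o, 'a) small_cat =
  Ob :: "'o set"
  Arr :: "'a set"
  adom :: "'a \<Rightarrow> 'o"
  acod :: "'a \<Rightarrow> 'o"
  aid :: "'o \<Rightarrow> 'a"
  acomp :: "'a \<Rightarrow> 'a \<Rightarrow> 'a"

locale small_category =
  fixes I :: "('o, 'a) small_cat"
  assumes dom_cod: "a \<in> Arr I \<Longrightarrow> adom I a \<in> Ob I \<and> acod I a \<in> Ob I"
    and id_arr: "i \<in> Ob I \<Longrightarrow> aid I i \<in> Arr I \<and> adom I (aid I i) = i \<and> acod I (aid I i) = i"
    and comp_arr: "\<lbrakk>a \<in> Arr I; b \<in> Arr I; adom I a = acod I b\<rbrakk>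
      \<Longrightarrow> acomp I a b \<in> Arr I \<and> adom I (acomp I a b) = adom I b \<and> acod I (acomp I a b) = acod I a"
    and comp_id_left: "a \<in> Arr I \<Longrightarrow> acomp I (aid I (acod I a)) a = a"
    and comp_id_right: "a \<in> Arr I \<Longrightarrow> acomp I a (aid I (adom I a)) = a"
    and comp_assoc: "\<lbrakk>a \<in> Arr I; b \<in> Arr I; c \<in> Arr I; adom I a = acod I b; adom I b = acod I c\<rbrakk>
      \<Longrightarrow> acomp I a (acomp I b c) = acomp I (acomp I a b) c"

text \<open>Functors, lax functors and monotone maps are normalised to \<open>undefined\<close> off their domain, so that
  equality in HOL is equality of functors and \<open>LaxFunc\<close> is a set in the intended sense.\<close>

record ('o, 'a, 'p, 'b) cat_map =
  fob :: "'o \<Rightarrow> 'p"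
  farr :: "'a \<Rightarrow> 'b"

locale cat_functor = I: small_category I + J: small_category J
  for I :: "('o, 'a) small_cat" and J :: "('p, 'b) small_cat" +
  fixes G :: "('o, 'a, 'p, 'b) cat_map"
  assumes fob: "fob G \<in> Ob I \<rightarrow>\<^sub>E Ob J"
    and farr: "farr G \<in> Arr I \<rightarrow>\<^sub>E Arr J"
    and fdom: "a \<in> Arr I \<Longrightarrow> adom J (farr G a) = fob G (adom I a)"
    and fcod: "a \<in> Arr I \<Longrightarrow> acod J (farr G a) = fob G (acod I a)"
    and fid: "i \<in> Ob I \<Longrightarrow> farr G (aid I i) = aid J (fob G i)"
    and fcomp: "\<lbrakk>a \<in> Arr I; b \<in> Arr I; adom I a = acod I b\<rbrakk>
      \<Longrightarrow> farr G (acomp I a b) = acomp J (farr G a) (farr G b)"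

text \<open>\<open>comp_functor I H G\<close> is the composite $H G$ of functors, where \<open>I\<close> is the domain of \<open>G\<close>.\<close>

definition comp_functor ::
  "('o, 'a) small_cat \<Rightarrow> ('p, 'b, 'q, 'c) cat_map \<Rightarrow> ('o, 'a, 'p, 'b) cat_map \<Rightarrow> ('o, 'a, 'q, 'c) cat_map"
where
  "comp_functor I H G = \<lparr>fob = compose (Ob I) (fob H) (fob G), farr = compose (Arr I) (farr H) (farr G)\<rparr>"

text \<open>The arrow $j \to i$ of $[n]$, for $i \le j$, is the pair \<open>(i, j)\<close>: target first.\<close>

definition ordinal :: "nat \<Rightarrow> (nat, nat \<times> nat) small_cat" where
  "ordinal n = \<lparr>Ob = {..n}, Arr = {(i, j). i \<le> j \<and> j \<le> n}, adom = snd, acod = fst,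
     aid = (\<lambda>i. (i, i)), acomp = (\<lambda>a b. (fst a, snd b))\<rparr>"

definition mono_maps :: "nat \<Rightarrow> nat \<Rightarrow> (nat \<Rightarrow> nat) set" where
  "mono_maps m n = {\<alpha> \<in> {..m} \<rightarrow>\<^sub>E {..n}. mono_on {..m} \<alpha>}"

definition ordinal_functor :: "nat \<Rightarrow> (nat \<Rightarrow> nat) \<Rightarrow> (nat, nat \<times> nat, nat, nat \<times> nat) cat_map" where
  "ordinal_functor m \<alpha> =
    \<lparr>fob = restrict \<alpha> {..m}, farr = restrict (\<lambda>(i, j). (\<alpha> i, \<alpha> j)) (Arr (ordinal m))\<rparr>"


section \<open>Bicategories\<close>

text \<open>\<open>Def\<close> is the set of deformations (2-cells); \<open>\<star>\<close> is horizontal composition of morphisms,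
  \<open>\<diamondop>\<close> is horizontal and \<open>\<cdot>\<close> vertical composition of deformations.\<close>

record ('o, 'm, 't) bicat =
  Obj :: "'o set"
  Mor :: "'m set"
  Def :: "'t set"
  src :: "'m \<Rightarrow> 'o"
  trg :: "'m \<Rightarrow> 'o"
  vsrc :: "'t \<Rightarrow> 'm"
  vtrg :: "'t \<Rightarrow> 'm"
  one :: "'o \<Rightarrow> 'm"
  hcomp :: "'m \<Rightarrow> 'm \<Rightarrow> 'm"  (infixl \<open>\<star>\<index>\<close> 75)
  vone :: "'m \<Rightarrow> 't"
  vcomp :: "'t \<Rightarrow> 't \<Rightarrow> 't"  (infixl \<open>\<cdot>\<index>\<close> 70)
  dcomp :: "'t \<Rightarrow> 't \<Rightarrow> 't"  (infixl \<open>\<diamondop>\<index>\<close> 75)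
  assoc :: "'m \<Rightarrow> 'm \<Rightarrow> 'm \<Rightarrow> 't"
  lunit :: "'m \<Rightarrow> 't"
  runit :: "'m \<Rightarrow> 't"

definition mor_hom :: "('o, 'm, 't) bicat \<Rightarrow> 'o \<Rightarrow> 'o \<Rightarrow> 'm set" where
  "mor_hom B y x = {u \<in> Mor B. src B u = y \<and> trg B u = x}"

definition def_hom :: "('o, 'm, 't) bicat \<Rightarrow> 'm \<Rightarrow> 'm \<Rightarrow> 't set" where
  "def_hom B u v = {\<phi> \<in> Def B. vsrc B \<phi> = u \<and> vtrg B \<phi> = v}"

definition composable :: "('o, 'm, 't) bicat \<Rightarrow> 'm \<Rightarrow> 'm \<Rightarrow> bool" where
  "composable B u v \<longleftrightarrow> u \<in> Mor B \<and> v \<in> Mor B \<and> src B u = trg B v"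

definition inverse_defs :: "('o, 'm, 't) bicat \<Rightarrow> 't \<Rightarrow> 't \<Rightarrow> bool" where
  "inverse_defs B \<phi> \<psi> \<longleftrightarrow> \<phi> \<in> Def B \<and> \<psi> \<in> def_hom B (vtrg B \<phi>) (vsrc B \<phi>) \<and>
     vcomp B \<psi> \<phi> = vone B (vsrc B \<phi>) \<and> vcomp B \<phi> \<psi> = vone B (vtrg B \<phi>)"

definition invertible_def :: "('o, 'm, 't) bicat \<Rightarrow> 't \<Rightarrow> bool" where
  "invertible_def B \<phi> \<longleftrightarrow> (\<exists>\<psi>. inverse_defs B \<phi> \<psi>)"

definition inv_def :: "('o, 'm, 't) bicat \<Rightarrow> 't \<Rightarrow> 't" where
  "inv_def B \<phi> = (THE \<psi>. inverse_defs B \<phi> \<psi>)"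

locale bicategory =
  fixes B :: "('o, 'm, 't) bicat" (structure)
  assumes mor_src_trg: "u \<in> Mor B \<Longrightarrow> src B u \<in> Obj B \<and> trg B u \<in> Obj B"
    and def_src_trg: "\<phi> \<in> Def B \<Longrightarrow> vsrc B \<phi> \<in> Mor B \<and> vtrg B \<phi> \<in> Mor B \<and>
      src B (vtrg B \<phi>) = src B (vsrc B \<phi>) \<and> trg B (vtrg B \<phi>) = trg B (vsrc B \<phi>)"
    \<comment> \<open>hom-categories\<close>
    and vone_hom: "u \<in> Mor B \<Longrightarrow> vone B u \<in> def_hom B u u"
    and vcomp_hom: "\<lbrakk>\<phi> \<in> def_hom B u v; \<psi> \<in> def_hom B v w\<rbrakk> \<Longrightarrow> \<psi> \<cdot> \<phi> \<in> def_hom B u w"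
    and vcomp_one_left: "\<phi> \<in> Def B \<Longrightarrow> vone B (vtrg B \<phi>) \<cdot> \<phi> = \<phi>"
    and vcomp_one_right: "\<phi> \<in> Def B \<Longrightarrow> \<phi> \<cdot> vone B (vsrc B \<phi>) = \<phi>"
    and vcomp_assoc: "\<lbrakk>\<phi> \<in> def_hom B u v; \<psi> \<in> def_hom B v w; \<theta> \<in> def_hom B w t\<rbrakk>
      \<Longrightarrow> \<theta> \<cdot> (\<psi> \<cdot> \<phi>) = (\<theta> \<cdot> \<psi>) \<cdot> \<phi>"
    \<comment> \<open>identities and horizontal composition functors\<close>
    and one_hom: "x \<in> Obj B \<Longrightarrow> one B x \<in> mor_hom B x x"
    and hcomp_hom: "\<lbrakk>u \<in> mor_hom B y x; v \<in> mor_hom B z y\<rbrakk> \<Longrightarrow> u \<star> v \<in> mor_hom B z x"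
    and dcomp_hom: "\<lbrakk>\<phi> \<in> def_hom B u u'; \<psi> \<in> def_hom B v v'; composable B u v\<rbrakk>
      \<Longrightarrow> \<phi> \<diamondop> \<psi> \<in> def_hom B (u \<star> v) (u' \<star> v')"
    and dcomp_vone: "composable B u v \<Longrightarrow> vone B u \<diamondop> vone B v = vone B (u \<star> v)"
    and interchange: "\<lbrakk>\<phi> \<in> def_hom B u u'; \<phi>' \<in> def_hom B u' u''; \<psi> \<in> def_hom B v v';
      \<psi>' \<in> def_hom B v' v''; composable B u v\<rbrakk>
      \<Longrightarrow> (\<phi>' \<cdot> \<phi>) \<diamondop> (\<psi>' \<cdot> \<psi>) = (\<phi>' \<diamondop> \<psi>') \<cdot> (\<phi> \<diamondop> \<psi>)"
    \<comment> \<open>constraints: type, invertibility, naturality\<close>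
    and assoc_hom: "\<lbrakk>composable B u v; composable B v w\<rbrakk>
      \<Longrightarrow> assoc B u v w \<in> def_hom B (u \<star> (v \<star> w)) ((u \<star> v) \<star> w)"
    and assoc_inv: "\<lbrakk>composable B u v; composable B v w\<rbrakk> \<Longrightarrow> invertible_def B (assoc B u v w)"
    and assoc_nat: "\<lbrakk>\<phi> \<in> def_hom B u u'; \<psi> \<in> def_hom B v v'; \<theta> \<in> def_hom B w w';
      composable B u v; composable B v w\<rbrakk>
      \<Longrightarrow> assoc B u' v' w' \<cdot> (\<phi> \<diamondop> (\<psi> \<diamondop> \<theta>)) = ((\<phi> \<diamondop> \<psi>) \<diamondop> \<theta>) \<cdot> assoc B u v w"
    and lunit_hom: "u \<in> mor_hom B y x \<Longrightarrow> lunit B u \<in> def_hom B (one B x \<star> u) u"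
    and lunit_inv: "u \<in> Mor B \<Longrightarrow> invertible_def B (lunit B u)"
    and lunit_nat: "\<lbrakk>\<phi> \<in> def_hom B u v; u \<in> mor_hom B y x\<rbrakk>
      \<Longrightarrow> lunit B v \<cdot> (vone B (one B x) \<diamondop> \<phi>) = \<phi> \<cdot> lunit B u"
    and runit_hom: "u \<in> mor_hom B y x \<Longrightarrow> runit B u \<in> def_hom B (u \<star> one B y) u"
    and runit_inv: "u \<in> Mor B \<Longrightarrow> invertible_def B (runit B u)"
    and runit_nat: "\<lbrakk>\<phi> \<in> def_hom B u v; u \<in> mor_hom B y x\<rbrakk>
      \<Longrightarrow> runit B v \<cdot> (\<phi> \<diamondop> vone B (one B y)) = \<phi> \<cdot> runit B u"
    \<comment> \<open>coherence\<close>
    and pentagon: "\<lbrakk>composable B t u; composable B u v; composable B v w\<rbrakk>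
      \<Longrightarrow> assoc B (t \<star> u) v w \<cdot> assoc B t u (v \<star> w) =
        (assoc B t u v \<diamondop> vone B w) \<cdot> assoc B t (u \<star> v) w \<cdot> (vone B t \<diamondop> assoc B u v w)"
    and triangle: "\<lbrakk>u \<in> mor_hom B y x; v \<in> mor_hom B z y\<rbrakk>
      \<Longrightarrow> (runit B u \<diamondop> vone B v) \<cdot> assoc B u (one B y) v = vone B u \<diamondop> lunit B v"

definition cat_bicat :: "('o, 'a) small_cat \<Rightarrow> ('o, 'a, 'a) bicat" where
  "cat_bicat I = \<lparr>Obj = Ob I, Mor = Arr I, Def = Arr I, src = adom I, trg = acod I,
     vsrc = (\<lambda>a. a), vtrg = (\<lambda>a. a), one = aid I, hcomp = acomp I,
     vone = (\<lambda>a. a), vcomp = (\<lambda>a b. a), dcomp = acomp I,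
     assoc = (\<lambda>a b c. acomp I a (acomp I b c)), lunit = (\<lambda>a. a), runit = (\<lambda>a. a)\<rparr>"


section \<open>Lax functors and homomorphisms\<close>

record ('o, 'm, 't, 'p, 'n, 's) lax =
  Fobj :: "'o \<Rightarrow> 'p"
  Fmor :: "'m \<Rightarrow> 'n"
  Fdef :: "'t \<Rightarrow> 's"
  Fcomp :: "'m \<Rightarrow> 'm \<Rightarrow> 's"
  Funit :: "'o \<Rightarrow> 's"

locale lax_functor = A: bicategory A + B: bicategory B
  for A :: "('o, 'm, 't) bicat" and B :: "('p, 'n, 's) bicat" +
  fixes F :: "('o, 'm, 't, 'p, 'n, 's) lax"
  assumes Fobj: "Fobj F \<in> Obj A \<rightarrow>\<^sub>E Obj B"
    and Fmor_ext: "Fmor F \<in> extensional (Mor A)"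
    and Fmor: "u \<in> mor_hom A y x \<Longrightarrow> Fmor F u \<in> mor_hom B (Fobj F y) (Fobj F x)"
    and Fdef_ext: "Fdef F \<in> extensional (Def A)"
    and Fdef: "\<phi> \<in> def_hom A u v \<Longrightarrow> Fdef F \<phi> \<in> def_hom B (Fmor F u) (Fmor F v)"
    and Fdef_vone: "u \<in> Mor A \<Longrightarrow> Fdef F (vone A u) = vone B (Fmor F u)"
    and Fdef_vcomp: "\<lbrakk>\<phi> \<in> def_hom A u v; \<psi> \<in> def_hom A v w\<rbrakk>
      \<Longrightarrow> Fdef F (\<psi> \<cdot>\<^bsub>A\<^esub> \<phi>) = Fdef F \<psi> \<cdot>\<^bsub>B\<^esub> Fdef F \<phi>"
    and Fcomp_ext: "\<not> composable A u v \<Longrightarrow> Fcomp F u v = undefined"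
    and Fcomp: "composable A u v
      \<Longrightarrow> Fcomp F u v \<in> def_hom B (Fmor F u \<star>\<^bsub>B\<^esub> Fmor F v) (Fmor F (u \<star>\<^bsub>A\<^esub> v))"
    and Fcomp_nat: "\<lbrakk>\<phi> \<in> def_hom A u u'; \<psi> \<in> def_hom A v v'; composable A u v\<rbrakk>
      \<Longrightarrow> Fcomp F u' v' \<cdot>\<^bsub>B\<^esub> (Fdef F \<phi> \<diamondop>\<^bsub>B\<^esub> Fdef F \<psi>) = Fdef F (\<phi> \<diamondop>\<^bsub>A\<^esub> \<psi>) \<cdot>\<^bsub>B\<^esub> Fcomp F u v"
    and Funit_ext: "Funit F \<in> extensional (Obj A)"
    and Funit: "x \<in> Obj A \<Longrightarrow> Funit F x \<in> def_hom B (one B (Fobj F x)) (Fmor F (one A x))"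
    and Fassoc: "\<lbrakk>composable A u v; composable A v w\<rbrakk>
      \<Longrightarrow> Fdef F (assoc A u v w) \<cdot>\<^bsub>B\<^esub> Fcomp F u (v \<star>\<^bsub>A\<^esub> w) \<cdot>\<^bsub>B\<^esub> (vone B (Fmor F u) \<diamondop>\<^bsub>B\<^esub> Fcomp F v w) =
        Fcomp F (u \<star>\<^bsub>A\<^esub> v) w \<cdot>\<^bsub>B\<^esub> (Fcomp F u v \<diamondop>\<^bsub>B\<^esub> vone B (Fmor F w)) \<cdot>\<^bsub>B\<^esub>
          assoc B (Fmor F u) (Fmor F v) (Fmor F w)"
    and Flunit: "u \<in> mor_hom A y x
      \<Longrightarrow> Fdef F (lunit A u) \<cdot>\<^bsub>B\<^esub> Fcomp F (one A x) u \<cdot>\<^bsub>B\<^esub> (Funit F x \<diamondop>\<^bsub>B\<^esub> vone B (Fmor F u)) =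
        lunit B (Fmor F u)"
    and Frunit: "u \<in> mor_hom A y x
      \<Longrightarrow> Fdef F (runit A u) \<cdot>\<^bsub>B\<^esub> Fcomp F u (one A y) \<cdot>\<^bsub>B\<^esub> (vone B (Fmor F u) \<diamondop>\<^bsub>B\<^esub> Funit F y) =
        runit B (Fmor F u)"

locale homomorphism = lax_functor A B F
  for A :: "('o, 'm, 't) bicat" and B :: "('p, 'n, 's) bicat" and F +
  assumes Fcomp_inv: "composable A u v \<Longrightarrow> invertible_def B (Fcomp F u v)"
    and Funit_inv: "x \<in> Obj A \<Longrightarrow> invertible_def B (Funit F x)"

text \<open>\<open>comp_lax A C G F\<close> is the composite $G F$ of $F : A \to B$ and $G : B \to C$.\<close>

definition comp_lax :: "('o, 'm, 't) bicat \<Rightarrow> ('q, 'l, 'r) bicat \<Rightarrow>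
  ('p, 'n, 's, 'q, 'l, 'r) lax \<Rightarrow> ('o, 'm, 't, 'p, 'n, 's) lax \<Rightarrow> ('o, 'm, 't, 'q, 'l, 'r) lax"
where
  "comp_lax A C G F = \<lparr>
     Fobj = compose (Obj A) (Fobj G) (Fobj F),
     Fmor = compose (Mor A) (Fmor G) (Fmor F),
     Fdef = compose (Def A) (Fdef G) (Fdef F),
     Fcomp = (\<lambda>u v. if composable A u v
       then Fdef G (Fcomp F u v) \<cdot>\<^bsub>C\<^esub> Fcomp G (Fmor F u) (Fmor F v) else undefined),
     Funit = (\<lambda>x\<in>Obj A. Fdef G (Funit F x) \<cdot>\<^bsub>C\<^esub> Funit G (Fobj F x))\<rparr>"

definition id_lax :: "('o, 'm, 't) bicat \<Rightarrow> ('o, 'm, 't, 'o, 'm, 't) lax" where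
  "id_lax A = \<lparr>Fobj = (\<lambda>x\<in>Obj A. x), Fmor = (\<lambda>u\<in>Mor A. u), Fdef = (\<lambda>\<phi>\<in>Def A. \<phi>),
     Fcomp = (\<lambda>u v. if composable A u v then vone A (u \<star>\<^bsub>A\<^esub> v) else undefined),
     Funit = (\<lambda>x\<in>Obj A. vone A (one A x))\<rparr>"

text \<open>A functor between categories, as a lax functor (with identity constraints) between the
  associated bicategories.\<close>

definition functor_lax ::
  "('o, 'a) small_cat \<Rightarrow> ('o, 'a, 'p, 'b) cat_map \<Rightarrow> ('o, 'a, 'a, 'p, 'b, 'b) lax"
where
  "functor_lax I G = \<lparr>Fobj = fob G, Fmor = farr G, Fdef = farr G,
     Fcomp = (\<lambda>a b. if composable (cat_bicat I) a b then farr G (acomp I a b) else undefined),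
     Funit = (\<lambda>i\<in>Ob I. farr G (aid I i))\<rparr>"


section \<open>Simplicial sets\<close>

text \<open>\<open>act X m n \<alpha> : X\<^sub>n \<rightarrow> X\<^sub>m\<close> is the operator of $\alpha : [m] \to [n]$.\<close>

record 'x sset =
  Sim :: "nat \<Rightarrow> 'x set"
  act :: "nat \<Rightarrow> nat \<Rightarrow> (nat \<Rightarrow> nat) \<Rightarrow> 'x \<Rightarrow> 'x"

locale simplicial_set =
  fixes X :: "'x sset"
  assumes act_closed: "\<lbrakk>\<alpha> \<in> mono_maps m n; x \<in> Sim X n\<rbrakk> \<Longrightarrow> act X m n \<alpha> x \<in> Sim X m"
    and act_id: "x \<in> Sim X n \<Longrightarrow> act X n n (\<lambda>i\<in>{..n}. i) x = x"
    and act_comp: "\<lbrakk>\<beta> \<in> mono_maps k m; \<alpha> \<in> mono_maps m n; x \<in> Sim X n\<rbrakk>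
      \<Longrightarrow> act X k n (compose {..k} \<alpha> \<beta>) x = act X k m \<beta> (act X m n \<alpha> x)"

locale sset_map = X: simplicial_set X + Y: simplicial_set Y
  for X :: "'x sset" and Y :: "'y sset" +
  fixes f :: "nat \<Rightarrow> 'x \<Rightarrow> 'y"
  assumes map_closed: "x \<in> Sim X n \<Longrightarrow> f n x \<in> Sim Y n"
    and map_act: "\<lbrakk>\<alpha> \<in> mono_maps m n; x \<in> Sim X n\<rbrakk>
      \<Longrightarrow> f m (act X m n \<alpha> x) = act Y m n \<alpha> (f n x)"

definition nerve :: "('o, 'm, 't) bicat \<Rightarrow> (nat, nat \<times> nat, nat \<times> nat, 'o, 'm, 't) lax sset" where
  "nerve B = \<lparr>
     Sim = (\<lambda>p. {F. lax_functor (cat_bicat (ordinal p)) B F}),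
     act = (\<lambda>m n \<alpha> F. comp_lax (cat_bicat (ordinal m)) B F
       (functor_lax (ordinal m) (ordinal_functor m \<alpha>)))\<rparr>"

definition nerve_map :: "('p, 'n, 's) bicat \<Rightarrow> ('o, 'm, 't, 'p, 'n, 's) lax \<Rightarrow>
  nat \<Rightarrow> (nat, nat \<times> nat, nat \<times> nat, 'o, 'm, 't) lax \<Rightarrow> (nat, nat \<times> nat, nat \<times> nat, 'p, 'n, 's) lax"
where
  "nerve_map B H p F = comp_lax (cat_bicat (ordinal p)) B H F"


section \<open>Homotopy colimits of diagrams of simplicial sets\<close>

record 'x bisset =
  BSim :: "nat \<Rightarrow> nat \<Rightarrow> 'x set"
  hact :: "nat \<Rightarrow> nat \<Rightarrow> (nat \<Rightarrow> nat) \<Rightarrow> nat \<Rightarrow> 'x \<Rightarrow> 'x"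
  vact :: "nat \<Rightarrow> nat \<Rightarrow> nat \<Rightarrow> (nat \<Rightarrow> nat) \<Rightarrow> 'x \<Rightarrow> 'x"

text \<open>\<open>hact S p' p \<alpha> q : S\<^sub>p\<^sub>,\<^sub>q \<rightarrow> S\<^sub>p\<^sub>'\<^sub>,\<^sub>q\<close> and \<open>vact S p q' q \<beta> : S\<^sub>p\<^sub>,\<^sub>q \<rightarrow> S\<^sub>p\<^sub>,\<^sub>q\<^sub>'\<close>.\<close>

definition diagonal :: "'x bisset \<Rightarrow> 'x sset" where
  "diagonal S = \<lparr>Sim = (\<lambda>n. BSim S n n),
     act = (\<lambda>m n \<alpha> s. hact S m n \<alpha> m (vact S n m n \<alpha> s))\<rparr>"

text \<open>A diagram of simplicial sets on $I^{op}$: \<open>SM X a : SO X (acod I a) \<rightarrow> SO X (adom I a)\<close>.\<close>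

record ('i, 'a, 'x) sset_diagram =
  SO :: "'i \<Rightarrow> 'x sset"
  SM :: "'a \<Rightarrow> nat \<Rightarrow> 'x \<Rightarrow> 'x"

type_synonym ('i, 'a, 'x) hocolim_simplex = "'x \<times> (nat, nat \<times> nat, 'i, 'a) cat_map"

definition hocolim_bisset ::
  "('i, 'a) small_cat \<Rightarrow> ('i, 'a, 'x) sset_diagram \<Rightarrow> ('i, 'a, 'x) hocolim_simplex bisset"
where
  "hocolim_bisset I X = \<lparr>
     BSim = (\<lambda>p q. {(x, G). cat_functor (ordinal q) I G \<and> x \<in> Sim (SO X (fob G 0)) p}),
     hact = (\<lambda>p' p \<alpha> q (x, G). (act (SO X (fob G 0)) p' p \<alpha> x, G)),
     vact = (\<lambda>p q' q \<beta> (x, G).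
       (SM X (farr G (0, \<beta> 0)) p x, comp_functor (ordinal q') G (ordinal_functor q' \<beta>)))\<rparr>"

definition hocolim ::
  "('i, 'a) small_cat \<Rightarrow> ('i, 'a, 'x) sset_diagram \<Rightarrow> ('i, 'a, 'x) hocolim_simplex sset"
where
  "hocolim I X = diagonal (hocolim_bisset I X)"

text \<open>The map of homotopy colimits induced by a transformation with components \<open>\<Psi> i\<close>.\<close>

definition hocolim_map :: "('i \<Rightarrow> nat \<Rightarrow> 'x \<Rightarrow> 'y) \<Rightarrow>
  nat \<Rightarrow> ('i, 'a, 'x) hocolim_simplex \<Rightarrow> ('i, 'a, 'y) hocolim_simplex"
where
  "hocolim_map \<Psi> n = (\<lambda>(x, G). (\<Psi> (fob G 0) n x, G))"


section \<open>Diagrams of bicategories and the Grothendieck construction\<close>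

text \<open>A functor $C : I^{op} \to Bicat$: \<open>CO C i\<close> is $C_i$ and \<open>CM C a\<close> is $a^*$.\<close>

record ('i, 'a, 'o, 'm, 't) bicat_diagram =
  CO :: "'i \<Rightarrow> ('o, 'm, 't) bicat"
  CM :: "'a \<Rightarrow> ('o, 'm, 't, 'o, 'm, 't) lax"

locale diagram = I: small_category I
  for I :: "('i, 'a) small_cat" +
  fixes C :: "('i, 'a, 'o, 'm, 't) bicat_diagram"
  assumes CO: "i \<in> Ob I \<Longrightarrow> bicategory (CO C i)"
    and CM: "a \<in> Arr I \<Longrightarrow> homomorphism (CO C (acod I a)) (CO C (adom I a)) (CM C a)"
    and CM_id: "i \<in> Ob I \<Longrightarrow> CM C (aid I i) = id_lax (CO C i)"
    and CM_comp: "\<lbrakk>a \<in> Arr I; b \<in> Arr I; adom I a = acod I b\<rbrakk>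
      \<Longrightarrow> CM C (acomp I a b) = comp_lax (CO C (acod I a)) (CO C (adom I b)) (CM C b) (CM C a)"

locale diagram_map = C: diagram I C + C': diagram I C'
  for I :: "('i, 'a) small_cat"
    and C :: "('i, 'a, 'o, 'm, 't) bicat_diagram" and C' :: "('i, 'a, 'p, 'n, 's) bicat_diagram" +
  fixes \<Phi> :: "'i \<Rightarrow> ('o, 'm, 't, 'p, 'n, 's) lax"
  assumes component: "i \<in> Ob I \<Longrightarrow> homomorphism (CO C i) (CO C' i) (\<Phi> i)"
    and naturality: "a \<in> Arr I \<Longrightarrow>
      comp_lax (CO C (acod I a)) (CO C' (adom I a)) (\<Phi> (adom I a)) (CM C a) =
      comp_lax (CO C (acod I a)) (CO C' (adom I a)) (CM C' a) (\<Phi> (acod I a))"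

definition nerve_diagram :: "('i, 'a) small_cat \<Rightarrow> ('i, 'a, 'o, 'm, 't) bicat_diagram \<Rightarrow>
  ('i, 'a, (nat, nat \<times> nat, nat \<times> nat, 'o, 'm, 't) lax) sset_diagram"
where
  "nerve_diagram I C =
    \<lparr>SO = (\<lambda>i. nerve (CO C i)), SM = (\<lambda>a. nerve_map (CO C (adom I a)) (CM C a))\<rparr>"

text \<open>A morphism $(u,a) : (y,j) \to (x,i)$ is the triple \<open>(x, u, a)\<close>, and a deformation $(\phi,a)$
  between such morphisms is \<open>(x, \<phi>, a)\<close>. The component \<open>x\<close> has to be recorded, because \<open>u\<close> only determines
  the object $a^*x$, whereas \<open>y\<close>, \<open>j\<close> and \<open>i\<close> are determined by \<open>u\<close> and \<open>a\<close>.\<close>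

definition grothendieck :: "('i, 'a) small_cat \<Rightarrow> ('i, 'a, 'o, 'm, 't) bicat_diagram \<Rightarrow>
  ('o \<times> 'i, 'o \<times> 'm \<times> 'a, 'o \<times> 't \<times> 'a) bicat"
where
  "grothendieck I C = \<lparr>
     Obj = {(x, i). i \<in> Ob I \<and> x \<in> Obj (CO C i)},
     Mor = {(x, u, a). a \<in> Arr I \<and> x \<in> Obj (CO C (acod I a)) \<and> u \<in> Mor (CO C (adom I a)) \<and>
       trg (CO C (adom I a)) u = Fobj (CM C a) x},
     Def = {(x, \<phi>, a). a \<in> Arr I \<and> x \<in> Obj (CO C (acod I a)) \<and> \<phi> \<in> Def (CO C (adom I a)) \<and>
       trg (CO C (adom I a)) (vsrc (CO C (adom I a)) \<phi>) = Fobj (CM C a) x},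
     src = (\<lambda>(x, u, a). (src (CO C (adom I a)) u, adom I a)),
     trg = (\<lambda>(x, u, a). (x, acod I a)),
     vsrc = (\<lambda>(x, \<phi>, a). (x, vsrc (CO C (adom I a)) \<phi>, a)),
     vtrg = (\<lambda>(x, \<phi>, a). (x, vtrg (CO C (adom I a)) \<phi>, a)),
     one = (\<lambda>(x, i). (x, one (CO C i) x, aid I i)),
     hcomp = (\<lambda>(x, u, a) (y, v, b).
       (x, Fmor (CM C b) u \<star>\<^bsub>CO C (adom I b)\<^esub> v, acomp I a b)),
     vone = (\<lambda>(x, u, a). (x, vone (CO C (adom I a)) u, a)),
     vcomp = (\<lambda>(x, \<psi>, a) (x', \<phi>, a'). (x, \<psi> \<cdot>\<^bsub>CO C (adom I a)\<^esub> \<phi>, a)),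
     dcomp = (\<lambda>(x, \<phi>, a) (y, \<psi>, b).
       (x, Fdef (CM C b) \<phi> \<diamondop>\<^bsub>CO C (adom I b)\<^esub> \<psi>, acomp I a b)),
     assoc = (\<lambda>(x, u, a) (y, v, b) (z, w, c).
       let D = CO C (adom I c); b_u = Fmor (CM C b) u in
       (x, (Fcomp (CM C c) b_u v \<diamondop>\<^bsub>D\<^esub> vone D w) \<cdot>\<^bsub>D\<^esub> assoc D (Fmor (CM C c) b_u) (Fmor (CM C c) v) w,
        acomp I (acomp I a b) c)),
     lunit = (\<lambda>(x, u, a).
       let D = CO C (adom I a) in
       (x, lunit D u \<cdot>\<^bsub>D\<^esub> (inv_def D (Funit (CM C a) x) \<diamondop>\<^bsub>D\<^esub> vone D u), a)),
     runit = (\<lambda>(x, u, a). (x, runit (CO C (adom I a)) u, a))\<rparr>"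

text \<open>The homomorphism of Grothendieck constructions induced by a transformation with components
  \<open>\<Phi> i\<close>. Since \<open>\<Phi>\<close> commutes with $b^*$, the constraint of $(u,a), (v,b)$ with $b : k \to j$ is that of
  $\Phi_k$ at $b^*u, v$.\<close>

definition grothendieck_map :: "('i, 'a) small_cat \<Rightarrow> ('i, 'a, 'o, 'm, 't) bicat_diagram \<Rightarrow>
  ('i \<Rightarrow> ('o, 'm, 't, 'p, 'n, 's) lax) \<Rightarrow>
  ('o \<times> 'i, 'o \<times> 'm \<times> 'a, 'o \<times> 't \<times> 'a, 'p \<times> 'i, 'p \<times> 'n \<times> 'a, 'p \<times> 's \<times> 'a) lax"
where
  "grothendieck_map I C \<Phi> = \<lparr>
     Fobj = (\<lambda>(x, i)\<in>Obj (grothendieck I C). (Fobj (\<Phi> i) x, i)),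
     Fmor = (\<lambda>(x, u, a)\<in>Mor (grothendieck I C).
       (Fobj (\<Phi> (acod I a)) x, Fmor (\<Phi> (adom I a)) u, a)),
     Fdef = (\<lambda>(x, \<phi>, a)\<in>Def (grothendieck I C).
       (Fobj (\<Phi> (acod I a)) x, Fdef (\<Phi> (adom I a)) \<phi>, a)),
     Fcomp = (\<lambda>f g. if composable (grothendieck I C) f g
       then (case (f, g) of ((x, u, a), (y, v, b)) \<Rightarrow>
         (Fobj (\<Phi> (acod I a)) x, Fcomp (\<Phi> (adom I b)) (Fmor (CM C b) u) v, acomp I a b))
       else undefined),
     Funit = (\<lambda>(x, i)\<in>Obj (grothendieck I C). (Fobj (\<Phi> i) x, Funit (\<Phi> i) x, aid I i))\<rparr>"


section \<open>Geometric realization and weak homotopy equivalences\<close>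

definition quotient_topology :: "'a topology \<Rightarrow> ('a \<Rightarrow> 'b) \<Rightarrow> 'b topology" where
  "quotient_topology X q =
    topology (\<lambda>U. U \<subseteq> q ` topspace X \<and> openin X {x \<in> topspace X. q x \<in> U})"

lemma openin_quotient_topology:
  "openin (quotient_topology X q) U \<longleftrightarrow> U \<subseteq> q ` topspace X \<and> openin X {x \<in> topspace X. q x \<in> U}"
proof -
  have "istopology (\<lambda>U. U \<subseteq> q ` topspace X \<and> openin X {x \<in> topspace X. q x \<in> U})"
    unfolding istopology_def
  proof (intro conjI allI impI; (elim conjE)?)
    fix S T assume "openin X {x \<in> topspace X. q x \<in> S}" "openin X {x \<in> topspace X. q x \<in> T}"
    then have "openin X ({x \<in> topspace X. q x \<in> S} \<inter> {x \<in> topspace X. q x \<in> T})" by blast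
    also have "{x \<in> topspace X. q x \<in> S} \<inter> {x \<in> topspace X. q x \<in> T} = {x \<in> topspace X. q x \<in> S \<inter> T}"
      by auto
    finally show "openin X {x \<in> topspace X. q x \<in> S \<inter> T}" .
  next
    fix \<K> assume *: "\<forall>K\<in>\<K>. K \<subseteq> q ` topspace X \<and> openin X {x \<in> topspace X. q x \<in> K}"
    have "openin X (\<Union>K\<in>\<K>. {x \<in> topspace X. q x \<in> K})" using * by blast
    also have "(\<Union>K\<in>\<K>. {x \<in> topspace X. q x \<in> K}) = {x \<in> topspace X. q x \<in> \<Union>\<K>}" by auto
    finally show "openin X {x \<in> topspace X. q x \<in> \<Union>\<K>}" .
  qed auto
  then show ?thesis unfolding quotient_topology_def by simp
qed

lemma topspace_quotient_topology: "topspace (quotient_topology X q) = q ` topspace X"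
proof -
  have "{x \<in> topspace X. q x \<in> q ` topspace X} = topspace X" by auto
  then have "openin (quotient_topology X q) (q ` topspace X)"
    by (simp add: openin_quotient_topology)
  then show ?thesis
    by (meson openin_quotient_topology openin_subset openin_topspace subset_antisym)
qed

lemma quotient_map_quotient_topology: "quotient_map X (quotient_topology X q) q"
  unfolding quotient_map_def topspace_quotient_topology
  by (auto simp: openin_quotient_topology)

type_synonym 'x rpoint = "nat \<times> 'x \<times> (nat \<Rightarrow> real)"

definition pre_realization :: "'x sset \<Rightarrow> 'x rpoint topology" where
  "pre_realization X = sum_topology (\<lambda>n. prod_topology (discrete_topology (Sim X n))
     (subtopology (powertop_real UNIV) (standard_simplex n))) UNIV"

text \<open>The affine map of standard simplices that extends the map \<open>\<alpha>\<close> of vertices.\<close>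

definition simplex_push :: "nat \<Rightarrow> (nat \<Rightarrow> nat) \<Rightarrow> (nat \<Rightarrow> real) \<Rightarrow> nat \<Rightarrow> real" where
  "simplex_push m \<alpha> t = (\<lambda>i. \<Sum>j | j \<le> m \<and> \<alpha> j = i. t j)"

definition glue :: "'x sset \<Rightarrow> ('x rpoint \<times> 'x rpoint) set" where
  "glue X = {((m, act X m n \<alpha> x, t), (n, x, simplex_push m \<alpha> t)) | m n \<alpha> x t.
     \<alpha> \<in> mono_maps m n \<and> x \<in> Sim X n \<and> t \<in> standard_simplex m}"

definition rclass :: "'x sset \<Rightarrow> 'x rpoint \<Rightarrow> 'x rpoint set" where
  "rclass X z = {w. (z, w) \<in> (glue X \<union> (glue X)\<inverse>)\<^sup>*}"

definition realization :: "'x sset \<Rightarrow> 'x rpoint set topology" where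
  "realization X = quotient_topology (pre_realization X) (rclass X)"

text \<open>The union ranges over the representatives of a class, and all its members are equal. The same
  device defines the induced maps on homotopy classes below.\<close>

definition realization_map :: "'y sset \<Rightarrow> (nat \<Rightarrow> 'x \<Rightarrow> 'y) \<Rightarrow> 'x rpoint set \<Rightarrow> 'y rpoint set" where
  "realization_map Y f c = (\<Union>(n, x, t)\<in>c. rclass Y (n, f n x, t))"

definition cube :: "nat \<Rightarrow> (nat \<Rightarrow> real) topology" where
  "cube n = product_topology (\<lambda>_. top_of_set {0..1}) {..<n}"

definition cube_boundary :: "nat \<Rightarrow> (nat \<Rightarrow> real) set" where
  "cube_boundary n = {t \<in> topspace (cube n). \<exists>i<n. t i = 0 \<or> t i = 1}"

definition based_cubes :: "nat \<Rightarrow> 'a topology \<Rightarrow> 'a \<Rightarrow> ((nat \<Rightarrow> real) \<Rightarrow> 'a) set" where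
  "based_cubes n X x = {g. continuous_map (cube n) X g \<and> g ` cube_boundary n \<subseteq> {x}}"

definition homotopy_class ::
  "nat \<Rightarrow> 'a topology \<Rightarrow> 'a \<Rightarrow> ((nat \<Rightarrow> real) \<Rightarrow> 'a) \<Rightarrow> ((nat \<Rightarrow> real) \<Rightarrow> 'a) set"
where
  "homotopy_class n X x g =
    Collect (homotopic_with (\<lambda>h. h ` cube_boundary n \<subseteq> {x}) (cube n) X g)"

definition homotopy_group :: "nat \<Rightarrow> 'a topology \<Rightarrow> 'a \<Rightarrow> ((nat \<Rightarrow> real) \<Rightarrow> 'a) set set" where
  "homotopy_group n X x = homotopy_class n X x ` based_cubes n X x"

definition homotopy_group_map :: "nat \<Rightarrow> 'b topology \<Rightarrow> ('a \<Rightarrow> 'b) \<Rightarrow> 'a \<Rightarrow>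
  ((nat \<Rightarrow> real) \<Rightarrow> 'a) set \<Rightarrow> ((nat \<Rightarrow> real) \<Rightarrow> 'b) set"
where
  "homotopy_group_map n Y f x \<gamma> = (\<Union>g\<in>\<gamma>. homotopy_class n Y (f x) (f \<circ> g))"

definition path_components_map :: "'b topology \<Rightarrow> ('a \<Rightarrow> 'b) \<Rightarrow> 'a set \<Rightarrow> 'b set" where
  "path_components_map Y f c = (\<Union>x\<in>c. path_component_of_set Y (f x))"

text \<open>The induced maps on homotopy groups are group homomorphisms, so bijectivity already means that they are
  isomorphisms; the group structure itself is not needed.\<close>

definition weak_homotopy_equivalence :: "'a topology \<Rightarrow> 'b topology \<Rightarrow> ('a \<Rightarrow> 'b) \<Rightarrow> bool" where
  "weak_homotopy_equivalence X Y f \<longleftrightarrow> continuous_map X Y f \<and>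
     bij_betw (path_components_map Y f) (path_components_of X) (path_components_of Y) \<and>
     (\<forall>x\<in>topspace X. \<forall>n\<ge>1.
        bij_betw (homotopy_group_map n Y f x) (homotopy_group n X x) (homotopy_group n Y (f x)))"

definition sset_weak_equivalence :: "'x sset \<Rightarrow> 'y sset \<Rightarrow> (nat \<Rightarrow> 'x \<Rightarrow> 'y) \<Rightarrow> bool" where
  "sset_weak_equivalence X Y f \<longleftrightarrow> sset_map X Y f \<and>
     weak_homotopy_equivalence (realization X) (realization Y) (realization_map Y f)"

end

theory Submission
  imports Defs "HOL-Analysis.Abstract_Topological_Spaces"
begin

text \<open>A simplex of the nerve of \<open>grothendieck I C\<close> with vertices over \<open>i\<^sub>0, \<dots>, i\<^sub>N\<close> can be
  transported along the diagram: for every \<open>j\<close> its initial part up to \<open>j\<close> becomes a simplex of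
  the nerve of \<open>CO C i\<^sub>j\<close>, the column over \<open>j\<close>. Hence a \<open>(p + 1 + q)\<close>-simplex gives a
  \<open>(p, q)\<close>-simplex of the bisimplicial set: its first \<open>p + 1\<close> vertices, transported to the next one,
  and the image in \<open>I\<close> of its last \<open>q + 1\<close> vertices. This is an inverse of \<open>\<eta>\<close> up to edgewise
  subdivision: a simplex of the threefold subdivision consists of three consecutive blocks, of which two
  are used, and each composite with \<open>\<eta>\<close> is joined to the restriction to one block by a map into the
  twofold subdivision, that is by a straight-line homotopy. Since the realization of the subdivision is
  homeomorphic to the realization, \<open>\<eta>\<close> realizes to a homotopy equivalence.\<close>

section \<open>Standard simplices and blockwise operators\<close>

text \<open>The obstacle is that pullback goes one way: an object over a vertex can be carried to
  the fibres over later vertices, never back. Over its j-th vertex a simplex of the Grothendieck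
  construction therefore shows only its part up to j, so its columns form a triangle, whereas a
  simplex of the homotopy colimit is a rectangle with columns of equal length. A rectangle inside
  the triangle takes all fibre vertices before all base vertices; this costs two blocks, and the
  third block carries the restriction with which a composite is compared. Two choices of a pair
  (fibre block, base block) can be joined by a simplex when they are comparable in both entries. All
  identities hold on the nose, because the pullbacks compose strictly, and \<eta> is defined by
  components, so naturality is a computation. The pullbacks are homomorphisms and not just lax:
  inverses of their unit constraints occur in the left unit constraint of
  \<open>grothendieck I C\<close>, and the invertibility of its associativity constraint comes from
  that of their composition constraints.\<close>

abbreviation simplex_space :: "nat \<Rightarrow> (nat \<Rightarrow> real) topology" where
  "simplex_space n \<equiv> subtopology (powertop_real UNIV) (standard_simplex n)"

lemma topspace_simplex_space [simp]: "topspace (simplex_space n) = standard_simplex n"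
  by simp

lemma simplex_nonneg: "t \<in> standard_simplex n \<Longrightarrow> 0 \<le> t i"
  and simplex_zero: "t \<in> standard_simplex n \<Longrightarrow> n < i \<Longrightarrow> t i = 0"
  and simplex_sum: "t \<in> standard_simplex n \<Longrightarrow> (\<Sum>i\<le>n. t i) = 1"
  by (auto simp: standard_simplex_def)

text \<open>The upper bound 1 on the coordinates, part of \<open>standard_simplex\<close>, follows
  from the rest: a nonnegative summand is at most the total.\<close>

lemma simplexI:
  assumes "\<And>i. 0 \<le> t i" "\<And>i. n < i \<Longrightarrow> t i = 0" "(\<Sum>i\<le>n. t i) = 1"
  shows "t \<in> standard_simplex n"
proof -
  have "t i \<le> 1" for i
  proof (cases "i \<le> n")
    case True
    then have "t i \<le> (\<Sum>i\<le>n. t i)" by (intro member_le_sum) (use assms in auto)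
    then show ?thesis using assms by simp
  qed (use assms in auto)
  then show ?thesis using assms by (auto simp: standard_simplex_def)
qed

lemma simplex_push_eq: "simplex_push m \<alpha> t i = (\<Sum>j\<le>m. if \<alpha> j = i then t j else 0)"
proof -
  have "{j. j \<le> m \<and> \<alpha> j = i} = {..m} \<inter> {j. \<alpha> j = i}" by auto
  then show ?thesis unfolding simplex_push_def by (simp add: sum.If_cases)
qed

lemma simplex_push_cong: "(\<And>j. j \<le> m \<Longrightarrow> \<alpha> j = \<beta> j) \<Longrightarrow> simplex_push m \<alpha> t = simplex_push m \<beta> t"
  by (intro ext) (simp add: simplex_push_eq)

text \<open>A point of a simplex is a probability measure on the vertices and
  \<open>simplex_push\<close> is the push-forward, so this is change of variables. Constant
  \<open>f\<close> gives the total mass, indicators of fibres give functoriality, and indicators of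
  initial segments give distribution functions in \<open>mono_maps_push_inj\<close>.\<close>

lemma simplex_push_sum:
  assumes "\<alpha> \<in> {..m} \<rightarrow> {..n}"
  shows "(\<Sum>i\<le>n. f i * simplex_push m \<alpha> t i) = (\<Sum>j\<le>m. f (\<alpha> j) * t j)"
proof -
  have "(\<Sum>i\<le>n. f i * simplex_push m \<alpha> t i) = (\<Sum>i\<le>n. \<Sum>j\<le>m. if \<alpha> j = i then f (\<alpha> j) * t j else 0)"
    by (auto simp: simplex_push_eq sum_distrib_left intro!: sum.cong)
  also have "\<dots> = (\<Sum>j\<le>m. \<Sum>i\<le>n. if \<alpha> j = i then f (\<alpha> j) * t j else 0)" by (rule sum.swap)
  also have "\<dots> = (\<Sum>j\<le>m. f (\<alpha> j) * t j)"
    by (intro sum.cong refl) (use assms in \<open>auto simp: sum.delta'\<close>)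
  finally show ?thesis .
qed

lemma simplex_push_in:
  assumes "\<alpha> \<in> {..m} \<rightarrow> {..n}" "t \<in> standard_simplex m"
  shows "simplex_push m \<alpha> t \<in> standard_simplex n"
proof (rule simplexI)
  show "0 \<le> simplex_push m \<alpha> t i" for i
    unfolding simplex_push_eq by (intro sum_nonneg) (use assms in \<open>auto simp: simplex_nonneg\<close>)
  show "simplex_push m \<alpha> t i = 0" if "n < i" for i
  proof -
    have "\<alpha> j \<noteq> i" if "j \<le> m" for j using Pi_mem[OF assms(1), of j] \<open>n < i\<close> that by auto
    then show ?thesis by (simp add: simplex_push_eq)
  qed
  show "(\<Sum>i\<le>n. simplex_push m \<alpha> t i) = 1"
    using simplex_push_sum[OF assms(1), of "\<lambda>_. 1" t] assms by (simp add: simplex_sum)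
qed

lemma simplex_push_comp:
  assumes "\<beta> \<in> {..k} \<rightarrow> {..m}"
  shows "simplex_push m \<alpha> (simplex_push k \<beta> t) = simplex_push k (\<lambda>i. \<alpha> (\<beta> i)) t"
proof
  fix i
  show "simplex_push m \<alpha> (simplex_push k \<beta> t) i = simplex_push k (\<lambda>i. \<alpha> (\<beta> i)) t i"
    using simplex_push_sum[OF assms, of "\<lambda>j. if \<alpha> j = i then 1 else 0" t]
    by (simp add: simplex_push_eq[of m] simplex_push_eq[of k "\<lambda>i. \<alpha> (\<beta> i)"] if_distrib if_distribR cong: if_cong)
qed

lemma continuous_map_simplex_push:
  assumes "\<alpha> \<in> {..m} \<rightarrow> {..n}"
  shows "continuous_map (simplex_space m) (simplex_space n) (simplex_push m \<alpha>)"
proof -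
  have "continuous_map (simplex_space m) euclideanreal (\<lambda>t. simplex_push m \<alpha> t i)" for i
    unfolding simplex_push_def
    by (intro continuous_map_sum continuous_map_from_subtopology continuous_map_product_projection) auto
  then show ?thesis
    using simplex_push_in[OF assms]
    by (auto simp: continuous_map_in_subtopology continuous_map_componentwise_UNIV)
qed

lemma mono_mapsD:
  assumes "\<alpha> \<in> mono_maps m n"
  shows "\<alpha> \<in> {..m} \<rightarrow> {..n}" "\<alpha> \<in> {..m} \<rightarrow>\<^sub>E {..n}" "\<And>i. i \<le> m \<Longrightarrow> \<alpha> i \<le> n"
    "\<And>i j. i \<le> j \<Longrightarrow> j \<le> m \<Longrightarrow> \<alpha> i \<le> \<alpha> j" "\<And>i. m < i \<Longrightarrow> \<alpha> i = undefined"
  using assms by (auto simp: mono_maps_def mono_on_def PiE_def extensional_def)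

lemma mono_maps_restrictI:
  assumes "\<And>i. i \<le> m \<Longrightarrow> \<alpha> i \<le> n" "\<And>i j. i \<le> j \<Longrightarrow> j \<le> m \<Longrightarrow> \<alpha> i \<le> \<alpha> j"
  shows "restrict \<alpha> {..m} \<in> mono_maps m n"
  using assms by (auto simp: mono_maps_def mono_on_def)

lemma mono_maps_id: "(\<lambda>i\<in>{..n}. i) \<in> mono_maps n n"
  by (rule mono_maps_restrictI) auto

lemma mono_maps_compose:
  assumes "\<beta> \<in> mono_maps k m" "\<alpha> \<in> mono_maps m n"
  shows "compose {..k} \<alpha> \<beta> \<in> mono_maps k n"
  unfolding compose_def
  by (rule mono_maps_restrictI) (use assms in \<open>auto simp: mono_mapsD\<close>)

lemma mono_maps_eqI:
  assumes "\<alpha> \<in> mono_maps m n" "\<beta> \<in> mono_maps m n'" "\<And>i. i \<le> m \<Longrightarrow> \<alpha> i = \<beta> i"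
  shows "\<alpha> = \<beta>"
  using assms by (metis ext mono_mapsD(5) not_le)

lemma finite_mono_maps: "finite (mono_maps m n)"
  unfolding mono_maps_def by (rule finite_subset[OF _ finite_PiE[of "{..m}" "\<lambda>_. {..n}"]]) auto

text \<open>The interval $[r(n+1)+n]$ is the join of $r+1$ blocks $[n]$; \<open>blocks r m n \<alpha>\<close> acts by \<open>\<alpha>\<close> on each of
  them.\<close>

definition blocks :: "nat \<Rightarrow> nat \<Rightarrow> nat \<Rightarrow> (nat \<Rightarrow> nat) \<Rightarrow> nat \<Rightarrow> nat" where
  "blocks r m n \<alpha> = (\<lambda>i\<in>{..r * Suc m + m}. (i div Suc m) * Suc n + \<alpha> (i mod Suc m))"

definition block :: "nat \<Rightarrow> nat \<Rightarrow> nat \<Rightarrow> nat" where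
  "block b n = (\<lambda>k\<in>{..n}. b * Suc n + k)"

text \<open>The product measure of \<open>w\<close> on the blocks and \<open>t\<close> inside a
  block, in lexicographic numbering: block \<open>b\<close> gets total weight \<open>w b\<close>,
  and the inner coordinates are the same in all blocks.\<close>

definition spread :: "(nat \<Rightarrow> real) \<Rightarrow> nat \<Rightarrow> (nat \<Rightarrow> real) \<Rightarrow> nat \<Rightarrow> real" where
  "spread w n t = (\<lambda>i. w (i div Suc n) * t (i mod Suc n))"

text \<open>Division with remainder as an exchange of one bound for two: blockwise maps are computed
  at \<open>b * Suc n + k\<close>, with a block number \<open>b\<close> and a position
  \<open>k\<close>.\<close>

lemma block_decomp:
  "i \<le> r * Suc n + n \<longleftrightarrow> (\<exists>b k. b \<le> r \<and> k \<le> n \<and> i = b * Suc n + k)"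
proof
  assume "i \<le> r * Suc n + n"
  then have "i < Suc r * Suc n" by simp
  then have "i div Suc n \<le> r" by (metis less_Suc_eq_le less_mult_imp_div_less)
  moreover have "i mod Suc n \<le> n" by (metis less_Suc_eq_le mod_less_divisor zero_less_Suc)
  ultimately show "\<exists>b k. b \<le> r \<and> k \<le> n \<and> i = b * Suc n + k" by (metis div_mult_mod_eq)
next
  assume "\<exists>b k. b \<le> r \<and> k \<le> n \<and> i = b * Suc n + k"
  then show "i \<le> r * Suc n + n" by (auto intro: add_mono mult_le_mono1 simp del: mult_Suc_right)
qed

lemma block_div: "k \<le> n \<Longrightarrow> (b * Suc n + k) div Suc n = b"
  and block_mod: "k \<le> n \<Longrightarrow> (b * Suc n + k) mod Suc n = k"
proof -
  assume "k \<le> n"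
  then have k: "k < Suc n" by simp
  show "(b * Suc n + k) mod Suc n = k" using k by (metis mod_less mod_mult_self3)
  show "(b * Suc n + k) div Suc n = b" using k by (metis Suc_neq_Zero add.right_neutral div_less div_mult_self3)
qed

text \<open>The numbering of the blocks is lexicographic; the monotonicity of all maps between
  blocks is read off from this comparison.\<close>

lemma block_le_iff:
  assumes "k \<le> n" "l \<le> n"
  shows "b * Suc n + k \<le> c * Suc n + l \<longleftrightarrow> b < c \<or> b = c \<and> k \<le> l"
proof (cases b c rule: linorder_cases)
  case less
  then have "b * Suc n + Suc n \<le> c * Suc n" by (metis Suc_leI add.commute mult_Suc mult_le_mono1)
  with assms less show ?thesis by linarith
next
  case greater
  then have "c * Suc n + Suc n \<le> b * Suc n" by (metis Suc_leI add.commute mult_Suc mult_le_mono1)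
  with assms greater show ?thesis by linarith
qed simp

lemma blocks_apply:
  "b \<le> r \<Longrightarrow> k \<le> m \<Longrightarrow> blocks r m n \<alpha> (b * Suc m + k) = b * Suc n + \<alpha> k"
  unfolding blocks_def by (subst restrict_apply') (use block_decomp[of "b * Suc m + k" r m] in blast, simp only: block_div block_mod)

lemma blocks_mono:
  assumes "\<alpha> \<in> mono_maps m n"
  shows "blocks r m n \<alpha> \<in> mono_maps (r * Suc m + m) (r * Suc n + n)"
proof -
  let ?f = "blocks r m n \<alpha>"
  have "restrict ?f {..r * Suc m + m} \<in> mono_maps (r * Suc m + m) (r * Suc n + n)"
  proof (rule mono_maps_restrictI)
    fix i assume "i \<le> r * Suc m + m"
    then obtain b k where "b \<le> r" "k \<le> m" "i = b * Suc m + k" unfolding block_decomp by auto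
    then show "?f i \<le> r * Suc n + n"
      unfolding block_decomp[of "?f i"] using blocks_apply mono_mapsD(3)[OF assms] by blast
  next
    fix i j assume ij: "i \<le> j" "j \<le> r * Suc m + m"
    then have "i \<le> r * Suc m + m" by simp
    then obtain b k where i: "b \<le> r" "k \<le> m" "i = b * Suc m + k" unfolding block_decomp by auto
    obtain c l where j: "c \<le> r" "l \<le> m" "j = c * Suc m + l" using ij unfolding block_decomp by auto
    have "b < c \<or> b = c \<and> k \<le> l" using ij block_le_iff i j by blast
    then have "b < c \<or> b = c \<and> \<alpha> k \<le> \<alpha> l" using mono_mapsD(4)[OF assms] j by blast
    then have "b * Suc n + \<alpha> k \<le> c * Suc n + \<alpha> l" using mono_mapsD(3)[OF assms] i j by (subst block_le_iff) auto
    then show "?f i \<le> ?f j" using blocks_apply i j by simp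
  qed
  moreover have "restrict ?f {..r * Suc m + m} = ?f" by (auto simp: blocks_def)
  ultimately show ?thesis by simp
qed

lemma block_mono: "b \<le> r \<Longrightarrow> block b n \<in> mono_maps n (r * Suc n + n)"
  unfolding block_def by (rule mono_maps_restrictI) (unfold block_decomp[of _ r], blast, simp)

lemma blocks_eqI:
  assumes "f \<in> mono_maps (r * Suc m + m) p" "g \<in> mono_maps (r * Suc m + m) q"
    and "\<And>b k. b \<le> r \<Longrightarrow> k \<le> m \<Longrightarrow> f (b * Suc m + k) = g (b * Suc m + k)"
  shows "f = g"
  by (rule mono_maps_eqI[OF assms(1,2)]) (use assms(3) in \<open>unfold block_decomp[of _ r m], blast\<close>)

lemma blocks_id: "blocks r n n (\<lambda>i\<in>{..n}. i) = (\<lambda>i\<in>{..r * Suc n + n}. i)"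
proof (rule blocks_eqI[OF blocks_mono[OF mono_maps_id] mono_maps_id])
  fix b k assume "b \<le> r" "k \<le> n"
  moreover from this have "b * Suc n + k \<in> {..r * Suc n + n}"
    unfolding atMost_iff block_decomp[of _ r n] by blast
  ultimately show "blocks r n n (\<lambda>i\<in>{..n}. i) (b * Suc n + k) = (\<lambda>i\<in>{..r * Suc n + n}. i) (b * Suc n + k)"
    by (simp only: blocks_apply restrict_apply' atMost_iff)
qed

lemma blocks_comp:
  assumes "\<beta> \<in> mono_maps k m" "\<alpha> \<in> mono_maps m n"
  shows "blocks r k n (compose {..k} \<alpha> \<beta>) =
    compose {..r * Suc k + k} (blocks r m n \<alpha>) (blocks r k m \<beta>)"
proof (rule blocks_eqI)
  show "blocks r k n (compose {..k} \<alpha> \<beta>) \<in> mono_maps (r * Suc k + k) (r * Suc n + n)"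
    by (intro blocks_mono mono_maps_compose[OF assms])
  show "compose {..r * Suc k + k} (blocks r m n \<alpha>) (blocks r k m \<beta>) \<in> mono_maps (r * Suc k + k) (r * Suc n + n)"
    by (rule mono_maps_compose[OF blocks_mono[OF assms(1)] blocks_mono[OF assms(2)]])
  fix b l assume "b \<le> r" "l \<le> k"
  moreover from this have "b * Suc k + l \<le> r * Suc k + k" unfolding block_decomp[of _ r k] by blast
  ultimately show "blocks r k n (compose {..k} \<alpha> \<beta>) (b * Suc k + l) =
    compose {..r * Suc k + k} (blocks r m n \<alpha>) (blocks r k m \<beta>) (b * Suc k + l)"
    using mono_mapsD(3)[OF assms(1)] by (simp add: compose_def blocks_apply block_def del: mult_Suc_right mult_Suc)
qed

text \<open>Naturality of the inclusion of one block; it makes the restriction to block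
  \<open>b\<close> a simplicial map in \<open>sset_map_block\<close>.\<close>

lemma blocks_block:
  assumes "\<alpha> \<in> mono_maps m n" "b \<le> r"
  shows "compose {..m} (blocks r m n \<alpha>) (block b m) = compose {..m} (block b n) \<alpha>"
  using assms mono_mapsD(3)[OF assms(1)] by (auto simp: compose_def block_def blocks_apply simp del: mult_Suc_right)

lemma sum_blocks: "(\<Sum>i\<le>r * Suc n + n. f i) = (\<Sum>b\<le>r. \<Sum>k\<le>n. f (b * Suc n + k))"
proof -
  have "(\<Sum>i\<le>r * Suc n + n. f i) = sum f {..<Suc r * Suc n}" by (intro sum.cong) auto
  also have "\<dots> = (\<Sum>b<Suc r. sum f {b * Suc n..<b * Suc n + Suc n})" by (rule sum.nat_group[symmetric])
  also have "\<dots> = (\<Sum>b\<le>r. \<Sum>k\<le>n. f (b * Suc n + k))"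
  proof (rule sum.cong)
    fix b
    show "sum f {b * Suc n..<b * Suc n + Suc n} = (\<Sum>k\<le>n. f (b * Suc n + k))"
      using sum.shift_bounds_nat_ivl[of f 0 "b * Suc n" "Suc n"] 
      by (simp add: add.commute atLeast0LessThan lessThan_Suc_atMost del: mult_Suc_right)
  qed (simp add: lessThan_Suc_atMost)
  finally show ?thesis .
qed

lemma spread_in:
  assumes w: "w \<in> standard_simplex r" and t: "t \<in> standard_simplex n"
  shows "spread w n t \<in> standard_simplex (r * Suc n + n)"
proof (rule simplexI)
  show "0 \<le> spread w n t i" for i
    unfolding spread_def using w t by (simp add: simplex_nonneg)
  show "spread w n t i = 0" if "r * Suc n + n < i" for i
  proof -
    have "Suc r * Suc n \<le> i" using that by simp
    then have "Suc r \<le> i div Suc n" by (metis div_le_mono nonzero_mult_div_cancel_right nat.distinct(1))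
    then show ?thesis using simplex_zero[OF w] by (simp add: spread_def)
  qed
  show "(\<Sum>i\<le>r * Suc n + n. spread w n t i) = 1"
    unfolding sum_blocks using simplex_sum[OF w] simplex_sum[OF t]
    by (simp add: spread_def block_div block_mod sum_distrib_left[symmetric] del: mult_Suc_right)
qed

text \<open>A product measure is pushed forward factor by factor, and \<open>blocks\<close> is the
  identity on block numbers and \<open>\<alpha>\<close> on positions. This compatibility makes
  \<open>spread_map\<close> well defined on classes.\<close>

lemma simplex_push_blocks:
  assumes \<alpha>: "\<alpha> \<in> mono_maps m n" and w: "w \<in> standard_simplex r"
  shows "simplex_push (r * Suc m + m) (blocks r m n \<alpha>) (spread w m t) = spread w n (simplex_push m \<alpha> t)"
proof
  fix i
  define c l where "c = i div Suc n" and "l = i mod Suc n"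
  have l: "l \<le> n" unfolding l_def by (metis less_Suc_eq_le mod_less_divisor zero_less_Suc)
  have i: "i = c * Suc n + l" unfolding c_def l_def by (metis div_mult_mod_eq)
  have eq: "b * Suc n + \<alpha> k = i \<longleftrightarrow> b = c \<and> \<alpha> k = l" if "k \<le> m" for b k
    using mono_mapsD(3)[OF \<alpha> that] l unfolding i
    by (metis block_div block_mod)
  have "simplex_push (r * Suc m + m) (blocks r m n \<alpha>) (spread w m t) i =
    (\<Sum>b\<le>r. \<Sum>k\<le>m. if b * Suc n + \<alpha> k = i then w b * t k else 0)"
    unfolding simplex_push_eq sum_blocks spread_def
    by (intro sum.cong refl) (simp add: blocks_apply block_div block_mod del: mult_Suc_right)
  also have "\<dots> = (\<Sum>b\<le>r. if b = c then (\<Sum>k\<le>m. if \<alpha> k = l then w c * t k else 0) else 0)"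
  proof (rule sum.cong[OF refl])
    fix b
    have "(\<Sum>k\<le>m. if b * Suc n + \<alpha> k = i then w b * t k else 0) =
      (\<Sum>k\<le>m. if b = c \<and> \<alpha> k = l then w b * t k else 0)"
      by (rule sum.cong) (simp_all only: eq atMost_iff)
    then show "(\<Sum>k\<le>m. if b * Suc n + \<alpha> k = i then w b * t k else 0) =
      (if b = c then (\<Sum>k\<le>m. if \<alpha> k = l then w c * t k else 0) else 0)"
      by (cases "b = c") (simp_all del: mult_Suc_right cong: if_cong)
  qed
  also have "\<dots> = (\<Sum>k\<le>m. if \<alpha> k = l then w c * t k else 0)"
    using simplex_zero[OF w, of c] by (simp cong: if_cong)
  also have "\<dots> = spread w n (simplex_push m \<alpha> t) i"
    unfolding spread_def simplex_push_eq c_def[symmetric] l_def[symmetric] sum_distrib_left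
    by (intro sum.cong) auto
  finally show "simplex_push (r * Suc m + m) (blocks r m n \<alpha>) (spread w m t) i = spread w n (simplex_push m \<alpha> t) i" .
qed

text \<open>At a vertex of the weight simplex the spread point lies on the face spanned by one
  block. Geometric spreading thus meets a simplicial operator there, which is how block restrictions
  enter the homotopies.\<close>

lemma simplex_push_block:
  assumes "t \<in> standard_simplex n"
  shows "simplex_push n (block b n) t = spread (\<lambda>j. if j = b then 1 else 0) n t"
proof
  fix i
  define c l where "c = i div Suc n" and "l = i mod Suc n"
  have l: "l \<le> n" unfolding l_def by (metis less_Suc_eq_le mod_less_divisor zero_less_Suc)
  have i: "i = c * Suc n + l" unfolding c_def l_def by (metis div_mult_mod_eq)
  have eq: "b * Suc n + k = i \<longleftrightarrow> c = b \<and> k = l" if "k \<le> n" for k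
    using that l unfolding i by (metis block_div block_mod)
  have "simplex_push n (block b n) t i = (\<Sum>k\<le>n. if k = l then (if c = b then t k else 0) else 0)"
    unfolding simplex_push_eq
    by (intro sum.cong refl) (simp add: block_def eq del: mult_Suc_right)
  also have "\<dots> = spread (\<lambda>j. if j = b then 1 else 0) n t i"
    using l by (simp add: spread_def c_def[symmetric] l_def[symmetric])
  finally show "simplex_push n (block b n) t i = spread (\<lambda>j. if j = b then 1 else 0) n t i" .
qed

section \<open>Geometric realization\<close>

text \<open>A product with a discrete space is a disjoint union of copies of the other factor, so
  openness is tested on slices.\<close>

lemma openin_prod_discrete:
  "openin (prod_topology (discrete_topology S) T) W \<longleftrightarrow>
    W \<subseteq> S \<times> topspace T \<and> (\<forall>x\<in>S. openin T {t. (x, t) \<in> W})"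
proof
  assume W: "openin (prod_topology (discrete_topology S) T) W"
  have "openin T {t. (x, t) \<in> W}" if "x \<in> S" for x
    unfolding openin_subopen[of T "{t. (x, t) \<in> W}"]
  proof clarify
    fix t assume "(x, t) \<in> W"
    with W obtain U V where "openin T V" "x \<in> U" "t \<in> V" "U \<times> V \<subseteq> W"
      unfolding openin_prod_topology_alt by metis
    then show "\<exists>V. openin T V \<and> t \<in> V \<and> V \<subseteq> {t. (x, t) \<in> W}" by blast
  qed
  moreover have "W \<subseteq> S \<times> topspace T" using openin_subset[OF W] by simp
  ultimately show "W \<subseteq> S \<times> topspace T \<and> (\<forall>x\<in>S. openin T {t. (x, t) \<in> W})" by blast
next
  assume W: "W \<subseteq> S \<times> topspace T \<and> (\<forall>x\<in>S. openin T {t. (x, t) \<in> W})"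
  then have "W = (\<Union>x\<in>S. {x} \<times> {t. (x, t) \<in> W})" by auto
  moreover have "openin (prod_topology (discrete_topology S) T) (\<Union>x\<in>S. {x} \<times> {t. (x, t) \<in> W})"
    using W by (intro openin_Union) (auto simp: openin_prod_Times_iff)
  ultimately show "openin (prod_topology (discrete_topology S) T) W" by simp
qed

definition points :: "'x sset \<Rightarrow> 'x rpoint set" where
  "points X = {(n, x, t). x \<in> Sim X n \<and> t \<in> standard_simplex n}"

lemma topspace_pre_realization: "topspace (pre_realization X) = points X"
  unfolding pre_realization_def points_def by auto

lemma openin_pre_realization:
  "openin (pre_realization X) W \<longleftrightarrow> W \<subseteq> points X \<and>
    (\<forall>n. \<forall>x\<in>Sim X n. openin (simplex_space n) {t. (n, x, t) \<in> W})"
proof -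
  have "openin (pre_realization X) W \<longleftrightarrow> W \<subseteq> points X \<and>
    (\<forall>n. openin (prod_topology (discrete_topology (Sim X n)) (simplex_space n)) {z. (n, z) \<in> W})"
    unfolding pre_realization_def openin_sum_topology by (auto simp: points_def)
  also have "\<dots> \<longleftrightarrow> W \<subseteq> points X \<and> (\<forall>n. \<forall>x\<in>Sim X n. openin (simplex_space n) {t. (n, x, t) \<in> W})"
    unfolding openin_prod_discrete by (fastforce simp: points_def)
  finally show ?thesis .
qed

lemma rclass_refl: "z \<in> rclass X z"
  by (simp add: rclass_def)

lemma rclass_eqI:
  assumes "(z, w) \<in> (glue X \<union> (glue X)\<inverse>)\<^sup>*"
  shows "rclass X z = rclass X w"
proof -
  have "sym ((glue X \<union> (glue X)\<inverse>)\<^sup>*)" by (intro sym_rtrancl) (auto simp: sym_def)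
  then have "(w, z) \<in> (glue X \<union> (glue X)\<inverse>)\<^sup>*" using assms by (auto dest: symD)
  then show ?thesis using assms unfolding rclass_def by (auto intro: rtrancl_trans)
qed

lemma rclass_glue:
  assumes "\<alpha> \<in> mono_maps m n" "x \<in> Sim X n" "t \<in> standard_simplex m"
  shows "rclass X (m, act X m n \<alpha> x, t) = rclass X (n, x, simplex_push m \<alpha> t)"
proof -
  have "((m, act X m n \<alpha> x, t), (n, x, simplex_push m \<alpha> t)) \<in> glue X"
    unfolding glue_def using assms by blast
  then show ?thesis by (intro rclass_eqI) blast
qed

definition glue_invariant :: "'x sset \<Rightarrow> ('x rpoint \<Rightarrow> 'b) \<Rightarrow> bool" where
  "glue_invariant X g \<longleftrightarrow> (\<forall>m n. \<forall>\<alpha>\<in>mono_maps m n. \<forall>x\<in>Sim X n. \<forall>t\<in>standard_simplex m.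
     g (m, act X m n \<alpha> x, t) = g (n, x, simplex_push m \<alpha> t))"

text \<open>Points of one class are joined by a zigzag of elementary gluings, and an invariant map
  is constant along each of them in either direction.\<close>

lemma glue_invariant_rclass:
  assumes "glue_invariant X g" "w \<in> rclass X z"
  shows "g w = g z"
proof -
  have "(z, w) \<in> (glue X \<union> (glue X)\<inverse>)\<^sup>*" using assms(2) by (simp add: rclass_def)
  then show ?thesis
  proof (induction rule: rtrancl_induct)
    case (step y w)
    then show ?case using assms(1) unfolding glue_invariant_def glue_def by fastforce
  qed simp
qed

text \<open>The values used below are themselves classes, hence sets. For an invariant map the union
  over the representatives is the common value, so no representative has to be chosen.\<close>

definition rlift :: "('x rpoint \<Rightarrow> 'b set) \<Rightarrow> 'x rpoint set \<Rightarrow> 'b set" where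
  "rlift g c = (\<Union>z\<in>c. g z)"

lemma rlift_rclass:
  assumes "glue_invariant X g"
  shows "rlift g (rclass X z) = g z"
proof -
  have "(\<Union>w\<in>rclass X z. g w) = (\<Union>w\<in>rclass X z. g z)"
    using glue_invariant_rclass[OF assms] by (rule SUP_cong[OF refl])
  then show ?thesis using rclass_refl[of z X] unfolding rlift_def by auto
qed

lemma topspace_realization: "topspace (realization X) = rclass X ` points X"
  unfolding realization_def topspace_quotient_topology topspace_pre_realization ..

lemma rclass_in_realization:
  "x \<in> Sim X n \<Longrightarrow> t \<in> standard_simplex n \<Longrightarrow> rclass X (n, x, t) \<in> topspace (realization X)"
  unfolding topspace_realization points_def by blast

lemma realization_cases:
  assumes "c \<in> topspace (realization X)"
  obtains n x t where "x \<in> Sim X n" "t \<in> standard_simplex n" "c = rclass X (n, x, t)"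
  using assms unfolding topspace_realization points_def by blast

text \<open>The realization is a quotient of a disjoint union of simplices, so it carries the
  topology that is coherent with the characteristic maps of all simplices, degenerate ones
  included.\<close>

lemma openin_realization:
  "openin (realization X) U \<longleftrightarrow> U \<subseteq> topspace (realization X) \<and>
    (\<forall>n. \<forall>x\<in>Sim X n. openin (simplex_space n) {t \<in> standard_simplex n. rclass X (n, x, t) \<in> U})"
proof -
  have "{t. (n, x, t) \<in> {z \<in> points X. rclass X z \<in> U}} = {t \<in> standard_simplex n. rclass X (n, x, t) \<in> U}"
    if "x \<in> Sim X n" for n x
    using that by (auto simp: points_def)
  then show ?thesis
    unfolding topspace_realization unfolding realization_def openin_quotient_topology topspace_pre_realization openin_pre_realization
    by auto
qed

lemma closedin_realization:
  "closedin (realization X) Z \<longleftrightarrow> Z \<subseteq> topspace (realization X) \<and>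
    (\<forall>n. \<forall>x\<in>Sim X n. closedin (simplex_space n) {t \<in> standard_simplex n. rclass X (n, x, t) \<in> Z})"
proof -
  have "standard_simplex n - {t \<in> standard_simplex n. rclass X (n, x, t) \<in> Z} =
    {t \<in> standard_simplex n. rclass X (n, x, t) \<in> topspace (realization X) - Z}" if "x \<in> Sim X n" for n x
    using that rclass_in_realization by fastforce
  then show ?thesis
    unfolding closedin_def[of "realization X"] openin_realization closedin_def topspace_simplex_space
    by auto
qed

lemma continuous_map_realization:
  assumes "\<And>n x. x \<in> Sim X n \<Longrightarrow> continuous_map (simplex_space n) T (\<lambda>t. f (rclass X (n, x, t)))"
  shows "continuous_map (realization X) T f"
  unfolding continuous_map
proof (intro conjI allI impI)
  show "f ` topspace (realization X) \<subseteq> topspace T"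
  proof clarify
    fix c assume "c \<in> topspace (realization X)"
    then obtain n x t where c: "x \<in> Sim X n" "t \<in> standard_simplex n" "c = rclass X (n, x, t)"
      by (rule realization_cases)
    show "f c \<in> topspace T"
      using continuous_map_funspace[OF assms[OF c(1)]] c by auto
  qed
  fix U assume U: "openin T U"
  show "openin (realization X) {c \<in> topspace (realization X). f c \<in> U}"
    unfolding openin_realization
  proof (intro conjI allI ballI)
    fix n x assume x: "x \<in> Sim X n"
    have "openin (simplex_space n) {t \<in> standard_simplex n. f (rclass X (n, x, t)) \<in> U}"
      using openin_continuous_map_preimage[OF assms[OF x] U] by simp
    moreover have "{t \<in> standard_simplex n. f (rclass X (n, x, t)) \<in> U} =
      {t \<in> standard_simplex n. rclass X (n, x, t) \<in> {c \<in> topspace (realization X). f c \<in> U}}"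
      using rclass_in_realization[OF x] by auto
    ultimately show "openin (simplex_space n)
      {t \<in> standard_simplex n. rclass X (n, x, t) \<in> {c \<in> topspace (realization X). f c \<in> U}}" by simp
  qed auto
qed

lemma continuous_map_rclass:
  assumes "x \<in> Sim X n"
  shows "continuous_map (simplex_space n) (realization X) (\<lambda>t. rclass X (n, x, t))"
  unfolding continuous_map
proof (intro conjI allI impI)
  show "(\<lambda>t. rclass X (n, x, t)) ` topspace (simplex_space n) \<subseteq> topspace (realization X)"
    using rclass_in_realization[OF assms] by auto
qed (use assms in \<open>auto simp: openin_realization\<close>)

text \<open>The product of a quotient map with a locally compact Hausdorff space is again a quotient
  map. With the unit interval as \<open>A\<close>, this allows homotopies on a realization to be
  checked simplex by simplex.\<close>

lemma continuous_map_prod_realization: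
  assumes A: "locally_compact_space A" "Hausdorff_space A"
    and h: "\<And>n x. x \<in> Sim X n \<Longrightarrow>
      continuous_map (prod_topology A (simplex_space n)) T (\<lambda>(s, t). h (s, rclass X (n, x, t)))"
  shows "continuous_map (prod_topology A (realization X)) T h"
proof -
  have "quotient_map (pre_realization X) (realization X) (rclass X)"
    unfolding realization_def by (rule quotient_map_quotient_topology)
  then have q: "quotient_map (prod_topology A (pre_realization X)) (prod_topology A (realization X))
      (\<lambda>(s, z). (s, rclass X z))"
    by (rule quotient_map_prod_right[OF A(1) disjI1[OF A(2)]])
  have "continuous_map (prod_topology A (pre_realization X)) T (h \<circ> (\<lambda>(s, z). (s, rclass X z)))"
    unfolding continuous_map
  proof (intro conjI allI impI)
    show "(h \<circ> (\<lambda>(s, z). (s, rclass X z))) ` topspace (prod_topology A (pre_realization X)) \<subseteq> topspace T"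
    proof clarify
      fix s n x t assume "(s, n, x, t) \<in> topspace (prod_topology A (pre_realization X))"
      then have "x \<in> Sim X n" "(s, t) \<in> topspace (prod_topology A (simplex_space n))"
        by (auto simp: topspace_pre_realization points_def)
      then show "(h \<circ> (\<lambda>(s, z). (s, rclass X z))) (s, n, x, t) \<in> topspace T"
        using Pi_mem[OF continuous_map_funspace[OF h[of x n]], of "(s, t)"] by simp
    qed
    fix U assume U: "openin T U"
    show "openin (prod_topology A (pre_realization X))
      {z \<in> topspace (prod_topology A (pre_realization X)). (h \<circ> (\<lambda>(s, z). (s, rclass X z))) z \<in> U}" (is "openin _ ?W")
      unfolding openin_prod_topology_alt
    proof (intro allI impI)
      fix s z assume "(s, z) \<in> ?W"
      then obtain n x t where z: "z = (n, x, t)" "x \<in> Sim X n" "t \<in> standard_simplex n" "s \<in> topspace A"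
        "h (s, rclass X z) \<in> U"
        by (auto simp: topspace_pre_realization points_def)
      let ?V = "{z \<in> topspace (prod_topology A (simplex_space n)). (\<lambda>(s, t). h (s, rclass X (n, x, t))) z \<in> U}"
      have "openin (prod_topology A (simplex_space n)) ?V"
        by (rule openin_continuous_map_preimage[OF h[OF z(2)] U])
      moreover have "(s, t) \<in> ?V" using z by auto
      ultimately obtain P Q where PQ: "openin A P" "openin (simplex_space n) Q" "s \<in> P" "t \<in> Q" "P \<times> Q \<subseteq> ?V"
        unfolding openin_prod_topology_alt by meson
      have Q: "Q \<subseteq> standard_simplex n" using openin_subset[OF PQ(2)] by simp
      \<comment> \<open>Each simplex is open in the disjoint union, so an open rectangle found over
        one simplex is an open rectangle of the whole product.\<close>
      have "openin (pre_realization X) ({n} \<times> {x} \<times> Q)"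
        unfolding openin_pre_realization
      proof (intro conjI allI ballI)
        show "{n} \<times> {x} \<times> Q \<subseteq> points X" using z Q by (auto simp: points_def)
        fix m y
        show "openin (simplex_space m) {t. (m, y, t) \<in> {n} \<times> {x} \<times> Q}"
          using PQ(2) by (cases "m = n \<and> y = x") auto
      qed
      moreover have "P \<times> ({n} \<times> {x} \<times> Q) \<subseteq> ?W"
        using PQ(5) Q z(2) openin_subset[OF PQ(1)] by (auto simp: topspace_pre_realization points_def)
      ultimately show "\<exists>P Q. openin A P \<and> openin (pre_realization X) Q \<and> s \<in> P \<and> z \<in> Q \<and> P \<times> Q \<subseteq> ?W"
        using PQ z(1) by blast
    qed
  qed
  then show ?thesis by (rule continuous_compose_quotient_map[OF q])
qed

lemma realization_map_eq_rlift:
  "realization_map Y f = rlift (\<lambda>(n, x, t). rclass Y (n, f n x, t))"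
  unfolding realization_map_def rlift_def ..

lemma realization_map_rclass:
  assumes "sset_map X Y f"
  shows "realization_map Y f (rclass X (n, x, t)) = rclass Y (n, f n x, t)"
proof -
  interpret sset_map X Y f by fact
  have "glue_invariant X (\<lambda>(n, x, t). rclass Y (n, f n x, t))"
    unfolding glue_invariant_def using map_closed by (auto simp: map_act rclass_glue)
  then show ?thesis unfolding realization_map_eq_rlift by (simp add: rlift_rclass)
qed

lemma continuous_map_realization_map:
  assumes "sset_map X Y f"
  shows "continuous_map (realization X) (realization Y) (realization_map Y f)"
proof (rule continuous_map_realization)
  interpret sset_map X Y f by fact
  fix n x assume "x \<in> Sim X n"
  then show "continuous_map (simplex_space n) (realization Y) (\<lambda>t. realization_map Y f (rclass X (n, x, t)))"
    unfolding realization_map_rclass[OF assms] by (intro continuous_map_rclass map_closed)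
qed

section \<open>Common refinements of points of simplices\<close>

text \<open>A monotone coupling of two finite mass distributions: atoms of positive mass
  \<open>s k\<close> placed along a chain of pairs \<open>(p k, q k)\<close>, with marginals
  \<open>a\<close> and \<open>b\<close>. The total mass is left arbitrary so that the induction can
  remove mass, and values beyond \<open>m\<close>, \<open>m'\<close> and \<open>M\<close> are left
  free.\<close>

definition coupling :: "nat \<Rightarrow> (nat \<Rightarrow> real) \<Rightarrow> nat \<Rightarrow> (nat \<Rightarrow> real) \<Rightarrow>
    nat \<Rightarrow> (nat \<Rightarrow> nat) \<Rightarrow> (nat \<Rightarrow> nat) \<Rightarrow> (nat \<Rightarrow> real) \<Rightarrow> bool" where
  "coupling m a m' b M p q s \<longleftrightarrow> (\<forall>k\<le>M. 0 < s k \<and> p k \<le> m \<and> q k \<le> m') \<and>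
     mono_on {..M} p \<and> mono_on {..M} q \<and>
     (\<forall>i\<le>m. simplex_push M p s i = a i) \<and> (\<forall>j\<le>m'. simplex_push M q s j = b j)"

lemma coupling_swap: "coupling m a m' b M p q s \<longleftrightarrow> coupling m' b m a M q p s"
  unfolding coupling_def by auto

lemma coupling_drop:
  assumes "coupling m a m' b M p q s" "a (Suc m) = 0"
  shows "coupling (Suc m) a m' b M p q s"
proof -
  have "simplex_push M p s (Suc m) = 0"
    unfolding simplex_push_eq using assms(1) by (intro sum.neutral) (auto simp: coupling_def)
  then show ?thesis using assms unfolding coupling_def by (auto simp: le_Suc_eq)
qed

lemma simplex_push_Suc_upd:
  "simplex_push (Suc M) (p(Suc M := m)) (s(Suc M := c)) i = simplex_push M p s i + (if m = i then c else 0)"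
proof -
  have "(\<Sum>j\<le>M. if (p(Suc M := m)) j = i then (s(Suc M := c)) j else 0) = (\<Sum>j\<le>M. if p j = i then s j else 0)"
    by (rule sum.cong) auto
  then show ?thesis by (simp add: simplex_push_eq)
qed

lemma mono_on_upd_top:
  assumes "mono_on {..M} p" "\<And>k. k \<le> M \<Longrightarrow> p k \<le> (m::nat)"
  shows "mono_on {..Suc M} (p(Suc M := m))"
  using assms by (auto simp: mono_on_def)

text \<open>The atom at the last corner takes all the mass of the new last index on the left and is
  subtracted from the last mass on the right. Placed at the top of the chain, it keeps both
  coordinate maps monotone.\<close>

lemma coupling_extend:
  assumes c: "coupling m a m' (b(m' := b m' - a (Suc m))) M p q s" and a: "0 < a (Suc m)"
  shows "coupling (Suc m) a m' b (Suc M) (p(Suc M := Suc m)) (q(Suc M := m')) (s(Suc M := a (Suc m)))"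
proof -
  have bnd: "\<And>k. k \<le> M \<Longrightarrow> p k \<le> m \<and> q k \<le> m'" using c by (simp add: coupling_def)
  have "simplex_push M p s (Suc m) = 0"
    unfolding simplex_push_eq by (intro sum.neutral ballI) (auto dest!: bnd)
  moreover have bnd': "\<And>k. k \<le> M \<Longrightarrow> p k \<le> Suc m" using bnd le_SucI by blast
  moreover have "mono_on {..Suc M} (p(Suc M := Suc m))" "mono_on {..Suc M} (q(Suc M := m'))"
    using c bnd bnd' by (auto intro!: mono_on_upd_top simp: coupling_def)
  ultimately show ?thesis
    using c a unfolding coupling_def by (auto simp: simplex_push_Suc_upd le_Suc_eq)
qed

text \<open>The corner rule of the transportation problem, run from the last corner: the smaller of
  the two last masses becomes an atom and its index is removed. Equivalently, an interval is cut at
  the partial sums of both distributions. The bound on \<open>M\<close> is kept because the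
  continuity of \<open>unspread\<close> rests on a finite union.\<close>

lemma coupling_exists:
  assumes "\<And>i. 0 \<le> a i" "\<And>i. 0 \<le> b i" "(\<Sum>i\<le>m. a i) = (\<Sum>i\<le>m'. b i)" "0 < (\<Sum>i\<le>m. a i)"
  shows "\<exists>M\<le>m + m'. \<exists>p q s. coupling m a m' b M p q s"
  using assms
proof (induction "m + m'" arbitrary: m m' a b rule: less_induct)
  case less
  \<comment> \<open>the case distinction below is symmetric, so it is stated once for both orders of the two points\<close>
  have step: "\<exists>M\<le>m + m'. \<exists>p q s. coupling m a m' b M p q s"
    if eq: "{(m, a), (m', b)} = {(m1, a1), (m2, b1)}" and m: "m + m' = m1 + m2"
      and cpl: "\<exists>M\<le>m1 + m2. \<exists>p q s. coupling m1 a1 m2 b1 M p q s" for m1 m2 a1 b1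
  proof -
    have "m = m1 \<and> a = a1 \<and> m' = m2 \<and> b = b1 \<or> m = m2 \<and> a = b1 \<and> m' = m1 \<and> b = a1"
      using eq by (auto simp: doubleton_eq_iff)
    then show ?thesis using cpl m coupling_swap by metis
  qed
  have main: "\<exists>M\<le>m1 + m2. \<exists>p q s. coupling m1 a1 m2 b1 M p q s"
    if m: "m1 + m2 = m + m'" and nn: "\<And>i. 0 \<le> a1 i" "\<And>i. 0 \<le> b1 i"
      and s: "(\<Sum>i\<le>m1. a1 i) = (\<Sum>i\<le>m2. b1 i)" "0 < (\<Sum>i\<le>m1. a1 i)"
      and ab: "a1 m1 = 0 \<or> 0 < a1 m1 \<and> a1 m1 \<le> b1 m2" for m1 m2 :: nat and a1 b1
  proof (cases "a1 m1 = 0")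
    case True
    then obtain k where k: "m1 = Suc k" using s by (cases m1) auto
    then have "\<exists>M\<le>k + m2. \<exists>p q s. coupling k a1 m2 b1 M p q s"
      using True m nn s by (intro less(1)) auto
    then show ?thesis using coupling_drop[of k a1 m2 b1] True k by (meson add_le_mono1 le_SucI le_trans lessI less_imp_le)
  next
    case False
    then have ab: "0 < a1 m1" "a1 m1 \<le> b1 m2" using ab by auto
    show ?thesis
    proof (cases "m1 = 0 \<or> (\<Sum>i\<le>m1. a1 i) = a1 m1")
      \<comment> \<open>All mass on the left sits at its last index. Since that mass is at most the
        last mass on the right and the totals agree, the right side is concentrated too, and one
        atom suffices.\<close>
      case True
      then have sa: "(\<Sum>i\<le>m1. a1 i) = a1 m1" by auto
      have s': "(\<Sum>i<m1. a1 i) + a1 m1 = (\<Sum>i\<le>m1. a1 i)" "(\<Sum>i<m2. b1 i) + b1 m2 = (\<Sum>i\<le>m2. b1 i)"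
        by (simp_all add: lessThan_Suc_atMost[symmetric])
      have "0 \<le> (\<Sum>i<m2. b1 i)" using nn by (simp add: sum_nonneg)
      then have z: "(\<Sum>i<m1. a1 i) = 0" "(\<Sum>i<m2. b1 i) = 0" "b1 m2 = a1 m1" using s' sa s ab by auto
      then have "\<And>i. i < m1 \<Longrightarrow> a1 i = 0" "\<And>i. i < m2 \<Longrightarrow> b1 i = 0"
        using nn by (simp_all add: sum_nonneg_eq_0_iff)
      then have "coupling m1 a1 m2 b1 0 (\<lambda>_. m1) (\<lambda>_. m2) (\<lambda>_. a1 m1)"
        using ab z unfolding coupling_def simplex_push_eq by (auto simp: mono_on_def le_less)
      then show ?thesis by blast
    next
      case False
      then obtain k where k: "m1 = Suc k" by (cases m1) auto
      \<comment> \<open>The last mass on the right after removal of the atom; it stays nonnegative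
        because of \<open>a1 m1 \<le> b1 m2\<close>.\<close>
      let ?b = "b1(m2 := b1 m2 - a1 (Suc k))"
      have "(\<Sum>i\<le>m2. ?b i) = (\<Sum>i<m2. b1 i) + (b1 m2 - a1 (Suc k))"
        by (simp add: lessThan_Suc_atMost[symmetric])
      also have "\<dots> = (\<Sum>i\<le>m2. b1 i) - a1 (Suc k)"
        by (simp add: lessThan_Suc_atMost[symmetric])
      finally have sb: "(\<Sum>i\<le>m2. ?b i) = (\<Sum>i\<le>k. a1 i)" using s k by simp
      have "0 \<le> (\<Sum>i\<le>k. a1 i)" using nn by (simp add: sum_nonneg)
      then have "0 < (\<Sum>i\<le>k. a1 i)" using False k by (auto simp: less_le)
      then have "\<exists>M\<le>k + m2. \<exists>p q s. coupling k a1 m2 ?b M p q s"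
        using k m nn s ab sb by (intro less(1)) auto
      then obtain M p q s where "M \<le> k + m2" "coupling k a1 m2 ?b M p q s" by blast
      then have "Suc M \<le> m1 + m2" "coupling m1 a1 m2 b1 (Suc M) (p(Suc M := Suc k)) (q(Suc M := m2)) (s(Suc M := a1 (Suc k)))"
        using coupling_extend k ab by auto
      then show ?thesis by blast
    qed
  qed
  show ?case
  proof (cases "a m = 0 \<or> 0 < a m \<and> a m \<le> b m'")
    case True
    then show ?thesis using main[of m m' a b] less.prems by blast
  next
    case False
    then have "b m' = 0 \<or> 0 < b m' \<and> b m' \<le> a m" using less.prems(1)[of m] less.prems(2)[of m'] by (auto simp: less_le)
    then show ?thesis using main[of m' m b a] less.prems step[of m' b m a] by (simp add: insert_commute add.commute)
  qed
qed

text \<open>Any two points of simplices are images of one interior point of a third simplex under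
  monotone maps. Interiority is what makes these maps comparable later, through
  \<open>mono_maps_push_inj\<close>.\<close>

lemma simplex_coupling:
  assumes "t \<in> standard_simplex m" "u \<in> standard_simplex n"
  obtains M p q s where "M \<le> m + n" "p \<in> mono_maps M m" "q \<in> mono_maps M n" "s \<in> standard_simplex M"
    "\<And>k. k \<le> M \<Longrightarrow> 0 < s k" "simplex_push M p s = t" "simplex_push M q s = u"
proof -
  have "(\<Sum>i\<le>m. t i) = 1" "(\<Sum>i\<le>n. u i) = 1" using assms simplex_sum by auto
  then have "\<exists>M\<le>m + n. \<exists>p q s. coupling m t n u M p q s"
    using assms by (intro coupling_exists) (auto simp: simplex_nonneg)
  then obtain M p q s where M: "M \<le> m + n" and c: "coupling m t n u M p q s" by blast
  \<comment> \<open>A coupling says nothing beyond \<open>M\<close>, whereas operators are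
    \<open>undefined\<close> and points of the simplex vanish there, so all three are
    normalised.\<close>
  let ?p = "restrict p {..M}" and ?q = "restrict q {..M}" and ?s = "\<lambda>k. if k \<le> M then s k else 0"
  have p: "?p \<in> mono_maps M m" and q: "?q \<in> mono_maps M n"
    using c by (auto intro!: mono_maps_restrictI simp: coupling_def mono_on_def)
  have push: "simplex_push M (restrict f {..M}) ?s = simplex_push M f s" for f
    by (intro ext) (simp add: simplex_push_eq cong: if_cong)
  have pt: "simplex_push M ?p ?s i = t i" for i
  proof (cases "i \<le> m")
    case False
    then have "simplex_push M ?p ?s i = 0"
      unfolding simplex_push_eq using mono_mapsD(3)[OF p] by (intro sum.neutral) auto
    then show ?thesis using simplex_zero[OF assms(1)] False by simp
  qed (use c push in \<open>simp add: coupling_def\<close>)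
  have qu: "simplex_push M ?q ?s i = u i" for i
  proof (cases "i \<le> n")
    case False
    then have "simplex_push M ?q ?s i = 0"
      unfolding simplex_push_eq using mono_mapsD(3)[OF q] by (intro sum.neutral) auto
    then show ?thesis using simplex_zero[OF assms(2)] False by simp
  qed (use c push in \<open>simp add: coupling_def\<close>)
  have "?s \<in> standard_simplex M"
  proof (rule simplexI)
    have "(\<Sum>k\<le>M. ?s k) = (\<Sum>i\<le>m. simplex_push M ?p ?s i)"
      using simplex_push_sum[OF mono_mapsD(1)[OF p], of "\<lambda>_. 1" ?s] by simp
    then show "(\<Sum>k\<le>M. ?s k) = 1" using pt simplex_sum[OF assms(1)] by simp
  qed (use c in \<open>auto simp: coupling_def less_imp_le\<close>)
  then show ?thesis
    using that[OF M p q, of ?s] pt qu c by (auto simp: coupling_def)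
qed

text \<open>Iterated coupling. All the points \<open>u b\<close> become images of the same
  \<open>s\<close>, as required by a spread point, whose inner coordinates agree in all
  blocks.\<close>

lemma simplex_common_refinement:
  assumes "\<And>b. b \<le> (r::nat) \<Longrightarrow> u b \<in> standard_simplex M"
  shows "\<exists>m\<le>Suc r * M. \<exists>p s. s \<in> standard_simplex m \<and> (\<forall>k\<le>m. 0 < s k) \<and>
    (\<forall>b\<le>r. p b \<in> mono_maps m M \<and> simplex_push m (p b) s = u b)"
  using assms
proof (induction r)
  case 0
  then have u: "u 0 \<in> standard_simplex M" by simp
  \<comment> \<open>Coupling \<open>u 0\<close> with the vertex of a 0-simplex merely replaces it by
    an interior point that is pushed to it.\<close>
  obtain m p q s where "m \<le> 0 + M" "q \<in> mono_maps m M" "s \<in> standard_simplex m"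
    "\<And>k. k \<le> m \<Longrightarrow> 0 < s k" "simplex_push m q s = u 0"
    using simplex_coupling[OF basis_in_standard_simplex[THEN iffD2, OF le_refl] u, of 0] by metis
  then show ?case by (intro exI[of _ m] conjI exI[of _ "\<lambda>_. q"] exI[of _ s]) auto
next
  case (Suc r)
  then obtain m p s where m: "m \<le> Suc r * M" "s \<in> standard_simplex m"
    and p: "\<forall>b\<le>r. p b \<in> mono_maps m M \<and> simplex_push m (p b) s = u b" by (meson le_SucI)
  obtain m' f g s' where m': "m' \<le> m + M" "s' \<in> standard_simplex m'" "\<And>k. k \<le> m' \<Longrightarrow> 0 < s' k"
    and f: "f \<in> mono_maps m' m" "simplex_push m' f s' = s"
    and g: "g \<in> mono_maps m' M" "simplex_push m' g s' = u (Suc r)"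
    using simplex_coupling[OF m(2) Suc.prems[OF le_refl]] by metis
  define p' where "p' b = (if b \<le> r then compose {..m'} (p b) f else g)" for b
  have "p' b \<in> mono_maps m' M \<and> simplex_push m' (p' b) s' = u b" if "b \<le> Suc r" for b
  proof (cases "b \<le> r")
    case True
    have "simplex_push m' (compose {..m'} (p b) f) s' = simplex_push m' (\<lambda>k. p b (f k)) s'"
      by (rule simplex_push_cong) (simp add: compose_def)
    also have "\<dots> = u b"
      using simplex_push_comp[OF mono_mapsD(1)[OF f(1)], of "p b" s'] f p True by simp
    finally show ?thesis using True p f mono_maps_compose unfolding p'_def by auto
  next
    case False
    then have "b = Suc r" using that by simp
    then show ?thesis using g by (simp add: p'_def)
  qed
  moreover have "m' \<le> Suc (Suc r) * M" using m m' by simp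
  ultimately show ?case using m' by blast
qed

text \<open>Every point is an image of a spread point with the given positive weights. A coupling of
  \<open>t\<close> with \<open>w\<close> distributes the atoms of \<open>t\<close> over the blocks;
  the conditional distributions inside the blocks are then refined to a common parameter
  \<open>s'\<close>. The bound on \<open>m\<close> depends on \<open>n\<close> and \<open>r\<close>
  only, not on the point.\<close>

lemma simplex_push_spread_surj:
  assumes t: "t \<in> standard_simplex n" and w: "w \<in> standard_simplex r" "\<And>b. b \<le> r \<Longrightarrow> 0 < w b"
  shows "\<exists>m\<le>Suc r * (n + r). \<exists>\<mu>\<in>mono_maps (r * Suc m + m) n. \<exists>s\<in>standard_simplex m.
    simplex_push (r * Suc m + m) \<mu> (spread w m s) = t"
proof -
  obtain M p q s where M: "M \<le> n + r" and p: "p \<in> mono_maps M n" "simplex_push M p s = t"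
    and q: "q \<in> mono_maps M r" "simplex_push M q s = w"
    and s: "s \<in> standard_simplex M" "\<And>k. k \<le> M \<Longrightarrow> 0 < s k"
    using simplex_coupling[OF t w(1)] by metis
  \<comment> \<open>The conditional distribution of the atoms given block \<open>b\<close>; the
    division is legitimate because \<open>w b\<close> is positive.\<close>
  define u where "u b k = (if k \<le> M \<and> q k = b then s k / w b else 0)" for b k
  have "u b \<in> standard_simplex M" if b: "b \<le> r" for b
  proof (rule simplexI)
    have "(\<Sum>k\<le>M. u b k) = simplex_push M q s b / w b"
      unfolding simplex_push_eq sum_divide_distrib by (intro sum.cong) (auto simp: u_def)
    then show "(\<Sum>k\<le>M. u b k) = 1" using q w(2)[OF b] by simp
  qed (use s w(2)[OF b] in \<open>auto simp: u_def less_imp_le\<close>)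
  then obtain m p' s' where m: "m \<le> Suc r * M" and s': "s' \<in> standard_simplex m" "\<And>k. k \<le> m \<Longrightarrow> 0 < s' k"
    and p': "\<And>b. b \<le> r \<Longrightarrow> p' b \<in> mono_maps m M" "\<And>b. b \<le> r \<Longrightarrow> simplex_push m (p' b) s' = u b"
    using simplex_common_refinement[of r u M] by metis
  \<comment> \<open>The vertex \<open>p' b k\<close> receives the positive mass \<open>s' k\<close>,
    and \<open>u b\<close> vanishes on atoms outside block \<open>b\<close>.\<close>
  have q_p': "q (p' b k) = b" if "b \<le> r" "k \<le> m" for b k
  proof (rule ccontr)
    assume "q (p' b k) \<noteq> b"
    then have "simplex_push m (p' b) s' (p' b k) = 0" using p'(2) that by (simp add: u_def)
    moreover have "s' k \<le> simplex_push m (p' b) s' (p' b k)"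
      unfolding simplex_push_def using that s' by (intro member_le_sum) (auto simp: less_imp_le)
    ultimately show False using s'(2)[OF that(2)] by simp
  qed
  define \<mu> where "\<mu> = (\<lambda>i\<in>{..r * Suc m + m}. p (p' (i div Suc m) (i mod Suc m)))"
  have \<mu>: "\<mu> (b * Suc m + k) = p (p' b k)" if "b \<le> r" "k \<le> m" for b k
    unfolding \<mu>_def using block_decomp[of "b * Suc m + k" r m] that
    by (subst restrict_apply') (blast, simp only: block_div block_mod)
  have "\<mu> \<in> mono_maps (r * Suc m + m) n"
    unfolding \<mu>_def
  proof (rule mono_maps_restrictI)
    fix i assume "i \<le> r * Suc m + m"
    then obtain b k where "b \<le> r" "k \<le> m" "i = b * Suc m + k" unfolding block_decomp by auto
    then show "p (p' (i div Suc m) (i mod Suc m)) \<le> n"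
      using mono_mapsD(3)[OF p(1)] mono_mapsD(3)[OF p'(1)] by (simp only: block_div block_mod)
  next
    fix i j assume ij: "i \<le> j" "j \<le> r * Suc m + m"
    then have "i \<le> r * Suc m + m" by simp
    then obtain b k where i: "b \<le> r" "k \<le> m" "i = b * Suc m + k" unfolding block_decomp by auto
    obtain c l where j: "c \<le> r" "l \<le> m" "j = c * Suc m + l" using ij unfolding block_decomp by auto
    have l: "p' c l \<le> M" using mono_mapsD(3)[OF p'(1)] j by simp
    have "b < c \<or> b = c \<and> k \<le> l" using ij block_le_iff i j by blast
    \<comment> \<open>Between different blocks the order comes from \<open>q\<close>: it is monotone
      and separates the atoms of an earlier block from those of a later one.\<close>
    then have "p' b k \<le> p' c l"
    proof
      assume "b < c"
      then have "q (p' b k) < q (p' c l)" using q_p' i j by simp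
      then show ?thesis using mono_mapsD(4)[OF q(1), of "p' c l" "p' b k"] mono_mapsD(3)[OF p'(1)] i
        by (meson linorder_not_less nat_le_linear)
    qed (use mono_mapsD(4)[OF p'(1)] j in auto)
    then show "p (p' (i div Suc m) (i mod Suc m)) \<le> p (p' (j div Suc m) (j mod Suc m))"
      using mono_mapsD(4)[OF p(1)] l i j by (simp only: block_div block_mod)
  qed
  moreover have "simplex_push (r * Suc m + m) \<mu> (spread w m s') = t"
  proof
    fix i
    have "simplex_push (r * Suc m + m) \<mu> (spread w m s') i =
      (\<Sum>b\<le>r. \<Sum>k\<le>m. if p (p' b k) = i then w b * s' k else 0)"
      unfolding simplex_push_eq sum_blocks spread_def
      by (intro sum.cong refl) (simp only: \<mu> block_div block_mod atMost_iff)
    also have "\<dots> = (\<Sum>b\<le>r. w b * simplex_push M p (u b) i)"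
    proof (rule sum.cong[OF refl])
      fix b assume b: "b \<in> {..r}"
      then have "simplex_push M p (u b) = simplex_push m (\<lambda>k. p (p' b k)) s'"
        using p'(2)[of b] simplex_push_comp[OF mono_mapsD(1)[OF p'(1)], of b p s'] by simp
      then show "(\<Sum>k\<le>m. if p (p' b k) = i then w b * s' k else 0) = w b * simplex_push M p (u b) i"
        by (simp add: simplex_push_eq sum_distrib_left if_distrib cong: if_cong)
    qed
    also have "\<dots> = (\<Sum>b\<le>r. \<Sum>k\<le>M. if q k = b then (if p k = i then s k else 0) else 0)"
      unfolding simplex_push_eq sum_distrib_left
      by (intro sum.cong refl) (use w(2) in \<open>auto simp: u_def less_imp_neq[THEN not_sym]\<close>)
    also have "\<dots> = (\<Sum>k\<le>M. \<Sum>b\<le>r. if q k = b then (if p k = i then s k else 0) else 0)" by (rule sum.swap)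
    also have "\<dots> = simplex_push M p s i"
      unfolding simplex_push_eq by (intro sum.cong refl) (use mono_mapsD(3)[OF q(1)] in \<open>simp cong: if_cong\<close>)
    finally show "simplex_push (r * Suc m + m) \<mu> (spread w m s') i = t i" using p by simp
  qed
  moreover have "m \<le> Suc r * (n + r)" using m M mult_le_mono2 order_trans by blast
  ultimately show ?thesis using s' by blast
qed

text \<open>The push-forward of a measure of full support determines a monotone map. If
  \<open>f k < g k\<close>, the mass sent to the vertices up to \<open>f k\<close> is strictly
  larger for \<open>f\<close> than for \<open>g\<close>.\<close>

lemma mono_maps_push_inj:
  assumes fg: "f \<in> mono_maps K n" "g \<in> mono_maps K n" and s: "\<And>k. k \<le> K \<Longrightarrow> 0 < s k"
    and eq: "simplex_push K f s = simplex_push K g s"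
  shows "f = g"
proof -
  have le: "g k \<le> f k" if fg: "f \<in> mono_maps K n" "g \<in> mono_maps K n"
    and eq: "simplex_push K f s = simplex_push K g s" and k: "k \<le> K" for f g k
  proof (rule ccontr)
    assume "\<not> g k \<le> f k"
    then have k': "f k < g k" by simp
    \<comment> \<open>The threshold \<open>f k\<close> is the one that separates the maps: an index
      that \<open>g\<close> sends below it lies before \<open>k\<close>, so \<open>f\<close> sends
      it below as well, and \<open>k\<close> itself is counted for \<open>f\<close> only.\<close>
    define \<phi> where "\<phi> i = (if i \<le> f k then 1 else 0 :: real)" for i
    have "(\<Sum>j\<le>K. \<phi> (f j) * s j) = (\<Sum>j\<le>K. \<phi> (g j) * s j)"
      using simplex_push_sum[OF mono_mapsD(1)[OF fg(1)], of \<phi> s] simplex_push_sum[OF mono_mapsD(1)[OF fg(2)], of \<phi> s] eq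
      by simp
    moreover have "(\<Sum>j\<le>K. \<phi> (g j) * s j) < (\<Sum>j\<le>K. \<phi> (f j) * s j)"
    proof (rule sum_strict_mono_ex1)
      show "\<forall>j\<in>{..K}. \<phi> (g j) * s j \<le> \<phi> (f j) * s j"
      proof
        fix j assume j: "j \<in> {..K}"
        have "f j \<le> f k" if "g j \<le> f k"
          using mono_mapsD(4)[OF fg(2), of k j] mono_mapsD(4)[OF fg(1), of j k] j k k' that
          by (metis atMost_iff leD nat_le_linear order_le_less_trans)
        then show "\<phi> (g j) * s j \<le> \<phi> (f j) * s j" using s j by (auto simp: \<phi>_def less_imp_le)
      qed
      show "\<exists>j\<in>{..K}. \<phi> (g j) * s j < \<phi> (f j) * s j"
        using k k' s by (intro bexI[of _ k]) (auto simp: \<phi>_def)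
    qed simp
    ultimately show False by simp
  qed
  show ?thesis
    by (rule mono_maps_eqI[OF fg]) (use le fg eq in \<open>metis antisym\<close>)
qed

section \<open>Edgewise subdivision\<close>

text \<open>An \<open>n\<close>-simplex has \<open>r + 1\<close> blocks of \<open>n + 1\<close>
  vertices each, hence the dimension \<open>r * Suc n + n\<close>: \<open>sd 1\<close> is the
  twofold and \<open>sd 2\<close> the threefold subdivision.\<close>

definition sd :: "nat \<Rightarrow> 'x sset \<Rightarrow> 'x sset" where
  "sd r X = \<lparr>Sim = (\<lambda>n. Sim X (r * Suc n + n)),
     act = (\<lambda>m n \<alpha>. act X (r * Suc m + m) (r * Suc n + n) (blocks r m n \<alpha>))\<rparr>"

lemma Sim_sd [simp]: "Sim (sd r X) n = Sim X (r * Suc n + n)"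
  and act_sd [simp]: "act (sd r X) m n \<alpha> = act X (r * Suc m + m) (r * Suc n + n) (blocks r m n \<alpha>)"
  by (simp_all add: sd_def)

lemma simplicial_set_sd:
  assumes "simplicial_set X"
  shows "simplicial_set (sd r X)"
proof -
  interpret simplicial_set X by fact
  show ?thesis
    by unfold_locales
      (simp_all only: Sim_sd act_sd blocks_id act_id blocks_comp act_comp[OF blocks_mono blocks_mono] act_closed[OF blocks_mono])
qed

lemma sset_map_id: "simplicial_set X \<Longrightarrow> sset_map X X (\<lambda>n x. x)"
  by (simp add: sset_map_def sset_map_axioms_def)

lemma sset_map_comp:
  assumes "sset_map X Y f" "sset_map Y Z g"
  shows "sset_map X Z (\<lambda>n x. g n (f n x))"
  using assms by (simp add: sset_map_def sset_map_axioms_def)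

lemma sset_map_sd:
  assumes "sset_map X Y f"
  shows "sset_map (sd r X) (sd r Y) (\<lambda>n. f (r * Suc n + n))"
  using assms by (simp add: sset_map_def sset_map_axioms_def simplicial_set_sd blocks_mono del: mult_Suc_right)

lemma sset_map_block:
  assumes "simplicial_set X" "b \<le> r"
  shows "sset_map (sd r X) X (\<lambda>n. act X n (r * Suc n + n) (block b n))"
proof -
  interpret simplicial_set X by fact
  show ?thesis
    unfolding sset_map_def sset_map_axioms_def
    by (simp add: assms simplicial_set_sd act_closed[OF block_mono] act_comp[symmetric] block_mono blocks_mono blocks_block del: mult_Suc_right)
qed

text \<open>The weights are a parameter of the map. At a vertex of the weight simplex it is the
  realization of \<open>\<kappa>\<close> followed by the restriction to one block; for positive
  weights and \<open>\<kappa>\<close> the identity it is a homeomorphism; a path of weights is a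
  homotopy between such maps.\<close>

definition spread_map :: "nat \<Rightarrow> 'y sset \<Rightarrow> (nat \<Rightarrow> 'x \<Rightarrow> 'y) \<Rightarrow> (nat \<Rightarrow> real) \<Rightarrow> 'x rpoint set \<Rightarrow> 'y rpoint set" where
  "spread_map r Z \<kappa> w = rlift (\<lambda>(n, x, t). rclass Z (r * Suc n + n, \<kappa> n x, spread w n t))"

lemma spread_map_rclass:
  assumes \<kappa>: "sset_map W (sd r Z) \<kappa>" and w: "w \<in> standard_simplex r"
  shows "spread_map r Z \<kappa> w (rclass W (n, x, t)) = rclass Z (r * Suc n + n, \<kappa> n x, spread w n t)"
proof -
  interpret sset_map W "sd r Z" \<kappa> by fact
  have "glue_invariant W (\<lambda>(n, x, t). rclass Z (r * Suc n + n, \<kappa> n x, spread w n t))"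
    unfolding glue_invariant_def
  proof (intro allI ballI)
    fix m n \<alpha> x t assume "\<alpha> \<in> mono_maps m n" "x \<in> Sim W n" "t \<in> standard_simplex m"
    then show "(case (m, act W m n \<alpha> x, t) of (n, x, t) \<Rightarrow> rclass Z (r * Suc n + n, \<kappa> n x, spread w n t)) =
      (case (n, x, simplex_push m \<alpha> t) of (n, x, t) \<Rightarrow> rclass Z (r * Suc n + n, \<kappa> n x, spread w n t))"
      using map_closed[of x n]
      by (simp add: map_act simplex_push_blocks[OF _ w] spread_in[OF w] rclass_glue blocks_mono del: mult_Suc_right)
  qed
  then show ?thesis unfolding spread_map_def by (simp add: rlift_rclass)
qed

text \<open>The weight simplex is convex, and \<open>spread\<close> is a product of coordinates of
  \<open>w\<close> and \<open>t\<close>, hence jointly continuous on every simplex along the segment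
  of weights.\<close>

lemma spread_map_homotopic:
  assumes \<kappa>: "sset_map W (sd r Z) \<kappa>" and w: "w \<in> standard_simplex r" "w' \<in> standard_simplex r"
  shows "homotopic_with (\<lambda>_. True) (realization W) (realization Z) (spread_map r Z \<kappa> w) (spread_map r Z \<kappa> w')"
proof -
  interpret sset_map W "sd r Z" \<kappa> by fact
  define v where "v s = (\<lambda>i. (1 - s) * w i + s * w' i)" for s :: real
  have v: "v s \<in> standard_simplex r" if "s \<in> {0..1}" for s
  proof (rule simplexI)
    show "(\<Sum>i\<le>r. v s i) = 1"
      using simplex_sum[OF w(1)] simplex_sum[OF w(2)] by (simp add: v_def sum.distrib sum_distrib_left[symmetric])
  qed (use w that in \<open>auto simp: v_def simplex_nonneg simplex_zero\<close>)
  have "continuous_map (prod_topology (top_of_set {0..1}) (realization W)) (realization Z)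
      (\<lambda>(s, c). spread_map r Z \<kappa> (v s) c)"
  proof (rule continuous_map_prod_realization)
    show "locally_compact_space (top_of_set {0..1::real})"
      by (simp add: compact_imp_locally_compact_space compact_space_subtopology)
    show "Hausdorff_space (top_of_set {0..1::real})"
      by (simp add: Hausdorff_space_subtopology)
    fix n x assume x: "x \<in> Sim W n"
    let ?P = "prod_topology (top_of_set {0..1::real}) (simplex_space n)"
    have "continuous_map ?P euclideanreal (\<lambda>z. spread (v (fst z)) n (snd z) i)" for i
    proof -
      have "continuous_map ?P euclideanreal (\<lambda>z. fst z)"
        using continuous_map_fst[of "top_of_set {0..1::real}" "simplex_space n"] by (simp add: continuous_map_in_subtopology)
      moreover have "continuous_map ?P (powertop_real UNIV) (\<lambda>z. snd z)"
        using continuous_map_snd[of "top_of_set {0..1::real}" "simplex_space n"] by (simp add: continuous_map_in_subtopology)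
      then have "continuous_map ?P euclideanreal (\<lambda>z. snd z (i mod Suc n))"
        by (simp add: continuous_map_componentwise_UNIV)
      ultimately show ?thesis
        unfolding spread_def v_def
        by (intro continuous_map_real_mult continuous_map_add continuous_map_diff) auto
    qed
    then have "continuous_map ?P (simplex_space (r * Suc n + n)) (\<lambda>z. spread (v (fst z)) n (snd z))"
      using spread_in[OF v] by (auto simp: continuous_map_in_subtopology continuous_map_componentwise_UNIV simp del: mult_Suc_right)
    then have "continuous_map ?P (realization Z)
        ((\<lambda>t. rclass Z (r * Suc n + n, \<kappa> n x, t)) \<circ> (\<lambda>z. spread (v (fst z)) n (snd z)))"
      by (rule continuous_map_compose) (use map_closed[OF x] in \<open>intro continuous_map_rclass, simp\<close>)
    then show "continuous_map ?P (realization Z)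
        (\<lambda>(s, t). case (s, rclass W (n, x, t)) of (s, c) \<Rightarrow> spread_map r Z \<kappa> (v s) c)"
      by (rule continuous_map_eq) (auto simp: spread_map_rclass[OF \<kappa>] v simp del: mult_Suc_right)
  qed
  then show ?thesis
    unfolding homotopic_with_def
    by (intro exI[of _ "\<lambda>(s, c). spread_map r Z \<kappa> (v s) c"]) (auto simp: v_def)
qed

lemma spread_map_vertex:
  assumes Z: "simplicial_set Z" and \<kappa>: "sset_map W (sd r Z) \<kappa>" and b: "b \<le> r"
    and c: "c \<in> topspace (realization W)"
  shows "spread_map r Z \<kappa> (\<lambda>j. if j = b then 1 else 0) c =
    realization_map Z (\<lambda>n x. act Z n (r * Suc n + n) (block b n) (\<kappa> n x)) c"
proof -
  interpret sset_map W "sd r Z" \<kappa> by fact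
  obtain n x t where x: "x \<in> Sim W n" "t \<in> standard_simplex n" and c: "c = rclass W (n, x, t)"
    using c by (rule realization_cases)
  have "spread_map r Z \<kappa> (\<lambda>j. if j = b then 1 else 0) c =
    rclass Z (r * Suc n + n, \<kappa> n x, simplex_push n (block b n) t)"
    unfolding c using b x by (subst spread_map_rclass[OF \<kappa>]) (simp_all add: simplex_push_block)
  also have "\<dots> = rclass Z (n, act Z n (r * Suc n + n) (block b n) (\<kappa> n x), t)"
    using map_closed[OF x(1)] x(2) by (subst rclass_glue[OF block_mono[OF b]]) simp_all
  also have "\<dots> = realization_map Z (\<lambda>n x. act Z n (r * Suc n + n) (block b n) (\<kappa> n x)) c"
    unfolding c by (rule realization_map_rclass[OF sset_map_comp[OF \<kappa> sset_map_block[OF Z b]], symmetric])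
  finally show ?thesis .
qed

text \<open>Together with \<open>spread_map_precomp\<close> this gives the naturality of the
  homeomorphism between the realizations of a simplicial set and of its subdivision.\<close>

lemma spread_map_natural:
  assumes \<kappa>: "sset_map W (sd r Y) \<kappa>" and f: "sset_map Y Z f" and w: "w \<in> standard_simplex r"
    and c: "c \<in> topspace (realization W)"
  shows "realization_map Z f (spread_map r Y \<kappa> w c) = spread_map r Z (\<lambda>n x. f (r * Suc n + n) (\<kappa> n x)) w c"
proof -
  obtain n x t where c: "c = rclass W (n, x, t)" using c by (rule realization_cases)
  show ?thesis
    unfolding c spread_map_rclass[OF \<kappa> w] realization_map_rclass[OF f]
      spread_map_rclass[OF sset_map_comp[OF \<kappa> sset_map_sd[OF f]] w] ..
qed

lemma spread_map_precomp:
  assumes \<kappa>: "sset_map W (sd r Z) \<kappa>" and f: "sset_map V W f" and w: "w \<in> standard_simplex r"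
    and c: "c \<in> topspace (realization V)"
  shows "spread_map r Z \<kappa> w (realization_map W f c) = spread_map r Z (\<lambda>n x. \<kappa> n (f n x)) w c"
proof -
  obtain n x t where c: "c = rclass V (n, x, t)" using c by (rule realization_cases)
  show ?thesis
    unfolding c realization_map_rclass[OF f] spread_map_rclass[OF \<kappa> w]
      spread_map_rclass[OF sset_map_comp[OF f \<kappa>] w] ..
qed

text \<open>For positive weights, \<open>spread_map r X (\<lambda>n x. x) w\<close> is a homeomorphism from the realization of the
  subdivision to that of \<open>X\<close>, and \<open>unspread\<close> is its inverse. The union below is over equal sets.\<close>

definition unspread_point :: "nat \<Rightarrow> 'x sset \<Rightarrow> (nat \<Rightarrow> real) \<Rightarrow> 'x rpoint \<Rightarrow> 'x rpoint set" where
  "unspread_point r X w = (\<lambda>(n, x, t).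
     \<Union>{rclass (sd r X) (m, act X (r * Suc m + m) n \<mu> x, s) | m \<mu> s.
       \<mu> \<in> mono_maps (r * Suc m + m) n \<and> s \<in> standard_simplex m \<and>
       simplex_push (r * Suc m + m) \<mu> (spread w m s) = t})"

definition unspread :: "nat \<Rightarrow> 'x sset \<Rightarrow> (nat \<Rightarrow> real) \<Rightarrow> 'x rpoint set \<Rightarrow> 'x rpoint set" where
  "unspread r X w = rlift (unspread_point r X w)"

lemma simplex_push_compose:
  assumes "\<beta> \<in> mono_maps k m"
  shows "simplex_push k (compose {..k} \<alpha> \<beta>) t = simplex_push m \<alpha> (simplex_push k \<beta> t)"
proof -
  have "simplex_push k (compose {..k} \<alpha> \<beta>) t = simplex_push k (\<lambda>i. \<alpha> (\<beta> i)) t"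
    by (rule simplex_push_cong) (simp add: compose_def)
  then show ?thesis using simplex_push_comp[OF mono_mapsD(1)[OF assms]] by simp
qed

lemma simplex_push_id:
  assumes "t \<in> standard_simplex n"
  shows "simplex_push n (\<lambda>i\<in>{..n}. i) t = t"
proof
  fix i
  have "simplex_push n (\<lambda>i\<in>{..n}. i) t i = (\<Sum>j\<le>n. if j = i then t j else 0)"
    unfolding simplex_push_eq by (intro sum.cong) auto
  then show "simplex_push n (\<lambda>i\<in>{..n}. i) t i = t i" using simplex_zero[OF assms, of i] by simp
qed

locale positive_spread = simplicial_set X for X :: "'x sset" +
  fixes r :: nat and w :: "nat \<Rightarrow> real"
  assumes w: "w \<in> standard_simplex r" and pos: "\<And>b. b \<le> r \<Longrightarrow> 0 < w b"
begin

text \<open>After a coupling of \<open>s\<close> and \<open>s'\<close> both representatives live in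
  one dimension \<open>M\<close> at one interior point. The two operators obtained there push the
  same interior spread point to the same image, so they are equal by
  \<open>mono_maps_push_inj\<close>.\<close>

lemma unspread_unique:
  assumes x: "x \<in> Sim X n"
    and \<mu>: "\<mu> \<in> mono_maps (r * Suc m + m) n" "s \<in> standard_simplex m"
    and \<nu>: "\<nu> \<in> mono_maps (r * Suc m' + m') n" "s' \<in> standard_simplex m'"
    and eq: "simplex_push (r * Suc m + m) \<mu> (spread w m s) = simplex_push (r * Suc m' + m') \<nu> (spread w m' s')"
  shows "rclass (sd r X) (m, act X (r * Suc m + m) n \<mu> x, s) = rclass (sd r X) (m', act X (r * Suc m' + m') n \<nu> x, s')"
proof -
  obtain M p q \<sigma> where p: "p \<in> mono_maps M m" "simplex_push M p \<sigma> = s"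
    and q: "q \<in> mono_maps M m'" "simplex_push M q \<sigma> = s'"
    and \<sigma>: "\<sigma> \<in> standard_simplex M" "\<And>k. k \<le> M \<Longrightarrow> 0 < \<sigma> k"
    using simplex_coupling[OF \<mu>(2) \<nu>(2)] by metis
  let ?K = "r * Suc M + M"
  \<comment> \<open>Gluing in the subdivision: \<open>f\<close> acts through \<open>blocks\<close>,
    so moving from dimension \<open>k\<close> to \<open>M\<close> composes \<open>\<rho>\<close>
    with the blockwise extension of \<open>f\<close>.\<close>
  have refine: "rclass (sd r X) (k, act X (r * Suc k + k) n \<rho> x, simplex_push M f \<sigma>) =
      rclass (sd r X) (M, act X ?K n (compose {..?K} \<rho> (blocks r M k f)) x, \<sigma>)"
    if "f \<in> mono_maps M k" "\<rho> \<in> mono_maps (r * Suc k + k) n" for f k \<rho>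
    using rclass_glue[OF that(1) _ \<sigma>(1), of "act X (r * Suc k + k) n \<rho> x" "sd r X"] act_closed[OF that(2) x]
    by (simp add: act_comp[OF blocks_mono[OF that(1)] that(2) x] del: mult_Suc_right)
  have push: "simplex_push ?K (compose {..?K} \<rho> (blocks r M k f)) (spread w M \<sigma>) =
      simplex_push (r * Suc k + k) \<rho> (spread w k (simplex_push M f \<sigma>))"
    if "f \<in> mono_maps M k" "\<rho> \<in> mono_maps (r * Suc k + k) n" for f k \<rho>
    using that by (simp add: simplex_push_compose[OF blocks_mono] simplex_push_blocks[OF _ w] del: mult_Suc_right)
  have "compose {..?K} \<mu> (blocks r M m p) = compose {..?K} \<nu> (blocks r M m' q)"
  proof (rule mono_maps_push_inj)
    show "0 < spread w M \<sigma> k" if k: "k \<le> ?K" for k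
    proof -
      obtain b l where "b \<le> r" "l \<le> M" "k = b * Suc M + l" using k unfolding block_decomp by auto
      then show ?thesis unfolding spread_def using pos \<sigma>(2) by (simp only: block_div block_mod) simp
    qed
    show "simplex_push ?K (compose {..?K} \<mu> (blocks r M m p)) (spread w M \<sigma>) =
      simplex_push ?K (compose {..?K} \<nu> (blocks r M m' q)) (spread w M \<sigma>)"
      using push[OF p(1) \<mu>(1)] push[OF q(1) \<nu>(1)] p q eq by simp
    show "compose {..?K} \<mu> (blocks r M m p) \<in> mono_maps ?K n"
      by (rule mono_maps_compose[OF blocks_mono[OF p(1)] \<mu>(1)])
    show "compose {..?K} \<nu> (blocks r M m' q) \<in> mono_maps ?K n"
      by (rule mono_maps_compose[OF blocks_mono[OF q(1)] \<nu>(1)])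
  qed
  then show ?thesis using refine[OF p(1) \<mu>(1)] refine[OF q(1) \<nu>(1)] p q by simp
qed

lemma unspread_point:
  assumes x: "x \<in> Sim X n" and \<mu>: "\<mu> \<in> mono_maps (r * Suc m + m) n" "s \<in> standard_simplex m"
    and t: "simplex_push (r * Suc m + m) \<mu> (spread w m s) = t"
  shows "unspread_point r X w (n, x, t) = rclass (sd r X) (m, act X (r * Suc m + m) n \<mu> x, s)"
proof -
  have "{rclass (sd r X) (m, act X (r * Suc m + m) n \<mu> x, s) | m \<mu> s.
      \<mu> \<in> mono_maps (r * Suc m + m) n \<and> s \<in> standard_simplex m \<and>
      simplex_push (r * Suc m + m) \<mu> (spread w m s) = t} = {rclass (sd r X) (m, act X (r * Suc m + m) n \<mu> x, s)}"
    (is "?A = {?c}")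
  proof
    show "?A \<subseteq> {?c}"
    proof clarify
      fix m' \<nu> s' assume "\<nu> \<in> mono_maps (r * Suc m' + m') n" "s' \<in> standard_simplex m'"
        "t = simplex_push (r * Suc m' + m') \<nu> (spread w m' s')"
      then show "rclass (sd r X) (m', act X (r * Suc m' + m') n \<nu> x, s') = ?c"
        using unspread_unique[OF x _ _ \<mu>] t by simp
    qed
    show "{?c} \<subseteq> ?A" using \<mu> t by blast
  qed
  then show ?thesis unfolding unspread_point_def by simp
qed

text \<open>One spread preimage of \<open>t\<close> serves both sides: composed with
  \<open>\<alpha>\<close>, its operator exhibits a spread preimage of the pushed point.\<close>

lemma glue_invariant_unspread_point: "glue_invariant X (unspread_point r X w)"
  unfolding glue_invariant_def
proof (intro allI ballI)
  fix m n \<alpha> x t assume \<alpha>: "\<alpha> \<in> mono_maps m n" and x: "x \<in> Sim X n" and t: "t \<in> standard_simplex m"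
  obtain k \<mu> s where \<mu>: "\<mu> \<in> mono_maps (r * Suc k + k) m" "s \<in> standard_simplex k"
    "simplex_push (r * Suc k + k) \<mu> (spread w k s) = t"
    using simplex_push_spread_surj[OF t w pos] by metis
  have "unspread_point r X w (m, act X m n \<alpha> x, t) =
    rclass (sd r X) (k, act X (r * Suc k + k) m \<mu> (act X m n \<alpha> x), s)"
    by (rule unspread_point[OF act_closed[OF \<alpha> x] \<mu>])
  also have "\<dots> = rclass (sd r X) (k, act X (r * Suc k + k) n (compose {..r * Suc k + k} \<alpha> \<mu>) x, s)"
    using act_comp[OF \<mu>(1) \<alpha> x] by simp
  also have "\<dots> = unspread_point r X w (n, x, simplex_push m \<alpha> t)"
    by (rule unspread_point[OF x mono_maps_compose[OF \<mu>(1) \<alpha>] \<mu>(2), symmetric])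
      (simp add: simplex_push_compose[OF \<mu>(1)] \<mu>(3) del: mult_Suc_right)
  finally show "unspread_point r X w (m, act X m n \<alpha> x, t) = unspread_point r X w (n, x, simplex_push m \<alpha> t)" .
qed

lemma unspread_rclass:
  assumes "x \<in> Sim X n" "\<mu> \<in> mono_maps (r * Suc m + m) n" "s \<in> standard_simplex m"
    and "simplex_push (r * Suc m + m) \<mu> (spread w m s) = t"
  shows "unspread r X w (rclass X (n, x, t)) = rclass (sd r X) (m, act X (r * Suc m + m) n \<mu> x, s)"
  using unspread_point[OF assms] rlift_rclass[OF glue_invariant_unspread_point] unfolding unspread_def by simp

lemma sset_map_sd_id: "sset_map (sd r X) (sd r X) (\<lambda>n x. x)"
  by (intro sset_map_id simplicial_set_sd simplicial_set_axioms)

lemma unspread_spread: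
  assumes "c \<in> topspace (realization (sd r X))"
  shows "unspread r X w (spread_map r X (\<lambda>n x. x) w c) = c"
proof -
  obtain n x t where x: "x \<in> Sim (sd r X) n" "t \<in> standard_simplex n" and c: "c = rclass (sd r X) (n, x, t)"
    using assms by (rule realization_cases)
  let ?K = "r * Suc n + n"
  have x': "x \<in> Sim X ?K" using x by simp
  show ?thesis
    unfolding c spread_map_rclass[OF sset_map_sd_id w]
    using unspread_rclass[OF x' mono_maps_id x(2) simplex_push_id[OF spread_in[OF w x(2)]]] act_id[OF x'] by simp
qed

lemma spread_unspread:
  assumes "c \<in> topspace (realization X)"
  shows "unspread r X w c \<in> topspace (realization (sd r X))"
    and "spread_map r X (\<lambda>n x. x) w (unspread r X w c) = c"
proof -
  obtain n x t where x: "x \<in> Sim X n" "t \<in> standard_simplex n" and c: "c = rclass X (n, x, t)"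
    using assms by (rule realization_cases)
  obtain m \<mu> s where \<mu>: "\<mu> \<in> mono_maps (r * Suc m + m) n" "s \<in> standard_simplex m"
    "simplex_push (r * Suc m + m) \<mu> (spread w m s) = t"
    using simplex_push_spread_surj[OF x(2) w pos] by metis
  show "unspread r X w c \<in> topspace (realization (sd r X))"
    unfolding c unspread_rclass[OF x(1) \<mu>] by (rule rclass_in_realization) (simp_all add: act_closed[OF \<mu>(1) x(1), simplified] \<mu>(2))
  show "spread_map r X (\<lambda>n x. x) w (unspread r X w c) = c"
    unfolding c unspread_rclass[OF x(1) \<mu>] spread_map_rclass[OF sset_map_sd_id w]
    using rclass_glue[OF \<mu>(1) x(1) spread_in[OF w \<mu>(2)]] \<mu>(3) by simp
qed

lemma continuous_map_spread:
  "continuous_map (simplex_space m) (simplex_space (r * Suc m + m)) (spread w m)"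
proof -
  have "continuous_map (simplex_space m) euclideanreal (\<lambda>t. spread w m t i)" for i
    unfolding spread_def
    by (intro continuous_map_real_mult continuous_map_from_subtopology continuous_map_product_projection) auto
  then show ?thesis
    using spread_in[OF w] by (auto simp: continuous_map_in_subtopology continuous_map_componentwise_UNIV simp del: mult_Suc_right)
qed

text \<open>No continuous choice of spread preimages is made; closed sets are tested instead. Over
  one simplex, the preimage of a closed set is a union of images of closed subsets of compact
  simplices, one for each \<open>m\<close> and \<open>\<mu>\<close>. These are compact in a
  Hausdorff space, and the bound on \<open>m\<close> with the finiteness of \<open>mono_maps\<close>
  makes the union finite.\<close>

lemma continuous_map_unspread:
  "continuous_map (realization X) (realization (sd r X)) (unspread r X w)"
  unfolding continuous_map_closedin
proof (intro conjI allI impI ballI)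
  show "unspread r X w \<in> topspace (realization X) \<rightarrow> topspace (realization (sd r X))"
    using spread_unspread by blast
  fix Z assume Z: "closedin (realization (sd r X)) Z"
  show "closedin (realization X) {c \<in> topspace (realization X). unspread r X w c \<in> Z}"
    unfolding closedin_realization
  proof (intro conjI allI ballI)
    fix n x assume x: "x \<in> Sim X n"
    define N where "N m = r * Suc m + m" for m
    define P where "P m \<mu> = {s \<in> standard_simplex m. rclass (sd r X) (m, act X (N m) n \<mu> x, s) \<in> Z}" for m \<mu>
    define Q where "Q m \<mu> = (\<lambda>s. simplex_push (N m) \<mu> (spread w m s)) ` P m \<mu>" for m \<mu>
    have "closedin (simplex_space n) (Q m \<mu>)" if \<mu>: "\<mu> \<in> mono_maps (N m) n" for m \<mu>
    proof -
      have "act X (N m) n \<mu> x \<in> Sim (sd r X) m" using act_closed[OF \<mu> x] by (simp add: N_def)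
      then have "closedin (simplex_space m) (P m \<mu>)"
        using Z unfolding closedin_realization P_def by blast
      moreover have "compact_space (simplex_space m)"
        using compactin_standard_simplex by (simp add: compact_space_subtopology)
      ultimately have "compactin (simplex_space m) (P m \<mu>)" by (rule closedin_compact_space[rotated])
      moreover have "continuous_map (simplex_space m) (simplex_space n) (simplex_push (N m) \<mu> \<circ> spread w m)"
        using continuous_map_compose[OF continuous_map_spread continuous_map_simplex_push] mono_mapsD(1)[OF \<mu>]
        unfolding N_def by blast
      ultimately have "compactin (simplex_space n) (Q m \<mu>)"
        using image_compactin unfolding Q_def comp_def by blast
      moreover have "Hausdorff_space (simplex_space n)"
        by (simp add: Hausdorff_space_subtopology Hausdorff_space_product_topology)
      ultimately show ?thesis by (simp add: compactin_imp_closedin)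
    qed
    then have "closedin (simplex_space n) (\<Union>\<mu>\<in>mono_maps (N m) n. Q m \<mu>)" for m
      by (intro closedin_Union) (auto intro: finite_mono_maps)
    then have "closedin (simplex_space n) (\<Union>m\<le>Suc r * (n + r). \<Union>\<mu>\<in>mono_maps (N m) n. Q m \<mu>)"
      by (intro closedin_Union) (auto simp del: mult_Suc_right)
    moreover have "{t \<in> standard_simplex n. rclass X (n, x, t) \<in> {c \<in> topspace (realization X). unspread r X w c \<in> Z}} =
      (\<Union>m\<le>Suc r * (n + r). \<Union>\<mu>\<in>mono_maps (N m) n. Q m \<mu>)"
    proof (intro equalityI subsetI)
      fix t assume "t \<in> {t \<in> standard_simplex n. rclass X (n, x, t) \<in> {c \<in> topspace (realization X). unspread r X w c \<in> Z}}"
      then have t: "t \<in> standard_simplex n" "unspread r X w (rclass X (n, x, t)) \<in> Z" by auto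
      obtain m \<mu> s where m: "m \<le> Suc r * (n + r)" and \<mu>: "\<mu> \<in> mono_maps (N m) n" "s \<in> standard_simplex m"
        "simplex_push (N m) \<mu> (spread w m s) = t"
        using simplex_push_spread_surj[OF t(1) w pos] unfolding N_def by metis
      then have "s \<in> P m \<mu>" using t(2) unspread_rclass[OF x, of \<mu> m s t] unfolding P_def N_def by simp
      then show "t \<in> (\<Union>m\<le>Suc r * (n + r). \<Union>\<mu>\<in>mono_maps (N m) n. Q m \<mu>)"
        using m \<mu> unfolding Q_def by blast
    next
      fix t assume "t \<in> (\<Union>m\<le>Suc r * (n + r). \<Union>\<mu>\<in>mono_maps (N m) n. Q m \<mu>)"
      then obtain m \<mu> s where \<mu>: "\<mu> \<in> mono_maps (N m) n" and s: "s \<in> P m \<mu>" "t = simplex_push (N m) \<mu> (spread w m s)"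
        unfolding Q_def by blast
      have s': "s \<in> standard_simplex m" using s by (simp add: P_def)
      have "t \<in> standard_simplex n"
        unfolding s(2) by (rule simplex_push_in[OF mono_mapsD(1)[OF \<mu>]]) (use spread_in[OF w s'] N_def in simp)
      then show "t \<in> {t \<in> standard_simplex n. rclass X (n, x, t) \<in> {c \<in> topspace (realization X). unspread r X w c \<in> Z}}"
        using unspread_rclass[OF x, of \<mu> m s t] \<mu> s s' rclass_in_realization[OF x] unfolding P_def N_def by auto
    qed
    ultimately show "closedin (simplex_space n)
      {t \<in> standard_simplex n. rclass X (n, x, t) \<in> {c \<in> topspace (realization X). unspread r X w c \<in> Z}}" by simp
  qed auto
qed

end

section \<open>Homotopy equivalences are weak homotopy equivalences\<close>

abbreviation cyl :: "nat \<Rightarrow> (real \<times> (nat \<Rightarrow> real)) topology" where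
  "cyl n \<equiv> prod_topology (top_of_set {0..1}) (cube n)"

lemma topspace_cube: "topspace (cube n) = {..<n} \<rightarrow>\<^sub>E {0..1}"
  by (simp add: cube_def)

lemma cube_boundary_subset: "cube_boundary n \<subseteq> topspace (cube n)"
  by (auto simp: cube_boundary_def)

lemma continuous_map_fst_cyl: "continuous_map (cyl n) euclideanreal fst"
  using continuous_map_fst[of "top_of_set {0..1::real}" "cube n"] by (simp add: continuous_map_in_subtopology)

lemma continuous_map_cube_component: "i < n \<Longrightarrow> continuous_map (cube n) euclideanreal (\<lambda>t. t i)"
  using continuous_map_product_projection[of i "{..<n}" "\<lambda>_. top_of_set {0..1::real}"]
  by (simp add: cube_def continuous_map_in_subtopology)

lemma continuous_map_cyl_component: "i < n \<Longrightarrow> continuous_map (cyl n) euclideanreal (\<lambda>z. snd z i)"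
  using continuous_map_compose[OF continuous_map_snd continuous_map_cube_component] by (simp add: comp_def)

lemma continuous_map_into_cube:
  assumes "\<And>i. i < n \<Longrightarrow> continuous_map X euclideanreal (\<lambda>x. f x i)"
    and "\<And>x. x \<in> topspace X \<Longrightarrow> f x \<in> {..<n} \<rightarrow>\<^sub>E {0..1}"
  shows "continuous_map X (cube n) f"
  unfolding cube_def continuous_map_componentwise continuous_map_in_subtopology
proof (intro conjI ballI)
  show "f ` topspace X \<subseteq> extensional {..<n}" using assms(2) by (auto simp: PiE_def)
  fix i assume i: "i \<in> {..<n}"
  show "continuous_map X euclidean (\<lambda>x. f x i)" using assms(1) i by simp
  have "f x i \<in> {0..1}" if "x \<in> topspace X" for x using PiE_mem[OF assms(2)[OF that] i] .
  then show "(\<lambda>x. f x i) \<in> topspace X \<rightarrow> {0..1}" by blast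
qed

text \<open>The retraction of the cylinder onto its bottom and sides is the radial projection from the point
  above its centre at height $2$; in coordinates centred at the axis it divides by \<open>radius\<close>.\<close>

fun radius :: "nat \<Rightarrow> real \<times> (nat \<Rightarrow> real) \<Rightarrow> real" where
  "radius 0 z = (2 - fst z) / 2"
| "radius (Suc k) z = max (radius k z) \<bar>2 * snd z k - 1\<bar>"

definition cyl_retraction :: "nat \<Rightarrow> real \<times> (nat \<Rightarrow> real) \<Rightarrow> real \<times> (nat \<Rightarrow> real)" where
  "cyl_retraction n z = (2 - (2 - fst z) / radius n z, \<lambda>i\<in>{..<n}. ((2 * snd z i - 1) / radius n z + 1) / 2)"

text \<open>Bottom and sides together; the open top is where extensions are read off.\<close>

definition cyl_base :: "nat \<Rightarrow> (real \<times> (nat \<Rightarrow> real)) set" where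
  "cyl_base n = {z \<in> topspace (cyl n). fst z = 0 \<or> snd z \<in> cube_boundary n}"

lemma radius_ge: "(2 - fst z) / 2 \<le> radius n z" "i < n \<Longrightarrow> \<bar>2 * snd z i - 1\<bar> \<le> radius n z"
proof -
  show "(2 - fst z) / 2 \<le> radius n z"
  proof (induction n)
    case (Suc n)
    then show ?case unfolding radius.simps by (rule max.coboundedI1)
  qed simp
  show "i < n \<Longrightarrow> \<bar>2 * snd z i - 1\<bar> \<le> radius n z"
    by (induction n) (auto simp: less_Suc_eq)
qed

text \<open>The radius is a maximum of finitely many terms. The term that attains it decides whether
  the projection ends on the bottom or on a side.\<close>

lemma radius_cases: "radius n z = (2 - fst z) / 2 \<or> (\<exists>i<n. radius n z = \<bar>2 * snd z i - 1\<bar>)"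
  by (induction n) (auto simp: max_def less_Suc_eq)

lemma continuous_map_radius: "k \<le> n \<Longrightarrow> continuous_map (cyl n) euclideanreal (radius k)"
proof (induction k)
  case 0
  have "radius 0 = (\<lambda>z. (2 - fst z) / 2)" by auto
  then show ?case
    by (simp only:) (intro continuous_map_real_divide continuous_map_diff continuous_map_fst_cyl, auto)
next
  case (Suc k)
  have "radius (Suc k) = (\<lambda>z. max (radius k z) \<bar>2 * snd z k - 1\<bar>)" by auto
  then show ?case
    using Suc by (simp only:) (intro continuous_map_real_max continuous_map_real_abs continuous_map_diff
        continuous_map_real_mult continuous_map_cyl_component, auto)
qed

lemma cyl_snd_range: "z \<in> topspace (cyl n) \<Longrightarrow> i < n \<Longrightarrow> snd z i \<in> {0..1}"
  using PiE_mem by (fastforce simp: topspace_cube)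

text \<open>The lower bound keeps the divisor positive; the upper bound keeps the projected height
  at most 1.\<close>

lemma radius_bounds:
  assumes "z \<in> topspace (cyl n)"
  shows "1 / 2 \<le> radius n z" "radius n z \<le> 2 - fst z"
proof -
  have s: "fst z \<in> {0..1}" using assms by auto
  then show "1 / 2 \<le> radius n z" using radius_ge(1)[of z n] by (auto simp: field_simps)
  show "radius n z \<le> 2 - fst z"
    using radius_cases[of n z]
  proof
    assume "\<exists>i<n. radius n z = \<bar>2 * snd z i - 1\<bar>"
    then obtain i where "i < n" "radius n z = \<bar>2 * snd z i - 1\<bar>" by blast
    then show ?thesis using cyl_snd_range[OF assms, of i] s by auto
  qed (use s in \<open>auto simp: field_simps\<close>)
qed

lemma cyl_retraction_base:
  assumes "z \<in> topspace (cyl n)"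
  shows "cyl_retraction n z \<in> cyl_base n"
proof -
  have s: "fst z \<in> {0..1}" using assms by auto
  note r = radius_bounds[OF assms]
  have 1: "2 - (2 - fst z) / radius n z \<in> {0..1}"
    using r radius_ge(1)[of z n] by (auto simp: field_simps)
  have 2: "((2 * snd z i - 1) / radius n z + 1) / 2 \<in> {0..1}" if "i < n" for i
    using r radius_ge(2)[OF that, of z] by (auto simp: field_simps)
  have top: "cyl_retraction n z \<in> topspace (cyl n)"
    using 1 2 by (auto simp: cyl_retraction_def topspace_cube)
  show ?thesis
    using radius_cases[of n z]
  proof
    assume "radius n z = (2 - fst z) / 2"
    then have "fst (cyl_retraction n z) = 0" using r by (simp add: cyl_retraction_def field_simps)
    then show ?thesis using top by (simp add: cyl_base_def)
  next
    assume "\<exists>i<n. radius n z = \<bar>2 * snd z i - 1\<bar>"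
    then obtain i where i: "i < n" "radius n z = \<bar>2 * snd z i - 1\<bar>" by blast
    then have "snd (cyl_retraction n z) i = 0 \<or> snd (cyl_retraction n z) i = 1"
      using r by (auto simp: cyl_retraction_def abs_if field_simps split: if_splits)
    then have "snd (cyl_retraction n z) \<in> cube_boundary n"
      using top i unfolding cube_boundary_def by auto
    then show ?thesis using top by (simp add: cyl_base_def)
  qed
qed

text \<open>On bottom and sides the radius is exactly 1: no term of the maximum exceeds 1 there, and
  the one belonging to the face in question equals 1.\<close>

lemma cyl_retraction_id:
  assumes "z \<in> cyl_base n"
  shows "cyl_retraction n z = z"
proof -
  have z: "z \<in> topspace (cyl n)" using assms by (simp add: cyl_base_def)
  then have s: "fst z \<in> {0..1}" by auto
  have le: "radius n z \<le> 1" 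
    using radius_cases[of n z]
  proof
    assume "\<exists>i<n. radius n z = \<bar>2 * snd z i - 1\<bar>"
    then show ?thesis using cyl_snd_range[OF z] by fastforce
  qed (use s in auto)
  have "radius n z = 1"
  proof (cases "fst z = 0")
    case True
    then show ?thesis using radius_ge(1)[of z n] le by simp
  next
    case False
    then obtain i where "i < n" "snd z i = 0 \<or> snd z i = 1"
      using assms by (auto simp: cyl_base_def cube_boundary_def)
    then show ?thesis using radius_ge(2)[of i n z] le by auto
  qed
  moreover have "(\<lambda>i\<in>{..<n}. snd z i) = snd z"
    using z by (auto simp: topspace_cube PiE_def extensional_restrict)
  ultimately show ?thesis
    by (simp add: cyl_retraction_def prod_eq_iff cong: restrict_cong)
qed

lemma continuous_map_cyl_retraction:
  "continuous_map (cyl n) (subtopology (cyl n) (cyl_base n)) (cyl_retraction n)"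
proof -
  have nz: "radius n z \<noteq> 0" if "z \<in> topspace (cyl n)" for z using radius_bounds(1)[OF that] by auto
  have mem: "cyl_retraction n z \<in> topspace (cyl n)" if "z \<in> topspace (cyl n)" for z
    using cyl_retraction_base[OF that] by (simp add: cyl_base_def)
  have 1: "continuous_map (cyl n) (top_of_set {0..1}) (\<lambda>z. fst (cyl_retraction n z))"
    unfolding continuous_map_in_subtopology
  proof
    show "continuous_map (cyl n) euclidean (\<lambda>z. fst (cyl_retraction n z))"
      unfolding cyl_retraction_def fst_conv
      by (intro continuous_map_diff continuous_map_real_divide continuous_map_fst_cyl continuous_map_radius) (use nz in auto)
    show "(\<lambda>z. fst (cyl_retraction n z)) \<in> topspace (cyl n) \<rightarrow> {0..1}" using mem by fastforce
  qed
  have 2: "continuous_map (cyl n) (cube n) (\<lambda>z. snd (cyl_retraction n z))"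
  proof (rule continuous_map_into_cube)
    fix i assume i: "i < n"
    have "continuous_map (cyl n) euclideanreal (\<lambda>z. ((2 * snd z i - 1) / radius n z + 1) / 2)"
      by (intro continuous_map_real_divide continuous_map_add continuous_map_diff continuous_map_real_mult
          continuous_map_radius continuous_map_cyl_component i) (use nz in auto)
    then show "continuous_map (cyl n) euclideanreal (\<lambda>z. snd (cyl_retraction n z) i)"
      using i by (simp add: cyl_retraction_def)
  next
    fix z assume "z \<in> topspace (cyl n)"
    then show "snd (cyl_retraction n z) \<in> {..<n} \<rightarrow>\<^sub>E {0..1}"
      using mem[of z] by (simp add: mem_Times_iff topspace_cube)
  qed
  have "continuous_map (cyl n) (cyl n) (cyl_retraction n)"
    using continuous_map_pairedI[OF 1 2] unfolding prod.collapse .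
  then show ?thesis
    unfolding continuous_map_in_subtopology using cyl_retraction_base by blast
qed

text \<open>The homotopy extension property of the cube relative to its boundary, by composition
  with the retraction.\<close>

lemma cyl_extension:
  assumes "continuous_map (subtopology (cyl n) (cyl_base n)) X J"
  obtains E where "continuous_map (cyl n) X E" "\<And>z. z \<in> cyl_base n \<Longrightarrow> E z = J z"
proof (rule that)
  show "continuous_map (cyl n) X (J \<circ> cyl_retraction n)"
    by (rule continuous_map_compose[OF continuous_map_cyl_retraction assms])
qed (simp add: cyl_retraction_id)

lemma closedin_cyl_fst: "closedin (cyl n) {z \<in> topspace (cyl n). fst z \<in> {c}}"
  by (rule closedin_continuous_map_preimage[OF continuous_map_fst_cyl]) simp

lemma closedin_cyl_component: "i < n \<Longrightarrow> closedin (cyl n) {z \<in> topspace (cyl n). snd z i \<in> {c}}"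
  by (rule closedin_continuous_map_preimage[OF continuous_map_cyl_component]) auto

lemma closedin_cyl_boundary: "closedin (cyl n) {z \<in> topspace (cyl n). snd z \<in> cube_boundary n}"
proof -
  have "closedin (cyl n) (\<Union>i<n. {z \<in> topspace (cyl n). snd z i \<in> {0}} \<union> {z \<in> topspace (cyl n). snd z i \<in> {1}})"
  proof (rule closedin_Union)
    fix S assume "S \<in> (\<lambda>i. {z \<in> topspace (cyl n). snd z i \<in> {0}} \<union> {z \<in> topspace (cyl n). snd z i \<in> {1}}) ` {..<n}"
    then obtain i where "i < n" "S = {z \<in> topspace (cyl n). snd z i \<in> {0}} \<union> {z \<in> topspace (cyl n). snd z i \<in> {1}}"
      by blast
    then show "closedin (cyl n) S"
      using closedin_Un[OF closedin_cyl_component[of i n 0] closedin_cyl_component[of i n 1]] by simp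
  qed simp
  moreover have "(\<Union>i<n. {z \<in> topspace (cyl n). snd z i \<in> {0}} \<union> {z \<in> topspace (cyl n). snd z i \<in> {1}}) =
    {z \<in> topspace (cyl n). snd z \<in> cube_boundary n}"
    by (auto simp: cube_boundary_def)
  ultimately show ?thesis by simp
qed

text \<open>The last coordinate is split off because it will be the parameter of a homotopy between
  maps on the smaller cube.\<close>

lemma cube_SucE:
  assumes "t \<in> topspace (cube (Suc n))"
  shows "restrict t {..<n} \<in> topspace (cube n)" "t n \<in> {0..1}"
    "t \<in> cube_boundary (Suc n) \<longleftrightarrow> restrict t {..<n} \<in> cube_boundary n \<or> t n = 0 \<or> t n = 1"
proof -
  show *: "restrict t {..<n} \<in> topspace (cube n)" "t n \<in> {0..1}"
    using assms by (auto simp: topspace_cube PiE_def)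
  show "t \<in> cube_boundary (Suc n) \<longleftrightarrow> restrict t {..<n} \<in> cube_boundary n \<or> t n = 0 \<or> t n = 1"
    using assms * by (auto simp: cube_boundary_def less_Suc_eq)
qed

lemma continuous_map_cube_restrict:
  "continuous_map (cube (Suc n)) (cube n) (\<lambda>t. restrict t {..<n})"
proof (rule continuous_map_into_cube)
  fix i assume "i < n"
  then show "continuous_map (cube (Suc n)) euclideanreal (\<lambda>t. restrict t {..<n} i)"
    using continuous_map_cube_component[of i "Suc n"] by simp
qed (use cube_SucE(1) in \<open>auto simp: topspace_cube\<close>)

lemma continuous_map_cyl_cube:
  "continuous_map (cyl n) (cube (Suc n)) (\<lambda>z. \<lambda>i\<in>{..<Suc n}. if i = n then fst z else snd z i)"
proof (rule continuous_map_into_cube)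
  fix i assume i: "i < Suc n"
  then show "continuous_map (cyl n) euclideanreal (\<lambda>z. (\<lambda>i\<in>{..<Suc n}. if i = n then fst z else snd z i) i)"
    using continuous_map_fst_cyl continuous_map_cyl_component[of i n] by (cases "i = n") auto
next
  fix z assume "z \<in> topspace (cyl n)"
  then show "(\<lambda>i\<in>{..<Suc n}. if i = n then fst z else snd z i) \<in> {..<Suc n} \<rightarrow>\<^sub>E {0..1}"
    using cyl_snd_range[of z n] by (auto simp: less_Suc_eq)
qed

section \<open>Homotopies relative to the boundary of the cube and change of base point\<close>

abbreviation rel_homotopic :: "nat \<Rightarrow> 'a topology \<Rightarrow> 'a \<Rightarrow> ((nat \<Rightarrow> real) \<Rightarrow> 'a) \<Rightarrow> ((nat \<Rightarrow> real) \<Rightarrow> 'a) \<Rightarrow> bool" where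
  "rel_homotopic n X x \<equiv> homotopic_with (\<lambda>h. h ` cube_boundary n \<subseteq> {x}) (cube n) X"

lemma rel_homotopic_iff:
  "rel_homotopic n X x p q \<longleftrightarrow> (\<exists>h. continuous_map (cyl n) X h \<and>
     (\<forall>t\<in>topspace (cube n). h (0, t) = p t) \<and> (\<forall>t\<in>topspace (cube n). h (1, t) = q t) \<and>
     (\<forall>s\<in>{0..1}. \<forall>t\<in>cube_boundary n. h (s, t) = x))"
  by (subst homotopic_with) (use cube_boundary_subset[of n] in \<open>auto simp: image_subset_iff subset_iff\<close>)

text \<open>Change of base point along the path \<open>e\<close> is well defined on classes.
  \<open>P\<close> and \<open>Q\<close> carry their initial cubes along \<open>e\<close>; with the
  homotopy between the initial cubes they fill the bottom and the sides of a cylinder of one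
  dimension more, and the top of an extension is a homotopy between the final cubes.\<close>

lemma rel_homotopic_transport:
  assumes P: "continuous_map (cyl n) X P" and Q: "continuous_map (cyl n) X Q"
    and bd: "\<And>s t. s \<in> {0..1} \<Longrightarrow> t \<in> cube_boundary n \<Longrightarrow> P (s, t) = e s \<and> Q (s, t) = e s"
    and e: "continuous_map (top_of_set {0..1}) X e"
    and start: "rel_homotopic n X (e 0) (\<lambda>t. P (0, t)) (\<lambda>t. Q (0, t))"
  shows "rel_homotopic n X (e 1) (\<lambda>t. P (1, t)) (\<lambda>t. Q (1, t))"
proof -
  obtain k where k: "continuous_map (cyl n) X k"
    and k01: "\<And>t. t \<in> topspace (cube n) \<Longrightarrow> k (0, t) = P (0, t)" "\<And>t. t \<in> topspace (cube n) \<Longrightarrow> k (1, t) = Q (0, t)"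
    and kb: "\<And>s t. s \<in> {0..1} \<Longrightarrow> t \<in> cube_boundary n \<Longrightarrow> k (s, t) = e 0"
    using start unfolding rel_homotopic_iff by auto
  let ?C = "cyl (Suc n)"
  \<comment> \<open>Four closed pieces: the bottom with the given homotopy, the two faces of the
    last coordinate with \<open>P\<close> and \<open>Q\<close>, and the remaining sides with the
    path \<open>e\<close>.\<close>
  define T where "T i = {z \<in> topspace ?C. if i = 0 then fst z \<in> {0} else if i = 1 then snd z n \<in> {0}
    else if i = 2 then snd z n \<in> {1} else snd z \<in> cube_boundary (Suc n) \<and> restrict (snd z) {..<n} \<in> cube_boundary n}" for i :: nat
  define F where "F i = (if i = 0 then (\<lambda>z. k (snd z n, restrict (snd z) {..<n}))
    else if i = 1 then (\<lambda>z. P (fst z, restrict (snd z) {..<n}))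
    else if i = 2 then (\<lambda>z. Q (fst z, restrict (snd z) {..<n})) else (\<lambda>z. e (fst z)))" for i :: nat
  define J where "J z = (if fst z = 0 then F 0 z else if snd z n = 0 then F 1 z else if snd z n = 1 then F 2 z else F 3 z)" for z
  have r: "continuous_map ?C (cube n) (\<lambda>z. restrict (snd z) {..<n})"
    using continuous_map_compose[OF continuous_map_snd continuous_map_cube_restrict] by (simp add: comp_def)
  have f: "continuous_map ?C (top_of_set {0..1}) fst" by (rule continuous_map_fst)
  have l: "continuous_map ?C (top_of_set {0..1}) (\<lambda>z. snd z n)"
    unfolding continuous_map_in_subtopology
    using continuous_map_cyl_component[of n "Suc n"] cyl_snd_range[of _ "Suc n" n] by auto
  have cF: "continuous_map ?C X (F i)" for i
    using continuous_map_compose[OF continuous_map_pairedI[OF l r] k]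
      continuous_map_compose[OF continuous_map_pairedI[OF f r] P]
      continuous_map_compose[OF continuous_map_pairedI[OF f r] Q]
      continuous_map_compose[OF f e]
    by (simp add: F_def comp_def)
  have cT: "closedin ?C (T i)" for i
  proof -
    have "closedin ?C {z \<in> topspace ?C. (\<lambda>z. (fst z, restrict (snd z) {..<n})) z \<in> {z \<in> topspace (cyl n). snd z \<in> cube_boundary n}}"
      by (rule closedin_continuous_map_preimage[OF continuous_map_pairedI[OF f r] closedin_cyl_boundary])
    moreover have "{z \<in> topspace ?C. (\<lambda>z. (fst z, restrict (snd z) {..<n})) z \<in> {z \<in> topspace (cyl n). snd z \<in> cube_boundary n}} =
      {z \<in> topspace ?C. snd z \<in> cube_boundary (Suc n) \<and> restrict (snd z) {..<n} \<in> cube_boundary n}"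
      using cube_SucE by fastforce
    ultimately show ?thesis
      unfolding T_def using closedin_cyl_fst[of "Suc n" 0] closedin_cyl_component[of n "Suc n" 0] closedin_cyl_component[of n "Suc n" 1]
      by (cases "i = 0"; cases "i = 1"; cases "i = 2"; simp del: topspace_prod_topology)
  qed
  have "continuous_map (subtopology ?C (cyl_base (Suc n))) X J"
  proof (rule pasting_lemma_closed)
    show "finite {..3::nat}" by simp
    show "closedin (subtopology ?C (cyl_base (Suc n))) (cyl_base (Suc n) \<inter> T i)" for i
      using cT by (metis closedin_subtopology inf_commute)
    show "continuous_map (subtopology (subtopology ?C (cyl_base (Suc n))) (cyl_base (Suc n) \<inter> T i)) X (F i)" for i
      by (intro continuous_map_from_subtopology cF)
    fix i j z
    assume "i \<in> {..3::nat}" "j \<in> {..3::nat}" and z: "z \<in> topspace (subtopology ?C (cyl_base (Suc n))) \<inter> (cyl_base (Suc n) \<inter> T i) \<inter> (cyl_base (Suc n) \<inter> T j)"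
    have top: "z \<in> topspace ?C" using z by auto
    then have "restrict (snd z) {..<n} \<in> topspace (cube n)" "snd z n \<in> {0..1}" "fst z \<in> {0..1}"
      using cube_SucE[of "snd z" n] by auto
    then show "F i z = F j z"
      using z unfolding T_def F_def by (auto simp: k01 kb bd split: if_splits)
  next
    fix z assume "z \<in> topspace (subtopology ?C (cyl_base (Suc n)))"
    then have z: "z \<in> topspace ?C" "z \<in> cyl_base (Suc n)" by auto
    have "snd z \<in> topspace (cube (Suc n))" using z(1) by auto
    then have "fst z = 0 \<or> snd z n = 0 \<or> snd z n = 1 \<or> snd z \<in> cube_boundary (Suc n) \<and> restrict (snd z) {..<n} \<in> cube_boundary n"
      using z(2) cube_SucE(3)[of "snd z" n] unfolding cyl_base_def by auto
    then have "z \<in> T (if fst z = 0 then 0 else if snd z n = 0 then 1 else if snd z n = 1 then 2 else 3)"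
      using z(1) unfolding T_def by auto
    then show "\<exists>j. j \<in> {..3::nat} \<and> z \<in> cyl_base (Suc n) \<inter> T j \<and> J z = F j z"
      using z(2) by (intro exI[of _ "if fst z = 0 then 0 else if snd z n = 0 then 1 else if snd z n = 1 then 2 else 3"]) (auto simp: J_def)
  qed
  then obtain E where E: "continuous_map ?C X E" and EJ: "\<And>z. z \<in> cyl_base (Suc n) \<Longrightarrow> E z = J z"
    using cyl_extension by blast
  \<comment> \<open>The inclusion of the top face: time is fixed at 1, and the last cube coordinate
    is the new homotopy parameter.\<close>
  let ?g = "\<lambda>z. (1::real, \<lambda>i\<in>{..<Suc n}. if i = n then fst z else snd z i)"
  have "continuous_map (cyl n) ?C ?g"
    by (intro continuous_map_pairedI continuous_map_cyl_cube) simp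
  then have h: "continuous_map (cyl n) X (E \<circ> ?g)" using continuous_map_compose E by blast
  have g: "?g z \<in> cyl_base (Suc n) \<and> E (?g z) = J (?g z) \<and> restrict (snd (?g z)) {..<n} = snd z"
    if z: "z \<in> topspace (cyl n)" "fst z = 0 \<or> fst z = 1 \<or> snd z \<in> cube_boundary n" for z
  proof -
    have top: "?g z \<in> topspace ?C"
      using Pi_mem[OF continuous_map_funspace[OF continuous_map_cyl_cube] z(1)] z(1) by (simp add: mem_Times_iff)
    have eq: "restrict (snd (?g z)) {..<n} = snd z"
      using z(1) by (auto simp: topspace_cube PiE_def extensional_def fun_eq_iff)
    have "snd (?g z) \<in> topspace (cube (Suc n))" using top by auto
    then have "snd (?g z) \<in> cube_boundary (Suc n)"
      using cube_SucE(3)[of "snd (?g z)" n] z(2) unfolding eq by auto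
    then have "?g z \<in> cyl_base (Suc n)" using top unfolding cyl_base_def by simp
    then show ?thesis using EJ eq by blast
  qed
  show ?thesis
    unfolding rel_homotopic_iff
  proof (intro exI[of _ "E \<circ> ?g"] conjI ballI h)
    fix t assume t: "t \<in> topspace (cube n)"
    show "(E \<circ> ?g) (0, t) = P (1, t)" using g[of "(0, t)"] t by (simp add: J_def F_def)
    show "(E \<circ> ?g) (1, t) = Q (1, t)" using g[of "(1, t)"] t by (simp add: J_def F_def)
  next
    fix s t assume st: "s \<in> {0..1::real}" "t \<in> cube_boundary n"
    then have "(s, t) \<in> topspace (cyl n)" using cube_boundary_subset by auto
    then show "(E \<circ> ?g) (s, t) = e 1" using g[of "(s, t)"] st bd[of 1 t] by (simp add: J_def F_def)
  qed
qed

text \<open>The homotopy from \<open>h\<close> to the identity carries \<open>h \<circ> g\<close> to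
  \<open>g\<close> and \<open>h \<circ> g'\<close> to \<open>g'\<close>, in both cases along the
  path of the base point, so \<open>rel_homotopic_transport\<close> applies.\<close>

lemma homotopic_id_injective:
  assumes H: "homotopic_with (\<lambda>_. True) X X h id" and x: "x \<in> topspace X"
    and g: "g \<in> based_cubes n X x" "g' \<in> based_cubes n X x"
    and eq: "rel_homotopic n X (h x) (h \<circ> g) (h \<circ> g')"
  shows "rel_homotopic n X x g g'"
proof -
  obtain H where H: "continuous_map (prod_topology (top_of_set {0..1::real}) X) X H"
    "\<forall>x. H (0, x) = h x" "\<forall>x. H (1, x) = x"
    using H unfolding homotopic_with_def id_apply by blast
  have P: "continuous_map (cyl n) X (\<lambda>z. H (fst z, f (snd z)))" if "f \<in> based_cubes n X x" for f
  proof -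
    have "continuous_map (cyl n) X (\<lambda>z. f (snd z))"
      using that continuous_map_compose[OF continuous_map_snd, of "cube n" X f] by (simp add: based_cubes_def comp_def)
    then show ?thesis
      using continuous_map_compose[OF continuous_map_pairedI[OF continuous_map_fst] H(1)] by (simp add: comp_def)
  qed
  have "continuous_map (top_of_set {0..1}) X (\<lambda>s. H (s, x))"
    using continuous_map_compose[OF continuous_map_pairedI[OF continuous_map_id[unfolded id_def]] H(1), of "\<lambda>_. x"] x
    by (simp add: comp_def)
  then show ?thesis
    using rel_homotopic_transport[OF P[OF g(1)] P[OF g(2)], of "\<lambda>s. H (s, x)"] g eq
    unfolding based_cubes_def by (auto simp: H comp_def image_subset_iff)
qed

text \<open>The cube \<open>k\<close> is carried along the path of the base point by an extension
  \<open>E\<close>, and its final cube is \<open>g\<close>. Both \<open>E\<close> and the homotopy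
  applied to \<open>g\<close> end at \<open>g\<close>; run backwards they give cubes that are
  homotopic, namely \<open>k\<close> and \<open>h \<circ> g\<close>.\<close>

lemma homotopic_id_surjective:
  assumes H: "homotopic_with (\<lambda>_. True) X X h id" and x: "x \<in> topspace X"
    and k: "k \<in> based_cubes n X (h x)"
  shows "\<exists>g\<in>based_cubes n X x. rel_homotopic n X (h x) k (h \<circ> g)"
proof -
  obtain H where H: "continuous_map (prod_topology (top_of_set {0..1::real}) X) X H"
    "\<forall>x. H (0, x) = h x" "\<forall>x. H (1, x) = x"
    using H unfolding homotopic_with_def id_apply by blast
  have k': "continuous_map (cube n) X k" "\<And>t. t \<in> cube_boundary n \<Longrightarrow> k t = h x"
    using k by (auto simp: based_cubes_def)
  have e: "continuous_map (top_of_set {0..1}) X (\<lambda>s. H (s, x))"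
    using continuous_map_compose[OF continuous_map_pairedI[OF continuous_map_id[unfolded id_def]] H(1), of "\<lambda>_. x"] x
    by (simp add: comp_def)
  define T where "T b = {z \<in> topspace (cyl n). if b then fst z \<in> {0} else snd z \<in> cube_boundary n}" for b
  define F where "F b = (if b then (\<lambda>z. k (snd z)) else (\<lambda>z. H (fst z, x)))" for b
  have "continuous_map (subtopology (cyl n) (cyl_base n)) X (\<lambda>z. if fst z = 0 then k (snd z) else H (fst z, x))"
  proof (rule pasting_lemma_closed)
    show "finite (UNIV :: bool set)" by simp
    show "closedin (subtopology (cyl n) (cyl_base n)) (cyl_base n \<inter> T b)" for b
    proof -
      have "closedin (cyl n) (T b)"
        using closedin_cyl_fst[of n 0] closedin_cyl_boundary[of n] unfolding T_def
          by (cases b; simp del: topspace_prod_topology)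
      then show ?thesis by (metis closedin_subtopology inf_commute)
    qed
    show "continuous_map (subtopology (subtopology (cyl n) (cyl_base n)) (cyl_base n \<inter> T b)) X (F b)" for b
      using continuous_map_compose[OF continuous_map_snd[of "top_of_set {0..1::real}" "cube n"] k'(1)]
        continuous_map_compose[OF continuous_map_fst[of "top_of_set {0..1}" "cube n"] e]
      by (intro continuous_map_from_subtopology) (simp add: F_def comp_def)
    show "F i z = F j z"
      if "z \<in> topspace (subtopology (cyl n) (cyl_base n)) \<inter> (cyl_base n \<inter> T i) \<inter> (cyl_base n \<inter> T j)" for i j z
      using that by (auto simp: T_def F_def k' H(2) split: if_splits)
    fix z assume "z \<in> topspace (subtopology (cyl n) (cyl_base n))"
    then show "\<exists>j. j \<in> UNIV \<and> z \<in> cyl_base n \<inter> T j \<and> (if fst z = 0 then k (snd z) else H (fst z, x)) = F j z"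
      by (intro exI[of _ "fst z = 0"]) (auto simp: T_def F_def cyl_base_def)
  qed
  then obtain E where E: "continuous_map (cyl n) X E"
    and EJ: "\<And>z. z \<in> cyl_base n \<Longrightarrow> E z = (if fst z = 0 then k (snd z) else H (fst z, x))"
    using cyl_extension by blast
  have E0: "E (0, t) = k t" if "t \<in> topspace (cube n)" for t
    using EJ[of "(0, t)"] that by (simp add: cyl_base_def)
  have Eb: "E (s, t) = H (s, x)" if "s \<in> {0..1}" "t \<in> cube_boundary n" for s t
    using EJ[of "(s, t)"] that cube_boundary_subset[of n] k' by (auto simp: cyl_base_def H)
  define g where "g t = E (1, t)" for t
  have cg: "continuous_map (cube n) X g"
    using continuous_map_compose[OF continuous_map_pairedI[OF _ continuous_map_id[unfolded id_def]] E, of "\<lambda>_. 1"]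
    by (simp add: g_def[abs_def] comp_def)
  then have g: "g \<in> based_cubes n X x" using Eb by (auto simp: based_cubes_def g_def H)
  have rev: "continuous_map (cyl n) (top_of_set {0..1}) (\<lambda>z. 1 - fst z)"
    using continuous_map_diff[OF _ continuous_map_fst_cyl, of n "\<lambda>_. 1"] by (auto simp: continuous_map_in_subtopology)
  \<comment> \<open>Time is reversed because the two homotopies agree at time 1 and the comparison
    is wanted at time 0.\<close>
  have "rel_homotopic n X (H (1 - 1, x)) (\<lambda>t. (\<lambda>z. E (1 - fst z, snd z)) (1, t)) (\<lambda>t. (\<lambda>z. H (1 - fst z, g (snd z))) (1, t))"
  proof (rule rel_homotopic_transport[where e = "\<lambda>s. H (1 - s, x)"])
    show "continuous_map (cyl n) X (\<lambda>z. E (1 - fst z, snd z))"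
      using continuous_map_compose[OF continuous_map_pairedI[OF rev continuous_map_snd] E] by (simp add: comp_def)
    show "continuous_map (cyl n) X (\<lambda>z. H (1 - fst z, g (snd z)))"
      using continuous_map_compose[OF continuous_map_pairedI[OF rev continuous_map_compose[OF continuous_map_snd cg]] H(1)]
      by (simp add: comp_def)
    have r: "continuous_map (top_of_set {0..1}) (top_of_set {0..1}) (\<lambda>s::real. 1 - s)"
      using continuous_map_diff[of "top_of_set {0..1}" "\<lambda>_. 1::real" "\<lambda>s. s"] by (auto simp: continuous_map_in_subtopology)
    show "continuous_map (top_of_set {0..1}) X (\<lambda>s. H (1 - s, x))"
      using continuous_map_compose[OF r e] by (simp add: comp_def)
    show "E (1 - fst (s, t), snd (s, t)) = H (1 - s, x) \<and> H (1 - fst (s, t), g (snd (s, t))) = H (1 - s, x)"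
      if "s \<in> {0..1}" "t \<in> cube_boundary n" for s t
      using that Eb[of "1 - s" t] Eb[of 1 t] by (simp add: g_def H)
    show "rel_homotopic n X (H (1 - 0, x)) (\<lambda>t. E (1 - fst (0, t), snd (0, t))) (\<lambda>t. H (1 - fst (0, t), g (snd (0, t))))"
      using cg g by (simp add: H g_def[symmetric] based_cubes_def)
  qed
  then have "rel_homotopic n X (h x) (\<lambda>t. E (0, t)) (h \<circ> g)" by (simp add: H comp_def)
  then have "rel_homotopic n X (h x) k (h \<circ> g)"
    unfolding rel_homotopic_iff by (simp add: E0)
  then show ?thesis using g by blast
qed

lemma based_cubes_comp:
  assumes "continuous_map X Y f" "g \<in> based_cubes n X x"
  shows "f \<circ> g \<in> based_cubes n Y (f x)"
  using assms continuous_map_compose[of "cube n" X g Y f] by (auto simp: based_cubes_def)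

lemma rel_homotopic_comp:
  assumes "continuous_map X Y f" "rel_homotopic n X x g g'"
  shows "rel_homotopic n Y (f x) (f \<circ> g) (f \<circ> g')"
  by (rule homotopic_with_compose_continuous_map_left[OF assms(2,1)]) auto

lemma homotopy_class_eq_iff:
  assumes "g \<in> based_cubes n X x"
  shows "homotopy_class n X x g = homotopy_class n X x g' \<longleftrightarrow> rel_homotopic n X x g g'"
proof
  assume "homotopy_class n X x g = homotopy_class n X x g'"
  moreover have "g \<in> homotopy_class n X x g" using assms by (simp add: homotopy_class_def based_cubes_def)
  ultimately show "rel_homotopic n X x g g'" by (auto simp: homotopy_class_def intro: homotopic_with_symD)
next
  assume "rel_homotopic n X x g g'"
  then show "homotopy_class n X x g = homotopy_class n X x g'"
    unfolding homotopy_class_def by (auto intro: homotopic_with_trans homotopic_with_symD)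
qed

text \<open>Homotopic cubes have homotopic images, so the union in the definition is over equal
  classes.\<close>

lemma homotopy_group_map_class:
  assumes f: "continuous_map X Y f" and g: "g \<in> based_cubes n X x"
  shows "homotopy_group_map n Y f x (homotopy_class n X x g) = homotopy_class n Y (f x) (f \<circ> g)"
proof -
  have "homotopy_class n Y (f x) (f \<circ> g') = homotopy_class n Y (f x) (f \<circ> g)" if "g' \<in> homotopy_class n X x g" for g'
    using rel_homotopic_comp[OF f, of n x g g'] homotopy_class_eq_iff[OF based_cubes_comp[OF f g], of "f \<circ> g'"] that
    by (simp add: homotopy_class_def)
  moreover have "g \<in> homotopy_class n X x g" using g by (simp add: homotopy_class_def based_cubes_def)
  ultimately show ?thesis unfolding homotopy_group_map_def by blast
qed

lemma homotopic_imp_path_component: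
  assumes "homotopic_with (\<lambda>_. True) X Y f g" "x \<in> topspace X"
  shows "path_component_of Y (f x) (g x)"
proof -
  obtain H where H: "continuous_map (prod_topology (top_of_set {0..1::real}) X) Y H"
    "\<forall>x. H (0, x) = f x" "\<forall>x. H (1, x) = g x"
    using assms(1) unfolding homotopic_with_def by blast
  have "continuous_map (top_of_set {0..1}) Y (\<lambda>s. H (s, x))"
    using continuous_map_compose[OF continuous_map_pairedI[OF continuous_map_id[unfolded id_def]] H(1), of "\<lambda>_. x"] assms(2)
    by (simp add: comp_def)
  then show ?thesis unfolding path_component_of_def pathin_def using H by (intro exI[of _ "\<lambda>s. H (s, x)"]) auto
qed

lemma path_component_of_map:
  assumes "continuous_map X Y f" "path_component_of X x y"
  shows "path_component_of Y (f x) (f y)"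
proof -
  obtain p where p: "pathin X p" "p 0 = x" "p 1 = y" using assms(2) unfolding path_component_of_def by blast
  then have "pathin Y (f \<circ> p)" using assms(1) unfolding pathin_def by (simp add: continuous_map_compose)
  then show ?thesis unfolding path_component_of_def using p by (intro exI[of _ "f \<circ> p"]) auto
qed

lemma path_component_of_set_eq_iff:
  assumes "x \<in> topspace X"
  shows "path_component_of_set X x = path_component_of_set X y \<longleftrightarrow> path_component_of X x y"
proof
  assume "path_component_of_set X x = path_component_of_set X y"
  then have "path_component_of X y x" using assms by (metis mem_Collect_eq path_component_of_refl)
  then show "path_component_of X x y" by (simp add: path_component_of_sym)
next
  assume "path_component_of X x y"
  then have "path_component_of X x = path_component_of X y" by (metis path_component_of_equiv)
  then show "path_component_of_set X x = path_component_of_set X y" by simp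
qed

text \<open>Left and right inverses may be different maps: \<open>g\<close>,
  \<open>g \<circ> f \<circ> g'\<close> and \<open>g'\<close> are homotopic, so \<open>g\<close> is
  an inverse on both sides. The homotopies do not fix base points, which is why the two preceding
  lemmas on maps homotopic to the identity are used for the homotopy groups.\<close>

lemma weak_homotopy_equivalence_of_homotopy_inverses:
  assumes f: "continuous_map X Y f" and g: "continuous_map Y X g" and g': "continuous_map Y X g'"
    and left: "homotopic_with (\<lambda>_. True) X X (g \<circ> f) id"
    and right: "homotopic_with (\<lambda>_. True) Y Y (f \<circ> g') id"
  shows "weak_homotopy_equivalence X Y f"
proof -
  have "homotopic_with (\<lambda>_. True) Y X (g \<circ> (f \<circ> g')) (g \<circ> id)"
    by (rule homotopic_with_compose_continuous_map_left[OF right g]) simp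
  moreover have "homotopic_with (\<lambda>_. True) Y X ((g \<circ> f) \<circ> g') (id \<circ> g')"
    by (rule homotopic_with_compose_continuous_map_right[OF left g']) simp
  ultimately have "homotopic_with (\<lambda>_. True) Y X g g'"
    using homotopic_with_trans homotopic_with_symD by (simp add: comp_assoc) blast
  then have "homotopic_with (\<lambda>_. True) Y Y (f \<circ> g) (f \<circ> g')"
    by (rule homotopic_with_compose_continuous_map_left[OF _ f]) simp
  then have right: "homotopic_with (\<lambda>_. True) Y Y (f \<circ> g) id" using right homotopic_with_trans by blast
  have ftop: "f x \<in> topspace Y" if "x \<in> topspace X" for x using continuous_map_funspace[OF f] that by auto
  have gtop: "g y \<in> topspace X" if "y \<in> topspace Y" for y using continuous_map_funspace[OF g] that by auto
  have pc: "path_components_map Y f (path_component_of_set X x) = path_component_of_set Y (f x)"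
    if x: "x \<in> topspace X" for x
  proof -
    have "path_component_of_set Y (f y) = path_component_of_set Y (f x)" if "y \<in> path_component_of_set X x" for y
      using path_component_of_map[OF f, of x y] path_component_of_set_eq_iff[OF ftop[OF x], of "f y"] that by simp
    moreover have "x \<in> path_component_of_set X x" using x by (simp add: path_component_of_refl)
    ultimately show ?thesis unfolding path_components_map_def by blast
  qed
  have "bij_betw (path_components_map Y f) (path_components_of X) (path_components_of Y)"
    unfolding bij_betw_def
  proof
    show "inj_on (path_components_map Y f) (path_components_of X)"
      unfolding path_components_of_def
    proof (rule inj_onI; clarify)
      fix x x' assume x: "x \<in> topspace X" "x' \<in> topspace X"
        and "path_components_map Y f (path_component_of_set X x) = path_components_map Y f (path_component_of_set X x')"
      then have "path_component_of Y (f x) (f x')" using pc path_component_of_set_eq_iff ftop by metis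
      then have "path_component_of X (g (f x)) (g (f x'))" by (rule path_component_of_map[OF g])
      moreover have "path_component_of X (g (f z)) z" if "z \<in> topspace X" for z
        using homotopic_imp_path_component[OF left that] by simp
      ultimately have "path_component_of X x x'"
        using x path_component_of_sym path_component_of_trans by metis
      then show "path_component_of_set X x = path_component_of_set X x'" using path_component_of_set_eq_iff x by metis
    qed
    show "path_components_map Y f ` path_components_of X = path_components_of Y"
    proof (intro equalityI subsetI)
      fix c assume "c \<in> path_components_map Y f ` path_components_of X"
      then show "c \<in> path_components_of Y" using pc ftop unfolding path_components_of_def by auto
    next
      fix c assume "c \<in> path_components_of Y"
      then obtain y where y: "y \<in> topspace Y" "c = path_component_of_set Y y" unfolding path_components_of_def by auto
      have "path_component_of Y (f (g y)) y" using homotopic_imp_path_component[OF right y(1)] by simp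
      then have "path_component_of_set Y (f (g y)) = c"
        using path_component_of_set_eq_iff[OF ftop[OF gtop[OF y(1)]]] y by metis
      then show "c \<in> path_components_map Y f ` path_components_of X"
        using pc[OF gtop[OF y(1)]] gtop[OF y(1)] unfolding path_components_of_def by blast
    qed
  qed
  moreover have "bij_betw (homotopy_group_map n Y f x) (homotopy_group n X x) (homotopy_group n Y (f x))"
    if x: "x \<in> topspace X" for x n
    unfolding bij_betw_def
  proof
    show "inj_on (homotopy_group_map n Y f x) (homotopy_group n X x)"
      unfolding homotopy_group_def
    proof (rule inj_onI; clarify)
      fix p q assume p: "p \<in> based_cubes n X x" and q: "q \<in> based_cubes n X x"
        and "homotopy_group_map n Y f x (homotopy_class n X x p) = homotopy_group_map n Y f x (homotopy_class n X x q)"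
      then have "rel_homotopic n Y (f x) (f \<circ> p) (f \<circ> q)"
        by (simp add: homotopy_group_map_class[OF f] homotopy_class_eq_iff[OF based_cubes_comp[OF f p]])
      then have "rel_homotopic n X (g (f x)) (g \<circ> (f \<circ> p)) (g \<circ> (f \<circ> q))" by (rule rel_homotopic_comp[OF g])
      then have "rel_homotopic n X x p q"
        using homotopic_id_injective[OF left x p q] by (simp add: comp_assoc)
      then show "homotopy_class n X x p = homotopy_class n X x q" by (simp add: homotopy_class_eq_iff[OF p])
    qed
    show "homotopy_group_map n Y f x ` homotopy_group n X x = homotopy_group n Y (f x)"
    proof (intro equalityI subsetI)
      fix c assume "c \<in> homotopy_group_map n Y f x ` homotopy_group n X x"
      then show "c \<in> homotopy_group n Y (f x)"
        using homotopy_group_map_class[OF f] based_cubes_comp[OF f] unfolding homotopy_group_def by auto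
    next
      fix c assume "c \<in> homotopy_group n Y (f x)"
      then obtain k where k: "k \<in> based_cubes n Y (f x)" "c = homotopy_class n Y (f x) k"
        unfolding homotopy_group_def by blast
      \<comment> \<open>Surjectivity of \<open>g \<circ> f\<close> supplies \<open>p\<close> for the
        cube \<open>g \<circ> k\<close>; after applying \<open>f\<close>, injectivity of
        \<open>f \<circ> g\<close> removes the factor \<open>f \<circ> g\<close> and leaves
        \<open>k\<close> homotopic to \<open>f \<circ> p\<close>.\<close>
      have "g \<circ> k \<in> based_cubes n X ((g \<circ> f) x)" using based_cubes_comp[OF g k(1)] by simp
      then obtain p where p: "p \<in> based_cubes n X x" "rel_homotopic n X ((g \<circ> f) x) (g \<circ> k) ((g \<circ> f) \<circ> p)"
        using homotopic_id_surjective[OF left x] by blast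
      then have "rel_homotopic n Y (f (g (f x))) (f \<circ> (g \<circ> k)) (f \<circ> (g \<circ> (f \<circ> p)))"
        using rel_homotopic_comp[OF f] by (simp add: comp_assoc) 
      then have "rel_homotopic n Y (f x) k (f \<circ> p)"
        using homotopic_id_injective[OF right ftop[OF x] k(1) based_cubes_comp[OF f p(1)]] by (simp add: comp_assoc)
      then have "c = homotopy_group_map n Y f x (homotopy_class n X x p)"
        using k homotopy_group_map_class[OF f p(1)] homotopy_class_eq_iff[OF k(1)] by simp
      then show "c \<in> homotopy_group_map n Y f x ` homotopy_group n X x"
        using p(1) unfolding homotopy_group_def by blast
    qed
  qed
  ultimately show ?thesis using f unfolding weak_homotopy_equivalence_def by blast
qed

section \<open>Weak equivalences detected on the threefold subdivision\<close>

lemma realization_map_comp: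
  assumes "sset_map X Y f" "sset_map Y Z g" "c \<in> topspace (realization X)"
  shows "realization_map Z g (realization_map Y f c) = realization_map Z (\<lambda>n x. g n (f n x)) c"
proof -
  obtain n x t where c: "c = rclass X (n, x, t)" using assms(3) by (rule realization_cases)
  show ?thesis
    unfolding c realization_map_rclass[OF assms(1)] realization_map_rclass[OF assms(2)]
      realization_map_rclass[OF sset_map_comp[OF assms(1,2)]] ..
qed

lemma realization_map_cong:
  assumes "sset_map X Y f" "sset_map X Y g" "\<And>n x. x \<in> Sim X n \<Longrightarrow> f n x = g n x" "c \<in> topspace (realization X)"
  shows "realization_map Y f c = realization_map Y g c"
proof -
  obtain n x t where x: "x \<in> Sim X n" and c: "c = rclass X (n, x, t)" using assms(4) by (rule realization_cases)
  show ?thesis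
    unfolding c realization_map_rclass[OF assms(1)] realization_map_rclass[OF assms(2)] assms(3)[OF x] ..
qed

text \<open>The barycentre of the weight simplex of three blocks. Its positivity makes spreading
  invertible.\<close>

definition third :: "nat \<Rightarrow> real" where
  "third i = (if i \<le> 2 then 1 / 3 else 0)"

lemma third_simplex: "third \<in> standard_simplex 2"
proof (rule simplexI)
  have "{..2::nat} = {0, 1, 2}" by auto
  then show "(\<Sum>i\<le>2. third i) = 1" by (simp add: third_def)
qed (auto simp: third_def)

lemma positive_spread_third: "simplicial_set X \<Longrightarrow> positive_spread X 2 third"
  using third_simplex by (simp add: positive_spread_def positive_spread_axioms_def third_def)

text \<open>Two blocks are two vertices of the weight simplex, and \<open>f\<close> and
  \<open>g\<close> are the maps that \<open>\<kappa>\<close> induces at these vertices.\<close>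

lemma homotopic_blocks:
  assumes Z: "simplicial_set Z" and \<kappa>: "sset_map W (sd r Z) \<kappa>" and b: "b \<le> r" "b' \<le> r"
    and f: "sset_map W Z f" "\<And>n x. x \<in> Sim W n \<Longrightarrow> act Z n (r * Suc n + n) (block b n) (\<kappa> n x) = f n x"
    and g: "sset_map W Z g" "\<And>n x. x \<in> Sim W n \<Longrightarrow> act Z n (r * Suc n + n) (block b' n) (\<kappa> n x) = g n x"
  shows "homotopic_with (\<lambda>_. True) (realization W) (realization Z) (realization_map Z f) (realization_map Z g)"
proof -
  have eq: "realization_map Z h c = spread_map r Z \<kappa> (\<lambda>j. if j = b then 1 else 0) c"
    if "b \<le> r" "sset_map W Z h" "\<And>n x. x \<in> Sim W n \<Longrightarrow> act Z n (r * Suc n + n) (block b n) (\<kappa> n x) = h n x"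
      "c \<in> topspace (realization W)" for b h c
    unfolding spread_map_vertex[OF Z \<kappa> that(1,4)]
    by (rule realization_map_cong[OF that(2) sset_map_comp[OF \<kappa> sset_map_block[OF Z that(1)]] _ that(4)])
      (simp only: that(3))
  show ?thesis
    by (rule homotopic_with_eq[OF spread_map_homotopic[OF \<kappa>,
      of "\<lambda>j. if j = b then 1 else 0" "\<lambda>j. if j = b' then 1 else 0"]])
      (use b eq[OF b(1) f] eq[OF b(2) g] in auto)
qed

text \<open>With positive \<open>w\<close> the map on the right is the homeomorphism from the
  subdivision, so every block restriction is homotopic to it. This lets a block restriction count as
  the identity.\<close>

lemma homotopic_block_spread:
  assumes Z: "simplicial_set Z" and b: "b \<le> r" and w: "w \<in> standard_simplex r"
  shows "homotopic_with (\<lambda>_. True) (realization (sd r Z)) (realization Z)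
    (realization_map Z (\<lambda>n. act Z n (r * Suc n + n) (block b n))) (spread_map r Z (\<lambda>n x. x) w)"
proof (rule homotopic_with_eq)
  have \<kappa>: "sset_map (sd r Z) (sd r Z) (\<lambda>n x. x)" by (intro sset_map_id simplicial_set_sd Z)
  show "homotopic_with (\<lambda>_. True) (realization (sd r Z)) (realization Z)
    (spread_map r Z (\<lambda>n x. x) (\<lambda>j. if j = b then 1 else 0)) (spread_map r Z (\<lambda>n x. x) w)"
    by (rule spread_map_homotopic[OF \<kappa>]) (use b w in auto)
  show "realization_map Z (\<lambda>n. act Z n (r * Suc n + n) (block b n)) c =
      spread_map r Z (\<lambda>n x. x) (\<lambda>j. if j = b then 1 else 0) c"
    if "c \<in> topspace (realization (sd r Z))" for c
    using spread_map_vertex[OF Z \<kappa> b that] by simp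
qed auto

text \<open>A weak equivalence criterion in terms of the threefold subdivision. The maps \<open>\<rho>\<close> and \<open>\<rho>'\<close> represent
  homotopy inverses through the homeomorphism of the realizations of \<open>sd 2 X\<close> and \<open>X\<close>; a map into
  \<open>sd 1\<close> joins two simplices and so gives a linear homotopy between them.\<close>

theorem sset_weak_equivalence_by_subdivision:
  assumes \<eta>: "sset_map Y X \<eta>" and \<rho>: "sset_map (sd 2 X) Y \<rho>" and \<rho>': "sset_map (sd 2 X) Y \<rho>'"
    and K: "sset_map (sd 2 X) (sd 1 X) K" and K': "sset_map (sd 2 Y) (sd 1 Y) K'"
    and K0: "\<And>n x. x \<in> Sim X (2 * Suc n + n) \<Longrightarrow> act X n (1 * Suc n + n) (block 0 n) (K n x) = \<eta> n (\<rho>' n x)"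
    and K1: "\<And>n x. x \<in> Sim X (2 * Suc n + n) \<Longrightarrow>
      act X n (1 * Suc n + n) (block 1 n) (K n x) = act X n (2 * Suc n + n) (block 2 n) x"
    and K'0: "\<And>n y. y \<in> Sim Y (2 * Suc n + n) \<Longrightarrow>
      act Y n (1 * Suc n + n) (block 0 n) (K' n y) = act Y n (2 * Suc n + n) (block 0 n) y"
    and K'1: "\<And>n y. y \<in> Sim Y (2 * Suc n + n) \<Longrightarrow>
      act Y n (1 * Suc n + n) (block 1 n) (K' n y) = \<rho> n (\<eta> (2 * Suc n + n) y)"
  shows "sset_weak_equivalence Y X \<eta>"
proof -
  interpret \<eta>: sset_map Y X \<eta> by fact
  note X = \<eta>.Y.simplicial_set_axioms and Y = \<eta>.X.simplicial_set_axioms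
  interpret X: positive_spread X 2 third by (rule positive_spread_third[OF X])
  interpret Y: positive_spread Y 2 third by (rule positive_spread_third[OF Y])
  let ?\<theta>X = "spread_map 2 X (\<lambda>n x. x) third" and ?\<theta>Y = "spread_map 2 Y (\<lambda>n x. x) third"
  let ?\<psi>X = "unspread 2 X third" and ?\<psi>Y = "unspread 2 Y third"
  let ?f = "realization_map X \<eta>"
  have \<sigma>: "sset_map (sd 2 Y) (sd 2 X) (\<lambda>n. \<eta> (2 * Suc n + n))" by (rule sset_map_sd[OF \<eta>])
  have "homotopic_with (\<lambda>_. True) (realization (sd 2 X)) (realization X)
      (realization_map X (\<lambda>n x. \<eta> n (\<rho>' n x))) (realization_map X (\<lambda>n. act X n (2 * Suc n + n) (block 2 n)))"
    by (rule homotopic_blocks[OF X K, of 0 1])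
      (use K0 K1 sset_map_comp[OF \<rho>' \<eta>] sset_map_block[OF X, of 2 2] in \<open>simp_all only: Sim_sd le_refl zero_le\<close>)
  then have "homotopic_with (\<lambda>_. True) (realization (sd 2 X)) (realization X)
      (realization_map X (\<lambda>n x. \<eta> n (\<rho>' n x))) ?\<theta>X"
    using homotopic_block_spread[OF X le_refl third_simplex] by (rule homotopic_with_trans)
  then have "homotopic_with (\<lambda>_. True) (realization X) (realization X)
      (realization_map X (\<lambda>n x. \<eta> n (\<rho>' n x)) \<circ> ?\<psi>X) (?\<theta>X \<circ> ?\<psi>X)"
    by (rule homotopic_with_compose_continuous_map_right[OF _ X.continuous_map_unspread]) simp
  then have right: "homotopic_with (\<lambda>_. True) (realization X) (realization X) (?f \<circ> (realization_map Y \<rho>' \<circ> ?\<psi>X)) id"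
    by (rule homotopic_with_eq) (auto simp: X.spread_unspread realization_map_comp[OF \<rho>' \<eta>])
  have "homotopic_with (\<lambda>_. True) (realization (sd 2 Y)) (realization Y)
      (realization_map Y (\<lambda>n y. \<rho> n (\<eta> (2 * Suc n + n) y))) (realization_map Y (\<lambda>n. act Y n (2 * Suc n + n) (block 0 n)))"
    by (rule homotopic_blocks[OF Y K', of 1 0])
      (use K'0 K'1 sset_map_comp[OF \<sigma> \<rho>] sset_map_block[OF Y, of 0 2] in \<open>simp_all only: Sim_sd le_refl zero_le\<close>)
  then have "homotopic_with (\<lambda>_. True) (realization (sd 2 Y)) (realization Y)
      (realization_map Y (\<lambda>n y. \<rho> n (\<eta> (2 * Suc n + n) y))) ?\<theta>Y"
    using homotopic_block_spread[OF Y zero_le third_simplex] by (rule homotopic_with_trans)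
  then have h: "homotopic_with (\<lambda>_. True) (realization Y) (realization Y)
      (realization_map Y (\<lambda>n y. \<rho> n (\<eta> (2 * Suc n + n) y)) \<circ> ?\<psi>Y) (?\<theta>Y \<circ> ?\<psi>Y)"
    by (rule homotopic_with_compose_continuous_map_right[OF _ Y.continuous_map_unspread]) simp
  \<comment> \<open>The homeomorphisms are natural, so conjugation turns the realization of
    \<open>\<eta>\<close> into that of its subdivision. In \<open>left\<close> this moves
    \<open>?\<psi>X\<close> past \<open>?f\<close>, to where the hypothesis on \<open>K'\<close>
    speaks.\<close>
  have nat: "?\<psi>X (?f c) = realization_map (sd 2 X) (\<lambda>n. \<eta> (2 * Suc n + n)) (?\<psi>Y c)"
    if c: "c \<in> topspace (realization Y)" for c
  proof -
    note d = Y.spread_unspread[OF c]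
    have "?f c = ?f (?\<theta>Y (?\<psi>Y c))" using d by simp
    also have "\<dots> = spread_map 2 X (\<lambda>n. \<eta> (2 * Suc n + n)) third (?\<psi>Y c)"
      by (rule spread_map_natural[OF Y.sset_map_sd_id \<eta> third_simplex d(1)])
    also have "\<dots> = ?\<theta>X (realization_map (sd 2 X) (\<lambda>n. \<eta> (2 * Suc n + n)) (?\<psi>Y c))"
      by (rule spread_map_precomp[OF X.sset_map_sd_id \<sigma> third_simplex d(1), symmetric])
    finally show ?thesis
      using X.unspread_spread continuous_map_funspace[OF continuous_map_realization_map[OF \<sigma>]] d(1) by auto
  qed
  have left: "homotopic_with (\<lambda>_. True) (realization Y) (realization Y) ((realization_map Y \<rho> \<circ> ?\<psi>X) \<circ> ?f) id"
    using h by (rule homotopic_with_eq) (auto simp: Y.spread_unspread nat realization_map_comp[OF \<sigma> \<rho>] simp del: mult_Suc_right)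
  have "weak_homotopy_equivalence (realization Y) (realization X) ?f"
    by (rule weak_homotopy_equivalence_of_homotopy_inverses[OF _ _ _ left right])
      (intro continuous_map_realization_map \<eta> \<rho> \<rho>' continuous_map_compose[OF X.continuous_map_unspread])+
  then show ?thesis using \<eta> by (simp add: sset_weak_equivalence_def)
qed

section \<open>Calculation in bicategories\<close>

context bicategory
begin

text \<open>The axioms are restated with sources and targets as terms in place of membership in
  hom-sets. Typing conditions then become equations that the simplifier proves.\<close>

lemma src_Obj [simp]: "u \<in> Mor B \<Longrightarrow> src B u \<in> Obj B"
  and trg_Obj [simp]: "u \<in> Mor B \<Longrightarrow> trg B u \<in> Obj B"
  using mor_src_trg by auto

lemma vsrc_Mor [simp]: "\<phi> \<in> Def B \<Longrightarrow> vsrc B \<phi> \<in> Mor B"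
  and vtrg_Mor [simp]: "\<phi> \<in> Def B \<Longrightarrow> vtrg B \<phi> \<in> Mor B"
  and src_vtrg [simp]: "\<phi> \<in> Def B \<Longrightarrow> src B (vtrg B \<phi>) = src B (vsrc B \<phi>)"
  and trg_vtrg [simp]: "\<phi> \<in> Def B \<Longrightarrow> trg B (vtrg B \<phi>) = trg B (vsrc B \<phi>)"
  using def_src_trg by auto

lemma Mor_one [simp]: "x \<in> Obj B \<Longrightarrow> one B x \<in> Mor B"
  and src_one [simp]: "x \<in> Obj B \<Longrightarrow> src B (one B x) = x"
  and trg_one [simp]: "x \<in> Obj B \<Longrightarrow> trg B (one B x) = x"
  using one_hom by (auto simp: mor_hom_def)

lemma Mor_hcomp [simp]: "u \<in> Mor B \<Longrightarrow> v \<in> Mor B \<Longrightarrow> src B u = trg B v \<Longrightarrow> u \<star> v \<in> Mor B"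
  and src_hcomp [simp]: "u \<in> Mor B \<Longrightarrow> v \<in> Mor B \<Longrightarrow> src B u = trg B v \<Longrightarrow> src B (u \<star> v) = src B v"
  and trg_hcomp [simp]: "u \<in> Mor B \<Longrightarrow> v \<in> Mor B \<Longrightarrow> src B u = trg B v \<Longrightarrow> trg B (u \<star> v) = trg B u"
  using hcomp_hom[of u "src B u" "trg B u" v "src B v"] by (auto simp: mor_hom_def)

lemma Def_vone [simp]: "u \<in> Mor B \<Longrightarrow> vone B u \<in> Def B"
  and vsrc_vone [simp]: "u \<in> Mor B \<Longrightarrow> vsrc B (vone B u) = u"
  and vtrg_vone [simp]: "u \<in> Mor B \<Longrightarrow> vtrg B (vone B u) = u"
  using vone_hom by (auto simp: def_hom_def)

lemma Def_vcomp [simp]: "\<phi> \<in> Def B \<Longrightarrow> \<psi> \<in> Def B \<Longrightarrow> vsrc B \<psi> = vtrg B \<phi> \<Longrightarrow> \<psi> \<cdot> \<phi> \<in> Def B"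
  and vsrc_vcomp [simp]: "\<phi> \<in> Def B \<Longrightarrow> \<psi> \<in> Def B \<Longrightarrow> vsrc B \<psi> = vtrg B \<phi> \<Longrightarrow> vsrc B (\<psi> \<cdot> \<phi>) = vsrc B \<phi>"
  and vtrg_vcomp [simp]: "\<phi> \<in> Def B \<Longrightarrow> \<psi> \<in> Def B \<Longrightarrow> vsrc B \<psi> = vtrg B \<phi> \<Longrightarrow> vtrg B (\<psi> \<cdot> \<phi>) = vtrg B \<psi>"
  using vcomp_hom[of \<phi> "vsrc B \<phi>" "vtrg B \<phi>" \<psi> "vtrg B \<psi>"] by (auto simp: def_hom_def)

text \<open>Oriented against the axiom, as a rewrite rule to right-nested composites.\<close>

lemma vcomp_assoc': "\<phi> \<in> Def B \<Longrightarrow> \<psi> \<in> Def B \<Longrightarrow> \<theta> \<in> Def B \<Longrightarrow> vsrc B \<psi> = vtrg B \<phi> \<Longrightarrow>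
    vsrc B \<theta> = vtrg B \<psi> \<Longrightarrow> \<theta> \<cdot> \<psi> \<cdot> \<phi> = \<theta> \<cdot> (\<psi> \<cdot> \<phi>)"
  using vcomp_assoc[of \<phi> "vsrc B \<phi>" "vtrg B \<phi>" \<psi> "vtrg B \<psi>" \<theta> "vtrg B \<theta>"] by (simp add: def_hom_def)

lemma vcomp_vone_left [simp]: "\<phi> \<in> Def B \<Longrightarrow> vtrg B \<phi> = u \<Longrightarrow> vone B u \<cdot> \<phi> = \<phi>"
  and vcomp_vone_right [simp]: "\<phi> \<in> Def B \<Longrightarrow> vsrc B \<phi> = u \<Longrightarrow> \<phi> \<cdot> vone B u = \<phi>"
  using vcomp_one_left vcomp_one_right by auto

lemma Def_dcomp [simp]: "\<phi> \<in> Def B \<Longrightarrow> \<psi> \<in> Def B \<Longrightarrow> src B (vsrc B \<phi>) = trg B (vsrc B \<psi>) \<Longrightarrow> \<phi> \<diamondop> \<psi> \<in> Def B"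
  and vsrc_dcomp [simp]: "\<phi> \<in> Def B \<Longrightarrow> \<psi> \<in> Def B \<Longrightarrow> src B (vsrc B \<phi>) = trg B (vsrc B \<psi>) \<Longrightarrow>
    vsrc B (\<phi> \<diamondop> \<psi>) = vsrc B \<phi> \<star> vsrc B \<psi>"
  and vtrg_dcomp [simp]: "\<phi> \<in> Def B \<Longrightarrow> \<psi> \<in> Def B \<Longrightarrow> src B (vsrc B \<phi>) = trg B (vsrc B \<psi>) \<Longrightarrow>
    vtrg B (\<phi> \<diamondop> \<psi>) = vtrg B \<phi> \<star> vtrg B \<psi>"
  using dcomp_hom[of \<phi> "vsrc B \<phi>" "vtrg B \<phi>" \<psi> "vsrc B \<psi>" "vtrg B \<psi>"] by (auto simp: def_hom_def composable_def)

lemma dcomp_vone' [simp]: "u \<in> Mor B \<Longrightarrow> v \<in> Mor B \<Longrightarrow> src B u = trg B v \<Longrightarrow> vone B u \<diamondop> vone B v = vone B (u \<star> v)"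
  using dcomp_vone by (simp add: composable_def)

lemma interchange': "\<phi> \<in> Def B \<Longrightarrow> \<phi>' \<in> Def B \<Longrightarrow> \<psi> \<in> Def B \<Longrightarrow> \<psi>' \<in> Def B \<Longrightarrow> vsrc B \<phi>' = vtrg B \<phi> \<Longrightarrow>
    vsrc B \<psi>' = vtrg B \<psi> \<Longrightarrow> src B (vsrc B \<phi>) = trg B (vsrc B \<psi>) \<Longrightarrow>
    (\<phi>' \<diamondop> \<psi>') \<cdot> (\<phi> \<diamondop> \<psi>) = (\<phi>' \<cdot> \<phi>) \<diamondop> (\<psi>' \<cdot> \<psi>)"
  using interchange[of \<phi> "vsrc B \<phi>" "vtrg B \<phi>" \<phi>' "vtrg B \<phi>'" \<psi> "vsrc B \<psi>" "vtrg B \<psi>" \<psi>' "vtrg B \<psi>'"]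
  by (simp add: def_hom_def composable_def)

lemma whisker_right: "\<phi> \<in> Def B \<Longrightarrow> \<phi>' \<in> Def B \<Longrightarrow> w \<in> Mor B \<Longrightarrow> vsrc B \<phi>' = vtrg B \<phi> \<Longrightarrow>
    src B (vsrc B \<phi>) = trg B w \<Longrightarrow> (\<phi>' \<cdot> \<phi>) \<diamondop> vone B w = (\<phi>' \<diamondop> vone B w) \<cdot> (\<phi> \<diamondop> vone B w)"
  and whisker_left: "\<phi> \<in> Def B \<Longrightarrow> \<phi>' \<in> Def B \<Longrightarrow> w \<in> Mor B \<Longrightarrow> vsrc B \<phi>' = vtrg B \<phi> \<Longrightarrow>
    src B w = trg B (vsrc B \<phi>) \<Longrightarrow> vone B w \<diamondop> (\<phi>' \<cdot> \<phi>) = (vone B w \<diamondop> \<phi>') \<cdot> (vone B w \<diamondop> \<phi>)"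
  by (simp_all add: interchange')

lemma Def_assoc [simp]: "u \<in> Mor B \<Longrightarrow> v \<in> Mor B \<Longrightarrow> w \<in> Mor B \<Longrightarrow> src B u = trg B v \<Longrightarrow> src B v = trg B w \<Longrightarrow>
    assoc B u v w \<in> Def B"
  and vsrc_assoc [simp]: "u \<in> Mor B \<Longrightarrow> v \<in> Mor B \<Longrightarrow> w \<in> Mor B \<Longrightarrow> src B u = trg B v \<Longrightarrow> src B v = trg B w \<Longrightarrow>
    vsrc B (assoc B u v w) = u \<star> (v \<star> w)"
  and vtrg_assoc [simp]: "u \<in> Mor B \<Longrightarrow> v \<in> Mor B \<Longrightarrow> w \<in> Mor B \<Longrightarrow> src B u = trg B v \<Longrightarrow> src B v = trg B w \<Longrightarrow>
    vtrg B (assoc B u v w) = (u \<star> v) \<star> w"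
  using assoc_hom[of u v w] by (auto simp: def_hom_def composable_def)

lemma assoc_nat': "\<phi> \<in> Def B \<Longrightarrow> \<psi> \<in> Def B \<Longrightarrow> \<theta> \<in> Def B \<Longrightarrow> src B (vsrc B \<phi>) = trg B (vsrc B \<psi>) \<Longrightarrow>
    src B (vsrc B \<psi>) = trg B (vsrc B \<theta>) \<Longrightarrow>
    assoc B (vtrg B \<phi>) (vtrg B \<psi>) (vtrg B \<theta>) \<cdot> (\<phi> \<diamondop> (\<psi> \<diamondop> \<theta>)) =
    ((\<phi> \<diamondop> \<psi>) \<diamondop> \<theta>) \<cdot> assoc B (vsrc B \<phi>) (vsrc B \<psi>) (vsrc B \<theta>)"
  using assoc_nat[of \<phi> "vsrc B \<phi>" "vtrg B \<phi>" \<psi> "vsrc B \<psi>" "vtrg B \<psi>" \<theta> "vsrc B \<theta>" "vtrg B \<theta>"]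
  by (simp add: def_hom_def composable_def)

lemma Def_lunit [simp]: "u \<in> Mor B \<Longrightarrow> lunit B u \<in> Def B"
  and vsrc_lunit [simp]: "u \<in> Mor B \<Longrightarrow> vsrc B (lunit B u) = one B (trg B u) \<star> u"
  and vtrg_lunit [simp]: "u \<in> Mor B \<Longrightarrow> vtrg B (lunit B u) = u"
  using lunit_hom[of u "src B u" "trg B u"] by (auto simp: def_hom_def mor_hom_def)

lemma Def_runit [simp]: "u \<in> Mor B \<Longrightarrow> runit B u \<in> Def B"
  and vsrc_runit [simp]: "u \<in> Mor B \<Longrightarrow> vsrc B (runit B u) = u \<star> one B (src B u)"
  and vtrg_runit [simp]: "u \<in> Mor B \<Longrightarrow> vtrg B (runit B u) = u"
  using runit_hom[of u "src B u" "trg B u"] by (auto simp: def_hom_def mor_hom_def)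

lemma lunit_nat': "\<phi> \<in> Def B \<Longrightarrow> lunit B (vtrg B \<phi>) \<cdot> (vone B (one B (trg B (vsrc B \<phi>))) \<diamondop> \<phi>) = \<phi> \<cdot> lunit B (vsrc B \<phi>)"
  using lunit_nat[of \<phi> "vsrc B \<phi>" "vtrg B \<phi>"] by (simp add: def_hom_def mor_hom_def)

lemma runit_nat': "\<phi> \<in> Def B \<Longrightarrow> runit B (vtrg B \<phi>) \<cdot> (\<phi> \<diamondop> vone B (one B (src B (vsrc B \<phi>)))) = \<phi> \<cdot> runit B (vsrc B \<phi>)"
  using runit_nat[of \<phi> "vsrc B \<phi>" "vtrg B \<phi>"] by (simp add: def_hom_def mor_hom_def)

lemma pentagon': "t \<in> Mor B \<Longrightarrow> u \<in> Mor B \<Longrightarrow> v \<in> Mor B \<Longrightarrow> w \<in> Mor B \<Longrightarrow> src B t = trg B u \<Longrightarrow> src B u = trg B v \<Longrightarrow>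
    src B v = trg B w \<Longrightarrow> assoc B (t \<star> u) v w \<cdot> assoc B t u (v \<star> w) =
        (assoc B t u v \<diamondop> vone B w) \<cdot> assoc B t (u \<star> v) w \<cdot> (vone B t \<diamondop> assoc B u v w)"
  using pentagon[of t u v w] by (simp add: composable_def)

lemma triangle': "u \<in> Mor B \<Longrightarrow> v \<in> Mor B \<Longrightarrow> src B u = trg B v \<Longrightarrow>
    (runit B u \<diamondop> vone B v) \<cdot> assoc B u (one B (src B u)) v = vone B u \<diamondop> lunit B v"
  using triangle[of u "src B u" "trg B u" v "src B v"] by (simp add: mor_hom_def)

lemma inverse_defs_iff: "inverse_defs B \<phi> \<psi> \<longleftrightarrow> \<phi> \<in> Def B \<and> \<psi> \<in> Def B \<and> vsrc B \<psi> = vtrg B \<phi> \<and> vtrg B \<psi> = vsrc B \<phi> \<and>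
    \<psi> \<cdot> \<phi> = vone B (vsrc B \<phi>) \<and> \<phi> \<cdot> \<psi> = vone B (vtrg B \<phi>)"
  by (auto simp: inverse_defs_def def_hom_def)

lemma inverse_defs_unique:
  assumes "inverse_defs B \<phi> \<psi>" "inverse_defs B \<phi> \<psi>'"
  shows "\<psi> = \<psi>'"
proof -
  have "\<psi> = (\<psi>' \<cdot> \<phi>) \<cdot> \<psi>" using assms by (simp add: inverse_defs_iff)
  also have "\<dots> = \<psi>' \<cdot> (\<phi> \<cdot> \<psi>)" by (rule vcomp_assoc') (use assms in \<open>auto simp: inverse_defs_iff\<close>)
  also have "\<dots> = \<psi>'" using assms by (simp add: inverse_defs_iff)
  finally show ?thesis .
qed

lemma inverse_defs_inv: "invertible_def B \<phi> \<Longrightarrow> inverse_defs B \<phi> (inv_def B \<phi>)"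
  unfolding invertible_def_def inv_def_def using inverse_defs_unique by (metis theI)

lemma inv_def_simps [simp]:
  assumes "invertible_def B \<phi>"
  shows "inv_def B \<phi> \<in> Def B" "vsrc B (inv_def B \<phi>) = vtrg B \<phi>" "vtrg B (inv_def B \<phi>) = vsrc B \<phi>"
    "inv_def B \<phi> \<cdot> \<phi> = vone B (vsrc B \<phi>)" "\<phi> \<cdot> inv_def B \<phi> = vone B (vtrg B \<phi>)"
  using inverse_defs_inv[OF assms] by (simp_all add: inverse_defs_iff)

lemma invertible_def_Def: "invertible_def B \<phi> \<Longrightarrow> \<phi> \<in> Def B"
  by (auto simp: invertible_def_def inverse_defs_def)

lemma invertible_defI:
  assumes "\<phi> \<in> Def B" "\<psi> \<in> Def B" "vsrc B \<psi> = vtrg B \<phi>" "vtrg B \<psi> = vsrc B \<phi>"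
    "\<psi> \<cdot> \<phi> = vone B (vsrc B \<phi>)" "\<phi> \<cdot> \<psi> = vone B (vtrg B \<phi>)"
  shows "invertible_def B \<phi>"
  unfolding invertible_def_def inverse_defs_iff using assms by blast

lemma invertible_vone: "u \<in> Mor B \<Longrightarrow> invertible_def B (vone B u)"
  by (rule invertible_defI[of _ "vone B u"]) simp_all

lemma invertible_inv: "invertible_def B \<phi> \<Longrightarrow> invertible_def B (inv_def B \<phi>)"
  by (rule invertible_defI[of _ \<phi>]) (simp_all add: invertible_def_Def)

lemma invertible_vcomp:
  assumes i: "invertible_def B \<phi>" "invertible_def B \<psi>" and c: "vsrc B \<psi> = vtrg B \<phi>"
  shows "invertible_def B (\<psi> \<cdot> \<phi>)"
proof -
  let ?f = "inv_def B \<phi>" and ?g = "inv_def B \<psi>"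
  note d = invertible_def_Def[OF i(1)] invertible_def_Def[OF i(2)]
  have "(?f \<cdot> ?g) \<cdot> (\<psi> \<cdot> \<phi>) = ?f \<cdot> ((?g \<cdot> \<psi>) \<cdot> \<phi>)"
    using d i c by (simp add: vcomp_assoc' del: inv_def_simps(4,5))
  moreover have "(\<psi> \<cdot> \<phi>) \<cdot> (?f \<cdot> ?g) = \<psi> \<cdot> ((\<phi> \<cdot> ?f) \<cdot> ?g)"
    using d i c by (simp add: vcomp_assoc' del: inv_def_simps(4,5))
  ultimately show ?thesis
    using d i c by (intro invertible_defI[of _ "?f \<cdot> ?g"]) simp_all
qed

lemma invertible_dcomp:
  assumes i: "invertible_def B \<phi>" "invertible_def B \<psi>" and c: "src B (vsrc B \<phi>) = trg B (vsrc B \<psi>)"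
  shows "invertible_def B (\<phi> \<diamondop> \<psi>)"
proof -
  note d = invertible_def_Def[OF i(1)] invertible_def_Def[OF i(2)]
  show ?thesis
    using d i c by (intro invertible_defI[of _ "inv_def B \<phi> \<diamondop> inv_def B \<psi>"]) (simp_all add: interchange')
qed

lemma vcomp_right_cancel:
  assumes "invertible_def B \<phi>" "\<psi> \<in> Def B" "\<psi>' \<in> Def B" "vsrc B \<psi> = vtrg B \<phi>" "vsrc B \<psi>' = vtrg B \<phi>"
    and "\<psi> \<cdot> \<phi> = \<psi>' \<cdot> \<phi>"
  shows "\<psi> = \<psi>'"
proof -
  note d = invertible_def_Def[OF assms(1)]
  have *: "\<theta> = \<theta> \<cdot> \<phi> \<cdot> inv_def B \<phi>" if "\<theta> \<in> Def B" "vsrc B \<theta> = vtrg B \<phi>" for \<theta>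
    using that assms(1) d by (simp add: vcomp_assoc')
  show ?thesis using *[OF assms(2,4)] *[OF assms(3,5)] assms(6) by simp
qed

end

context lax_functor
begin

lemma Obj_Fobj [simp]: "x \<in> Obj A \<Longrightarrow> Fobj F x \<in> Obj B"
  using Fobj by auto

lemma Mor_Fmor [simp]: "u \<in> Mor A \<Longrightarrow> Fmor F u \<in> Mor B"
  and src_Fmor [simp]: "u \<in> Mor A \<Longrightarrow> src B (Fmor F u) = Fobj F (src A u)"
  and trg_Fmor [simp]: "u \<in> Mor A \<Longrightarrow> trg B (Fmor F u) = Fobj F (trg A u)"
  using Fmor[of u "src A u" "trg A u"] by (auto simp: mor_hom_def)

lemma Def_Fdef [simp]: "\<phi> \<in> Def A \<Longrightarrow> Fdef F \<phi> \<in> Def B"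
  and vsrc_Fdef [simp]: "\<phi> \<in> Def A \<Longrightarrow> vsrc B (Fdef F \<phi>) = Fmor F (vsrc A \<phi>)"
  and vtrg_Fdef [simp]: "\<phi> \<in> Def A \<Longrightarrow> vtrg B (Fdef F \<phi>) = Fmor F (vtrg A \<phi>)"
  using Fdef[of \<phi> "vsrc A \<phi>" "vtrg A \<phi>"] by (auto simp: def_hom_def)

lemma Fdef_vone' [simp]: "u \<in> Mor A \<Longrightarrow> Fdef F (vone A u) = vone B (Fmor F u)"
  by (rule Fdef_vone)

lemma Fdef_vcomp': "\<phi> \<in> Def A \<Longrightarrow> \<psi> \<in> Def A \<Longrightarrow> vsrc A \<psi> = vtrg A \<phi> \<Longrightarrow>
    Fdef F (\<psi> \<cdot>\<^bsub>A\<^esub> \<phi>) = Fdef F \<psi> \<cdot>\<^bsub>B\<^esub> Fdef F \<phi>"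
  using Fdef_vcomp[of \<phi> "vsrc A \<phi>" "vtrg A \<phi>" \<psi> "vtrg A \<psi>"] by (simp add: def_hom_def)

lemma Def_Fcomp [simp]: "u \<in> Mor A \<Longrightarrow> v \<in> Mor A \<Longrightarrow> src A u = trg A v \<Longrightarrow> Fcomp F u v \<in> Def B"
  and vsrc_Fcomp [simp]: "u \<in> Mor A \<Longrightarrow> v \<in> Mor A \<Longrightarrow> src A u = trg A v \<Longrightarrow>
    vsrc B (Fcomp F u v) = Fmor F u \<star>\<^bsub>B\<^esub> Fmor F v"
  and vtrg_Fcomp [simp]: "u \<in> Mor A \<Longrightarrow> v \<in> Mor A \<Longrightarrow> src A u = trg A v \<Longrightarrow>
    vtrg B (Fcomp F u v) = Fmor F (u \<star>\<^bsub>A\<^esub> v)"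
  using Fcomp[of u v] by (auto simp: def_hom_def composable_def)

lemma Fcomp_nat': "\<phi> \<in> Def A \<Longrightarrow> \<psi> \<in> Def A \<Longrightarrow> src A (vsrc A \<phi>) = trg A (vsrc A \<psi>) \<Longrightarrow>
    Fcomp F (vtrg A \<phi>) (vtrg A \<psi>) \<cdot>\<^bsub>B\<^esub> (Fdef F \<phi> \<diamondop>\<^bsub>B\<^esub> Fdef F \<psi>) =
    Fdef F (\<phi> \<diamondop>\<^bsub>A\<^esub> \<psi>) \<cdot>\<^bsub>B\<^esub> Fcomp F (vsrc A \<phi>) (vsrc A \<psi>)"
  using Fcomp_nat[of \<phi> "vsrc A \<phi>" "vtrg A \<phi>" \<psi> "vsrc A \<psi>" "vtrg A \<psi>"] by (simp add: def_hom_def composable_def)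

lemma Def_Funit [simp]: "x \<in> Obj A \<Longrightarrow> Funit F x \<in> Def B"
  and vsrc_Funit [simp]: "x \<in> Obj A \<Longrightarrow> vsrc B (Funit F x) = one B (Fobj F x)"
  and vtrg_Funit [simp]: "x \<in> Obj A \<Longrightarrow> vtrg B (Funit F x) = Fmor F (one A x)"
  using Funit[of x] by (auto simp: def_hom_def)

lemma Fassoc': "u \<in> Mor A \<Longrightarrow> v \<in> Mor A \<Longrightarrow> w \<in> Mor A \<Longrightarrow> src A u = trg A v \<Longrightarrow> src A v = trg A w \<Longrightarrow>
    Fdef F (assoc A u v w) \<cdot>\<^bsub>B\<^esub> Fcomp F u (v \<star>\<^bsub>A\<^esub> w) \<cdot>\<^bsub>B\<^esub> (vone B (Fmor F u) \<diamondop>\<^bsub>B\<^esub> Fcomp F v w) =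
        Fcomp F (u \<star>\<^bsub>A\<^esub> v) w \<cdot>\<^bsub>B\<^esub> (Fcomp F u v \<diamondop>\<^bsub>B\<^esub> vone B (Fmor F w)) \<cdot>\<^bsub>B\<^esub>
          assoc B (Fmor F u) (Fmor F v) (Fmor F w)"
  using Fassoc[of u v w] by (simp add: composable_def)

lemma Flunit': "u \<in> Mor A \<Longrightarrow>
    Fdef F (lunit A u) \<cdot>\<^bsub>B\<^esub> Fcomp F (one A (trg A u)) u \<cdot>\<^bsub>B\<^esub> (Funit F (trg A u) \<diamondop>\<^bsub>B\<^esub> vone B (Fmor F u)) =
        lunit B (Fmor F u)"
  using Flunit[of u "src A u" "trg A u"] by (simp add: mor_hom_def)

lemma Frunit': "u \<in> Mor A \<Longrightarrow>
    Fdef F (runit A u) \<cdot>\<^bsub>B\<^esub> Fcomp F u (one A (src A u)) \<cdot>\<^bsub>B\<^esub> (vone B (Fmor F u) \<diamondop>\<^bsub>B\<^esub> Funit F (src A u)) =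
        runit B (Fmor F u)"
  using Frunit[of u "src A u" "trg A u"] by (simp add: mor_hom_def)

end

context lax_functor
begin

text \<open>With \<open>F\<close> the pullback along the last arrow, the composite of
  \<open>Fcomp\<close> and \<open>assoc\<close> is the associativity constraint of the Grothendieck
  construction. Its naturality is that of the two factors, one after the other.\<close>

lemma lax_assoc_nat:
  assumes [simp]: "\<phi> \<in> Def A" "\<psi> \<in> Def A" "\<theta> \<in> Def B" "src A (vsrc A \<phi>) = trg A (vsrc A \<psi>)"
    "Fobj F (src A (vsrc A \<psi>)) = trg B (vsrc B \<theta>)"
  shows "((Fcomp F (vtrg A \<phi>) (vtrg A \<psi>) \<diamondop>\<^bsub>B\<^esub> vone B (vtrg B \<theta>)) \<cdot>\<^bsub>B\<^esub>
      assoc B (Fmor F (vtrg A \<phi>)) (Fmor F (vtrg A \<psi>)) (vtrg B \<theta>)) \<cdot>\<^bsub>B\<^esub>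
      (Fdef F \<phi> \<diamondop>\<^bsub>B\<^esub> (Fdef F \<psi> \<diamondop>\<^bsub>B\<^esub> \<theta>)) =
    (Fdef F (\<phi> \<diamondop>\<^bsub>A\<^esub> \<psi>) \<diamondop>\<^bsub>B\<^esub> \<theta>) \<cdot>\<^bsub>B\<^esub>
      ((Fcomp F (vsrc A \<phi>) (vsrc A \<psi>) \<diamondop>\<^bsub>B\<^esub> vone B (vsrc B \<theta>)) \<cdot>\<^bsub>B\<^esub>
      assoc B (Fmor F (vsrc A \<phi>)) (Fmor F (vsrc A \<psi>)) (vsrc B \<theta>))" (is "(?c' \<cdot>\<^bsub>B\<^esub> ?a') \<cdot>\<^bsub>B\<^esub> ?f = ?g \<cdot>\<^bsub>B\<^esub> (?c \<cdot>\<^bsub>B\<^esub> ?a)")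
proof -
  have "(?c' \<cdot>\<^bsub>B\<^esub> ?a') \<cdot>\<^bsub>B\<^esub> ?f = ?c' \<cdot>\<^bsub>B\<^esub> (?a' \<cdot>\<^bsub>B\<^esub> ?f)" by (simp add: B.vcomp_assoc')
  also have "?a' \<cdot>\<^bsub>B\<^esub> ?f = ((Fdef F \<phi> \<diamondop>\<^bsub>B\<^esub> Fdef F \<psi>) \<diamondop>\<^bsub>B\<^esub> \<theta>) \<cdot>\<^bsub>B\<^esub> ?a"
    using B.assoc_nat'[of "Fdef F \<phi>" "Fdef F \<psi>" \<theta>] by simp
  also have "?c' \<cdot>\<^bsub>B\<^esub> (((Fdef F \<phi> \<diamondop>\<^bsub>B\<^esub> Fdef F \<psi>) \<diamondop>\<^bsub>B\<^esub> \<theta>) \<cdot>\<^bsub>B\<^esub> ?a) =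
      ?c' \<cdot>\<^bsub>B\<^esub> ((Fdef F \<phi> \<diamondop>\<^bsub>B\<^esub> Fdef F \<psi>) \<diamondop>\<^bsub>B\<^esub> \<theta>) \<cdot>\<^bsub>B\<^esub> ?a"
    by (simp add: B.vcomp_assoc')
  also have "?c' \<cdot>\<^bsub>B\<^esub> ((Fdef F \<phi> \<diamondop>\<^bsub>B\<^esub> Fdef F \<psi>) \<diamondop>\<^bsub>B\<^esub> \<theta>) = ?g \<cdot>\<^bsub>B\<^esub> ?c"
    by (simp add: B.interchange' Fcomp_nat')
  finally show ?thesis by (simp add: B.vcomp_assoc')
qed

text \<open>The inverse unit constraint and \<open>\<phi>\<close> act on different factors, so they
  commute by interchange; what remains is the naturality of \<open>lunit\<close>.\<close>

lemma lax_lunit_nat: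
  assumes x: "x \<in> Obj A" "invertible_def B (Funit F x)" and \<phi>: "\<phi> \<in> Def B" "trg B (vsrc B \<phi>) = Fobj F x"
  shows "(lunit B (vtrg B \<phi>) \<cdot>\<^bsub>B\<^esub> (inv_def B (Funit F x) \<diamondop>\<^bsub>B\<^esub> vone B (vtrg B \<phi>))) \<cdot>\<^bsub>B\<^esub>
      (vone B (Fmor F (one A x)) \<diamondop>\<^bsub>B\<^esub> \<phi>) =
    \<phi> \<cdot>\<^bsub>B\<^esub> (lunit B (vsrc B \<phi>) \<cdot>\<^bsub>B\<^esub> (inv_def B (Funit F x) \<diamondop>\<^bsub>B\<^esub> vone B (vsrc B \<phi>)))" (is "(?l' \<cdot>\<^bsub>B\<^esub> ?i') \<cdot>\<^bsub>B\<^esub> ?e = _")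
proof -
  note [simp] = x \<phi>
  have "(?l' \<cdot>\<^bsub>B\<^esub> ?i') \<cdot>\<^bsub>B\<^esub> ?e = ?l' \<cdot>\<^bsub>B\<^esub> (inv_def B (Funit F x) \<diamondop>\<^bsub>B\<^esub> \<phi>)"
    by (simp add: B.vcomp_assoc' B.interchange')
  also have "inv_def B (Funit F x) \<diamondop>\<^bsub>B\<^esub> \<phi> =
      (vone B (one B (Fobj F x)) \<diamondop>\<^bsub>B\<^esub> \<phi>) \<cdot>\<^bsub>B\<^esub> (inv_def B (Funit F x) \<diamondop>\<^bsub>B\<^esub> vone B (vsrc B \<phi>))"
    by (simp add: B.interchange')
  also have "?l' \<cdot>\<^bsub>B\<^esub> \<dots> = (?l' \<cdot>\<^bsub>B\<^esub> (vone B (one B (Fobj F x)) \<diamondop>\<^bsub>B\<^esub> \<phi>)) \<cdot>\<^bsub>B\<^esub>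
      (inv_def B (Funit F x) \<diamondop>\<^bsub>B\<^esub> vone B (vsrc B \<phi>))"
    by (simp add: B.vcomp_assoc' B.interchange')
  also have "?l' \<cdot>\<^bsub>B\<^esub> (vone B (one B (Fobj F x)) \<diamondop>\<^bsub>B\<^esub> \<phi>) = \<phi> \<cdot>\<^bsub>B\<^esub> lunit B (vsrc B \<phi>)"
    using B.lunit_nat'[of \<phi>] by simp
  finally show ?thesis by (simp add: B.vcomp_assoc')
qed

text \<open>The pentagon of the Grothendieck construction, with \<open>F\<close> the pullback along
  the last arrow and \<open>\<kappa>\<close> the composition constraint of the pullback before it.
  Strict functoriality makes \<open>Fdef F \<kappa>\<close> composed with \<open>Fcomp F P Q\<close>
  the composition constraint of the composite pullback, which is the factor on the left side. The
  proof combines the pentagon of \<open>B\<close>, the associativity axiom of \<open>F\<close>, and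
  naturality of \<open>assoc\<close> and of \<open>Fcomp\<close>.\<close>

lemma lax_pentagon:
  assumes P: "P \<in> Mor A" and Q: "Q \<in> Mor A" and V: "V \<in> Mor A" and PQ: "src A P = trg A Q" and QV: "src A Q = trg A V"
    and \<kappa>: "\<kappa> \<in> Def A" "vsrc A \<kappa> = P \<star>\<^bsub>A\<^esub> Q" and w: "w \<in> Mor B" "Fobj F (src A V) = trg B w"
  defines "p \<equiv> Fmor F P" and "q \<equiv> Fmor F Q" and "v \<equiv> Fmor F V" and "S \<equiv> vtrg A \<kappa>"
  shows "((Fcomp F S V \<diamondop>\<^bsub>B\<^esub> vone B w) \<cdot>\<^bsub>B\<^esub> assoc B (Fmor F S) v w) \<cdot>\<^bsub>B\<^esub>
      (((Fdef F \<kappa> \<cdot>\<^bsub>B\<^esub> Fcomp F P Q) \<diamondop>\<^bsub>B\<^esub> vone B (v \<star>\<^bsub>B\<^esub> w)) \<cdot>\<^bsub>B\<^esub> assoc B p q (v \<star>\<^bsub>B\<^esub> w)) =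
    (Fdef F ((\<kappa> \<diamondop>\<^bsub>A\<^esub> vone A V) \<cdot>\<^bsub>A\<^esub> assoc A P Q V) \<diamondop>\<^bsub>B\<^esub> vone B w) \<cdot>\<^bsub>B\<^esub>
      ((Fcomp F P (Q \<star>\<^bsub>A\<^esub> V) \<diamondop>\<^bsub>B\<^esub> vone B w) \<cdot>\<^bsub>B\<^esub> assoc B p (Fmor F (Q \<star>\<^bsub>A\<^esub> V)) w) \<cdot>\<^bsub>B\<^esub>
      (vone B p \<diamondop>\<^bsub>B\<^esub> ((Fcomp F Q V \<diamondop>\<^bsub>B\<^esub> vone B w) \<cdot>\<^bsub>B\<^esub> assoc B q v w))" (is "?lhs = ?rhs")
proof -
  note [simp] = P Q V PQ QV \<kappa> w
  have S [simp]: "S \<in> Mor A" "src A S = trg A V" "trg A S = trg A P" unfolding S_def by simp_all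
  have [simp]: "p \<in> Mor B" "q \<in> Mor B" "v \<in> Mor B" "src B p = Fobj F (trg A Q)" "trg B p = Fobj F (trg A P)"
    "src B q = Fobj F (trg A V)" "trg B q = Fobj F (trg A Q)" "src B v = trg B w" "trg B v = Fobj F (trg A V)"
    unfolding p_def q_def v_def by simp_all
  have [simp]: "vsrc B (Fcomp F P Q) = p \<star>\<^bsub>B\<^esub> q" "vsrc B (Fcomp F Q V) = q \<star>\<^bsub>B\<^esub> v"
    "vsrc B (Fcomp F S V) = Fmor F S \<star>\<^bsub>B\<^esub> v" "vsrc B (Fcomp F P (Q \<star>\<^bsub>A\<^esub> V)) = p \<star>\<^bsub>B\<^esub> Fmor F (Q \<star>\<^bsub>A\<^esub> V)"
    "vsrc B (Fcomp F (P \<star>\<^bsub>A\<^esub> Q) V) = Fmor F (P \<star>\<^bsub>A\<^esub> Q) \<star>\<^bsub>B\<^esub> v"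
    unfolding p_def q_def v_def by simp_all
  have [simp]: "vtrg A \<kappa> = S" unfolding S_def ..
  let ?\<zeta> = "Fdef F \<kappa> \<cdot>\<^bsub>B\<^esub> Fcomp F P Q"
  let ?X = "Fdef F (assoc A P Q V) \<cdot>\<^bsub>B\<^esub> Fcomp F P (Q \<star>\<^bsub>A\<^esub> V) \<cdot>\<^bsub>B\<^esub> (vone B p \<diamondop>\<^bsub>B\<^esub> Fcomp F Q V)"
  let ?Y = "Fcomp F (P \<star>\<^bsub>A\<^esub> Q) V \<cdot>\<^bsub>B\<^esub> (Fcomp F P Q \<diamondop>\<^bsub>B\<^esub> vone B v)"
  have XY: "?X = ?Y \<cdot>\<^bsub>B\<^esub> assoc B p q v"
    using Fassoc'[OF P Q V PQ QV] unfolding p_def q_def v_def .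
  have nat1: "assoc B (Fmor F S) v w \<cdot>\<^bsub>B\<^esub> (?\<zeta> \<diamondop>\<^bsub>B\<^esub> vone B (v \<star>\<^bsub>B\<^esub> w)) =
      ((?\<zeta> \<diamondop>\<^bsub>B\<^esub> vone B v) \<diamondop>\<^bsub>B\<^esub> vone B w) \<cdot>\<^bsub>B\<^esub> assoc B (p \<star>\<^bsub>B\<^esub> q) v w"
    using B.assoc_nat'[of ?\<zeta> "vone B v" "vone B w"] by simp
  have nat2: "assoc B p (Fmor F (Q \<star>\<^bsub>A\<^esub> V)) w \<cdot>\<^bsub>B\<^esub> (vone B p \<diamondop>\<^bsub>B\<^esub> (Fcomp F Q V \<diamondop>\<^bsub>B\<^esub> vone B w)) =
      ((vone B p \<diamondop>\<^bsub>B\<^esub> Fcomp F Q V) \<diamondop>\<^bsub>B\<^esub> vone B w) \<cdot>\<^bsub>B\<^esub> assoc B p (q \<star>\<^bsub>B\<^esub> v) w"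
    using B.assoc_nat'[of "vone B p" "Fcomp F Q V" "vone B w"] by simp
  have pent: "assoc B (p \<star>\<^bsub>B\<^esub> q) v w \<cdot>\<^bsub>B\<^esub> assoc B p q (v \<star>\<^bsub>B\<^esub> w) =
      (assoc B p q v \<diamondop>\<^bsub>B\<^esub> vone B w) \<cdot>\<^bsub>B\<^esub> (assoc B p (q \<star>\<^bsub>B\<^esub> v) w \<cdot>\<^bsub>B\<^esub> (vone B p \<diamondop>\<^bsub>B\<^esub> assoc B q v w))"
    using B.pentagon'[of p q v w] by (simp add: B.vcomp_assoc')
  have nat3: "Fdef F (\<kappa> \<diamondop>\<^bsub>A\<^esub> vone A V) \<cdot>\<^bsub>B\<^esub> Fcomp F (P \<star>\<^bsub>A\<^esub> Q) V = Fcomp F S V \<cdot>\<^bsub>B\<^esub> (Fdef F \<kappa> \<diamondop>\<^bsub>B\<^esub> vone B v)"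
    using Fcomp_nat'[of \<kappa> "vone A V"] by (simp add: v_def)
  have Y: "Fdef F (\<kappa> \<diamondop>\<^bsub>A\<^esub> vone A V) \<cdot>\<^bsub>B\<^esub> ?Y = Fcomp F S V \<cdot>\<^bsub>B\<^esub> (?\<zeta> \<diamondop>\<^bsub>B\<^esub> vone B v)"
  proof -
    have "Fdef F (\<kappa> \<diamondop>\<^bsub>A\<^esub> vone A V) \<cdot>\<^bsub>B\<^esub> ?Y =
      Fdef F (\<kappa> \<diamondop>\<^bsub>A\<^esub> vone A V) \<cdot>\<^bsub>B\<^esub> Fcomp F (P \<star>\<^bsub>A\<^esub> Q) V \<cdot>\<^bsub>B\<^esub> (Fcomp F P Q \<diamondop>\<^bsub>B\<^esub> vone B v)"
      by (simp add: B.vcomp_assoc')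
    also have "\<dots> = Fcomp F S V \<cdot>\<^bsub>B\<^esub> ((Fdef F \<kappa> \<diamondop>\<^bsub>B\<^esub> vone B v) \<cdot>\<^bsub>B\<^esub> (Fcomp F P Q \<diamondop>\<^bsub>B\<^esub> vone B v))"
      unfolding nat3 by (simp add: B.vcomp_assoc' v_def)
    also have "\<dots> = Fcomp F S V \<cdot>\<^bsub>B\<^esub> (?\<zeta> \<diamondop>\<^bsub>B\<^esub> vone B v)" by (simp add: B.interchange')
    finally show ?thesis .
  qed
  have "?lhs = (Fcomp F S V \<diamondop>\<^bsub>B\<^esub> vone B w) \<cdot>\<^bsub>B\<^esub>
      ((assoc B (Fmor F S) v w \<cdot>\<^bsub>B\<^esub> (?\<zeta> \<diamondop>\<^bsub>B\<^esub> vone B (v \<star>\<^bsub>B\<^esub> w))) \<cdot>\<^bsub>B\<^esub> assoc B p q (v \<star>\<^bsub>B\<^esub> w))"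
    by (simp add: B.vcomp_assoc')
  also have "\<dots> = (Fcomp F S V \<diamondop>\<^bsub>B\<^esub> vone B w) \<cdot>\<^bsub>B\<^esub>
      (((?\<zeta> \<diamondop>\<^bsub>B\<^esub> vone B v) \<diamondop>\<^bsub>B\<^esub> vone B w) \<cdot>\<^bsub>B\<^esub> (assoc B (p \<star>\<^bsub>B\<^esub> q) v w \<cdot>\<^bsub>B\<^esub> assoc B p q (v \<star>\<^bsub>B\<^esub> w)))"
    unfolding nat1 by (simp add: B.vcomp_assoc')
  finally have L: "?lhs = \<dots>" .
  let ?U = "vone B p \<diamondop>\<^bsub>B\<^esub> assoc B q v w"
  have "?rhs = (Fdef F (\<kappa> \<diamondop>\<^bsub>A\<^esub> vone A V) \<diamondop>\<^bsub>B\<^esub> vone B w) \<cdot>\<^bsub>B\<^esub> ((Fdef F (assoc A P Q V) \<diamondop>\<^bsub>B\<^esub> vone B w) \<cdot>\<^bsub>B\<^esub>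
      ((Fcomp F P (Q \<star>\<^bsub>A\<^esub> V) \<diamondop>\<^bsub>B\<^esub> vone B w) \<cdot>\<^bsub>B\<^esub> ((assoc B p (Fmor F (Q \<star>\<^bsub>A\<^esub> V)) w \<cdot>\<^bsub>B\<^esub>
      (vone B p \<diamondop>\<^bsub>B\<^esub> (Fcomp F Q V \<diamondop>\<^bsub>B\<^esub> vone B w))) \<cdot>\<^bsub>B\<^esub> ?U)))"
    by (simp add: Fdef_vcomp' B.vcomp_assoc' B.whisker_right B.whisker_left p_def[symmetric] q_def[symmetric] v_def[symmetric])
  also have "\<dots> = (Fdef F (\<kappa> \<diamondop>\<^bsub>A\<^esub> vone A V) \<diamondop>\<^bsub>B\<^esub> vone B w) \<cdot>\<^bsub>B\<^esub>
      ((?X \<diamondop>\<^bsub>B\<^esub> vone B w) \<cdot>\<^bsub>B\<^esub> (assoc B p (q \<star>\<^bsub>B\<^esub> v) w \<cdot>\<^bsub>B\<^esub> ?U))"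
    unfolding nat2
    by (simp add: B.vcomp_assoc' B.whisker_right p_def[symmetric] q_def[symmetric] v_def[symmetric])
  also have "\<dots> = ((Fdef F (\<kappa> \<diamondop>\<^bsub>A\<^esub> vone A V) \<cdot>\<^bsub>B\<^esub> ?Y) \<diamondop>\<^bsub>B\<^esub> vone B w) \<cdot>\<^bsub>B\<^esub>
      ((assoc B p q v \<diamondop>\<^bsub>B\<^esub> vone B w) \<cdot>\<^bsub>B\<^esub> (assoc B p (q \<star>\<^bsub>B\<^esub> v) w \<cdot>\<^bsub>B\<^esub> ?U))"
    unfolding XY
    by (simp add: B.vcomp_assoc' B.whisker_right p_def[symmetric] q_def[symmetric] v_def[symmetric])
  also have "\<dots> = ((Fcomp F S V \<cdot>\<^bsub>B\<^esub> (?\<zeta> \<diamondop>\<^bsub>B\<^esub> vone B v)) \<diamondop>\<^bsub>B\<^esub> vone B w) \<cdot>\<^bsub>B\<^esub>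
      (assoc B (p \<star>\<^bsub>B\<^esub> q) v w \<cdot>\<^bsub>B\<^esub> assoc B p q (v \<star>\<^bsub>B\<^esub> w))"
    unfolding Y pent ..
  also have "\<dots> = ?lhs"
    unfolding L by (simp add: B.vcomp_assoc' B.whisker_right p_def[symmetric] q_def[symmetric] v_def[symmetric])
  finally show ?thesis by (rule sym)
qed

text \<open>The inverse of the unit constraint is removed by composing both sides with the
  invertible \<open>?e\<close>. What remains is the right unit axiom of \<open>F\<close> followed by
  the triangle of \<open>B\<close>.\<close>

lemma lax_triangle:
  assumes u: "u \<in> Mor A" and v: "v \<in> Mor B" "Fobj F (src A u) = trg B v" and i: "invertible_def B (Funit F (src A u))"
  defines "y \<equiv> src A u"
  shows "(Fdef F (runit A u) \<diamondop>\<^bsub>B\<^esub> vone B v) \<cdot>\<^bsub>B\<^esub>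
      ((Fcomp F u (one A y) \<diamondop>\<^bsub>B\<^esub> vone B v) \<cdot>\<^bsub>B\<^esub> assoc B (Fmor F u) (Fmor F (one A y)) v) =
    vone B (Fmor F u) \<diamondop>\<^bsub>B\<^esub> (lunit B v \<cdot>\<^bsub>B\<^esub> (inv_def B (Funit F y) \<diamondop>\<^bsub>B\<^esub> vone B v))" (is "?lhs = ?rhs")
proof -
  have y [simp]: "y \<in> Obj A" "src A u = y" "Fobj F y = trg B v" "src B (Fmor F u) = trg B v" "invertible_def B (Funit F y)"
    using u v i by (simp_all add: y_def)
  note [simp] = u v(1)
  let ?p = "Fmor F u"
  let ?e = "vone B ?p \<diamondop>\<^bsub>B\<^esub> (Funit F y \<diamondop>\<^bsub>B\<^esub> vone B v)"
  have nat: "assoc B ?p (Fmor F (one A y)) v \<cdot>\<^bsub>B\<^esub> ?e =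
      ((vone B ?p \<diamondop>\<^bsub>B\<^esub> Funit F y) \<diamondop>\<^bsub>B\<^esub> vone B v) \<cdot>\<^bsub>B\<^esub> assoc B ?p (one B (Fobj F y)) v"
    using B.assoc_nat'[of "vone B ?p" "Funit F y" "vone B v"] by simp
  have r: "Fdef F (runit A u) \<cdot>\<^bsub>B\<^esub> (Fcomp F u (one A y) \<cdot>\<^bsub>B\<^esub> (vone B ?p \<diamondop>\<^bsub>B\<^esub> Funit F y)) = runit B ?p"
    using Frunit'[OF u] by (simp add: B.vcomp_assoc')
  have "?lhs \<cdot>\<^bsub>B\<^esub> ?e = (Fdef F (runit A u) \<diamondop>\<^bsub>B\<^esub> vone B v) \<cdot>\<^bsub>B\<^esub> ((Fcomp F u (one A y) \<diamondop>\<^bsub>B\<^esub> vone B v) \<cdot>\<^bsub>B\<^esub>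
      (assoc B ?p (Fmor F (one A y)) v \<cdot>\<^bsub>B\<^esub> ?e))"
    by (simp add: B.vcomp_assoc')
  also have "\<dots> = ((Fdef F (runit A u) \<cdot>\<^bsub>B\<^esub> (Fcomp F u (one A y) \<cdot>\<^bsub>B\<^esub> (vone B ?p \<diamondop>\<^bsub>B\<^esub> Funit F y))) \<diamondop>\<^bsub>B\<^esub> vone B v) \<cdot>\<^bsub>B\<^esub>
      assoc B ?p (one B (Fobj F y)) v"
    unfolding nat by (simp add: B.vcomp_assoc' B.whisker_right)
  also have "\<dots> = vone B ?p \<diamondop>\<^bsub>B\<^esub> lunit B v"
    unfolding r using B.triangle'[of ?p v] by simp
  also have "\<dots> = ?rhs \<cdot>\<^bsub>B\<^esub> ?e"
    by (simp add: B.vcomp_assoc' B.interchange')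
  finally have eq: "?lhs \<cdot>\<^bsub>B\<^esub> ?e = ?rhs \<cdot>\<^bsub>B\<^esub> ?e" .
  show ?thesis
  proof (rule B.vcomp_right_cancel[OF _ _ _ _ _ eq])
    show "invertible_def B ?e" by (intro B.invertible_dcomp B.invertible_vone) simp_all
  qed simp_all
qed

end

section \<open>The Grothendieck construction is a bicategory\<close>

context diagram
begin

abbreviation GC where "GC \<equiv> grothendieck I C"

lemma Ob_adom [simp]: "a \<in> Arr I \<Longrightarrow> adom I a \<in> Ob I"
  and Ob_acod [simp]: "a \<in> Arr I \<Longrightarrow> acod I a \<in> Ob I"
  using I.dom_cod by auto

lemma aid_simps [simp]: "i \<in> Ob I \<Longrightarrow> aid I i \<in> Arr I" "i \<in> Ob I \<Longrightarrow> adom I (aid I i) = i" "i \<in> Ob I \<Longrightarrow> acod I (aid I i) = i"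
  using I.id_arr by auto

lemma acomp_simps [simp]:
  assumes "a \<in> Arr I" "b \<in> Arr I" "adom I a = acod I b"
  shows "acomp I a b \<in> Arr I" "adom I (acomp I a b) = adom I b" "acod I (acomp I a b) = acod I a"
  using I.comp_arr[OF assms] by auto

lemma acomp_aid [simp]: "a \<in> Arr I \<Longrightarrow> acod I a = i \<Longrightarrow> acomp I (aid I i) a = a"
  "a \<in> Arr I \<Longrightarrow> adom I a = i \<Longrightarrow> acomp I a (aid I i) = a"
  using I.comp_id_left I.comp_id_right by auto

text \<open>The diagram is strictly functorial, so these are equations. Rewriting goes from the
  pullback along a composite to iterated pullbacks, where the constraints of the single pullbacks
  become visible.\<close>

lemma CM_comp_simps [simp]:
  assumes "a \<in> Arr I" "b \<in> Arr I" "adom I a = acod I b"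
  shows "x \<in> Obj (CO C (acod I a)) \<Longrightarrow> Fobj (CM C (acomp I a b)) x = Fobj (CM C b) (Fobj (CM C a) x)"
    and "u \<in> Mor (CO C (acod I a)) \<Longrightarrow> Fmor (CM C (acomp I a b)) u = Fmor (CM C b) (Fmor (CM C a) u)"
    and "\<phi> \<in> Def (CO C (acod I a)) \<Longrightarrow> Fdef (CM C (acomp I a b)) \<phi> = Fdef (CM C b) (Fdef (CM C a) \<phi>)"
    and "u \<in> Mor (CO C (acod I a)) \<Longrightarrow> v \<in> Mor (CO C (acod I a)) \<Longrightarrow> src (CO C (acod I a)) u = trg (CO C (acod I a)) v \<Longrightarrow>
      Fcomp (CM C (acomp I a b)) u v =
      Fdef (CM C b) (Fcomp (CM C a) u v) \<cdot>\<^bsub>CO C (adom I b)\<^esub> Fcomp (CM C b) (Fmor (CM C a) u) (Fmor (CM C a) v)"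
    and "x \<in> Obj (CO C (acod I a)) \<Longrightarrow> Funit (CM C (acomp I a b)) x =
      Fdef (CM C b) (Funit (CM C a) x) \<cdot>\<^bsub>CO C (adom I b)\<^esub> Funit (CM C b) (Fobj (CM C a) x)"
  unfolding CM_comp[OF assms] comp_lax_def by (simp_all add: compose_def composable_def)

lemma CM_id_simps [simp]:
  assumes "i \<in> Ob I"
  shows "x \<in> Obj (CO C i) \<Longrightarrow> Fobj (CM C (aid I i)) x = x"
    and "u \<in> Mor (CO C i) \<Longrightarrow> Fmor (CM C (aid I i)) u = u"
    and "\<phi> \<in> Def (CO C i) \<Longrightarrow> Fdef (CM C (aid I i)) \<phi> = \<phi>"
    and "u \<in> Mor (CO C i) \<Longrightarrow> v \<in> Mor (CO C i) \<Longrightarrow> src (CO C i) u = trg (CO C i) v \<Longrightarrow>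
      Fcomp (CM C (aid I i)) u v = vone (CO C i) (u \<star>\<^bsub>CO C i\<^esub> v)"
    and "x \<in> Obj (CO C i) \<Longrightarrow> Funit (CM C (aid I i)) x = vone (CO C i) (one (CO C i) x)"
  unfolding CM_id[OF assms] id_lax_def by (simp_all add: composable_def)

lemma GC_Obj [simp]: "(x, i) \<in> Obj GC \<longleftrightarrow> i \<in> Ob I \<and> x \<in> Obj (CO C i)"
  and GC_Mor [simp]: "(x, u, a) \<in> Mor GC \<longleftrightarrow> a \<in> Arr I \<and> x \<in> Obj (CO C (acod I a)) \<and> u \<in> Mor (CO C (adom I a)) \<and>
    trg (CO C (adom I a)) u = Fobj (CM C a) x"
  and GC_Def [simp]: "(x, \<phi>, a) \<in> Def GC \<longleftrightarrow> a \<in> Arr I \<and> x \<in> Obj (CO C (acod I a)) \<and> \<phi> \<in> Def (CO C (adom I a)) \<and>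
    trg (CO C (adom I a)) (vsrc (CO C (adom I a)) \<phi>) = Fobj (CM C a) x"
  and GC_src [simp]: "src GC (x, u, a) = (src (CO C (adom I a)) u, adom I a)"
  and GC_trg [simp]: "trg GC (x, u, a) = (x, acod I a)"
  and GC_vsrc [simp]: "vsrc GC (x, \<phi>, a) = (x, vsrc (CO C (adom I a)) \<phi>, a)"
  and GC_vtrg [simp]: "vtrg GC (x, \<phi>, a) = (x, vtrg (CO C (adom I a)) \<phi>, a)"
  and GC_one [simp]: "one GC (x, i) = (x, one (CO C i) x, aid I i)"
  and GC_hcomp [simp]: "(x, u, a) \<star>\<^bsub>GC\<^esub> (y, v, b) = (x, Fmor (CM C b) u \<star>\<^bsub>CO C (adom I b)\<^esub> v, acomp I a b)"
  and GC_vone [simp]: "vone GC (x, u, a) = (x, vone (CO C (adom I a)) u, a)"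
  and GC_vcomp [simp]: "(x, \<psi>, a) \<cdot>\<^bsub>GC\<^esub> (y, \<phi>, b) = (x, \<psi> \<cdot>\<^bsub>CO C (adom I a)\<^esub> \<phi>, a)"
  and GC_dcomp [simp]: "(x, \<phi>, a) \<diamondop>\<^bsub>GC\<^esub> (y, \<psi>, b) = (x, Fdef (CM C b) \<phi> \<diamondop>\<^bsub>CO C (adom I b)\<^esub> \<psi>, acomp I a b)"
  and GC_assoc [simp]: "assoc GC (x, u, a) (y, v, b) (z, w, c) =
    (x, (Fcomp (CM C c) (Fmor (CM C b) u) v \<diamondop>\<^bsub>CO C (adom I c)\<^esub> vone (CO C (adom I c)) w) \<cdot>\<^bsub>CO C (adom I c)\<^esub>
      assoc (CO C (adom I c)) (Fmor (CM C c) (Fmor (CM C b) u)) (Fmor (CM C c) v) w, acomp I (acomp I a b) c)"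
  and GC_lunit [simp]: "lunit GC (x, u, a) = (x, lunit (CO C (adom I a)) u \<cdot>\<^bsub>CO C (adom I a)\<^esub>
      (inv_def (CO C (adom I a)) (Funit (CM C a) x) \<diamondop>\<^bsub>CO C (adom I a)\<^esub> vone (CO C (adom I a)) u), a)"
  and GC_runit [simp]: "runit GC (x, u, a) = (x, runit (CO C (adom I a)) u, a)"
  by (simp_all add: grothendieck_def Let_def)

text \<open>Vertical composition takes place inside one fibre, so an inverse in the fibre is an
  inverse.\<close>

lemma GC_invertible:
  assumes "a \<in> Arr I" "x \<in> Obj (CO C (acod I a))" "invertible_def (CO C (adom I a)) \<phi>"
    and "trg (CO C (adom I a)) (vsrc (CO C (adom I a)) \<phi>) = Fobj (CM C a) x"
  shows "invertible_def GC (x, \<phi>, a)"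
proof -
  interpret D: bicategory "CO C (adom I a)" using CO assms by simp
  show ?thesis
    unfolding invertible_def_def inverse_defs_def def_hom_def
    using assms D.invertible_def_Def[OF assms(3)]
    by (intro exI[of _ "(x, inv_def (CO C (adom I a)) \<phi>, a)"]) simp
qed

theorem bicategory_grothendieck: "bicategory GC"
proof (unfold_locales, goal_cases)
  case (1 u)
  obtain x f a where u: "u = (x, f, a)" using prod_cases3 by blast
  then interpret D: bicategory "CO C (adom I a)" using CO 1 by simp
  show ?case using 1 u by simp
next
  case (2 \<phi>)
  obtain x f a where u: "\<phi> = (x, f, a)" using prod_cases3 by blast
  then interpret D: bicategory "CO C (adom I a)" using CO 2 by simp
  show ?case using 2 u by simp
next
  case (3 u)
  obtain x f a where u: "u = (x, f, a)" using prod_cases3 by blast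
  then interpret D: bicategory "CO C (adom I a)" using CO 3 by simp
  show ?case using 3 u by (simp add: def_hom_def)
next
  case (4 \<phi> u v \<psi> w)
  obtain x f a y g b where e: "\<phi> = (x, f, a)" "\<psi> = (y, g, b)" using prod_cases3 by metis
  then interpret D: bicategory "CO C (adom I a)" using CO 4 by (simp add: def_hom_def)
  show ?case using 4 e by (auto simp: def_hom_def)
next
  case (5 \<phi>)
  obtain x f a where u: "\<phi> = (x, f, a)" using prod_cases3 by blast
  then interpret D: bicategory "CO C (adom I a)" using CO 5 by simp
  show ?case using 5 u by simp
next
  case (6 \<phi>)
  obtain x f a where u: "\<phi> = (x, f, a)" using prod_cases3 by blast
  then interpret D: bicategory "CO C (adom I a)" using CO 6 by simp
  show ?case using 6 u by simp
next
  case (7 \<phi> u v \<psi> w \<theta> t)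
  obtain x f a y g b z h c where e: "\<phi> = (x, f, a)" "\<psi> = (y, g, b)" "\<theta> = (z, h, c)" using prod_cases3 by metis
  then interpret D: bicategory "CO C (adom I a)" using CO 7 by (simp add: def_hom_def)
  show ?case using 7 e by (auto simp: def_hom_def D.vcomp_assoc')
next
  case (8 x)
  obtain y i where x: "x = (y, i)" by fastforce
  then interpret D: bicategory "CO C i" using CO 8 by simp
  show ?case using 8 x by (simp add: mor_hom_def)
next
  case (9 u y x v z)
  obtain x' f a y' g b where e: "u = (x', f, a)" "v = (y', g, b)" using prod_cases3 by metis
  then have ab: "a \<in> Arr I" "b \<in> Arr I" "adom I a = acod I b" using 9 by (auto simp: mor_hom_def)
  interpret F: homomorphism "CO C (acod I b)" "CO C (adom I b)" "CM C b" using CM ab by simp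
  interpret E: homomorphism "CO C (acod I a)" "CO C (acod I b)" "CM C a" using CM ab by metis
  show ?case using 9 e ab by (auto simp: mor_hom_def)
next
  case (10 \<phi> u u' \<psi> v v')
  obtain x' f a y' g b where e: "\<phi> = (x', f, a)" "\<psi> = (y', g, b)" using prod_cases3 by metis
  then have ab: "a \<in> Arr I" "b \<in> Arr I" "adom I a = acod I b" using 10 by (auto simp: def_hom_def composable_def)
  interpret F: homomorphism "CO C (acod I b)" "CO C (adom I b)" "CM C b" using CM ab by simp
  interpret E: homomorphism "CO C (acod I a)" "CO C (acod I b)" "CM C a" using CM ab by metis
  show ?case using 10 e ab by (auto simp: def_hom_def composable_def)
next
  case (11 u v)
  obtain x' f a y' g b where e: "u = (x', f, a)" "v = (y', g, b)" using prod_cases3 by metis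
  then have ab: "a \<in> Arr I" "b \<in> Arr I" "adom I a = acod I b" using 11 by (auto simp: composable_def)
  interpret F: homomorphism "CO C (acod I b)" "CO C (adom I b)" "CM C b" using CM ab by simp
  show ?case using 11 e ab by (auto simp: composable_def)
next
  case (12 \<phi> u u' \<phi>' u'' \<psi> v v' \<psi>' v'')
  obtain x1 f1 a1 x2 f2 a2 x3 f3 a3 x4 f4 a4 where e: "\<phi> = (x1, f1, a1)" "\<phi>' = (x2, f2, a2)" "\<psi> = (x3, f3, a3)" "\<psi>' = (x4, f4, a4)"
    using prod_cases3 by metis
  then have ab: "a1 \<in> Arr I" "a3 \<in> Arr I" "adom I a1 = acod I a3" using 12 by (auto simp: def_hom_def composable_def)
  interpret F: homomorphism "CO C (acod I a3)" "CO C (adom I a3)" "CM C a3" using CM ab by simp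
  interpret E: homomorphism "CO C (acod I a1)" "CO C (acod I a3)" "CM C a1" using CM ab by metis
  show ?case using 12 e ab by (auto simp: def_hom_def composable_def F.B.interchange' F.Fdef_vcomp')
next
  case (13 u v w)
  obtain x f a y g b z h c where e: "u = (x, f, a)" "v = (y, g, b)" "w = (z, h, c)" using prod_cases3 by metis
  then have ab: "a \<in> Arr I" "b \<in> Arr I" "c \<in> Arr I" "adom I a = acod I b" "adom I b = acod I c"
    using 13 by (auto simp: composable_def)
  interpret F: homomorphism "CO C (acod I c)" "CO C (adom I c)" "CM C c" using CM ab by simp
  interpret E: homomorphism "CO C (acod I b)" "CO C (acod I c)" "CM C b" using CM ab by metis
  interpret H: homomorphism "CO C (acod I a)" "CO C (acod I b)" "CM C a" using CM ab by metis
  show ?case using 13 e ab I.comp_assoc[of a b c] by (auto simp: def_hom_def composable_def)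
next
  case (14 u v w)
  obtain x f a y g b z h c where e: "u = (x, f, a)" "v = (y, g, b)" "w = (z, h, c)" using prod_cases3 by metis
  then have ab: "a \<in> Arr I" "b \<in> Arr I" "c \<in> Arr I" "adom I a = acod I b" "adom I b = acod I c"
    using 14 by (auto simp: composable_def)
  interpret F: homomorphism "CO C (acod I c)" "CO C (adom I c)" "CM C c" using CM ab by simp
  interpret E: homomorphism "CO C (acod I b)" "CO C (acod I c)" "CM C b" using CM ab by metis
  interpret H: homomorphism "CO C (acod I a)" "CO C (acod I b)" "CM C a" using CM ab by metis
  show ?case
    using 14 ab unfolding e GC_assoc
    by (intro GC_invertible)
      (auto simp: composable_def intro!: F.B.invertible_vcomp F.B.invertible_dcomp F.B.invertible_vone F.Fcomp_inv F.B.assoc_inv)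
next
  case (15 \<phi> u u' \<psi> v v' \<theta> w w')
  obtain x f a y g b z h c where e: "\<phi> = (x, f, a)" "\<psi> = (y, g, b)" "\<theta> = (z, h, c)" using prod_cases3 by metis
  then have ab: "a \<in> Arr I" "b \<in> Arr I" "c \<in> Arr I" "adom I a = acod I b" "adom I b = acod I c"
    using 15 by (auto simp: def_hom_def composable_def)
  interpret F: homomorphism "CO C (acod I c)" "CO C (adom I c)" "CM C c" using CM ab by simp
  interpret E: homomorphism "CO C (acod I b)" "CO C (acod I c)" "CM C b" using CM ab by metis
  interpret H: homomorphism "CO C (acod I a)" "CO C (acod I b)" "CM C a" using CM ab by metis
  show ?case
    using 15 e ab F.lax_assoc_nat[of "Fdef (CM C b) f" g h] by (auto simp: def_hom_def composable_def)
next
  case (16 u y x)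
  obtain z f a where e: "u = (z, f, a)" using prod_cases3 by metis
  then have a: "a \<in> Arr I" using 16 by (auto simp: mor_hom_def)
  interpret F: homomorphism "CO C (acod I a)" "CO C (adom I a)" "CM C a" using CM a by simp
  show ?case using 16 e a F.Funit_inv by (auto simp: def_hom_def mor_hom_def)
next
  case (17 u)
  obtain z f a where e: "u = (z, f, a)" using prod_cases3 by metis
  then have a: "a \<in> Arr I" using 17 by auto
  interpret F: homomorphism "CO C (acod I a)" "CO C (adom I a)" "CM C a" using CM a by simp
  show ?case
    using 17 a unfolding e GC_lunit
    by (intro GC_invertible)
      (auto simp: F.Funit_inv intro!: F.B.invertible_vcomp F.B.invertible_dcomp F.B.invertible_vone F.B.invertible_inv F.Funit_inv F.B.lunit_inv)
next
  case (18 \<phi> u v y x)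
  obtain z f a where e: "\<phi> = (z, f, a)" using prod_cases3 by metis
  then have a: "a \<in> Arr I" using 18 by (auto simp: def_hom_def)
  interpret F: homomorphism "CO C (acod I a)" "CO C (adom I a)" "CM C a" using CM a by simp
  show ?case using 18 e a F.lax_lunit_nat[of z f] F.Funit_inv by (auto simp: def_hom_def mor_hom_def)
next
  case (19 u y x)
  obtain z f a where e: "u = (z, f, a)" using prod_cases3 by metis
  then have a: "a \<in> Arr I" using 19 by (auto simp: mor_hom_def)
  interpret F: homomorphism "CO C (acod I a)" "CO C (adom I a)" "CM C a" using CM a by simp
  show ?case using 19 e a by (auto simp: def_hom_def mor_hom_def)
next
  case (20 u)
  obtain z f a where e: "u = (z, f, a)" using prod_cases3 by metis
  then have a: "a \<in> Arr I" using 20 by auto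
  interpret F: homomorphism "CO C (acod I a)" "CO C (adom I a)" "CM C a" using CM a by simp
  show ?case using 20 a unfolding e GC_runit by (intro GC_invertible) (auto intro!: F.B.runit_inv)
next
  case (21 \<phi> u v y x)
  obtain z f a where e: "\<phi> = (z, f, a)" using prod_cases3 by metis
  then have a: "a \<in> Arr I" using 21 by (auto simp: def_hom_def)
  interpret F: homomorphism "CO C (acod I a)" "CO C (adom I a)" "CM C a" using CM a by simp
  show ?case using 21 e a F.B.runit_nat'[of f] by (auto simp: def_hom_def mor_hom_def)
next
  case (22 t u v w)
  obtain x1 f1 a1 x2 f2 a2 x3 f3 a3 x4 f4 a4 where e: "t = (x1, f1, a1)" "u = (x2, f2, a2)" "v = (x3, f3, a3)" "w = (x4, f4, a4)"
    using prod_cases3 by metis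
  then have ab: "a1 \<in> Arr I" "a2 \<in> Arr I" "a3 \<in> Arr I" "a4 \<in> Arr I"
    "adom I a1 = acod I a2" "adom I a2 = acod I a3" "adom I a3 = acod I a4"
    using 22 by (auto simp: composable_def)
  interpret F: homomorphism "CO C (acod I a4)" "CO C (adom I a4)" "CM C a4" using CM ab by simp
  interpret E: homomorphism "CO C (acod I a3)" "CO C (acod I a4)" "CM C a3" using CM ab by metis
  interpret H: homomorphism "CO C (acod I a2)" "CO C (acod I a3)" "CM C a2" using CM ab by metis
  interpret K: homomorphism "CO C (acod I a1)" "CO C (acod I a2)" "CM C a1" using CM ab by metis
  \<comment> \<open>The pullback along \<open>a3\<close> followed by \<open>a4\<close> has the
    composition constraint of \<open>a3\<close>, pulled back, after that of \<open>a4\<close>. This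
    fixes the instance: \<open>P\<close> and \<open>Q\<close> are pulled back to the fibre in which
    \<open>f3\<close> lives, and \<open>\<kappa>\<close> is the constraint of
    \<open>a3\<close>.\<close>
  show ?case
    using 22 ab I.comp_assoc[of a1 a2 a3] I.comp_assoc[of a2 a3 a4] I.comp_assoc[of a1 a2 "acomp I a3 a4"]
      I.comp_assoc[of a1 "acomp I a2 a3" a4] I.comp_assoc[of "acomp I a1 a2" a3 a4]
      F.lax_pentagon[of "Fmor (CM C a3) (Fmor (CM C a2) f1)" "Fmor (CM C a3) f2" f3
        "Fcomp (CM C a3) (Fmor (CM C a2) f1) f2" f4]
    unfolding e by (auto simp: composable_def)
next
  case (23 u y x v z)
  obtain x' f a y' g b where e: "u = (x', f, a)" "v = (y', g, b)" using prod_cases3 by metis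
  then have ab: "a \<in> Arr I" "b \<in> Arr I" "adom I a = acod I b" using 23 by (auto simp: mor_hom_def)
  interpret F: homomorphism "CO C (acod I b)" "CO C (adom I b)" "CM C b" using CM ab by simp
  interpret E: homomorphism "CO C (acod I a)" "CO C (acod I b)" "CM C a" using CM ab by metis
  show ?case using 23 e ab F.lax_triangle[of f g] F.Funit_inv by (auto simp: mor_hom_def)
qed

end

section \<open>Simplices of the geometric nerve\<close>

lemma small_category_ordinal: "small_category (ordinal n)"
  by unfold_locales (auto simp: ordinal_def)

lemma bicategory_cat_bicat:
  assumes "small_category I"
  shows "bicategory (cat_bicat I)"
proof -
  interpret small_category I by fact
  show ?thesis
    by unfold_locales
      (auto simp: cat_bicat_def def_hom_def mor_hom_def composable_def invertible_def_def inverse_defs_def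
        dom_cod id_arr comp_arr comp_id_left comp_id_right comp_assoc)
qed

lemma ordinal_simps [simp]: "Ob (ordinal n) = {..n}" "a \<in> Arr (ordinal n) \<longleftrightarrow> fst a \<le> snd a \<and> snd a \<le> n"
  "adom (ordinal n) a = snd a" "acod (ordinal n) a = fst a" "aid (ordinal n) i = (i, i)" "acomp (ordinal n) a b = (fst a, snd b)"
  by (auto simp: ordinal_def)

lemma ordinal_bicat_simps [simp]:
  "Obj (cat_bicat (ordinal n)) = {..n}"
  "a \<in> Mor (cat_bicat (ordinal n)) \<longleftrightarrow> fst a \<le> snd a \<and> snd a \<le> n"
  "a \<in> Def (cat_bicat (ordinal n)) \<longleftrightarrow> fst a \<le> snd a \<and> snd a \<le> n"
  "src (cat_bicat (ordinal n)) a = snd a" "trg (cat_bicat (ordinal n)) a = fst a"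
  "vsrc (cat_bicat (ordinal n)) a = a" "vtrg (cat_bicat (ordinal n)) a = a"
  "one (cat_bicat (ordinal n)) i = (i, i)" "vone (cat_bicat (ordinal n)) a = a"
  "hcomp (cat_bicat (ordinal n)) a b = (fst a, snd b)" "vcomp (cat_bicat (ordinal n)) a b = a"
  "dcomp (cat_bicat (ordinal n)) a b = (fst a, snd b)"
  "assoc (cat_bicat (ordinal n)) a b c = (fst a, snd c)"
  "lunit (cat_bicat (ordinal n)) a = a" "runit (cat_bicat (ordinal n)) a = a"
  by (simp_all add: cat_bicat_def)

lemma composable_ordinal [simp]:
  "composable (cat_bicat (ordinal n)) a b \<longleftrightarrow> fst a \<le> snd a \<and> snd a = fst b \<and> fst b \<le> snd b \<and> snd b \<le> n"
  by (auto simp: composable_def)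

text \<open>An ordinal has identity deformations only, so a lax functor on it is determined by its
  objects, edges and constraints; \<open>Fdef\<close> is forced to consist of identities.\<close>

definition nsimplex :: "('o, 'm, 't) bicat \<Rightarrow> nat \<Rightarrow> (nat \<Rightarrow> 'o) \<Rightarrow> (nat \<Rightarrow> nat \<Rightarrow> 'm) \<Rightarrow> (nat \<Rightarrow> nat \<Rightarrow> nat \<Rightarrow> 't) \<Rightarrow>
    (nat \<Rightarrow> 't) \<Rightarrow> (nat, nat \<times> nat, nat \<times> nat, 'o, 'm, 't) lax" where
  "nsimplex B n x u c e = \<lparr>
     Fobj = (\<lambda>i\<in>{..n}. x i),
     Fmor = (\<lambda>a\<in>Arr (ordinal n). u (fst a) (snd a)),
     Fdef = (\<lambda>a\<in>Arr (ordinal n). vone B (u (fst a) (snd a))),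
     Fcomp = (\<lambda>a b. if composable (cat_bicat (ordinal n)) a b then c (fst a) (snd a) (snd b) else undefined),
     Funit = (\<lambda>i\<in>{..n}. e i)\<rparr>"

lemma nsimplex_simps [simp]:
  "i \<le> n \<Longrightarrow> Fobj (nsimplex B n x u c e) i = x i"
  "i \<le> j \<Longrightarrow> j \<le> n \<Longrightarrow> Fmor (nsimplex B n x u c e) (i, j) = u i j"
  "i \<le> j \<Longrightarrow> j \<le> k \<Longrightarrow> k \<le> n \<Longrightarrow> Fcomp (nsimplex B n x u c e) (i, j) (j, k) = c i j k"
  "i \<le> n \<Longrightarrow> Funit (nsimplex B n x u c e) i = e i"
  by (simp_all add: nsimplex_def)

locale lax_simplex = bicategory B for B :: "('o, 'm, 't) bicat" (structure) +
  fixes n :: nat and x :: "nat \<Rightarrow> 'o" and u :: "nat \<Rightarrow> nat \<Rightarrow> 'm" and c :: "nat \<Rightarrow> nat \<Rightarrow> nat \<Rightarrow> 't" and e :: "nat \<Rightarrow> 't"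
  assumes obj [simp]: "i \<le> n \<Longrightarrow> x i \<in> Obj B"
    and mor [simp]: "i \<le> j \<Longrightarrow> j \<le> n \<Longrightarrow> u i j \<in> Mor B"
    and mor_src [simp]: "i \<le> j \<Longrightarrow> j \<le> n \<Longrightarrow> src B (u i j) = x j"
    and mor_trg [simp]: "i \<le> j \<Longrightarrow> j \<le> n \<Longrightarrow> trg B (u i j) = x i"
    and comp [simp]: "i \<le> j \<Longrightarrow> j \<le> k \<Longrightarrow> k \<le> n \<Longrightarrow> c i j k \<in> Def B"
    and comp_vsrc [simp]: "i \<le> j \<Longrightarrow> j \<le> k \<Longrightarrow> k \<le> n \<Longrightarrow> vsrc B (c i j k) = u i j \<star> u j k"
    and comp_vtrg [simp]: "i \<le> j \<Longrightarrow> j \<le> k \<Longrightarrow> k \<le> n \<Longrightarrow> vtrg B (c i j k) = u i k"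
    and unit [simp]: "i \<le> n \<Longrightarrow> e i \<in> Def B"
    and unit_vsrc [simp]: "i \<le> n \<Longrightarrow> vsrc B (e i) = one B (x i)"
    and unit_vtrg [simp]: "i \<le> n \<Longrightarrow> vtrg B (e i) = u i i"
    and assoc_law: "i \<le> j \<Longrightarrow> j \<le> k \<Longrightarrow> k \<le> l \<Longrightarrow> l \<le> n \<Longrightarrow>
      c i j l \<cdot> (vone B (u i j) \<diamondop> c j k l) = c i k l \<cdot> (c i j k \<diamondop> vone B (u k l)) \<cdot> assoc B (u i j) (u j k) (u k l)"
    and lunit_law: "i \<le> j \<Longrightarrow> j \<le> n \<Longrightarrow> c i i j \<cdot> (e i \<diamondop> vone B (u i j)) = lunit B (u i j)"
    and runit_law: "i \<le> j \<Longrightarrow> j \<le> n \<Longrightarrow> c i j j \<cdot> (vone B (u i j) \<diamondop> e j) = runit B (u i j)"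

lemma Sim_nerve: "F \<in> Sim (nerve B) n \<longleftrightarrow> lax_functor (cat_bicat (ordinal n)) B F"
  by (simp add: nerve_def)

context lax_simplex
begin

lemma nsimplex_in_nerve: "nsimplex B n x u c e \<in> Sim (nerve B) n"
  unfolding Sim_nerve
proof (intro lax_functor.intro lax_functor_axioms.intro bicategory_cat_bicat small_category_ordinal bicategory_axioms, goal_cases)
  case (13 f g h)
  then show ?case using assoc_law[of "fst f" "fst g" "fst h" "snd h"] by (auto simp: nsimplex_def)
qed (auto simp: nsimplex_def mor_hom_def def_hom_def extensional_def lunit_law runit_law)

end

text \<open>The values off the domain are normalised, so a simplex equals its normal form and
  equality of simplices can be tested on components, as in \<open>nerve_eqI\<close>.\<close>

lemma lax_simplex_of_nerve:
  assumes F: "F \<in> Sim (nerve B) n"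
  shows "lax_simplex B n (Fobj F) (\<lambda>i j. Fmor F (i, j)) (\<lambda>i j k. Fcomp F (i, j) (j, k)) (Funit F)"
    and "F = nsimplex B n (Fobj F) (\<lambda>i j. Fmor F (i, j)) (\<lambda>i j k. Fcomp F (i, j) (j, k)) (Funit F)"
proof -
  interpret lax_functor "cat_bicat (ordinal n)" B F using F by (simp add: Sim_nerve)
  let ?A = "cat_bicat (ordinal n)"
  have d: "Fdef F (i, j) = vone B (Fmor F (i, j))" if "i \<le> j" "j \<le> n" for i j
    using Fdef_vone'[of "(i, j)"] that by simp
  show "lax_simplex B n (Fobj F) (\<lambda>i j. Fmor F (i, j)) (\<lambda>i j k. Fcomp F (i, j) (j, k)) (Funit F)"
  proof (unfold_locales, goal_cases)
    case (11 i j k l)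
    then show ?case using Fassoc'[of "(i, j)" "(j, k)" "(k, l)"] by (simp add: d)
  next
    case (12 i j)
    then show ?case using Flunit'[of "(i, j)"] by (simp add: d)
  next
    case (13 i j)
    then show ?case using Frunit'[of "(i, j)"] by (simp add: d)
  qed (use Mor_Fmor src_Fmor trg_Fmor Def_Fcomp vsrc_Fcomp vtrg_Fcomp in simp_all)
  have "Fobj F i = undefined" if "\<not> i \<le> n" for i
    using Fobj that by (auto simp: PiE_def extensional_def)
  moreover have "Fmor F (i, j) = undefined" "Fdef F (i, j) = undefined" if "\<not> (i \<le> j \<and> j \<le> n)" for i j
    using Fmor_ext Fdef_ext that by (auto simp: extensional_def)
  moreover have "Funit F i = undefined" if "\<not> i \<le> n" for i
    using Funit_ext that by (auto simp: extensional_def)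
  moreover have "Fcomp F (i, j) (k, l) = undefined" if "\<not> (i \<le> j \<and> j = k \<and> k \<le> l \<and> l \<le> n)" for i j k l
    using Fcomp_ext[of "(i, j)" "(k, l)"] that by auto
  ultimately show "F = nsimplex B n (Fobj F) (\<lambda>i j. Fmor F (i, j)) (\<lambda>i j k. Fcomp F (i, j) (j, k)) (Funit F)"
    by (intro lax.equality) (auto simp: nsimplex_def d fun_eq_iff restrict_def)
qed

lemma nsimplex_cong:
  assumes "\<And>i. i \<le> n \<Longrightarrow> x i = x' i" "\<And>i j. i \<le> j \<Longrightarrow> j \<le> n \<Longrightarrow> u i j = u' i j"
    "\<And>i j k. i \<le> j \<Longrightarrow> j \<le> k \<Longrightarrow> k \<le> n \<Longrightarrow> c i j k = c' i j k" "\<And>i. i \<le> n \<Longrightarrow> e i = e' i"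
  shows "nsimplex B n x u c e = nsimplex B n x' u' c' e'"
  unfolding nsimplex_def using assms by (auto simp: restrict_def fun_eq_iff)

lemma nerve_eqI:
  assumes "F \<in> Sim (nerve B) n" "F' \<in> Sim (nerve B) n"
    and "\<And>i. i \<le> n \<Longrightarrow> Fobj F i = Fobj F' i" "\<And>i j. i \<le> j \<Longrightarrow> j \<le> n \<Longrightarrow> Fmor F (i, j) = Fmor F' (i, j)"
    "\<And>i j k. i \<le> j \<Longrightarrow> j \<le> k \<Longrightarrow> k \<le> n \<Longrightarrow> Fcomp F (i, j) (j, k) = Fcomp F' (i, j) (j, k)"
    "\<And>i. i \<le> n \<Longrightarrow> Funit F i = Funit F' i"
  shows "F = F'"
proof -
  have "F = nsimplex B n (Fobj F) (\<lambda>i j. Fmor F (i, j)) (\<lambda>i j k. Fcomp F (i, j) (j, k)) (Funit F)"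
    by (rule lax_simplex_of_nerve(2)[OF assms(1)])
  also have "\<dots> = nsimplex B n (Fobj F') (\<lambda>i j. Fmor F' (i, j)) (\<lambda>i j k. Fcomp F' (i, j) (j, k)) (Funit F')"
    by (rule nsimplex_cong) (use assms(3-) in auto)
  also have "\<dots> = F'" by (rule lax_simplex_of_nerve(2)[OF assms(2), symmetric])
  finally show ?thesis .
qed

lemma (in lax_simplex) lax_simplex_reindex:
  assumes "\<And>i. i \<le> m \<Longrightarrow> \<alpha> i \<le> n" "\<And>i j. i \<le> j \<Longrightarrow> j \<le> m \<Longrightarrow> \<alpha> i \<le> \<alpha> j"
  shows "lax_simplex B m (\<lambda>i. x (\<alpha> i)) (\<lambda>i j. u (\<alpha> i) (\<alpha> j)) (\<lambda>i j k. c (\<alpha> i) (\<alpha> j) (\<alpha> k)) (\<lambda>i. e (\<alpha> i))"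
  by unfold_locales (use assms in \<open>simp_all add: assoc_law lunit_law runit_law\<close>)

lemma act_nerve_nsimplex:
  assumes F: "F \<in> Sim (nerve B) n" and \<alpha>: "\<alpha> \<in> mono_maps m n"
  shows "act (nerve B) m n \<alpha> F = nsimplex B m (\<lambda>i. Fobj F (\<alpha> i)) (\<lambda>i j. Fmor F (\<alpha> i, \<alpha> j))
    (\<lambda>i j k. Fcomp F (\<alpha> i, \<alpha> j) (\<alpha> j, \<alpha> k)) (\<lambda>i. Funit F (\<alpha> i))"
proof -
  interpret lax_simplex B n "Fobj F" "\<lambda>i j. Fmor F (i, j)" "\<lambda>i j k. Fcomp F (i, j) (j, k)" "Funit F"
    by (rule lax_simplex_of_nerve[OF F])
  have d: "Fdef F (i, j) = vone B (Fmor F (i, j))" if "i \<le> j" "j \<le> n" for i j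
    using arg_cong[OF lax_simplex_of_nerve(2)[OF F], of Fdef] that by (simp add: nsimplex_def)
  note le = mono_mapsD(3,4)[OF \<alpha>]
  show ?thesis
    unfolding nerve_def nsimplex_def functor_lax_def ordinal_functor_def comp_lax_def
    using le by (auto simp: compose_def restrict_def fun_eq_iff d)
qed

lemma act_nerve:
  assumes F: "F \<in> Sim (nerve B) n" and \<alpha>: "\<alpha> \<in> mono_maps m n"
  shows "act (nerve B) m n \<alpha> F \<in> Sim (nerve B) m"
    "i \<le> m \<Longrightarrow> Fobj (act (nerve B) m n \<alpha> F) i = Fobj F (\<alpha> i)"
    "i \<le> j \<Longrightarrow> j \<le> m \<Longrightarrow> Fmor (act (nerve B) m n \<alpha> F) (i, j) = Fmor F (\<alpha> i, \<alpha> j)"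
    "i \<le> j \<Longrightarrow> j \<le> k \<Longrightarrow> k \<le> m \<Longrightarrow> Fcomp (act (nerve B) m n \<alpha> F) (i, j) (j, k) = Fcomp F (\<alpha> i, \<alpha> j) (\<alpha> j, \<alpha> k)"
    "i \<le> m \<Longrightarrow> Funit (act (nerve B) m n \<alpha> F) i = Funit F (\<alpha> i)"
  using lax_simplex.nsimplex_in_nerve[OF lax_simplex.lax_simplex_reindex[OF lax_simplex_of_nerve(1)[OF F] mono_mapsD(3,4)[OF \<alpha>]]]
  unfolding act_nerve_nsimplex[OF assms] by simp_all

lemma simplicial_set_nerve: "simplicial_set (nerve B)"
proof
  show "act (nerve B) m n \<alpha> x \<in> Sim (nerve B) m" if "\<alpha> \<in> mono_maps m n" "x \<in> Sim (nerve B) n" for \<alpha> m n x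
    using act_nerve that by blast
  show "act (nerve B) n n (\<lambda>i\<in>{..n}. i) x = x" if "x \<in> Sim (nerve B) n" for n x
  proof -
    have "(\<lambda>i\<in>{..n}. i) \<in> mono_maps n n" by (auto simp: mono_maps_def mono_on_def)
    then show ?thesis by (intro nerve_eqI[OF _ that]) (simp_all add: act_nerve[OF that])
  qed
  show "act (nerve B) k n (compose {..k} \<alpha> \<beta>) x = act (nerve B) k m \<beta> (act (nerve B) m n \<alpha> x)"
    if a: "\<beta> \<in> mono_maps k m" "\<alpha> \<in> mono_maps m n" "x \<in> Sim (nerve B) n" for k m n \<alpha> \<beta> x
  proof -
    have c: "compose {..k} \<alpha> \<beta> \<in> mono_maps k n"
      using a(1,2) by (auto simp: mono_maps_def mono_on_def compose_def PiE_iff)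
    note x' = act_nerve(1)[OF a(3,2)]
    note le = mono_mapsD(3,4)[OF a(1)]
    have "compose {..k} \<alpha> \<beta> i = \<alpha> (\<beta> i)" if "i \<le> k" for i using that by (simp add: compose_def)
    then show ?thesis
      by (intro nerve_eqI[OF act_nerve(1)[OF a(3) c] act_nerve(1)[OF x' a(1)]])
        (simp_all add: act_nerve[OF a(3) c] act_nerve[OF x' a(1)] act_nerve[OF a(3,2)] le)
  qed
qed

context lax_functor
begin

text \<open>The associativity law of a composite with \<open>F\<close>, from a single instance of
  the law in \<open>A\<close>. It is not stated for whole simplices because the columns below know
  their laws at first only for indices that end at the vertex of the column.\<close>

lemma lax_assoc_transport:
  assumes u [simp]: "u \<in> Mor A" "v \<in> Mor A" "w \<in> Mor A" "src A u = trg A v" "src A v = trg A w"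
    and p [simp]: "p \<in> Def A" "vsrc A p = u \<star>\<^bsub>A\<^esub> v" "vtrg A p = s"
    and q [simp]: "q \<in> Def A" "vsrc A q = v \<star>\<^bsub>A\<^esub> w" "vtrg A q = t"
    and m [simp]: "m \<in> Def A" "vsrc A m = u \<star>\<^bsub>A\<^esub> t" and k [simp]: "k \<in> Def A" "vsrc A k = s \<star>\<^bsub>A\<^esub> w"
    and law: "m \<cdot>\<^bsub>A\<^esub> (vone A u \<diamondop>\<^bsub>A\<^esub> q) = k \<cdot>\<^bsub>A\<^esub> (p \<diamondop>\<^bsub>A\<^esub> vone A w) \<cdot>\<^bsub>A\<^esub> assoc A u v w"
  shows "Fdef F m \<cdot>\<^bsub>B\<^esub> Fcomp F u t \<cdot>\<^bsub>B\<^esub> (vone B (Fmor F u) \<diamondop>\<^bsub>B\<^esub> (Fdef F q \<cdot>\<^bsub>B\<^esub> Fcomp F v w)) =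
    Fdef F k \<cdot>\<^bsub>B\<^esub> Fcomp F s w \<cdot>\<^bsub>B\<^esub> ((Fdef F p \<cdot>\<^bsub>B\<^esub> Fcomp F u v) \<diamondop>\<^bsub>B\<^esub> vone B (Fmor F w)) \<cdot>\<^bsub>B\<^esub>
      assoc B (Fmor F u) (Fmor F v) (Fmor F w)"
proof -
  have s [simp]: "s \<in> Mor A" "src A s = trg A w" "trg A s = trg A u"
    using A.vtrg_Mor[OF p(1)] A.src_vtrg[OF p(1)] A.trg_vtrg[OF p(1)] by simp_all
  have t [simp]: "t \<in> Mor A" "src A t = src A w" "trg A t = trg A v"
    using A.vtrg_Mor[OF q(1)] A.src_vtrg[OF q(1)] A.trg_vtrg[OF q(1)] by simp_all
  let ?fu = "Fmor F u" and ?fv = "Fmor F v" and ?fw = "Fmor F w"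
  have n1: "Fcomp F u t \<cdot>\<^bsub>B\<^esub> (vone B ?fu \<diamondop>\<^bsub>B\<^esub> Fdef F q) = Fdef F (vone A u \<diamondop>\<^bsub>A\<^esub> q) \<cdot>\<^bsub>B\<^esub> Fcomp F u (v \<star>\<^bsub>A\<^esub> w)"
    using Fcomp_nat'[of "vone A u" q] by simp
  have n2: "Fcomp F s w \<cdot>\<^bsub>B\<^esub> (Fdef F p \<diamondop>\<^bsub>B\<^esub> vone B ?fw) = Fdef F (p \<diamondop>\<^bsub>A\<^esub> vone A w) \<cdot>\<^bsub>B\<^esub> Fcomp F (u \<star>\<^bsub>A\<^esub> v) w"
    using Fcomp_nat'[of p "vone A w"] by simp
  have l: "Fdef F m \<cdot>\<^bsub>B\<^esub> Fdef F (vone A u \<diamondop>\<^bsub>A\<^esub> q) =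
      Fdef F k \<cdot>\<^bsub>B\<^esub> (Fdef F (p \<diamondop>\<^bsub>A\<^esub> vone A w) \<cdot>\<^bsub>B\<^esub> Fdef F (assoc A u v w))"
    using arg_cong[OF law, of "Fdef F"] by (simp add: Fdef_vcomp' B.vcomp_assoc')
  have fa: "Fdef F (assoc A u v w) \<cdot>\<^bsub>B\<^esub> (Fcomp F u (v \<star>\<^bsub>A\<^esub> w) \<cdot>\<^bsub>B\<^esub> (vone B ?fu \<diamondop>\<^bsub>B\<^esub> Fcomp F v w)) =
      Fcomp F (u \<star>\<^bsub>A\<^esub> v) w \<cdot>\<^bsub>B\<^esub> ((Fcomp F u v \<diamondop>\<^bsub>B\<^esub> vone B ?fw) \<cdot>\<^bsub>B\<^esub> assoc B ?fu ?fv ?fw)"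
    using Fassoc'[of u v w] by (simp add: B.vcomp_assoc')
  have "Fdef F m \<cdot>\<^bsub>B\<^esub> Fcomp F u t \<cdot>\<^bsub>B\<^esub> (vone B ?fu \<diamondop>\<^bsub>B\<^esub> (Fdef F q \<cdot>\<^bsub>B\<^esub> Fcomp F v w)) =
      Fdef F m \<cdot>\<^bsub>B\<^esub> ((Fcomp F u t \<cdot>\<^bsub>B\<^esub> (vone B ?fu \<diamondop>\<^bsub>B\<^esub> Fdef F q)) \<cdot>\<^bsub>B\<^esub> (vone B ?fu \<diamondop>\<^bsub>B\<^esub> Fcomp F v w))"
    by (simp add: B.vcomp_assoc' B.whisker_left)
  also have "\<dots> = (Fdef F m \<cdot>\<^bsub>B\<^esub> Fdef F (vone A u \<diamondop>\<^bsub>A\<^esub> q)) \<cdot>\<^bsub>B\<^esub>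
      (Fcomp F u (v \<star>\<^bsub>A\<^esub> w) \<cdot>\<^bsub>B\<^esub> (vone B ?fu \<diamondop>\<^bsub>B\<^esub> Fcomp F v w))"
    unfolding n1 by (simp add: B.vcomp_assoc')
  also have "\<dots> = Fdef F k \<cdot>\<^bsub>B\<^esub> (Fdef F (p \<diamondop>\<^bsub>A\<^esub> vone A w) \<cdot>\<^bsub>B\<^esub> (Fdef F (assoc A u v w) \<cdot>\<^bsub>B\<^esub>
      (Fcomp F u (v \<star>\<^bsub>A\<^esub> w) \<cdot>\<^bsub>B\<^esub> (vone B ?fu \<diamondop>\<^bsub>B\<^esub> Fcomp F v w))))"
    unfolding l by (simp add: B.vcomp_assoc')
  also have "\<dots> = Fdef F k \<cdot>\<^bsub>B\<^esub> ((Fdef F (p \<diamondop>\<^bsub>A\<^esub> vone A w) \<cdot>\<^bsub>B\<^esub> Fcomp F (u \<star>\<^bsub>A\<^esub> v) w) \<cdot>\<^bsub>B\<^esub>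
      ((Fcomp F u v \<diamondop>\<^bsub>B\<^esub> vone B ?fw) \<cdot>\<^bsub>B\<^esub> assoc B ?fu ?fv ?fw))"
    unfolding fa by (simp add: B.vcomp_assoc')
  also have "\<dots> = Fdef F k \<cdot>\<^bsub>B\<^esub> Fcomp F s w \<cdot>\<^bsub>B\<^esub> ((Fdef F p \<cdot>\<^bsub>B\<^esub> Fcomp F u v) \<diamondop>\<^bsub>B\<^esub> vone B ?fw) \<cdot>\<^bsub>B\<^esub> assoc B ?fu ?fv ?fw"
    unfolding n2[symmetric] by (simp add: B.vcomp_assoc' B.whisker_right)
  finally show ?thesis .
qed

lemma lax_lunit_transport:
  assumes [simp]: "u \<in> Mor A" "e \<in> Def A" "vsrc A e = one A (trg A u)" "c \<in> Def A" "vsrc A c = vtrg A e \<star>\<^bsub>A\<^esub> u"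
    and law: "c \<cdot>\<^bsub>A\<^esub> (e \<diamondop>\<^bsub>A\<^esub> vone A u) = lunit A u"
  shows "Fdef F c \<cdot>\<^bsub>B\<^esub> Fcomp F (vtrg A e) u \<cdot>\<^bsub>B\<^esub> ((Fdef F e \<cdot>\<^bsub>B\<^esub> Funit F (trg A u)) \<diamondop>\<^bsub>B\<^esub> vone B (Fmor F u)) = lunit B (Fmor F u)"
proof -
  let ?fu = "Fmor F u"
  have n: "Fcomp F (vtrg A e) u \<cdot>\<^bsub>B\<^esub> (Fdef F e \<diamondop>\<^bsub>B\<^esub> vone B ?fu) = Fdef F (e \<diamondop>\<^bsub>A\<^esub> vone A u) \<cdot>\<^bsub>B\<^esub> Fcomp F (one A (trg A u)) u"
    using Fcomp_nat'[of e "vone A u"] by simp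
  have [simp]: "src A (vtrg A e) = trg A u" "trg A (vtrg A e) = trg A u" by simp_all
  have "Fdef F c \<cdot>\<^bsub>B\<^esub> Fcomp F (vtrg A e) u \<cdot>\<^bsub>B\<^esub> ((Fdef F e \<cdot>\<^bsub>B\<^esub> Funit F (trg A u)) \<diamondop>\<^bsub>B\<^esub> vone B ?fu) =
    Fdef F c \<cdot>\<^bsub>B\<^esub> ((Fcomp F (vtrg A e) u \<cdot>\<^bsub>B\<^esub> (Fdef F e \<diamondop>\<^bsub>B\<^esub> vone B ?fu)) \<cdot>\<^bsub>B\<^esub> (Funit F (trg A u) \<diamondop>\<^bsub>B\<^esub> vone B ?fu))"
    by (simp add: B.vcomp_assoc' B.whisker_right)
  also have "\<dots> = Fdef F (c \<cdot>\<^bsub>A\<^esub> (e \<diamondop>\<^bsub>A\<^esub> vone A u)) \<cdot>\<^bsub>B\<^esub> Fcomp F (one A (trg A u)) u \<cdot>\<^bsub>B\<^esub> (Funit F (trg A u) \<diamondop>\<^bsub>B\<^esub> vone B ?fu)"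
    unfolding n by (simp add: B.vcomp_assoc' Fdef_vcomp')
  also have "\<dots> = lunit B ?fu" unfolding law by (rule Flunit') simp
  finally show ?thesis .
qed

lemma lax_runit_transport:
  assumes [simp]: "u \<in> Mor A" "e \<in> Def A" "vsrc A e = one A (src A u)" "c \<in> Def A" "vsrc A c = u \<star>\<^bsub>A\<^esub> vtrg A e"
    and law: "c \<cdot>\<^bsub>A\<^esub> (vone A u \<diamondop>\<^bsub>A\<^esub> e) = runit A u"
  shows "Fdef F c \<cdot>\<^bsub>B\<^esub> Fcomp F u (vtrg A e) \<cdot>\<^bsub>B\<^esub> (vone B (Fmor F u) \<diamondop>\<^bsub>B\<^esub> (Fdef F e \<cdot>\<^bsub>B\<^esub> Funit F (src A u))) = runit B (Fmor F u)"
proof -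
  let ?fu = "Fmor F u"
  have n: "Fcomp F u (vtrg A e) \<cdot>\<^bsub>B\<^esub> (vone B ?fu \<diamondop>\<^bsub>B\<^esub> Fdef F e) = Fdef F (vone A u \<diamondop>\<^bsub>A\<^esub> e) \<cdot>\<^bsub>B\<^esub> Fcomp F u (one A (src A u))"
    using Fcomp_nat'[of "vone A u" e] by simp
  have [simp]: "src A (vtrg A e) = src A u" "trg A (vtrg A e) = src A u" by simp_all
  have "Fdef F c \<cdot>\<^bsub>B\<^esub> Fcomp F u (vtrg A e) \<cdot>\<^bsub>B\<^esub> (vone B ?fu \<diamondop>\<^bsub>B\<^esub> (Fdef F e \<cdot>\<^bsub>B\<^esub> Funit F (src A u))) =
    Fdef F c \<cdot>\<^bsub>B\<^esub> ((Fcomp F u (vtrg A e) \<cdot>\<^bsub>B\<^esub> (vone B ?fu \<diamondop>\<^bsub>B\<^esub> Fdef F e)) \<cdot>\<^bsub>B\<^esub> (vone B ?fu \<diamondop>\<^bsub>B\<^esub> Funit F (src A u)))"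
    by (simp add: B.vcomp_assoc' B.whisker_left)
  also have "\<dots> = Fdef F (c \<cdot>\<^bsub>A\<^esub> (vone A u \<diamondop>\<^bsub>A\<^esub> e)) \<cdot>\<^bsub>B\<^esub> Fcomp F u (one A (src A u)) \<cdot>\<^bsub>B\<^esub> (vone B ?fu \<diamondop>\<^bsub>B\<^esub> Funit F (src A u))"
    unfolding n by (simp add: B.vcomp_assoc' Fdef_vcomp')
  also have "\<dots> = runit B ?fu" unfolding law by (rule Frunit') simp
  finally show ?thesis .
qed

lemma Fdef_vone_all: "\<forall>u\<in>Mor A. Fdef F (vone A u) = vone B (Fmor F u)"
  by simp

lemma lax_simplex_map:
  assumes "lax_simplex A n x u c e"
  shows "lax_simplex B n (\<lambda>i. Fobj F (x i)) (\<lambda>i j. Fmor F (u i j))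
    (\<lambda>i j k. Fdef F (c i j k) \<cdot>\<^bsub>B\<^esub> Fcomp F (u i j) (u j k)) (\<lambda>i. Fdef F (e i) \<cdot>\<^bsub>B\<^esub> Funit F (x i))"
proof -
  interpret S: lax_simplex A n x u c e by fact
  show ?thesis
  proof (unfold_locales, goal_cases)
    case (11 i j k l)
    show ?case
      by (rule lax_assoc_transport[OF _ _ _ _ _ _ _ S.comp_vtrg _ _ S.comp_vtrg _ _ _ _ S.assoc_law]) (use 11 in simp_all)
  next
    case (12 i j)
    then show ?case using lax_lunit_transport[of "u i j" "e i" "c i i j"] S.lunit_law by simp
  next
    case (13 i j)
    then show ?case using lax_runit_transport[of "u i j" "e j" "c i j j"] S.runit_law by simp
  qed simp_all
qed

end

lemma nerve_Fdef:
  assumes F: "F \<in> Sim (nerve B) n" and "i \<le> j" "j \<le> n"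
  shows "Fdef F (i, j) = vone B (Fmor F (i, j))"
  using arg_cong[OF lax_simplex_of_nerve(2)[OF F], of Fdef] assms(2,3) by (simp add: nsimplex_def)

text \<open>Preservation of identities is the law of \<open>H\<close> that enters the formula. In
  this form it applies to composites and to \<open>grothendieck_map\<close> from one
  equation.\<close>

lemma nerve_map_nsimplex:
  assumes F: "F \<in> Sim (nerve B) n" and H: "\<forall>u\<in>Mor B. Fdef H (vone B u) = vone B' (Fmor H u)"
  shows "nerve_map B' H n F = nsimplex B' n (\<lambda>i. Fobj H (Fobj F i)) (\<lambda>i j. Fmor H (Fmor F (i, j)))
    (\<lambda>i j k. Fdef H (Fcomp F (i, j) (j, k)) \<cdot>\<^bsub>B'\<^esub> Fcomp H (Fmor F (i, j)) (Fmor F (j, k)))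
    (\<lambda>i. Fdef H (Funit F i) \<cdot>\<^bsub>B'\<^esub> Funit H (Fobj F i))"
proof -
  interpret lax_simplex B n "Fobj F" "\<lambda>i j. Fmor F (i, j)" "\<lambda>i j k. Fcomp F (i, j) (j, k)" "Funit F"
    by (rule lax_simplex_of_nerve[OF F])
  show ?thesis
    unfolding nerve_map_def nsimplex_def comp_lax_def
    by (auto simp: compose_def restrict_def fun_eq_iff nerve_Fdef[OF F] H)
qed

lemma nerve_map_simps:
  assumes H: "lax_functor B B' H" and F: "F \<in> Sim (nerve B) n"
  shows "nerve_map B' H n F \<in> Sim (nerve B') n"
    "i \<le> n \<Longrightarrow> Fobj (nerve_map B' H n F) i = Fobj H (Fobj F i)"
    "i \<le> j \<Longrightarrow> j \<le> n \<Longrightarrow> Fmor (nerve_map B' H n F) (i, j) = Fmor H (Fmor F (i, j))"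
    "i \<le> j \<Longrightarrow> j \<le> k \<Longrightarrow> k \<le> n \<Longrightarrow> Fcomp (nerve_map B' H n F) (i, j) (j, k) =
      Fdef H (Fcomp F (i, j) (j, k)) \<cdot>\<^bsub>B'\<^esub> Fcomp H (Fmor F (i, j)) (Fmor F (j, k))"
    "i \<le> n \<Longrightarrow> Funit (nerve_map B' H n F) i = Fdef H (Funit F i) \<cdot>\<^bsub>B'\<^esub> Funit H (Fobj F i)"
proof -
  interpret H: lax_functor B B' H by fact
  note S = H.lax_simplex_map[OF lax_simplex_of_nerve(1)[OF F]]
  show "nerve_map B' H n F \<in> Sim (nerve B') n"
    using lax_simplex.nsimplex_in_nerve[OF S] by (simp add: nerve_map_nsimplex[OF F H.Fdef_vone_all])
qed (simp_all add: nerve_map_nsimplex[OF F lax_functor.Fdef_vone_all[OF H]])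

lemma nerve_map_act:
  assumes H: "lax_functor B B' H" and F: "F \<in> Sim (nerve B) n" and \<alpha>: "\<alpha> \<in> mono_maps m n"
  shows "nerve_map B' H m (act (nerve B) m n \<alpha> F) = act (nerve B') m n \<alpha> (nerve_map B' H n F)"
proof -
  note F' = nerve_map_simps[OF H F] and F'' = act_nerve[OF F \<alpha>]
  note le = mono_mapsD(3,4)[OF \<alpha>]
  show ?thesis
    by (rule nerve_eqI[OF nerve_map_simps(1)[OF H F''(1)] act_nerve(1)[OF F'(1) \<alpha>]])
      (simp_all add: nerve_map_simps[OF H F''(1)] act_nerve[OF F'(1) \<alpha>] F' F'' le)
qed

section \<open>Functors on ordinals\<close>

lemma cat_functor_ordinalD:
  assumes "cat_functor (ordinal q) I G"
  shows "i \<le> q \<Longrightarrow> fob G i \<in> Ob I" "i \<le> j \<Longrightarrow> j \<le> q \<Longrightarrow> farr G (i, j) \<in> Arr I"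
    "i \<le> j \<Longrightarrow> j \<le> q \<Longrightarrow> adom I (farr G (i, j)) = fob G j" "i \<le> j \<Longrightarrow> j \<le> q \<Longrightarrow> acod I (farr G (i, j)) = fob G i"
    "i \<le> q \<Longrightarrow> farr G (i, i) = aid I (fob G i)"
    "i \<le> j \<Longrightarrow> j \<le> k \<Longrightarrow> k \<le> q \<Longrightarrow> acomp I (farr G (i, j)) (farr G (j, k)) = farr G (i, k)"
    "\<not> i \<le> q \<Longrightarrow> fob G i = undefined" "\<not> (i \<le> j \<and> j \<le> q) \<Longrightarrow> farr G (i, j) = undefined"
proof -
  interpret cat_functor "ordinal q" I G by fact
  show "i \<le> q \<Longrightarrow> fob G i \<in> Ob I" "i \<le> j \<Longrightarrow> j \<le> q \<Longrightarrow> farr G (i, j) \<in> Arr I"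
    using fob farr by (auto simp: PiE_iff)
  show "i \<le> j \<Longrightarrow> j \<le> q \<Longrightarrow> adom I (farr G (i, j)) = fob G j" "i \<le> j \<Longrightarrow> j \<le> q \<Longrightarrow> acod I (farr G (i, j)) = fob G i"
    using fdom[of "(i, j)"] fcod[of "(i, j)"] by auto
  show "i \<le> q \<Longrightarrow> farr G (i, i) = aid I (fob G i)" using fid[of i] by auto
  show "i \<le> j \<Longrightarrow> j \<le> k \<Longrightarrow> k \<le> q \<Longrightarrow> acomp I (farr G (i, j)) (farr G (j, k)) = farr G (i, k)"
    using fcomp[of "(i, j)" "(j, k)"] by auto
  show "\<not> i \<le> q \<Longrightarrow> fob G i = undefined" "\<not> (i \<le> j \<and> j \<le> q) \<Longrightarrow> farr G (i, j) = undefined"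
    using fob farr by (auto simp: PiE_iff extensional_def)
qed

lemma cat_functor_ordinal_eqI:
  assumes G: "cat_functor (ordinal q) I G" and G': "cat_functor (ordinal q) I G'"
    and "\<And>i. i \<le> q \<Longrightarrow> fob G i = fob G' i" "\<And>i j. i \<le> j \<Longrightarrow> j \<le> q \<Longrightarrow> farr G (i, j) = farr G' (i, j)"
  shows "G = G'"
proof (rule cat_map.equality)
  show "fob G = fob G'" using assms(3) cat_functor_ordinalD(7)[OF G] cat_functor_ordinalD(7)[OF G'] by (metis ext)
  show "farr G = farr G'"
  proof
    fix a show "farr G a = farr G' a"
      using assms(4) cat_functor_ordinalD(8)[OF G] cat_functor_ordinalD(8)[OF G'] by (cases a) metis
  qed
qed simp

abbreviation reindex :: "nat \<Rightarrow> (nat, nat \<times> nat, 'i, 'a) cat_map \<Rightarrow> (nat \<Rightarrow> nat) \<Rightarrow> (nat, nat \<times> nat, 'i, 'a) cat_map" where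
  "reindex m G \<beta> \<equiv> comp_functor (ordinal m) G (ordinal_functor m \<beta>)"

lemma cat_functor_ordinalI:
  assumes "small_category I"
    and "\<And>i. i \<le> q \<Longrightarrow> x i \<in> Ob I" "\<And>i j. i \<le> j \<Longrightarrow> j \<le> q \<Longrightarrow> a i j \<in> Arr I"
    "\<And>i j. i \<le> j \<Longrightarrow> j \<le> q \<Longrightarrow> adom I (a i j) = x j" "\<And>i j. i \<le> j \<Longrightarrow> j \<le> q \<Longrightarrow> acod I (a i j) = x i"
    "\<And>i. i \<le> q \<Longrightarrow> a i i = aid I (x i)"
    "\<And>i j k. i \<le> j \<Longrightarrow> j \<le> k \<Longrightarrow> k \<le> q \<Longrightarrow> acomp I (a i j) (a j k) = a i k"
  shows "cat_functor (ordinal q) I \<lparr>fob = (\<lambda>i\<in>{..q}. x i), farr = (\<lambda>b\<in>Arr (ordinal q). a (fst b) (snd b))\<rparr>"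
  by (intro cat_functor.intro cat_functor_axioms.intro small_category_ordinal assms(1)) (use assms(2-) in auto)

lemma cat_functor_reindex:
  assumes G: "cat_functor (ordinal q) I G" and \<beta>: "\<beta> \<in> mono_maps m q"
  shows "cat_functor (ordinal m) I (reindex m G \<beta>)"
    "i \<le> m \<Longrightarrow> fob (reindex m G \<beta>) i = fob G (\<beta> i)"
    "i \<le> j \<Longrightarrow> j \<le> m \<Longrightarrow> farr (reindex m G \<beta>) (i, j) = farr G (\<beta> i, \<beta> j)"
proof -
  note le = mono_mapsD(3,4)[OF \<beta>]
  have eq: "reindex m G \<beta> = \<lparr>fob = (\<lambda>i\<in>{..m}. fob G (\<beta> i)), farr = (\<lambda>b\<in>Arr (ordinal m). farr G (\<beta> (fst b), \<beta> (snd b)))\<rparr>"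
    unfolding comp_functor_def ordinal_functor_def by (auto simp: compose_def restrict_def fun_eq_iff)
  show "cat_functor (ordinal m) I (reindex m G \<beta>)"
    unfolding eq
  proof (rule cat_functor_ordinalI)
    show "small_category I" using G by (simp add: cat_functor_def)
  qed (use le cat_functor_ordinalD[OF G] in simp_all)
  show "i \<le> m \<Longrightarrow> fob (reindex m G \<beta>) i = fob G (\<beta> i)"
    "i \<le> j \<Longrightarrow> j \<le> m \<Longrightarrow> farr (reindex m G \<beta>) (i, j) = farr G (\<beta> i, \<beta> j)"
    unfolding eq by simp_all
qed

lemma reindex_id:
  assumes G: "cat_functor (ordinal q) I G"
  shows "reindex q G (\<lambda>i\<in>{..q}. i) = G"
proof -
  have "(\<lambda>i\<in>{..q}. i) \<in> mono_maps q q" by (auto simp: mono_maps_def mono_on_def)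
  note r = cat_functor_reindex[OF G this]
  show ?thesis by (rule cat_functor_ordinal_eqI[OF r(1) G]) (simp_all add: r)
qed

lemma reindex_reindex:
  assumes G: "cat_functor (ordinal q) I G" and \<beta>: "\<beta> \<in> mono_maps m q" "\<gamma> \<in> mono_maps k m" "\<delta> \<in> mono_maps k q"
    and eq: "\<And>i. i \<le> k \<Longrightarrow> \<delta> i = \<beta> (\<gamma> i)"
  shows "reindex k (reindex m G \<beta>) \<gamma> = reindex k G \<delta>"
proof -
  note r = cat_functor_reindex[OF G \<beta>(1)]
  show ?thesis
    by (rule cat_functor_ordinal_eqI[OF cat_functor_reindex(1)[OF r(1) \<beta>(2)] cat_functor_reindex(1)[OF G \<beta>(3)]])
      (simp_all add: cat_functor_reindex[OF r(1) \<beta>(2)] cat_functor_reindex[OF G \<beta>(3)] r eq mono_mapsD(3,4)[OF \<beta>(2)])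
qed

section \<open>The bisimplicial set of a diagram\<close>

context diagram
begin

abbreviation ND where "ND i \<equiv> nerve (CO C i)"

definition pull :: "'a \<Rightarrow> nat \<Rightarrow> (nat, nat \<times> nat, nat \<times> nat, 'o, 'm, 't) lax \<Rightarrow> (nat, nat \<times> nat, nat \<times> nat, 'o, 'm, 't) lax" where
  "pull a = nerve_map (CO C (adom I a)) (CM C a)"

lemma lax_functor_CM: "a \<in> Arr I \<Longrightarrow> lax_functor (CO C (acod I a)) (CO C (adom I a)) (CM C a)"
  using CM homomorphism.axioms(1) by blast

lemma pull_simps:
  assumes a: "a \<in> Arr I" "acod I a = j" "adom I a = k" and F: "F \<in> Sim (ND j) n"
  shows "pull a n F \<in> Sim (ND k) n"
    "i \<le> n \<Longrightarrow> Fobj (pull a n F) i = Fobj (CM C a) (Fobj F i)"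
    "i \<le> j' \<Longrightarrow> j' \<le> n \<Longrightarrow> Fmor (pull a n F) (i, j') = Fmor (CM C a) (Fmor F (i, j'))"
    "i \<le> j' \<Longrightarrow> j' \<le> k' \<Longrightarrow> k' \<le> n \<Longrightarrow> Fcomp (pull a n F) (i, j') (j', k') =
      Fdef (CM C a) (Fcomp F (i, j') (j', k')) \<cdot>\<^bsub>CO C k\<^esub> Fcomp (CM C a) (Fmor F (i, j')) (Fmor F (j', k'))"
    "i \<le> n \<Longrightarrow> Funit (pull a n F) i = Fdef (CM C a) (Funit F i) \<cdot>\<^bsub>CO C k\<^esub> Funit (CM C a) (Fobj F i)"
  using nerve_map_simps[OF lax_functor_CM[OF a(1)], of F n] assms by (simp_all add: pull_def)

lemma pull_id:
  assumes "i \<in> Ob I" "F \<in> Sim (ND i) n"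
  shows "pull (aid I i) n F = F"
proof -
  interpret S: lax_simplex "CO C i" n "Fobj F" "\<lambda>i j. Fmor F (i, j)" "\<lambda>i j k. Fcomp F (i, j) (j, k)" "Funit F"
    by (rule lax_simplex_of_nerve[OF assms(2)])
  note p = pull_simps[OF aid_simps(1,3,2)[OF assms(1)] assms(2)]
  show ?thesis
    by (rule nerve_eqI[OF p(1) assms(2)]) (simp_all add: p assms(1))
qed

text \<open>Pullbacks of simplices compose strictly, since composition of lax functors is strict and
  the diagram is a functor.\<close>

lemma pull_comp:
  assumes a: "a \<in> Arr I" "b \<in> Arr I" "adom I a = acod I b" and F: "F \<in> Sim (ND (acod I a)) n"
  shows "pull b n (pull a n F) = pull (acomp I a b) n F"
proof -
  interpret S: lax_simplex "CO C (acod I a)" n "Fobj F" "\<lambda>i j. Fmor F (i, j)" "\<lambda>i j k. Fcomp F (i, j) (j, k)" "Funit F"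
    by (rule lax_simplex_of_nerve[OF F])
  interpret A: lax_functor "CO C (acod I a)" "CO C (acod I b)" "CM C a" using lax_functor_CM[of a] a by simp
  interpret B: lax_functor "CO C (acod I b)" "CO C (adom I b)" "CM C b" using lax_functor_CM[of b] a by simp
  note p = pull_simps[OF a(1) refl a(3) F]
  note pp = pull_simps[OF a(2) refl refl p(1)]
  note q = pull_simps[OF acomp_simps(1,3,2)[OF a] F]
  show ?thesis
    by (rule nerve_eqI[OF pp(1) q(1)])
      (simp_all add: p pp q a B.Fdef_vcomp' B.B.vcomp_assoc')
qed

lemma pull_act:
  assumes "a \<in> Arr I" "acod I a = i" "adom I a = j" "F \<in> Sim (ND i) n" "\<alpha> \<in> mono_maps m n"
  shows "pull a m (act (ND i) m n \<alpha> F) = act (ND j) m n \<alpha> (pull a n F)"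
  using nerve_map_act[OF lax_functor_CM[OF assms(1)]] assms by (auto simp: pull_def)

definition bisimplices where
  "bisimplices p q = {(F, G). cat_functor (ordinal q) I G \<and> F \<in> Sim (ND (fob G 0)) p}"

text \<open>Fibre and base direction get independent operators, although the homotopy colimit uses
  equal ones: \<open>rho\<close> and the joins below pick different vertices in the two directions.
  The simplex is first transported to the new first vertex of the base, then restricted.\<close>

definition biact where
  "biact p' p \<alpha> q' \<beta> = (\<lambda>(F, G). (act (ND (fob G (\<beta> 0))) p' p \<alpha> (pull (farr G (0, \<beta> 0)) p F), reindex q' G \<beta>))"

lemma biact_closed:
  assumes "\<alpha> \<in> mono_maps p' p" "\<beta> \<in> mono_maps q' q" "s \<in> bisimplices p q"
  shows "biact p' p \<alpha> q' \<beta> s \<in> bisimplices p' q'"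
proof -
  obtain F G where s: "s = (F, G)" by (cases s)
  then have G: "cat_functor (ordinal q) I G" and F: "F \<in> Sim (ND (fob G 0)) p" using assms(3) by (auto simp: bisimplices_def)
  note g = cat_functor_ordinalD[OF G] and b = mono_mapsD(3)[OF assms(2), of 0]
  have "pull (farr G (0, \<beta> 0)) p F \<in> Sim (ND (fob G (\<beta> 0))) p"
    by (rule pull_simps[OF _ _ _ F]) (use g b in auto)
  then show ?thesis
    using act_nerve(1)[OF _ assms(1)] cat_functor_reindex[OF G assms(2)] by (auto simp: s bisimplices_def biact_def)
qed

lemma biact_id:
  assumes "s \<in> bisimplices p q"
  shows "biact p p (\<lambda>i\<in>{..p}. i) q (\<lambda>i\<in>{..q}. i) s = s"
proof -
  obtain F G where s: "s = (F, G)" by (cases s)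
  then have G: "cat_functor (ordinal q) I G" and F: "F \<in> Sim (ND (fob G 0)) p" using assms by (auto simp: bisimplices_def)
  note g = cat_functor_ordinalD[OF G, of 0]
  have "pull (farr G (0, 0)) p F = F" using pull_id[OF _ F] g by simp
  moreover have "act (ND (fob G 0)) p p (\<lambda>i\<in>{..p}. i) F = F"
    using simplicial_set.act_id[OF simplicial_set_nerve F] .
  ultimately show ?thesis using reindex_id[OF G] by (simp add: s biact_def)
qed

text \<open>By \<open>pull_act\<close> the second transport moves past the first restriction, and
  consecutive transports merge by \<open>pull_comp\<close>. Composites of operators are given
  pointwise, which suits operators with explicit formulas.\<close>

lemma biact_comp:
  assumes \<alpha>: "\<alpha> \<in> mono_maps p' p" "\<alpha>' \<in> mono_maps p'' p'" "\<alpha>'' \<in> mono_maps p'' p" "\<And>i. i \<le> p'' \<Longrightarrow> \<alpha>'' i = \<alpha> (\<alpha>' i)"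
    and \<beta>: "\<beta> \<in> mono_maps q' q" "\<beta>' \<in> mono_maps q'' q'" "\<beta>'' \<in> mono_maps q'' q" "\<And>i. i \<le> q'' \<Longrightarrow> \<beta>'' i = \<beta> (\<beta>' i)"
    and s: "s \<in> bisimplices p q"
  shows "biact p'' p' \<alpha>' q'' \<beta>' (biact p' p \<alpha> q' \<beta> s) = biact p'' p \<alpha>'' q'' \<beta>'' s"
proof -
  obtain F G where s: "s = (F, G)" and G: "cat_functor (ordinal q) I G" and F: "F \<in> Sim (ND (fob G 0)) p"
    using assms by (auto simp: bisimplices_def)
  note r = cat_functor_reindex[OF G \<beta>(1)]
  note g = cat_functor_ordinalD[OF G]
  have le: "\<beta> 0 \<le> q" "\<beta>' 0 \<le> q'" "\<beta> 0 \<le> \<beta> (\<beta>' 0)" "\<beta> (\<beta>' 0) \<le> q"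
    using mono_mapsD(3)[OF \<beta>(1)] mono_mapsD(3)[OF \<beta>(2)] mono_mapsD(4)[OF \<beta>(1)] by auto
  let ?a = "farr G (0, \<beta> 0)" and ?b = "farr G (\<beta> 0, \<beta> (\<beta>' 0))"
  have P: "pull ?a p F \<in> Sim (ND (fob G (\<beta> 0))) p"
    by (rule pull_simps[OF _ _ _ F]) (use g le in auto)
  have b: "?b \<in> Arr I" "acod I ?b = fob G (\<beta> 0)" "adom I ?b = fob G (\<beta> (\<beta>' 0))" using g le by auto
  have P': "pull ?b p (pull ?a p F) \<in> Sim (ND (fob G (\<beta> (\<beta>' 0)))) p"
    by (rule pull_simps[OF b P])
  have "act (ND (fob G (\<beta> (\<beta>' 0)))) p'' p' \<alpha>' (pull ?b p' (act (ND (fob G (\<beta> 0))) p' p \<alpha> (pull ?a p F))) =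
    act (ND (fob G (\<beta> (\<beta>' 0)))) p'' p' \<alpha>' (act (ND (fob G (\<beta> (\<beta>' 0)))) p' p \<alpha> (pull ?b p (pull ?a p F)))"
    using pull_act[OF b P \<alpha>(1)] by simp
  also have "\<dots> = act (ND (fob G (\<beta> (\<beta>' 0)))) p'' p \<alpha>'' (pull ?b p (pull ?a p F))"
  proof -
    have "compose {..p''} \<alpha> \<alpha>' = \<alpha>''"
      using \<alpha>(3,4) by (auto simp: compose_def fun_eq_iff mono_maps_def PiE_iff extensional_def)
    then show ?thesis using simplicial_set.act_comp[OF simplicial_set_nerve \<alpha>(2,1) P'] by simp
  qed
  also have "pull ?b p (pull ?a p F) = pull (farr G (0, \<beta> (\<beta>' 0))) p F"
    using pull_comp[of ?a ?b F p] g le F by simp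
  finally show ?thesis
    using \<beta>(4)[of 0] reindex_reindex[OF G \<beta>] r(2)[OF le(2)] r(2)[of 0] r(3)[of 0 "\<beta>' 0"] le by (simp add: s biact_def)
qed

abbreviation HC where "HC \<equiv> hocolim I (nerve_diagram I C)"

lemma Sim_hocolim: "Sim HC n = bisimplices n n"
  by (auto simp: hocolim_def diagonal_def hocolim_bisset_def nerve_diagram_def bisimplices_def)

lemma act_hocolim:
  assumes \<alpha>: "\<alpha> \<in> mono_maps m n" and s: "s \<in> bisimplices n n"
  shows "act HC m n \<alpha> s = biact m n \<alpha> m \<alpha> s"
proof -
  obtain F G where s: "s = (F, G)" and G: "cat_functor (ordinal n) I G"
    using assms by (auto simp: bisimplices_def)
  have "adom I (farr G (0, \<alpha> 0)) = fob G (\<alpha> 0)" using cat_functor_ordinalD[OF G] mono_mapsD(3)[OF \<alpha>] by simp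
  then show ?thesis
    using cat_functor_reindex(2)[OF G \<alpha>, of 0]
    by (simp add: s hocolim_def diagonal_def hocolim_bisset_def nerve_diagram_def biact_def pull_def)
qed

lemma simplicial_set_hocolim: "simplicial_set HC"
proof
  show "act HC m n \<alpha> x \<in> Sim HC m" if "\<alpha> \<in> mono_maps m n" "x \<in> Sim HC n" for \<alpha> m n x
    using that biact_closed act_hocolim by (simp add: Sim_hocolim)
  show "act HC n n (\<lambda>i\<in>{..n}. i) x = x" if "x \<in> Sim HC n" for n x
    using that act_hocolim[of "\<lambda>i\<in>{..n}. i" n n x] biact_id by (simp add: Sim_hocolim mono_maps_def mono_on_def)
  show "act HC k n (compose {..k} \<alpha> \<beta>) x = act HC k m \<beta> (act HC m n \<alpha> x)"
    if a: "\<beta> \<in> mono_maps k m" "\<alpha> \<in> mono_maps m n" "x \<in> Sim HC n" for k m n \<alpha> \<beta> x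
  proof -
    have c: "compose {..k} \<alpha> \<beta> \<in> mono_maps k n"
      using a(1,2) by (auto simp: mono_maps_def mono_on_def compose_def PiE_iff)
    have x: "x \<in> bisimplices n n" using a by (simp add: Sim_hocolim)
    have "compose {..k} \<alpha> \<beta> i = \<alpha> (\<beta> i)" if "i \<le> k" for i using that by (simp add: compose_def)
    then show ?thesis
      using biact_comp[OF a(2,1) c _ a(2,1) c _ x] biact_closed[OF a(2,2) x]
      by (simp add: act_hocolim[OF c x] act_hocolim[OF a(2) x] act_hocolim[OF a(1)])
  qed
qed

end

section \<open>Fans\<close>

text \<open>A fan consists of a simplex \<open>G\<close> of the nerve of \<open>I\<close> and of simplices \<open>col j\<close> over its vertices, such
  that \<open>col j\<close> is transported into an initial part of \<open>col m\<close> for \<open>j \<le> m\<close>. The pairs \<open>(k, j)\<close> with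
  \<open>k \<le> len j\<close> then carry a lax functor to the Grothendieck construction, and \<open>fan_simplex\<close> restricts it
  along a chain \<open>(\<mu>, \<nu>)\<close> of such pairs. Both the simplices of the homotopy colimit and those of the nerve
  of the Grothendieck construction are given by fans.\<close>

definition fan_simplex where
  "fan_simplex I C G col n \<mu> \<nu> = nsimplex (grothendieck I C) n
     (\<lambda>k. (Fobj (col (\<nu> k)) (\<mu> k), fob G (\<nu> k)))
     (\<lambda>k l. (Fobj (col (\<nu> k)) (\<mu> k), Fmor (col (\<nu> l)) (\<mu> k, \<mu> l), farr G (\<nu> k, \<nu> l)))
     (\<lambda>k l m. (Fobj (col (\<nu> k)) (\<mu> k), Fcomp (col (\<nu> m)) (\<mu> k, \<mu> l) (\<mu> l, \<mu> m), farr G (\<nu> k, \<nu> m)))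
     (\<lambda>k. (Fobj (col (\<nu> k)) (\<mu> k), Funit (col (\<nu> k)) (\<mu> k), farr G (\<nu> k, \<nu> k)))"

locale fan = diagram I C
  for I :: "('i, 'a) small_cat" and C :: "('i, 'a, 'o, 'm, 't) bicat_diagram" +
  fixes q :: nat and G :: "(nat, nat \<times> nat, 'i, 'a) cat_map" and len :: "nat \<Rightarrow> nat"
    and col :: "nat \<Rightarrow> (nat, nat \<times> nat, nat \<times> nat, 'o, 'm, 't) lax"
  assumes G: "cat_functor (ordinal q) I G"
    and len_mono: "j \<le> m \<Longrightarrow> m \<le> q \<Longrightarrow> len j \<le> len m"
    and col: "j \<le> q \<Longrightarrow> col j \<in> Sim (ND (fob G j)) (len j)"
    and pull_col: "j \<le> m \<Longrightarrow> m \<le> q \<Longrightarrow>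
      pull (farr G (j, m)) (len j) (col j) = act (ND (fob G m)) (len j) (len m) (\<lambda>i\<in>{..len j}. i) (col m)"
begin

lemmas GD [simp] = cat_functor_ordinalD(1-4,6)[OF G]

text \<open>The components of \<open>pull_col\<close>. The constraints of a later column are the
  transported ones of an earlier column composed with the constraints of the pullback, and the
  latter are exactly what the associativity and left unit of the Grothendieck construction
  contribute.\<close>

lemma pull_col_simps:
  assumes jm: "j \<le> m" "m \<le> q"
  shows "k \<le> len j \<Longrightarrow> Fobj (CM C (farr G (j, m))) (Fobj (col j) k) = Fobj (col m) k"
    "k \<le> l \<Longrightarrow> l \<le> len j \<Longrightarrow> Fmor (CM C (farr G (j, m))) (Fmor (col j) (k, l)) = Fmor (col m) (k, l)"
    "k \<le> l \<Longrightarrow> l \<le> p \<Longrightarrow> p \<le> len j \<Longrightarrow> Fdef (CM C (farr G (j, m))) (Fcomp (col j) (k, l) (l, p)) \<cdot>\<^bsub>CO C (fob G m)\<^esub>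
      Fcomp (CM C (farr G (j, m))) (Fmor (col j) (k, l)) (Fmor (col j) (l, p)) = Fcomp (col m) (k, l) (l, p)"
    "k \<le> len j \<Longrightarrow> Fdef (CM C (farr G (j, m))) (Funit (col j) k) \<cdot>\<^bsub>CO C (fob G m)\<^esub>
      Funit (CM C (farr G (j, m))) (Fobj (col j) k) = Funit (col m) k"
proof -
  have j: "j \<le> q" using jm by simp
  have a: "farr G (j, m) \<in> Arr I" "acod I (farr G (j, m)) = fob G j" "adom I (farr G (j, m)) = fob G m"
    using jm by auto
  have \<iota>: "(\<lambda>i\<in>{..len j}. i) \<in> mono_maps (len j) (len m)"
    using len_mono[OF jm] by (auto simp: mono_maps_def mono_on_def)
  note p = pull_simps[OF a col[OF j]] and q = act_nerve[OF col[OF jm(2)] \<iota>]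
  show "k \<le> len j \<Longrightarrow> Fobj (CM C (farr G (j, m))) (Fobj (col j) k) = Fobj (col m) k"
    using p(2)[of k] q(2)[of k] pull_col[OF jm] by simp
  show "k \<le> l \<Longrightarrow> l \<le> len j \<Longrightarrow> Fmor (CM C (farr G (j, m))) (Fmor (col j) (k, l)) = Fmor (col m) (k, l)"
    using p(3)[of k l] q(3)[of k l] pull_col[OF jm] by simp
  show "k \<le> l \<Longrightarrow> l \<le> p \<Longrightarrow> p \<le> len j \<Longrightarrow> Fdef (CM C (farr G (j, m))) (Fcomp (col j) (k, l) (l, p)) \<cdot>\<^bsub>CO C (fob G m)\<^esub>
      Fcomp (CM C (farr G (j, m))) (Fmor (col j) (k, l)) (Fmor (col j) (l, p)) = Fcomp (col m) (k, l) (l, p)"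
    using p(4)[of k l p] q(4)[of k l p] pull_col[OF jm] by simp
  show "k \<le> len j \<Longrightarrow> Fdef (CM C (farr G (j, m))) (Funit (col j) k) \<cdot>\<^bsub>CO C (fob G m)\<^esub>
      Funit (CM C (farr G (j, m))) (Fobj (col j) k) = Funit (col m) k"
    using p(5)[of k] q(5)[of k] pull_col[OF jm] by simp
qed

lemma col_simplex: "j \<le> q \<Longrightarrow> lax_simplex (CO C (fob G j)) (len j) (Fobj (col j)) (\<lambda>i k. Fmor (col j) (i, k))
    (\<lambda>i k l. Fcomp (col j) (i, k) (k, l)) (Funit (col j))"
  by (rule lax_simplex_of_nerve[OF col])

text \<open>A monotone map from the ordinal to the poset of pairs that carries the lax functor of
  the fan.\<close>

definition chain :: "nat \<Rightarrow> (nat \<Rightarrow> nat) \<Rightarrow> (nat \<Rightarrow> nat) \<Rightarrow> bool" where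
  "chain n \<mu> \<nu> \<longleftrightarrow> (\<forall>k\<le>n. \<nu> k \<le> q \<and> \<mu> k \<le> len (\<nu> k)) \<and> (\<forall>k l. k \<le> l \<longrightarrow> l \<le> n \<longrightarrow> \<mu> k \<le> \<mu> l \<and> \<nu> k \<le> \<nu> l)"

text \<open>Each law lives in the fibre over the last base vertex it involves and is the law of the
  column there. The constraints of the Grothendieck construction differ from those of the fibre by
  constraints of pullbacks, and \<open>pull_col_simps\<close> accounts for the difference.\<close>

lemma fan_simplex_in_nerve:
  assumes "chain n \<mu> \<nu>"
  shows "fan_simplex I C G col n \<mu> \<nu> \<in> Sim (nerve GC) n"
proof -
  have le: "k \<le> n \<Longrightarrow> \<nu> k \<le> q" "k \<le> n \<Longrightarrow> \<mu> k \<le> len (\<nu> k)" "k \<le> l \<Longrightarrow> l \<le> n \<Longrightarrow> \<mu> k \<le> \<mu> l"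
    "k \<le> l \<Longrightarrow> l \<le> n \<Longrightarrow> \<nu> k \<le> \<nu> l" "k \<le> l \<Longrightarrow> l \<le> n \<Longrightarrow> \<mu> k \<le> len (\<nu> l)" for k l
    using assms unfolding chain_def by (blast, blast, blast, blast, meson order_trans)
  note units = cat_functor_ordinalD(5)[OF G]
  note pc = pull_col_simps
  interpret GC: bicategory GC by (rule bicategory_grothendieck)
  show ?thesis
    unfolding fan_simplex_def
  proof (intro lax_simplex.nsimplex_in_nerve lax_simplex.intro lax_simplex_axioms.intro GC.bicategory_axioms, goal_cases)
    case (1 i)
    interpret S: lax_simplex "CO C (fob G (\<nu> i))" "len (\<nu> i)" "Fobj (col (\<nu> i))" "\<lambda>k l. Fmor (col (\<nu> i)) (k, l)"
      "\<lambda>k l m. Fcomp (col (\<nu> i)) (k, l) (l, m)" "Funit (col (\<nu> i))" by (rule col_simplex) (use 1 le in simp)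
    show ?case using 1 le by simp
  next
    case (2 i j)
    then have "i \<le> n" by simp
    interpret S: lax_simplex "CO C (fob G (\<nu> j))" "len (\<nu> j)" "Fobj (col (\<nu> j))" "\<lambda>k l. Fmor (col (\<nu> j)) (k, l)"
      "\<lambda>k l m. Fcomp (col (\<nu> j)) (k, l) (l, m)" "Funit (col (\<nu> j))" by (rule col_simplex) (use 2 le in simp)
    interpret T: lax_simplex "CO C (fob G (\<nu> i))" "len (\<nu> i)" "Fobj (col (\<nu> i))" "\<lambda>k l. Fmor (col (\<nu> i)) (k, l)"
      "\<lambda>k l m. Fcomp (col (\<nu> i)) (k, l) (l, m)" "Funit (col (\<nu> i))" by (rule col_simplex) (use \<open>i \<le> n\<close> le in simp)
    show ?case using 2 le \<open>i \<le> n\<close> by (simp add: pc)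
  next
    case (3 i j)
    interpret S: lax_simplex "CO C (fob G (\<nu> j))" "len (\<nu> j)" "Fobj (col (\<nu> j))" "\<lambda>k l. Fmor (col (\<nu> j)) (k, l)"
      "\<lambda>k l m. Fcomp (col (\<nu> j)) (k, l) (l, m)" "Funit (col (\<nu> j))" by (rule col_simplex) (use 3 le in simp)
    show ?case using 3 le by simp
  next
    case (4 i j)
    then show ?case using le by simp
  next
    case (5 i j k)
    then have i: "i \<le> j" "j \<le> n" "i \<le> k" by auto
    interpret S: lax_simplex "CO C (fob G (\<nu> k))" "len (\<nu> k)" "Fobj (col (\<nu> k))" "\<lambda>i l. Fmor (col (\<nu> k)) (i, l)"
      "\<lambda>i l m. Fcomp (col (\<nu> k)) (i, l) (l, m)" "Funit (col (\<nu> k))" by (rule col_simplex) (use 5 le in simp)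
    interpret T: lax_simplex "CO C (fob G (\<nu> i))" "len (\<nu> i)" "Fobj (col (\<nu> i))" "\<lambda>k l. Fmor (col (\<nu> i)) (k, l)"
      "\<lambda>k l m. Fcomp (col (\<nu> i)) (k, l) (l, m)" "Funit (col (\<nu> i))" by (rule col_simplex) (use i le in simp)
    show ?case using 5 i le by (simp add: pc)
  next
    case (6 i j k)
    then have i: "i \<le> j" "j \<le> n" "i \<le> k" by auto
    interpret S: lax_simplex "CO C (fob G (\<nu> k))" "len (\<nu> k)" "Fobj (col (\<nu> k))" "\<lambda>i l. Fmor (col (\<nu> k)) (i, l)"
      "\<lambda>i l m. Fcomp (col (\<nu> k)) (i, l) (l, m)" "Funit (col (\<nu> k))" by (rule col_simplex) (use 6 le in simp)
    show ?case using 6 i le by (simp add: pc)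
  next
    case (7 i j k)
    then have i: "i \<le> j" "j \<le> n" "i \<le> k" by auto
    interpret S: lax_simplex "CO C (fob G (\<nu> k))" "len (\<nu> k)" "Fobj (col (\<nu> k))" "\<lambda>i l. Fmor (col (\<nu> k)) (i, l)"
      "\<lambda>i l m. Fcomp (col (\<nu> k)) (i, l) (l, m)" "Funit (col (\<nu> k))" by (rule col_simplex) (use 7 le in simp)
    show ?case using 7 i le by simp
  next
    case (8 i)
    interpret S: lax_simplex "CO C (fob G (\<nu> i))" "len (\<nu> i)" "Fobj (col (\<nu> i))" "\<lambda>a b. Fmor (col (\<nu> i)) (a, b)"
      "\<lambda>a b c. Fcomp (col (\<nu> i)) (a, b) (b, c)" "Funit (col (\<nu> i))" by (rule col_simplex) (use 8 le in simp)
    show ?case using 8 le by (simp add: units)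
  next
    case (9 i)
    interpret S: lax_simplex "CO C (fob G (\<nu> i))" "len (\<nu> i)" "Fobj (col (\<nu> i))" "\<lambda>a b. Fmor (col (\<nu> i)) (a, b)"
      "\<lambda>a b c. Fcomp (col (\<nu> i)) (a, b) (b, c)" "Funit (col (\<nu> i))" by (rule col_simplex) (use 9 le in simp)
    show ?case using 9 le by (simp add: units)
  next
    case (10 i)
    interpret S: lax_simplex "CO C (fob G (\<nu> i))" "len (\<nu> i)" "Fobj (col (\<nu> i))" "\<lambda>a b. Fmor (col (\<nu> i)) (a, b)"
      "\<lambda>a b c. Fcomp (col (\<nu> i)) (a, b) (b, c)" "Funit (col (\<nu> i))" by (rule col_simplex) (use 10 le in simp)
    show ?case using 10 le by (simp add: units)
  next
    case (11 i j k l)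
    then have i: "i \<le> j" "i \<le> k" "i \<le> l" "j \<le> k" "j \<le> l" "k \<le> l" "j \<le> n" "k \<le> n" "l \<le> n" by auto
    interpret S: lax_simplex "CO C (fob G (\<nu> l))" "len (\<nu> l)" "Fobj (col (\<nu> l))" "\<lambda>a b. Fmor (col (\<nu> l)) (a, b)"
      "\<lambda>a b c. Fcomp (col (\<nu> l)) (a, b) (b, c)" "Funit (col (\<nu> l))" by (rule col_simplex) (use i le in simp)
    interpret T: lax_simplex "CO C (fob G (\<nu> k))" "len (\<nu> k)" "Fobj (col (\<nu> k))" "\<lambda>a b. Fmor (col (\<nu> k)) (a, b)"
      "\<lambda>a b c. Fcomp (col (\<nu> k)) (a, b) (b, c)" "Funit (col (\<nu> k))" by (rule col_simplex) (use i le in simp)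
    interpret U: lax_simplex "CO C (fob G (\<nu> j))" "len (\<nu> j)" "Fobj (col (\<nu> j))" "\<lambda>a b. Fmor (col (\<nu> j)) (a, b)"
      "\<lambda>a b c. Fcomp (col (\<nu> j)) (a, b) (b, c)" "Funit (col (\<nu> j))" by (rule col_simplex) (use i le in simp)
    interpret V: lax_simplex "CO C (fob G (\<nu> i))" "len (\<nu> i)" "Fobj (col (\<nu> i))" "\<lambda>a b. Fmor (col (\<nu> i)) (a, b)"
      "\<lambda>a b c. Fcomp (col (\<nu> i)) (a, b) (b, c)" "Funit (col (\<nu> i))" by (rule col_simplex) (use i le in simp)
    interpret H: lax_functor "CO C (fob G (\<nu> k))" "CO C (fob G (\<nu> l))" "CM C (farr G (\<nu> k, \<nu> l))"
      using lax_functor_CM[of "farr G (\<nu> k, \<nu> l)"] i le by simp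
    interpret H2: homomorphism "CO C (fob G (\<nu> j))" "CO C (fob G (\<nu> l))" "CM C (farr G (\<nu> j, \<nu> l))"
      using CM[of "farr G (\<nu> j, \<nu> l)"] i le by simp
    \<comment> \<open>The composition constraint in the last column splits into the transported
      constraint \<open>?P\<close> and the constraint \<open>?Q\<close> of the pullback. In the law
      to be shown, \<open>?P\<close> comes from horizontal composition and \<open>?Q\<close> from
      the associativity constraint.\<close>
    let ?P = "Fdef (CM C (farr G (\<nu> k, \<nu> l))) (Fcomp (col (\<nu> k)) (\<mu> i, \<mu> j) (\<mu> j, \<mu> k))"
    let ?Q = "Fcomp (CM C (farr G (\<nu> k, \<nu> l))) (Fmor (col (\<nu> k)) (\<mu> i, \<mu> j)) (Fmor (col (\<nu> k)) (\<mu> j, \<mu> k))"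
    let ?one = "vone (CO C (fob G (\<nu> l))) (Fmor (col (\<nu> l)) (\<mu> k, \<mu> l))"
    have w: "(?P \<cdot>\<^bsub>CO C (fob G (\<nu> l))\<^esub> ?Q) \<diamondop>\<^bsub>CO C (fob G (\<nu> l))\<^esub> ?one =
        (?P \<diamondop>\<^bsub>CO C (fob G (\<nu> l))\<^esub> ?one) \<cdot>\<^bsub>CO C (fob G (\<nu> l))\<^esub> (?Q \<diamondop>\<^bsub>CO C (fob G (\<nu> l))\<^esub> ?one)"
      by (rule S.whisker_right) (use i le in \<open>simp_all add: pc(1,2)\<close>)
    have X: "Fcomp (col (\<nu> l)) (\<mu> i, \<mu> j) (\<mu> j, \<mu> k) = ?P \<cdot>\<^bsub>CO C (fob G (\<nu> l))\<^esub> ?Q"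
      using i le by (simp add: pc(3))
    have "Fcomp (col (\<nu> l)) (\<mu> i, \<mu> j) (\<mu> j, \<mu> k) \<diamondop>\<^bsub>CO C (fob G (\<nu> l))\<^esub> ?one =
        (?P \<diamondop>\<^bsub>CO C (fob G (\<nu> l))\<^esub> ?one) \<cdot>\<^bsub>CO C (fob G (\<nu> l))\<^esub> (?Q \<diamondop>\<^bsub>CO C (fob G (\<nu> l))\<^esub> ?one)"
      unfolding X by (rule w)
    then show ?case
      using S.assoc_law[of "\<mu> i" "\<mu> j" "\<mu> k" "\<mu> l"] i le H2.Fdef_vone'
      by (simp add: pc S.vcomp_assoc')
  next
    case (12 i j)
    then have i: "i \<le> j" "i \<le> n" "j \<le> n" by auto
    interpret S: lax_simplex "CO C (fob G (\<nu> j))" "len (\<nu> j)" "Fobj (col (\<nu> j))" "\<lambda>a b. Fmor (col (\<nu> j)) (a, b)"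
      "\<lambda>a b c. Fcomp (col (\<nu> j)) (a, b) (b, c)" "Funit (col (\<nu> j))" by (rule col_simplex) (use i le in simp)
    interpret T: lax_simplex "CO C (fob G (\<nu> i))" "len (\<nu> i)" "Fobj (col (\<nu> i))" "\<lambda>a b. Fmor (col (\<nu> i)) (a, b)"
      "\<lambda>a b c. Fcomp (col (\<nu> i)) (a, b) (b, c)" "Funit (col (\<nu> i))" by (rule col_simplex) (use i le in simp)
    interpret H: homomorphism "CO C (fob G (\<nu> i))" "CO C (fob G (\<nu> j))" "CM C (farr G (\<nu> i, \<nu> j))"
      using CM[of "farr G (\<nu> i, \<nu> j)"] i le by simp
    let ?B = "CO C (fob G (\<nu> j))" and ?\<Phi> = "CM C (farr G (\<nu> i, \<nu> j))"
    let ?v = "Fmor (col (\<nu> j)) (\<mu> i, \<mu> j)" and ?c = "Fcomp (col (\<nu> j)) (\<mu> i, \<mu> i) (\<mu> i, \<mu> j)"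
    let ?e = "Fdef ?\<Phi> (Funit (col (\<nu> i)) (\<mu> i))" and ?u = "Funit ?\<Phi> (Fobj (col (\<nu> i)) (\<mu> i))"
    have inv: "invertible_def ?B ?u" by (rule H.Funit_inv) (use i le in simp)
    have l: "?c \<cdot>\<^bsub>?B\<^esub> ((?e \<cdot>\<^bsub>?B\<^esub> ?u) \<diamondop>\<^bsub>?B\<^esub> vone ?B ?v) = lunit ?B ?v"
      using S.lunit_law[of "\<mu> i" "\<mu> j"] i le by (simp add: pc(4))
    \<comment> \<open>The left unit constraint contains the inverse of \<open>?u\<close>, and the
      unit of the last column is \<open>?e\<close> after \<open>?u\<close>; inserting
      \<open>?u\<close> with its inverse produces the left unit law of the column.\<close>
    have "?e \<diamondop>\<^bsub>?B\<^esub> vone ?B ?v = ((?e \<cdot>\<^bsub>?B\<^esub> ?u) \<diamondop>\<^bsub>?B\<^esub> vone ?B ?v) \<cdot>\<^bsub>?B\<^esub> (inv_def ?B ?u \<diamondop>\<^bsub>?B\<^esub> vone ?B ?v)"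
      using i le inv by (simp add: S.interchange' S.vcomp_assoc' pc(1,2))
    then have "?c \<cdot>\<^bsub>?B\<^esub> (?e \<diamondop>\<^bsub>?B\<^esub> vone ?B ?v) =
        ?c \<cdot>\<^bsub>?B\<^esub> ((?e \<cdot>\<^bsub>?B\<^esub> ?u) \<diamondop>\<^bsub>?B\<^esub> vone ?B ?v) \<cdot>\<^bsub>?B\<^esub> (inv_def ?B ?u \<diamondop>\<^bsub>?B\<^esub> vone ?B ?v)"
      using i le inv by (simp add: S.vcomp_assoc' pc(1,2))
    then show ?case unfolding l using i le by (simp add: units)
  next
    case (13 i j)
    then have i: "i \<le> j" "i \<le> n" "j \<le> n" by auto
    interpret S: lax_simplex "CO C (fob G (\<nu> j))" "len (\<nu> j)" "Fobj (col (\<nu> j))" "\<lambda>a b. Fmor (col (\<nu> j)) (a, b)"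
      "\<lambda>a b c. Fcomp (col (\<nu> j)) (a, b) (b, c)" "Funit (col (\<nu> j))" by (rule col_simplex) (use i le in simp)
    show ?case using S.runit_law[of "\<mu> i" "\<mu> j"] i le by (simp add: units)
  qed
qed

end

section \<open>The columns of a simplex over the Grothendieck construction\<close>

locale grothendieck_simplex = diagram I C
  for I :: "('i, 'a) small_cat" and C :: "('i, 'a, 'o, 'm, 't) bicat_diagram" +
  fixes N :: nat and \<sigma> :: "(nat, nat \<times> nat, nat \<times> nat, 'o \<times> 'i, 'o \<times> 'm \<times> 'a, 'o \<times> 't \<times> 'a) lax"
  assumes \<sigma>: "\<sigma> \<in> Sim (nerve GC) N"
begin

definition vtx where "vtx k = fst (Fobj \<sigma> k)"
definition idx where "idx k = snd (Fobj \<sigma> k)"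
definition edg where "edg k l = fst (snd (Fmor \<sigma> (k, l)))"
definition arr where "arr k l = snd (snd (Fmor \<sigma> (k, l)))"
definition cmp where "cmp k l m = fst (snd (Fcomp \<sigma> (k, l) (l, m)))"
definition unt where "unt k = fst (snd (Funit \<sigma> k))"

lemma Fobj_\<sigma>: "Fobj \<sigma> k = (vtx k, idx k)"
  by (simp add: vtx_def idx_def)

sublocale S: lax_simplex GC N "Fobj \<sigma>" "\<lambda>k l. Fmor \<sigma> (k, l)" "\<lambda>k l m. Fcomp \<sigma> (k, l) (l, m)" "Funit \<sigma>"
  by (rule lax_simplex_of_nerve[OF \<sigma>])

lemma vertex [simp]:
  assumes "k \<le> N"
  shows "idx k \<in> Ob I" "vtx k \<in> Obj (CO C (idx k))"
  using S.obj[OF assms] by (simp_all add: Fobj_\<sigma>)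

lemma edge:
  assumes "k \<le> l" "l \<le> N"
  shows Fmor_\<sigma>: "Fmor \<sigma> (k, l) = (vtx k, edg k l, arr k l)"
    and "arr k l \<in> Arr I" "adom I (arr k l) = idx l" "acod I (arr k l) = idx k"
    and "edg k l \<in> Mor (CO C (idx l))" "src (CO C (idx l)) (edg k l) = vtx l"
    and "trg (CO C (idx l)) (edg k l) = Fobj (CM C (arr k l)) (vtx k)"
proof -
  obtain y f b where f: "Fmor \<sigma> (k, l) = (y, f, b)" using prod_cases3 by blast
  have *: "edg k l = f" "arr k l = b" by (simp_all add: edg_def arr_def f)
  show "Fmor \<sigma> (k, l) = (vtx k, edg k l, arr k l)"
    "arr k l \<in> Arr I" "adom I (arr k l) = idx l" "acod I (arr k l) = idx k"
    "edg k l \<in> Mor (CO C (idx l))" "src (CO C (idx l)) (edg k l) = vtx l"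
    "trg (CO C (idx l)) (edg k l) = Fobj (CM C (arr k l)) (vtx k)"
    using S.mor[OF assms] S.mor_src[OF assms] S.mor_trg[OF assms] unfolding * by (auto simp: f Fobj_\<sigma>)
qed

lemmas edge_simps [simp] = edge(2-)

lemma comp:
  assumes "k \<le> l" "l \<le> m" "m \<le> N"
  shows Fcomp_\<sigma>: "Fcomp \<sigma> (k, l) (l, m) = (vtx k, cmp k l m, arr k m)"
    and "acomp I (arr k l) (arr l m) = arr k m"
    and "cmp k l m \<in> Def (CO C (idx m))" "vtrg (CO C (idx m)) (cmp k l m) = edg k m"
    and "vsrc (CO C (idx m)) (cmp k l m) = Fmor (CM C (arr l m)) (edg k l) \<star>\<^bsub>CO C (idx m)\<^esub> edg l m"
proof -
  obtain y f b where f: "Fcomp \<sigma> (k, l) (l, m) = (y, f, b)" using prod_cases3 by blast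
  have *: "cmp k l m = f" by (simp add: cmp_def f)
  have kl: "k \<le> l" "l \<le> N" "k \<le> m" "m \<le> N" using assms by auto
  have b: "b = arr k m" "y = vtx k"
    using S.comp_vtrg[OF assms] f Fmor_\<sigma>[OF kl(3,4)] by auto
  have a: "acomp I (arr k l) (arr l m) = b"
    using S.comp_vsrc[OF assms] f Fmor_\<sigma>[OF kl(1,2)] Fmor_\<sigma>[OF assms(2,3)] by auto
  show "Fcomp \<sigma> (k, l) (l, m) = (vtx k, cmp k l m, arr k m)"
    "acomp I (arr k l) (arr l m) = arr k m"
    "cmp k l m \<in> Def (CO C (idx m))" "vtrg (CO C (idx m)) (cmp k l m) = edg k m"
    "vsrc (CO C (idx m)) (cmp k l m) = Fmor (CM C (arr l m)) (edg k l) \<star>\<^bsub>CO C (idx m)\<^esub> edg l m"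
    using S.comp[OF assms] S.comp_vsrc[OF assms] S.comp_vtrg[OF assms] a b edge(3)[OF kl(3,4)] unfolding *
    by (auto simp: f Fmor_\<sigma>[OF kl(1,2)] Fmor_\<sigma>[OF assms(2,3)] Fmor_\<sigma>[OF kl(3,4)] edge(3)[OF kl(3,4)] edge(3)[OF assms(2,3)])
qed

lemmas comp_simps [simp] = comp(2-)

lemma unit:
  assumes "k \<le> N"
  shows Funit_\<sigma>: "Funit \<sigma> k = (vtx k, unt k, arr k k)"
    and "arr k k = aid I (idx k)"
    and "unt k \<in> Def (CO C (idx k))" "vsrc (CO C (idx k)) (unt k) = one (CO C (idx k)) (vtx k)"
    and "vtrg (CO C (idx k)) (unt k) = edg k k"
proof -
  obtain y f b where f: "Funit \<sigma> k = (y, f, b)" using prod_cases3 by blast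
  have *: "unt k = f" by (simp add: unt_def f)
  have b: "y = vtx k" "b = arr k k" "b = aid I (idx k)"
    using S.unit_vtrg[OF assms] S.unit_vsrc[OF assms] f Fmor_\<sigma>[OF le_refl assms] by (auto simp: Fobj_\<sigma>)
  then have a: "arr k k = aid I (idx k)" by simp
  have d: "adom I b = idx k" using b assms by simp
  show "Funit \<sigma> k = (vtx k, unt k, arr k k)" "arr k k = aid I (idx k)"
    "unt k \<in> Def (CO C (idx k))" "vsrc (CO C (idx k)) (unt k) = one (CO C (idx k)) (vtx k)"
    "vtrg (CO C (idx k)) (unt k) = edg k k"
    using S.unit[OF assms] S.unit_vsrc[OF assms] S.unit_vtrg[OF assms] a b d unfolding *
    by (auto simp: f Fmor_\<sigma>[OF le_refl assms] Fobj_\<sigma>)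
qed

lemmas unit_simps [simp] = unit(2-)

lemma homomorphism_arr: "k \<le> l \<Longrightarrow> l \<le> N \<Longrightarrow> homomorphism (CO C (idx k)) (CO C (idx l)) (CM C (arr k l))"
  using CM[of "arr k l"] by simp

text \<open>The column over vertex \<open>j\<close> is the initial part of \<open>\<sigma>\<close> transported to the fibre over \<open>j\<close>.\<close>

definition cvtx where "cvtx j k = Fobj (CM C (arr k j)) (vtx k)"
definition cedg where "cedg j k l = Fmor (CM C (arr l j)) (edg k l)"
text \<open>The source of \<open>cmp k l m\<close> in the fibre over \<open>m\<close> is a
  composite. The constraint of the pullback from \<open>m\<close> to \<open>j\<close> must come
  first, to start from the composite of the two pulled back edges.\<close>

definition ccmp where "ccmp j k l m = Fdef (CM C (arr m j)) (cmp k l m) \<cdot>\<^bsub>CO C (idx j)\<^esub>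
  Fcomp (CM C (arr m j)) (Fmor (CM C (arr l m)) (edg k l)) (edg l m)"
definition cunt where "cunt j k = Fdef (CM C (arr k j)) (unt k) \<cdot>\<^bsub>CO C (idx j)\<^esub> Funit (CM C (arr k j)) (vtx k)"

definition column where
  "column j = nsimplex (CO C (idx j)) j (cvtx j) (cedg j) (ccmp j) (cunt j)"

lemma column_simps [simp]:
  "k \<le> j \<Longrightarrow> Fobj (column j) k = cvtx j k"
  "k \<le> l \<Longrightarrow> l \<le> j \<Longrightarrow> Fmor (column j) (k, l) = cedg j k l"
  "k \<le> l \<Longrightarrow> l \<le> m \<Longrightarrow> m \<le> j \<Longrightarrow> Fcomp (column j) (k, l) (l, m) = ccmp j k l m"
  "k \<le> j \<Longrightarrow> Funit (column j) k = cunt j k"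
  by (simp_all add: column_def)

text \<open>Oriented against \<open>CM_comp_simps\<close>: along a simplex, iterated pullbacks
  collapse to one arrow \<open>arr k m\<close>, so columns over different vertices become
  comparable.\<close>

lemma CM_arr_comp [simp]:
  assumes "k \<le> l" "l \<le> m" "m \<le> N"
  shows "x \<in> Obj (CO C (idx k)) \<Longrightarrow> Fobj (CM C (arr l m)) (Fobj (CM C (arr k l)) x) = Fobj (CM C (arr k m)) x"
    and "u \<in> Mor (CO C (idx k)) \<Longrightarrow> Fmor (CM C (arr l m)) (Fmor (CM C (arr k l)) u) = Fmor (CM C (arr k m)) u"
    and "\<phi> \<in> Def (CO C (idx k)) \<Longrightarrow> Fdef (CM C (arr l m)) (Fdef (CM C (arr k l)) \<phi>) = Fdef (CM C (arr k m)) \<phi>"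
    and "u \<in> Mor (CO C (idx k)) \<Longrightarrow> v \<in> Mor (CO C (idx k)) \<Longrightarrow> src (CO C (idx k)) u = trg (CO C (idx k)) v \<Longrightarrow>
      Fdef (CM C (arr l m)) (Fcomp (CM C (arr k l)) u v) \<cdot>\<^bsub>CO C (idx m)\<^esub>
      Fcomp (CM C (arr l m)) (Fmor (CM C (arr k l)) u) (Fmor (CM C (arr k l)) v) = Fcomp (CM C (arr k m)) u v"
    and "x \<in> Obj (CO C (idx k)) \<Longrightarrow> Fdef (CM C (arr l m)) (Funit (CM C (arr k l)) x) \<cdot>\<^bsub>CO C (idx m)\<^esub>
      Funit (CM C (arr l m)) (Fobj (CM C (arr k l)) x) = Funit (CM C (arr k m)) x"
proof -
  have a: "arr k l \<in> Arr I" "arr l m \<in> Arr I" "adom I (arr k l) = acod I (arr l m)" and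
    d: "acod I (arr k l) = idx k" "adom I (arr l m) = idx m" using assms by auto
  note c = CM_comp_simps[OF a, unfolded d comp(2)[OF assms]]
  show "x \<in> Obj (CO C (idx k)) \<Longrightarrow> Fobj (CM C (arr l m)) (Fobj (CM C (arr k l)) x) = Fobj (CM C (arr k m)) x"
    "u \<in> Mor (CO C (idx k)) \<Longrightarrow> Fmor (CM C (arr l m)) (Fmor (CM C (arr k l)) u) = Fmor (CM C (arr k m)) u"
    "\<phi> \<in> Def (CO C (idx k)) \<Longrightarrow> Fdef (CM C (arr l m)) (Fdef (CM C (arr k l)) \<phi>) = Fdef (CM C (arr k m)) \<phi>"
    "u \<in> Mor (CO C (idx k)) \<Longrightarrow> v \<in> Mor (CO C (idx k)) \<Longrightarrow> src (CO C (idx k)) u = trg (CO C (idx k)) v \<Longrightarrow>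
      Fdef (CM C (arr l m)) (Fcomp (CM C (arr k l)) u v) \<cdot>\<^bsub>CO C (idx m)\<^esub>
      Fcomp (CM C (arr l m)) (Fmor (CM C (arr k l)) u) (Fmor (CM C (arr k l)) v) = Fcomp (CM C (arr k m)) u v"
    "x \<in> Obj (CO C (idx k)) \<Longrightarrow> Fdef (CM C (arr l m)) (Funit (CM C (arr k l)) x) \<cdot>\<^bsub>CO C (idx m)\<^esub>
      Funit (CM C (arr l m)) (Fobj (CM C (arr k l)) x) = Funit (CM C (arr k m)) x"
    by (simp_all only: c)
qed

lemma cvtx_simps [simp]: "k \<le> j \<Longrightarrow> j \<le> N \<Longrightarrow> cvtx j k \<in> Obj (CO C (idx j))"
proof -
  assume kj: "k \<le> j" "j \<le> N"
  interpret H: homomorphism "CO C (idx k)" "CO C (idx j)" "CM C (arr k j)" by (rule homomorphism_arr[OF kj])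
  show ?thesis using kj by (simp add: cvtx_def)
qed

lemma cedg_simps [simp]:
  assumes kj: "k \<le> l" "l \<le> j" "j \<le> N"
  shows "cedg j k l \<in> Mor (CO C (idx j))" "src (CO C (idx j)) (cedg j k l) = cvtx j l"
    "trg (CO C (idx j)) (cedg j k l) = cvtx j k"
proof -
  interpret H: homomorphism "CO C (idx l)" "CO C (idx j)" "CM C (arr l j)" by (rule homomorphism_arr[OF kj(2,3)])
  show "cedg j k l \<in> Mor (CO C (idx j))" "src (CO C (idx j)) (cedg j k l) = cvtx j l"
    "trg (CO C (idx j)) (cedg j k l) = cvtx j k"
    using kj by (simp_all add: cedg_def cvtx_def)
qed

lemma ccmp_simps [simp]:
  assumes kj: "k \<le> l" "l \<le> m" "m \<le> j" "j \<le> N"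
  shows "ccmp j k l m \<in> Def (CO C (idx j))"
    "vsrc (CO C (idx j)) (ccmp j k l m) = cedg j k l \<star>\<^bsub>CO C (idx j)\<^esub> cedg j l m"
    "vtrg (CO C (idx j)) (ccmp j k l m) = cedg j k m"
proof -
  have le: "l \<le> j" "k \<le> m" "m \<le> N" "l \<le> N" "k \<le> j" using kj by auto
  interpret H: homomorphism "CO C (idx m)" "CO C (idx j)" "CM C (arr m j)" by (rule homomorphism_arr[OF kj(3,4)])
  interpret K: homomorphism "CO C (idx l)" "CO C (idx m)" "CM C (arr l m)" by (rule homomorphism_arr[OF kj(2) le(3)])
  show "ccmp j k l m \<in> Def (CO C (idx j))"
    "vsrc (CO C (idx j)) (ccmp j k l m) = cedg j k l \<star>\<^bsub>CO C (idx j)\<^esub> cedg j l m"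
    "vtrg (CO C (idx j)) (ccmp j k l m) = cedg j k m"
    using kj le by (simp_all add: ccmp_def cedg_def)
qed

lemma cunt_simps [simp]:
  assumes kj: "k \<le> j" "j \<le> N"
  shows "cunt j k \<in> Def (CO C (idx j))" "vsrc (CO C (idx j)) (cunt j k) = one (CO C (idx j)) (cvtx j k)"
    "vtrg (CO C (idx j)) (cunt j k) = cedg j k k"
proof -
  interpret H: homomorphism "CO C (idx k)" "CO C (idx j)" "CM C (arr k j)" by (rule homomorphism_arr[OF kj])
  show "cunt j k \<in> Def (CO C (idx j))" "vsrc (CO C (idx j)) (cunt j k) = one (CO C (idx j)) (cvtx j k)"
    "vtrg (CO C (idx j)) (cunt j k) = cedg j k k"
    using kj by (simp_all add: cunt_def cedg_def cvtx_def)
qed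

text \<open>Strict functoriality: transport to \<open>j\<close> and on to \<open>j'\<close> is
  transport to \<open>j'\<close>, also for the composition and unit constraints. This is the
  compatibility that makes the columns a fan.\<close>

lemma column_transport:
  assumes j: "j \<le> j'" "j' \<le> N"
  shows "k \<le> j \<Longrightarrow> Fobj (CM C (arr j j')) (cvtx j k) = cvtx j' k"
    and "k \<le> l \<Longrightarrow> l \<le> j \<Longrightarrow> Fmor (CM C (arr j j')) (cedg j k l) = cedg j' k l"
    and "k \<le> l \<Longrightarrow> l \<le> m \<Longrightarrow> m \<le> j \<Longrightarrow> Fdef (CM C (arr j j')) (ccmp j k l m) \<cdot>\<^bsub>CO C (idx j')\<^esub>
      Fcomp (CM C (arr j j')) (cedg j k l) (cedg j l m) = ccmp j' k l m"
    and "k \<le> j \<Longrightarrow> Fdef (CM C (arr j j')) (cunt j k) \<cdot>\<^bsub>CO C (idx j')\<^esub> Funit (CM C (arr j j')) (cvtx j k) = cunt j' k"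
proof -
  interpret H: homomorphism "CO C (idx j)" "CO C (idx j')" "CM C (arr j j')" by (rule homomorphism_arr[OF j])
  have jN: "j \<le> N" using j by simp
  show "k \<le> j \<Longrightarrow> Fobj (CM C (arr j j')) (cvtx j k) = cvtx j' k"
    using j by (simp add: cvtx_def)
  show "k \<le> l \<Longrightarrow> l \<le> j \<Longrightarrow> Fmor (CM C (arr j j')) (cedg j k l) = cedg j' k l"
    using j by (simp add: cedg_def)
  show "Fdef (CM C (arr j j')) (ccmp j k l m) \<cdot>\<^bsub>CO C (idx j')\<^esub>
      Fcomp (CM C (arr j j')) (cedg j k l) (cedg j l m) = ccmp j' k l m" if k: "k \<le> l" "l \<le> m" "m \<le> j"
  proof -
    have le: "m \<le> N" "l \<le> N" "l \<le> j" using k j by auto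
    interpret K: homomorphism "CO C (idx m)" "CO C (idx j)" "CM C (arr m j)" by (rule homomorphism_arr[OF k(3) jN])
    interpret L: homomorphism "CO C (idx l)" "CO C (idx m)" "CM C (arr l m)" by (rule homomorphism_arr[OF k(2) le(1)])
    interpret J: homomorphism "CO C (idx l)" "CO C (idx j)" "CM C (arr l j)" by (rule homomorphism_arr[OF le(3) jN])
    interpret J': homomorphism "CO C (idx m)" "CO C (idx j')" "CM C (arr m j')"
      by (rule homomorphism_arr) (use k j in auto)
    let ?u = "Fmor (CM C (arr l m)) (edg k l)"
    have u: "cedg j k l = Fmor (CM C (arr m j)) ?u" "cedg j l m = Fmor (CM C (arr m j)) (edg l m)"
      using k j le by (simp_all add: cedg_def)
    have "ccmp j' k l m = Fdef (CM C (arr m j')) (cmp k l m) \<cdot>\<^bsub>CO C (idx j')\<^esub>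
        (Fdef (CM C (arr j j')) (Fcomp (CM C (arr m j)) ?u (edg l m)) \<cdot>\<^bsub>CO C (idx j')\<^esub>
        Fcomp (CM C (arr j j')) (Fmor (CM C (arr m j)) ?u) (Fmor (CM C (arr m j)) (edg l m)))"
      unfolding ccmp_def by (subst CM_arr_comp(4)) (use k j le in auto)
    moreover have "Fdef (CM C (arr j j')) (ccmp j k l m) = Fdef (CM C (arr m j')) (cmp k l m) \<cdot>\<^bsub>CO C (idx j')\<^esub>
        Fdef (CM C (arr j j')) (Fcomp (CM C (arr m j)) ?u (edg l m))"
      unfolding ccmp_def[of j] using k j le by (simp add: H.Fdef_vcomp')
    moreover have "Fdef (CM C (arr m j')) (cmp k l m) \<cdot>\<^bsub>CO C (idx j')\<^esub>
        Fdef (CM C (arr j j')) (Fcomp (CM C (arr m j)) ?u (edg l m)) \<cdot>\<^bsub>CO C (idx j')\<^esub>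
        Fcomp (CM C (arr j j')) (Fmor (CM C (arr m j)) ?u) (Fmor (CM C (arr m j)) (edg l m)) =
      Fdef (CM C (arr m j')) (cmp k l m) \<cdot>\<^bsub>CO C (idx j')\<^esub>
        (Fdef (CM C (arr j j')) (Fcomp (CM C (arr m j)) ?u (edg l m)) \<cdot>\<^bsub>CO C (idx j')\<^esub>
        Fcomp (CM C (arr j j')) (Fmor (CM C (arr m j)) ?u) (Fmor (CM C (arr m j)) (edg l m)))"
      by (rule H.B.vcomp_assoc') (use k j le in simp_all)
    ultimately show ?thesis unfolding u by simp
  qed
  show "Fdef (CM C (arr j j')) (cunt j k) \<cdot>\<^bsub>CO C (idx j')\<^esub> Funit (CM C (arr j j')) (cvtx j k) = cunt j' k" if k: "k \<le> j"
  proof -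
    have le: "k \<le> N" "k \<le> j'" using k j by auto
    interpret K: homomorphism "CO C (idx k)" "CO C (idx j)" "CM C (arr k j)" by (rule homomorphism_arr[OF k jN])
    interpret J: homomorphism "CO C (idx k)" "CO C (idx j')" "CM C (arr k j')" by (rule homomorphism_arr[OF le(2) j(2)])
    have "cunt j' k = Fdef (CM C (arr k j')) (unt k) \<cdot>\<^bsub>CO C (idx j')\<^esub> (Fdef (CM C (arr j j')) (Funit (CM C (arr k j)) (vtx k)) \<cdot>\<^bsub>CO C (idx j')\<^esub>
      Funit (CM C (arr j j')) (Fobj (CM C (arr k j)) (vtx k)))"
      unfolding cunt_def by (subst CM_arr_comp(5)) (use k j le in auto)
    then show ?thesis
      unfolding cunt_def[of j] cvtx_def using k j le by (simp add: H.Fdef_vcomp' H.B.vcomp_assoc' del: CM_arr_comp(5))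
  qed
qed

text \<open>The laws of \<open>\<sigma>\<close> are the laws of the columns at indices that end in the vertex of the column.\<close>

lemma column_last:
  assumes "k \<le> l" "l \<le> N"
  shows "cvtx l l = vtx l" "cedg l k l = edg k l" "cunt l l = unt l"
    and "m \<le> k \<Longrightarrow> ccmp l m k l = cmp m k l"
proof -
  interpret D: bicategory "CO C (idx l)" using CO assms by simp
  show "cvtx l l = vtx l" "cedg l k l = edg k l" "cunt l l = unt l"
    using assms by (simp_all add: cvtx_def cedg_def cunt_def)
  assume m: "m \<le> k"
  then have "m \<le> l" using assms by simp
  interpret H: homomorphism "CO C (idx k)" "CO C (idx l)" "CM C (arr k l)" by (rule homomorphism_arr[OF assms])
  show "ccmp l m k l = cmp m k l" using assms m \<open>m \<le> l\<close> by (simp add: ccmp_def)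
qed

text \<open>The associativity law of \<open>\<sigma>\<close> takes place in the fibre over its last
  vertex \<open>p\<close>. The factor \<open>?Q\<close> from the associativity constraint of the
  Grothendieck construction joins \<open>?P\<close> to form \<open>ccmp p k l m\<close>.\<close>

lemma column_assoc_last:
  assumes k: "k \<le> l" "l \<le> m" "m \<le> p" "p \<le> N"
  shows "ccmp p k l p \<cdot>\<^bsub>CO C (idx p)\<^esub> (vone (CO C (idx p)) (cedg p k l) \<diamondop>\<^bsub>CO C (idx p)\<^esub> ccmp p l m p) =
    ccmp p k m p \<cdot>\<^bsub>CO C (idx p)\<^esub> (ccmp p k l m \<diamondop>\<^bsub>CO C (idx p)\<^esub> vone (CO C (idx p)) (cedg p m p)) \<cdot>\<^bsub>CO C (idx p)\<^esub>
      assoc (CO C (idx p)) (cedg p k l) (cedg p l m) (cedg p m p)"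
proof -
  have le: "k \<le> m" "k \<le> p" "l \<le> p" "l \<le> N" "m \<le> N" using k by auto
  interpret H: homomorphism "CO C (idx m)" "CO C (idx p)" "CM C (arr m p)" by (rule homomorphism_arr[OF k(3,4)])
  interpret K: homomorphism "CO C (idx l)" "CO C (idx p)" "CM C (arr l p)" by (rule homomorphism_arr[OF le(3) k(4)])
  interpret L: homomorphism "CO C (idx l)" "CO C (idx m)" "CM C (arr l m)" by (rule homomorphism_arr[OF k(2) le(5)])
  let ?B = "CO C (idx p)"
  let ?P = "Fdef (CM C (arr m p)) (cmp k l m)" and ?Q = "Fcomp (CM C (arr m p)) (Fmor (CM C (arr l m)) (edg k l)) (edg l m)"
  have c: "cedg p k l = Fmor (CM C (arr l p)) (edg k l)" "cedg p l m = Fmor (CM C (arr m p)) (edg l m)" "cedg p m p = edg m p"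
    "ccmp p k l p = cmp k l p" "ccmp p l m p = cmp l m p" "ccmp p k m p = cmp k m p" "ccmp p k l m = ?P \<cdot>\<^bsub>?B\<^esub> ?Q"
    using k le column_last by (simp_all add: cedg_def ccmp_def)
  have w: "(?P \<cdot>\<^bsub>?B\<^esub> ?Q) \<diamondop>\<^bsub>?B\<^esub> vone ?B (edg m p) = (?P \<diamondop>\<^bsub>?B\<^esub> vone ?B (edg m p)) \<cdot>\<^bsub>?B\<^esub> (?Q \<diamondop>\<^bsub>?B\<^esub> vone ?B (edg m p))"
    by (rule H.B.whisker_right) (use k le in simp_all)
  have "cmp k l p \<cdot>\<^bsub>?B\<^esub> (vone ?B (Fmor (CM C (arr l p)) (edg k l)) \<diamondop>\<^bsub>?B\<^esub> cmp l m p) =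
      cmp k m p \<cdot>\<^bsub>?B\<^esub> (?P \<diamondop>\<^bsub>?B\<^esub> vone ?B (edg m p)) \<cdot>\<^bsub>?B\<^esub> ((?Q \<diamondop>\<^bsub>?B\<^esub> vone ?B (edg m p)) \<cdot>\<^bsub>?B\<^esub>
      assoc ?B (Fmor (CM C (arr l p)) (edg k l)) (Fmor (CM C (arr m p)) (edg l m)) (edg m p))"
    using S.assoc_law[OF k] k le by (simp add: Fcomp_\<sigma> Fmor_\<sigma>)
  then show ?thesis
    unfolding c w using k le by (simp add: H.B.vcomp_assoc')
qed

text \<open>The law of \<open>\<sigma>\<close> carries the inverse of \<open>?u\<close> on its right
  side; composing with \<open>?u\<close> cancels it there and completes \<open>?e\<close> to the
  unit of the column.\<close>

lemma column_lunit_last: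
  assumes k: "k \<le> l" "l \<le> N"
  shows "ccmp l k k l \<cdot>\<^bsub>CO C (idx l)\<^esub> (cunt l k \<diamondop>\<^bsub>CO C (idx l)\<^esub> vone (CO C (idx l)) (cedg l k l)) =
    lunit (CO C (idx l)) (cedg l k l)"
proof -
  interpret H: homomorphism "CO C (idx k)" "CO C (idx l)" "CM C (arr k l)" by (rule homomorphism_arr[OF k])
  let ?B = "CO C (idx l)"
  let ?e = "Fdef (CM C (arr k l)) (unt k)" and ?u = "Funit (CM C (arr k l)) (vtx k)" and ?one = "vone (CO C (idx l)) (edg k l)"
  have kN: "k \<le> N" using k by simp
  have inv: "invertible_def ?B ?u" by (rule H.Funit_inv) (use kN in simp)
  have w: "(?e \<cdot>\<^bsub>?B\<^esub> ?u) \<diamondop>\<^bsub>?B\<^esub> ?one = (?e \<diamondop>\<^bsub>?B\<^esub> ?one) \<cdot>\<^bsub>?B\<^esub> (?u \<diamondop>\<^bsub>?B\<^esub> ?one)"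
    by (rule H.B.whisker_right) (use k kN in simp_all)
  have "cmp k k l \<cdot>\<^bsub>?B\<^esub> (?e \<diamondop>\<^bsub>?B\<^esub> ?one) = lunit ?B (edg k l) \<cdot>\<^bsub>?B\<^esub> (inv_def ?B ?u \<diamondop>\<^bsub>?B\<^esub> ?one)"
    using S.lunit_law[OF k] k kN by (simp add: Fcomp_\<sigma> Fmor_\<sigma> Funit_\<sigma> del: unit_simps(1))
  then have "cmp k k l \<cdot>\<^bsub>?B\<^esub> (?e \<diamondop>\<^bsub>?B\<^esub> ?one) \<cdot>\<^bsub>?B\<^esub> (?u \<diamondop>\<^bsub>?B\<^esub> ?one) =
      lunit ?B (edg k l) \<cdot>\<^bsub>?B\<^esub> (inv_def ?B ?u \<diamondop>\<^bsub>?B\<^esub> ?one) \<cdot>\<^bsub>?B\<^esub> (?u \<diamondop>\<^bsub>?B\<^esub> ?one)" by simp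
  then have "cmp k k l \<cdot>\<^bsub>?B\<^esub> ((?e \<cdot>\<^bsub>?B\<^esub> ?u) \<diamondop>\<^bsub>?B\<^esub> ?one) = lunit ?B (edg k l)"
    unfolding w using k kN inv by (simp add: H.B.vcomp_assoc' H.B.interchange')
  then show ?thesis using column_last[OF k] k by (simp add: cunt_def)
qed

lemma column_runit_last:
  assumes k: "k \<le> l" "l \<le> N"
  shows "ccmp l k l l \<cdot>\<^bsub>CO C (idx l)\<^esub> (vone (CO C (idx l)) (cedg l k l) \<diamondop>\<^bsub>CO C (idx l)\<^esub> cunt l l) =
    runit (CO C (idx l)) (cedg l k l)"
proof -
  interpret D: bicategory "CO C (idx l)" using CO k by simp
  show ?thesis
    using S.runit_law[OF k] column_last[OF k] column_last[OF le_refl k(2)] k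
    by (simp add: Fcomp_\<sigma> Fmor_\<sigma> Funit_\<sigma>)
qed

text \<open>A law whose last index is \<open>p\<close> is first obtained in the column over
  \<open>p\<close>, where it is a law of \<open>\<sigma>\<close>, and then transported from
  \<open>p\<close> to \<open>j\<close>. Pullback preserves the laws, and
  \<open>column_transport\<close> identifies the result.\<close>

lemma column_simplex:
  assumes j: "j \<le> N"
  shows "lax_simplex (CO C (idx j)) j (cvtx j) (cedg j) (ccmp j) (cunt j)"
proof (intro lax_simplex.intro lax_simplex_axioms.intro, goal_cases)
  case 1
  show ?case using CO j by simp
next
  case (12 k l m p)
  then have le: "k \<le> l" "l \<le> m" "m \<le> p" "p \<le> j" "p \<le> N" "k \<le> m" "k \<le> p" "l \<le> p" using j by auto
  interpret H: homomorphism "CO C (idx p)" "CO C (idx j)" "CM C (arr p j)" by (rule homomorphism_arr[OF le(4) j])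
  have "Fdef (CM C (arr p j)) (ccmp p k l p) \<cdot>\<^bsub>CO C (idx j)\<^esub> Fcomp (CM C (arr p j)) (cedg p k l) (cedg p l p) \<cdot>\<^bsub>CO C (idx j)\<^esub>
      (vone (CO C (idx j)) (Fmor (CM C (arr p j)) (cedg p k l)) \<diamondop>\<^bsub>CO C (idx j)\<^esub>
        (Fdef (CM C (arr p j)) (ccmp p l m p) \<cdot>\<^bsub>CO C (idx j)\<^esub> Fcomp (CM C (arr p j)) (cedg p l m) (cedg p m p))) =
    Fdef (CM C (arr p j)) (ccmp p k m p) \<cdot>\<^bsub>CO C (idx j)\<^esub> Fcomp (CM C (arr p j)) (cedg p k m) (cedg p m p) \<cdot>\<^bsub>CO C (idx j)\<^esub>
      ((Fdef (CM C (arr p j)) (ccmp p k l m) \<cdot>\<^bsub>CO C (idx j)\<^esub> Fcomp (CM C (arr p j)) (cedg p k l) (cedg p l m)) \<diamondop>\<^bsub>CO C (idx j)\<^esub>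
        vone (CO C (idx j)) (Fmor (CM C (arr p j)) (cedg p m p))) \<cdot>\<^bsub>CO C (idx j)\<^esub>
      assoc (CO C (idx j)) (Fmor (CM C (arr p j)) (cedg p k l)) (Fmor (CM C (arr p j)) (cedg p l m)) (Fmor (CM C (arr p j)) (cedg p m p))"
    by (rule H.lax_assoc_transport[OF _ _ _ _ _ _ _ _ _ _ _ _ _ _ _ column_assoc_last[OF le(1-3,5)]]) (use le in simp_all)
  then show ?case using le j by (simp add: column_transport)
next
  case (13 k l)
  then have le: "k \<le> l" "l \<le> j" "l \<le> N" using j by auto
  interpret H: homomorphism "CO C (idx l)" "CO C (idx j)" "CM C (arr l j)" by (rule homomorphism_arr[OF le(2) j])
  have "Fdef (CM C (arr l j)) (ccmp l k k l) \<cdot>\<^bsub>CO C (idx j)\<^esub> Fcomp (CM C (arr l j)) (cedg l k k) (cedg l k l) \<cdot>\<^bsub>CO C (idx j)\<^esub>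
      ((Fdef (CM C (arr l j)) (cunt l k) \<cdot>\<^bsub>CO C (idx j)\<^esub> Funit (CM C (arr l j)) (cvtx l k)) \<diamondop>\<^bsub>CO C (idx j)\<^esub>
        vone (CO C (idx j)) (Fmor (CM C (arr l j)) (cedg l k l))) =
      lunit (CO C (idx j)) (Fmor (CM C (arr l j)) (cedg l k l))"
    using H.lax_lunit_transport[OF _ _ _ _ _ column_lunit_last[OF le(1,3)]] le by simp
  then show ?case using le j by (simp add: column_transport)
next
  case (14 k l)
  then have le: "k \<le> l" "l \<le> j" "l \<le> N" using j by auto
  interpret H: homomorphism "CO C (idx l)" "CO C (idx j)" "CM C (arr l j)" by (rule homomorphism_arr[OF le(2) j])
  have "Fdef (CM C (arr l j)) (ccmp l k l l) \<cdot>\<^bsub>CO C (idx j)\<^esub> Fcomp (CM C (arr l j)) (cedg l k l) (cedg l l l) \<cdot>\<^bsub>CO C (idx j)\<^esub>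
      (vone (CO C (idx j)) (Fmor (CM C (arr l j)) (cedg l k l)) \<diamondop>\<^bsub>CO C (idx j)\<^esub>
      (Fdef (CM C (arr l j)) (cunt l l) \<cdot>\<^bsub>CO C (idx j)\<^esub> Funit (CM C (arr l j)) (cvtx l l))) =
      runit (CO C (idx j)) (Fmor (CM C (arr l j)) (cedg l k l))"
    using H.lax_runit_transport[OF _ _ _ _ _ column_runit_last[OF le(1,3)]] le by simp
  then show ?case using le j by (simp add: column_transport)
qed (use j in simp_all)

lemma column_in_nerve: "j \<le> N \<Longrightarrow> column j \<in> Sim (ND (idx j)) j"
  unfolding column_def by (rule lax_simplex.nsimplex_in_nerve[OF column_simplex])

definition base where
  "base = \<lparr>fob = (\<lambda>i\<in>{..N}. idx i), farr = (\<lambda>b\<in>Arr (ordinal N). arr (fst b) (snd b))\<rparr>"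

lemma base_simps [simp]:
  "i \<le> N \<Longrightarrow> fob base i = idx i" "i \<le> j \<Longrightarrow> j \<le> N \<Longrightarrow> farr base (i, j) = arr i j"
  by (simp_all add: base_def)

lemma cat_functor_base: "cat_functor (ordinal N) I base"
  unfolding base_def by (rule cat_functor_ordinalI) (use I.small_category_axioms in simp_all)

text \<open>Column \<open>j\<close> has length \<open>j\<close>, because only vertices up to
  \<open>j\<close> can be transported to the fibre over \<open>j\<close>: the fan is a
  triangle.\<close>

sublocale F: fan I C N base "\<lambda>j. j" column
proof (intro fan.intro fan_axioms.intro diagram_axioms)
  show "cat_functor (ordinal N) I base" by (rule cat_functor_base)
  show "column j \<in> Sim (ND (fob base j)) j" if "j \<le> N" for j using column_in_nerve that by simp
  show "pull (farr base (j, m)) j (column j) = act (ND (fob base m)) j m (\<lambda>i\<in>{..j}. i) (column m)"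
    if jm: "j \<le> m" "m \<le> N" for j m
  proof -
    have j: "j \<le> N" using jm by simp
    have \<iota>: "(\<lambda>i\<in>{..j}. i) \<in> mono_maps j m" using jm by (auto simp: mono_maps_def mono_on_def)
    have a: "arr j m \<in> Arr I" "acod I (arr j m) = idx j" "adom I (arr j m) = idx m" using jm by simp_all
    note p = pull_simps[OF a column_in_nerve[OF j]] and q = act_nerve[OF column_in_nerve[OF jm(2)] \<iota>]
    have "pull (arr j m) j (column j) = act (ND (idx m)) j m (\<lambda>i\<in>{..j}. i) (column m)"
      by (rule nerve_eqI[OF p(1) q(1)]) (use jm in \<open>simp_all add: p q column_transport\<close>)
    then show ?thesis using jm by simp
  qed
qed

text \<open>On the diagonal every constituent ends at the vertex of its column, where by
  \<open>column_last\<close> no transport has taken place.\<close>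

lemma fan_simplex_column: "fan_simplex I C base column N (\<lambda>k. k) (\<lambda>k. k) = \<sigma>"
proof -
  have "fan_simplex I C base column N (\<lambda>k. k) (\<lambda>k. k) \<in> Sim (nerve GC) N"
    by (rule F.fan_simplex_in_nerve) (simp add: F.chain_def)
  then show ?thesis
    by (rule nerve_eqI[OF _ \<sigma>])
      (simp_all add: fan_simplex_def column_last column_last(1,3)[OF le_refl] Fobj_\<sigma> Fmor_\<sigma> Fcomp_\<sigma> Funit_\<sigma> del: unit_simps(1))
qed

end

lemma fan_simplex_cong:
  assumes "\<And>k. k \<le> n \<Longrightarrow> Fobj (col (\<nu> k)) (\<mu> k) = Fobj (col' (\<nu>' k)) (\<mu>' k)"
    and "\<And>k l. k \<le> l \<Longrightarrow> l \<le> n \<Longrightarrow> Fmor (col (\<nu> l)) (\<mu> k, \<mu> l) = Fmor (col' (\<nu>' l)) (\<mu>' k, \<mu>' l)"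
    and "\<And>k l m. k \<le> l \<Longrightarrow> l \<le> m \<Longrightarrow> m \<le> n \<Longrightarrow>
      Fcomp (col (\<nu> m)) (\<mu> k, \<mu> l) (\<mu> l, \<mu> m) = Fcomp (col' (\<nu>' m)) (\<mu>' k, \<mu>' l) (\<mu>' l, \<mu>' m)"
    and "\<And>k. k \<le> n \<Longrightarrow> Funit (col (\<nu> k)) (\<mu> k) = Funit (col' (\<nu>' k)) (\<mu>' k)"
    and "\<And>k. k \<le> n \<Longrightarrow> fob G (\<nu> k) = fob G' (\<nu>' k)"
    and "\<And>k l. k \<le> l \<Longrightarrow> l \<le> n \<Longrightarrow> farr G (\<nu> k, \<nu> l) = farr G' (\<nu>' k, \<nu>' l)"
  shows "fan_simplex I C G col n \<mu> \<nu> = fan_simplex I C G' col' n \<mu>' \<nu>'"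
  unfolding fan_simplex_def by (rule nsimplex_cong) (use assms in simp_all)

lemma fan_simplex_chain_cong:
  assumes "\<And>k. k \<le> n \<Longrightarrow> \<mu> k = \<mu>' k" "\<And>k. k \<le> n \<Longrightarrow> \<nu> k = \<nu>' k"
  shows "fan_simplex I C G col n \<mu> \<nu> = fan_simplex I C G col n \<mu>' \<nu>'"
  by (rule fan_simplex_cong) (simp_all add: assms)

lemma (in fan) act_fan_simplex:
  assumes "chain n \<mu> \<nu>" and \<alpha>: "\<alpha> \<in> mono_maps m n"
  shows "act (nerve GC) m n \<alpha> (fan_simplex I C G col n \<mu> \<nu>) = fan_simplex I C G col m (\<lambda>k. \<mu> (\<alpha> k)) (\<lambda>k. \<nu> (\<alpha> k))"
proof -
  note le = mono_mapsD(3,4)[OF \<alpha>]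
  show ?thesis
    unfolding act_nerve_nsimplex[OF fan_simplex_in_nerve[OF assms(1)] \<alpha>]
    unfolding fan_simplex_def by (rule nsimplex_cong) (simp_all add: le)
qed

section \<open>The comparison map\<close>

context diagram
begin

definition bicolumn where
  "bicolumn p s j = pull (farr (snd s) (0, j)) p (fst s)"

text \<open>The columns of a simplex of the homotopy colimit have equal length, so the fan is a
  square, and \<eta> restricts its lax functor to the diagonal.\<close>

definition eta where
  "eta n s = fan_simplex I C (snd s) (bicolumn n s) n (\<lambda>k. k) (\<lambda>k. k)"

lemma bisimplices_fan:
  assumes "s \<in> bisimplices p q"
  shows "fan I C q (snd s) (\<lambda>_. p) (bicolumn p s)"
proof (intro fan.intro fan_axioms.intro diagram_axioms)
  have G: "cat_functor (ordinal q) I (snd s)" and F: "fst s \<in> Sim (ND (fob (snd s) 0)) p"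
    using assms by (auto simp: bisimplices_def)
  note g = cat_functor_ordinalD[OF G]
  show "cat_functor (ordinal q) I (snd s)" by (rule G)
  show col: "bicolumn p s j \<in> Sim (ND (fob (snd s) j)) p" if "j \<le> q" for j
    unfolding bicolumn_def by (rule pull_simps[OF _ _ _ F]) (use g that in auto)
  show "pull (farr (snd s) (j, m)) p (bicolumn p s j) = act (ND (fob (snd s) m)) p p (\<lambda>i\<in>{..p}. i) (bicolumn p s m)"
    if "j \<le> m" "m \<le> q" for j m
  proof -
    have "pull (farr (snd s) (j, m)) p (bicolumn p s j) = bicolumn p s m"
      unfolding bicolumn_def using pull_comp[of "farr (snd s) (0, j)" "farr (snd s) (j, m)" "fst s" p] g that F by simp
    then show ?thesis using simplicial_set.act_id[OF simplicial_set_nerve col[OF that(2)]] by simp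
  qed
qed simp

lemma bicolumn_biact:
  assumes \<alpha>: "\<alpha> \<in> mono_maps p' p" and \<beta>: "\<beta> \<in> mono_maps q' q" and s: "s \<in> bisimplices p q" and j: "j \<le> q'"
  shows "bicolumn p' (biact p' p \<alpha> q' \<beta> s) j = act (ND (fob (snd s) (\<beta> j))) p' p \<alpha> (bicolumn p s (\<beta> j))"
proof -
  interpret fan I C q "snd s" "\<lambda>_. p" "bicolumn p s" by (rule bisimplices_fan[OF s])
  have le: "\<beta> 0 \<le> \<beta> j" "\<beta> j \<le> q" "\<beta> 0 \<le> q" using mono_mapsD(3,4)[OF \<beta>] j by auto
  have "pull (farr (snd s) (\<beta> 0, \<beta> j)) p (bicolumn p s (\<beta> 0)) = bicolumn p s (\<beta> j)"
    using pull_col[OF le(1,2)] simplicial_set.act_id[OF simplicial_set_nerve col[OF le(2)]] by simp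
  moreover have "pull (farr (snd s) (\<beta> 0, \<beta> j)) p' (act (ND (fob (snd s) (\<beta> 0))) p' p \<alpha> (bicolumn p s (\<beta> 0))) =
      act (ND (fob (snd s) (\<beta> j))) p' p \<alpha> (pull (farr (snd s) (\<beta> 0, \<beta> j)) p (bicolumn p s (\<beta> 0)))"
    by (rule pull_act[OF _ _ _ col[OF le(3)] \<alpha>]) (use le in simp_all)
  ultimately show ?thesis
    using cat_functor_reindex(3)[OF G \<beta>, of 0 j] j
    by (cases s) (simp add: bicolumn_def biact_def)
qed

lemma eta_in_nerve:
  assumes "s \<in> bisimplices n n"
  shows "eta n s \<in> Sim (nerve GC) n"
proof -
  interpret fan I C n "snd s" "\<lambda>_. n" "bicolumn n s" by (rule bisimplices_fan[OF assms])
  show ?thesis unfolding eta_def by (rule fan_simplex_in_nerve) (simp add: chain_def)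
qed

lemma eta_biact:
  assumes \<alpha>: "\<alpha> \<in> mono_maps m n" and s: "s \<in> bisimplices n n"
  shows "eta m (biact m n \<alpha> m \<alpha> s) = act (nerve GC) m n \<alpha> (eta n s)"
proof -
  interpret fan I C n "snd s" "\<lambda>_. n" "bicolumn n s" by (rule bisimplices_fan[OF s])
  note le = mono_mapsD(3,4)[OF \<alpha>]
  note b = bicolumn_biact[OF \<alpha> \<alpha> s] and a = act_nerve[OF col \<alpha>]
  have r: "snd (biact m n \<alpha> m \<alpha> s) = reindex m (snd s) \<alpha>" by (cases s) (simp add: biact_def)
  have "eta m (biact m n \<alpha> m \<alpha> s) = fan_simplex I C (snd s) (bicolumn n s) m \<alpha> \<alpha>"
    unfolding eta_def r by (rule fan_simplex_cong) (simp_all add: b a le cat_functor_reindex[OF G \<alpha>])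
  also have "\<dots> = act (nerve GC) m n \<alpha> (eta n s)"
    unfolding eta_def by (subst act_fan_simplex[OF _ \<alpha>]) (simp_all add: chain_def)
  finally show ?thesis .
qed

lemma sset_map_eta: "sset_map HC (nerve GC) eta"
  unfolding sset_map_def sset_map_axioms_def
  by (simp add: simplicial_set_hocolim simplicial_set_nerve Sim_hocolim eta_in_nerve act_hocolim eta_biact)

text \<open>The fibre part of a bisimplex lies over the first base vertex, so it is taken from the
  column over \<open>\<beta> 0\<close>; this is why \<open>\<alpha>\<close> has to select vertices
  up to \<open>\<beta> 0\<close>.\<close>

definition rho where
  "rho N p \<alpha> q \<beta> \<sigma> = (act (ND (grothendieck_simplex.idx \<sigma> (\<beta> 0))) p (\<beta> 0) \<alpha> (grothendieck_simplex.column C \<sigma> (\<beta> 0)),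
     reindex q (grothendieck_simplex.base N \<sigma>) \<beta>)"

end

context grothendieck_simplex
begin

context
  fixes p q :: nat and \<alpha> \<beta> :: "nat \<Rightarrow> nat"
  assumes \<beta>: "\<beta> \<in> mono_maps q N" and \<alpha>: "\<alpha> \<in> mono_maps p (\<beta> 0)"
begin

lemma rho_in_bisimplices: "rho N p \<alpha> q \<beta> \<sigma> \<in> bisimplices p q"
proof -
  have b: "\<beta> 0 \<le> N" using mono_mapsD(3)[OF \<beta>] by simp
  show ?thesis
    unfolding rho_def bisimplices_def
    using cat_functor_reindex[OF cat_functor_base \<beta>] act_nerve(1)[OF column_in_nerve[OF b] \<alpha>] b by simp
qed

lemma bicolumn_rho:
  assumes j: "j \<le> q"
  shows "i \<le> p \<Longrightarrow> Fobj (bicolumn p (rho N p \<alpha> q \<beta> \<sigma>) j) i = cvtx (\<beta> j) (\<alpha> i)"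
    "i \<le> k \<Longrightarrow> k \<le> p \<Longrightarrow> Fmor (bicolumn p (rho N p \<alpha> q \<beta> \<sigma>) j) (i, k) = cedg (\<beta> j) (\<alpha> i) (\<alpha> k)"
    "i \<le> k \<Longrightarrow> k \<le> l \<Longrightarrow> l \<le> p \<Longrightarrow> Fcomp (bicolumn p (rho N p \<alpha> q \<beta> \<sigma>) j) (i, k) (k, l) = ccmp (\<beta> j) (\<alpha> i) (\<alpha> k) (\<alpha> l)"
    "i \<le> p \<Longrightarrow> Funit (bicolumn p (rho N p \<alpha> q \<beta> \<sigma>) j) i = cunt (\<beta> j) (\<alpha> i)"
proof -
  have b: "\<beta> 0 \<le> N" "\<beta> 0 \<le> \<beta> j" "\<beta> j \<le> N" using mono_mapsD(3,4)[OF \<beta>] j by auto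
  have c: "bicolumn p (rho N p \<alpha> q \<beta> \<sigma>) j = pull (arr (\<beta> 0) (\<beta> j)) p (act (ND (idx (\<beta> 0))) p (\<beta> 0) \<alpha> (column (\<beta> 0)))"
    using cat_functor_reindex(3)[OF cat_functor_base \<beta>, of 0 j] b j by (simp add: bicolumn_def rho_def)
  have a: "arr (\<beta> 0) (\<beta> j) \<in> Arr I" "acod I (arr (\<beta> 0) (\<beta> j)) = idx (\<beta> 0)" "adom I (arr (\<beta> 0) (\<beta> j)) = idx (\<beta> j)"
    using b by simp_all
  note t = act_nerve[OF column_in_nerve[OF b(1)] \<alpha>]
  note u = pull_simps[OF a t(1)]
  note le = mono_mapsD(3,4)[OF \<alpha>]
  show "i \<le> p \<Longrightarrow> Fobj (bicolumn p (rho N p \<alpha> q \<beta> \<sigma>) j) i = cvtx (\<beta> j) (\<alpha> i)"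
    "i \<le> k \<Longrightarrow> k \<le> p \<Longrightarrow> Fmor (bicolumn p (rho N p \<alpha> q \<beta> \<sigma>) j) (i, k) = cedg (\<beta> j) (\<alpha> i) (\<alpha> k)"
    "i \<le> k \<Longrightarrow> k \<le> l \<Longrightarrow> l \<le> p \<Longrightarrow> Fcomp (bicolumn p (rho N p \<alpha> q \<beta> \<sigma>) j) (i, k) (k, l) = ccmp (\<beta> j) (\<alpha> i) (\<alpha> k) (\<alpha> l)"
    "i \<le> p \<Longrightarrow> Funit (bicolumn p (rho N p \<alpha> q \<beta> \<sigma>) j) i = cunt (\<beta> j) (\<alpha> i)"
    unfolding c using b by (simp_all add: u t le column_transport)
qed

lemma snd_rho: "snd (rho N p \<alpha> q \<beta> \<sigma>) = reindex q base \<beta>"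
  by (simp add: rho_def)

end

text \<open>Every \<open>\<alpha> k\<close> is at most \<open>\<beta> 0\<close>, so the whole
  rectangle selected by \<open>\<alpha>\<close> and \<open>\<beta>\<close> lies in the triangle of
  columns of \<open>\<sigma>\<close>. Its diagonal is the chain \<open>(\<alpha>, \<beta>)\<close>
  in the fan of \<open>\<sigma>\<close>.\<close>

lemma eta_rho:
  assumes \<beta>: "\<beta> \<in> mono_maps n N" and \<alpha>: "\<alpha> \<in> mono_maps n (\<beta> 0)"
  shows "eta n (rho N n \<alpha> n \<beta> \<sigma>) = fan_simplex I C base column n \<alpha> \<beta>"
proof -
  have le: "\<alpha> k \<le> \<beta> l" if "k \<le> n" "l \<le> n" for k l
    using mono_mapsD(3)[OF \<alpha> that(1)] mono_mapsD(4)[OF \<beta> _ that(2), of 0] by simp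
  note le = le mono_mapsD(3,4)[OF \<beta>] mono_mapsD(4)[OF \<alpha>]
  show ?thesis
    unfolding eta_def snd_rho[OF \<beta> \<alpha>]
    by (rule fan_simplex_cong) (simp_all add: bicolumn_rho[OF \<beta> \<alpha>] le cat_functor_reindex[OF cat_functor_base \<beta>])
qed

lemma reindexed:
  assumes \<gamma>: "\<gamma> \<in> mono_maps M N"
  defines "\<tau> \<equiv> act (nerve GC) M N \<gamma> \<sigma>"
  shows "grothendieck_simplex I C M \<tau>"
    "k \<le> j \<Longrightarrow> j \<le> M \<Longrightarrow> grothendieck_simplex.cvtx C \<tau> j k = cvtx (\<gamma> j) (\<gamma> k)"
    "k \<le> l \<Longrightarrow> l \<le> j \<Longrightarrow> j \<le> M \<Longrightarrow> grothendieck_simplex.cedg C \<tau> j k l = cedg (\<gamma> j) (\<gamma> k) (\<gamma> l)"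
    "k \<le> l \<Longrightarrow> l \<le> m \<Longrightarrow> m \<le> j \<Longrightarrow> j \<le> M \<Longrightarrow> grothendieck_simplex.ccmp C \<tau> j k l m = ccmp (\<gamma> j) (\<gamma> k) (\<gamma> l) (\<gamma> m)"
    "k \<le> j \<Longrightarrow> j \<le> M \<Longrightarrow> grothendieck_simplex.cunt C \<tau> j k = cunt (\<gamma> j) (\<gamma> k)"
    "j \<le> M \<Longrightarrow> grothendieck_simplex.idx \<tau> j = idx (\<gamma> j)"
    "k \<le> j \<Longrightarrow> j \<le> M \<Longrightarrow> grothendieck_simplex.arr \<tau> k j = arr (\<gamma> k) (\<gamma> j)"
proof -
  show g: "grothendieck_simplex I C M \<tau>"
    unfolding \<tau>_def using act_nerve(1)[OF \<sigma> \<gamma>]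
    by (intro grothendieck_simplex.intro grothendieck_simplex_axioms.intro diagram_axioms)
  interpret T: grothendieck_simplex I C M \<tau> by (rule g)
  note a = act_nerve[OF \<sigma> \<gamma>, folded \<tau>_def]
  note le = mono_mapsD(3,4)[OF \<gamma>]
  have v: "T.vtx k = vtx (\<gamma> k)" "T.idx k = idx (\<gamma> k)" "T.unt k = unt (\<gamma> k)" if "k \<le> M" for k
    using that by (simp_all add: T.vtx_def vtx_def T.idx_def idx_def T.unt_def unt_def a)
  have e: "T.edg k l = edg (\<gamma> k) (\<gamma> l)" "T.arr k l = arr (\<gamma> k) (\<gamma> l)" if "k \<le> l" "l \<le> M" for k l
    using that by (simp_all add: T.edg_def edg_def T.arr_def arr_def a)
  have c: "T.cmp k l m = cmp (\<gamma> k) (\<gamma> l) (\<gamma> m)" if "k \<le> l" "l \<le> m" "m \<le> M" for k l m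
    using that by (simp add: T.cmp_def cmp_def a)
  show "k \<le> j \<Longrightarrow> j \<le> M \<Longrightarrow> T.cvtx j k = cvtx (\<gamma> j) (\<gamma> k)"
    "k \<le> l \<Longrightarrow> l \<le> j \<Longrightarrow> j \<le> M \<Longrightarrow> T.cedg j k l = cedg (\<gamma> j) (\<gamma> k) (\<gamma> l)"
    "k \<le> l \<Longrightarrow> l \<le> m \<Longrightarrow> m \<le> j \<Longrightarrow> j \<le> M \<Longrightarrow> T.ccmp j k l m = ccmp (\<gamma> j) (\<gamma> k) (\<gamma> l) (\<gamma> m)"
    "k \<le> j \<Longrightarrow> j \<le> M \<Longrightarrow> T.cunt j k = cunt (\<gamma> j) (\<gamma> k)"
    "j \<le> M \<Longrightarrow> T.idx j = idx (\<gamma> j)"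
    "k \<le> j \<Longrightarrow> j \<le> M \<Longrightarrow> T.arr k j = arr (\<gamma> k) (\<gamma> j)"
    by (simp_all add: T.cvtx_def cvtx_def T.cedg_def cedg_def T.ccmp_def ccmp_def T.cunt_def cunt_def v e c)
qed

text \<open>The columns of a restricted simplex are restrictions of the columns. The operators
  \<open>\<delta>\<close> and \<open>\<epsilon>\<close> complete the commuting squares; for a
  blockwise operator both are the operator on a single block.\<close>

lemma rho_reindexed:
  assumes \<beta>: "\<beta> \<in> mono_maps q N" and \<alpha>: "\<alpha> \<in> mono_maps p (\<beta> 0)" and \<gamma>: "\<gamma> \<in> mono_maps M N"
    and \<beta>': "\<beta>' \<in> mono_maps q' M" and \<alpha>': "\<alpha>' \<in> mono_maps p' (\<beta>' 0)"
    and \<delta>: "\<delta> \<in> mono_maps p' p" "\<And>i. i \<le> p' \<Longrightarrow> \<gamma> (\<alpha>' i) = \<alpha> (\<delta> i)"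
    and \<epsilon>: "\<epsilon> \<in> mono_maps q' q" "\<And>i. i \<le> q' \<Longrightarrow> \<gamma> (\<beta>' i) = \<beta> (\<epsilon> i)"
  shows "rho M p' \<alpha>' q' \<beta>' (act (nerve GC) M N \<gamma> \<sigma>) = biact p' p \<delta> q' \<epsilon> (rho N p \<alpha> q \<beta> \<sigma>)"
proof -
  define \<tau> where "\<tau> = act (nerve GC) M N \<gamma> \<sigma>"
  note r = reindexed[OF \<gamma>, folded \<tau>_def]
  interpret T: grothendieck_simplex I C M \<tau> by (rule r)
  interpret R: fan I C q "snd (rho N p \<alpha> q \<beta> \<sigma>)" "\<lambda>_. p" "bicolumn p (rho N p \<alpha> q \<beta> \<sigma>)"
    by (rule bisimplices_fan[OF rho_in_bisimplices[OF \<beta> \<alpha>]])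
  have b: "\<beta>' 0 \<le> M" using mono_mapsD(3)[OF \<beta>'] by simp
  have e: "\<epsilon> 0 \<le> q" using mono_mapsD(3)[OF \<epsilon>(1)] by simp
  note b0 = \<epsilon>(2)[of 0, simplified]
  have f: "fob (snd (rho N p \<alpha> q \<beta> \<sigma>)) (\<epsilon> 0) = idx (\<beta> (\<epsilon> 0))"
    using cat_functor_reindex(2)[OF cat_functor_base \<beta> e] mono_mapsD(3)[OF \<beta> e] by (simp add: snd_rho[OF \<beta> \<alpha>])
  have i: "T.idx (\<beta>' 0) = idx (\<beta> (\<epsilon> 0))" using r(6)[OF b] b0 by simp
  note L = act_nerve[OF T.column_in_nerve[OF b] \<alpha>', unfolded i]
  note R = act_nerve[OF R.col[OF e] \<delta>(1), unfolded f]
  note le = mono_mapsD(3,4)[OF \<alpha>'] mono_mapsD(3,4)[OF \<delta>(1)]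
  have 1: "act (ND (idx (\<beta> (\<epsilon> 0)))) p' (\<beta>' 0) \<alpha>' (T.column (\<beta>' 0)) =
      act (ND (idx (\<beta> (\<epsilon> 0)))) p' p \<delta> (bicolumn p (rho N p \<alpha> q \<beta> \<sigma>) (\<epsilon> 0))"
    by (rule nerve_eqI[OF L(1) R(1)]) (simp_all add: L R le r b b0 \<delta>(2) bicolumn_rho[OF \<beta> \<alpha> e])
  have 2: "reindex q' T.base \<beta>' = reindex q' (reindex q base \<beta>) \<epsilon>"
  proof (rule cat_functor_ordinal_eqI)
    note u = cat_functor_reindex[OF T.cat_functor_base \<beta>'] and v = cat_functor_reindex[OF cat_functor_base \<beta>]
    note w = cat_functor_reindex[OF v(1) \<epsilon>(1)]
    note le = mono_mapsD(3,4)[OF \<beta>'] mono_mapsD(3,4)[OF \<epsilon>(1)] mono_mapsD(3,4)[OF \<beta>]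
    show "cat_functor (ordinal q') I (reindex q' T.base \<beta>')" by (rule u)
    show "cat_functor (ordinal q') I (reindex q' (reindex q base \<beta>) \<epsilon>)" by (rule w)
    show "fob (reindex q' T.base \<beta>') i = fob (reindex q' (reindex q base \<beta>) \<epsilon>) i" if "i \<le> q'" for i
      using that by (simp add: u v w le r \<epsilon>(2))
    show "farr (reindex q' T.base \<beta>') (i, j) = farr (reindex q' (reindex q base \<beta>) \<epsilon>) (i, j)" if "i \<le> j" "j \<le> q'" for i j
      using that by (simp add: u v w le r \<epsilon>(2))
  qed
  have "biact p' p \<delta> q' \<epsilon> (rho N p \<alpha> q \<beta> \<sigma>) =
    (act (ND (idx (\<beta> (\<epsilon> 0)))) p' p \<delta> (bicolumn p (rho N p \<alpha> q \<beta> \<sigma>) (\<epsilon> 0)), reindex q' (reindex q base \<beta>) \<epsilon>)"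
    using f by (simp add: biact_def split_beta bicolumn_def snd_rho[OF \<beta> \<alpha>])
  then show ?thesis unfolding \<tau>_def[symmetric] using 1 2 by (simp add: rho_def i)
qed

lemma fan_simplex_reindexed:
  assumes \<gamma>: "\<gamma> \<in> mono_maps M N" and le: "\<And>k. k \<le> m \<Longrightarrow> \<nu> k \<le> M \<and> \<mu> k \<le> \<nu> k"
    "\<And>k l. k \<le> l \<Longrightarrow> l \<le> m \<Longrightarrow> \<mu> k \<le> \<mu> l \<and> \<nu> k \<le> \<nu> l"
  defines "\<tau> \<equiv> act (nerve GC) M N \<gamma> \<sigma>"
  shows "fan_simplex I C (grothendieck_simplex.base M \<tau>) (grothendieck_simplex.column C \<tau>) m \<mu> \<nu> =
    fan_simplex I C base column m (\<lambda>k. \<gamma> (\<mu> k)) (\<lambda>k. \<gamma> (\<nu> k))"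
proof -
  note r = reindexed[OF \<gamma>, folded \<tau>_def]
  interpret T: grothendieck_simplex I C M \<tau> by (rule r)
  have le': "\<mu> k \<le> \<nu> l" if "k \<le> l" "l \<le> m" for k l using le(1)[of l] le(2)[of k l] that by simp
  have "\<mu> k \<le> M" if "k \<le> m" for k using le(1)[OF that] by simp
  note le' = le' this
  note g = mono_mapsD(3,4)[OF \<gamma>]
  show ?thesis by (rule fan_simplex_cong) (simp_all add: le le' r g)
qed

end

context diagram
begin

lemma grothendieck_simplexI: "\<sigma> \<in> Sim (nerve GC) N \<Longrightarrow> grothendieck_simplex I C N \<sigma>"
  by (intro grothendieck_simplex.intro grothendieck_simplex_axioms.intro diagram_axioms)

lemma eta_simps:
  "k \<le> n \<Longrightarrow> Fobj (eta n s) k = (Fobj (bicolumn n s k) k, fob (snd s) k)"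
  "k \<le> l \<Longrightarrow> l \<le> n \<Longrightarrow> Fmor (eta n s) (k, l) = (Fobj (bicolumn n s k) k, Fmor (bicolumn n s l) (k, l), farr (snd s) (k, l))"
  "k \<le> l \<Longrightarrow> l \<le> m \<Longrightarrow> m \<le> n \<Longrightarrow> Fcomp (eta n s) (k, l) (l, m) =
    (Fobj (bicolumn n s k) k, Fcomp (bicolumn n s m) (k, l) (l, m), farr (snd s) (k, m))"
  "k \<le> n \<Longrightarrow> Funit (eta n s) k = (Fobj (bicolumn n s k) k, Funit (bicolumn n s k) k, farr (snd s) (k, k))"
  by (simp_all add: eta_def fan_simplex_def)

text \<open>The column of \<open>eta N s\<close> over \<open>j\<close> is the initial part up to
  \<open>j\<close> of the \<open>j\<close>-th column of \<open>s\<close>, because columns of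
  \<open>s\<close> are transported into each other. The operator \<open>\<alpha>\<close> is used
  with two codomains, for the shortened and for the full column.\<close>

lemma rho_eta:
  assumes s: "s \<in> bisimplices N N" and \<beta>: "\<beta> \<in> mono_maps q N" and \<alpha>: "\<alpha> \<in> mono_maps p (\<beta> 0)"
    and \<alpha>': "\<alpha> \<in> mono_maps p N"
  shows "rho N p \<alpha> q \<beta> (eta N s) = biact p N \<alpha> q \<beta> s"
proof -
  interpret Y: fan I C N "snd s" "\<lambda>_. N" "bicolumn N s" by (rule bisimplices_fan[OF s])
  interpret E: grothendieck_simplex I C N "eta N s" by (rule grothendieck_simplexI[OF eta_in_nerve[OF s]])
  have v: "E.vtx k = Fobj (bicolumn N s k) k" "E.idx k = fob (snd s) k" "E.unt k = Funit (bicolumn N s k) k" if "k \<le> N" for k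
    using that by (simp_all add: E.vtx_def E.idx_def E.unt_def eta_simps)
  have e: "E.edg k l = Fmor (bicolumn N s l) (k, l)" "E.arr k l = farr (snd s) (k, l)" if "k \<le> l" "l \<le> N" for k l
    using that by (simp_all add: E.edg_def E.arr_def eta_simps)
  have c: "E.cmp k l m = Fcomp (bicolumn N s m) (k, l) (l, m)" if "k \<le> l" "l \<le> m" "m \<le> N" for k l m
    using that by (simp add: E.cmp_def eta_simps)
  have b: "\<beta> 0 \<le> N" using mono_mapsD(3)[OF \<beta>] by simp
  have col: "E.cvtx j k = Fobj (bicolumn N s j) k" "E.cunt j k = Funit (bicolumn N s j) k" if "k \<le> j" "j \<le> N" for k j
    using that by (simp_all add: E.cvtx_def E.cunt_def v e Y.pull_col_simps)
  have col2: "E.cedg j k l = Fmor (bicolumn N s j) (k, l)" if "k \<le> l" "l \<le> j" "j \<le> N" for k l j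
    using that by (simp add: E.cedg_def v e Y.pull_col_simps)
  have col3: "E.ccmp j k l m = Fcomp (bicolumn N s j) (k, l) (l, m)" if "k \<le> l" "l \<le> m" "m \<le> j" "j \<le> N" for k l m j
    using that by (simp add: E.ccmp_def v e c Y.pull_col_simps)
  note L = act_nerve[OF E.column_in_nerve[OF b] \<alpha>, unfolded v(2)[OF b]]
  note R = act_nerve[OF Y.col[OF b] \<alpha>']
  note le = mono_mapsD(3,4)[OF \<alpha>]
  have 1: "act (ND (fob (snd s) (\<beta> 0))) p (\<beta> 0) \<alpha> (E.column (\<beta> 0)) = act (ND (fob (snd s) (\<beta> 0))) p N \<alpha> (bicolumn N s (\<beta> 0))"
    by (rule nerve_eqI[OF L(1) R(1)]) (simp_all add: L R le b col col2 col3)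
  have 2: "E.base = snd s"
    by (rule cat_functor_ordinal_eqI[OF E.cat_functor_base Y.G]) (simp_all add: v e)
  show ?thesis
    using 1 2 v(2)[OF b] by (simp add: rho_def biact_def split_beta bicolumn_def)
qed

end

section \<open>Selection of blocks and joins of selected blocks\<close>

definition blockmap :: "nat \<Rightarrow> (nat \<Rightarrow> nat) \<Rightarrow> nat \<Rightarrow> nat \<Rightarrow> nat" where
  "blockmap r f n = (\<lambda>i\<in>{..r * Suc n + n}. f (i div Suc n) * Suc n + i mod Suc n)"

lemma blockmap_apply:
  assumes "b \<le> r" "k \<le> n"
  shows "blockmap r f n (b * Suc n + k) = f b * Suc n + k"
  unfolding blockmap_def
  by (subst restrict_apply') (use assms block_decomp[of "b * Suc n + k" r n] in blast, simp only: assms block_div block_mod)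

lemma block_apply: "k \<le> n \<Longrightarrow> block b n k = b * Suc n + k"
  by (simp add: block_def)

lemma blockmap_block: "b \<le> r \<Longrightarrow> k \<le> n \<Longrightarrow> blockmap r f n (block b n k) = block (f b) n k"
  by (simp only: block_apply blockmap_apply)

text \<open>An earlier block lies below the first vertex of a later one, which is the condition on
  the operators of \<open>rho\<close>.\<close>

lemma block_mono': "b < c \<Longrightarrow> block b n \<in> mono_maps n (block c n 0)"
  unfolding block_def[of b]
  by (rule mono_maps_restrictI) (use block_le_iff[of _ n 0 b c] in \<open>auto simp: block_apply simp del: mult_Suc_right\<close>)

lemma blocks_block_apply:
  assumes "\<alpha> \<in> mono_maps m n" "b \<le> r" "k \<le> m"
  shows "blocks r m n \<alpha> (block b m k) = block b n (\<alpha> k)"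
  using assms mono_mapsD(3)[OF assms(1)] by (simp only: block_apply blocks_apply)

text \<open>Strictness of \<open>f\<close> is essential: two blocks sent to the same block would
  destroy monotonicity, since positions start again at 0 in each block.\<close>

locale block_inclusion =
  fixes r R :: nat and f :: "nat \<Rightarrow> nat"
  assumes f_le: "b \<le> r \<Longrightarrow> f b \<le> R" and f_less: "b < c \<Longrightarrow> c \<le> r \<Longrightarrow> f b < f c"
begin

lemma blockmap_mono: "blockmap r f n \<in> mono_maps (r * Suc n + n) (R * Suc n + n)"
proof -
  have "restrict (blockmap r f n) {..r * Suc n + n} \<in> mono_maps (r * Suc n + n) (R * Suc n + n)"
  proof (rule mono_maps_restrictI)
    fix i assume "i \<le> r * Suc n + n"
    then obtain b k where "b \<le> r" "k \<le> n" "i = b * Suc n + k" unfolding block_decomp by blast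
    then show "blockmap r f n i \<le> R * Suc n + n"
      unfolding block_decomp[of "blockmap r f n i"] using blockmap_apply f_le by blast
  next
    fix i j assume ij: "i \<le> j" "j \<le> r * Suc n + n"
    then have "i \<le> r * Suc n + n" by (rule le_trans)
    then obtain b k where i: "b \<le> r" "k \<le> n" "i = b * Suc n + k" unfolding block_decomp by blast
    obtain c l where j: "c \<le> r" "l \<le> n" "j = c * Suc n + l" using ij unfolding block_decomp by blast
    have "b < c \<or> b = c \<and> k \<le> l" using ij block_le_iff i j by blast
    then have "f b < f c \<or> f b = f c \<and> k \<le> l" using f_less j by blast
    then show "blockmap r f n i \<le> blockmap r f n j"
      using i j by (simp only: blockmap_apply block_le_iff)
  qed
  moreover have "restrict (blockmap r f n) {..r * Suc n + n} = blockmap r f n" by (auto simp: blockmap_def)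
  ultimately show ?thesis by simp
qed

text \<open>Renaming blocks commutes with acting inside blocks, so constructions that select blocks
  are simplicial maps of subdivisions.\<close>

lemma blocks_blockmap:
  assumes \<alpha>: "\<alpha> \<in> mono_maps m n" and i: "i \<le> r * Suc m + m"
  shows "blocks R m n \<alpha> (blockmap r f m i) = blockmap r f n (blocks r m n \<alpha> i)"
proof -
  obtain b k where b: "b \<le> r" "k \<le> m" "i = b * Suc m + k" using i unfolding block_decomp by blast
  show ?thesis
    unfolding b(3) using b(1,2) f_le[OF b(1)] mono_mapsD(3)[OF \<alpha> b(2)] by (simp only: blockmap_apply blocks_apply)
qed

end

lemma blockmap_le:
  assumes "\<And>b. b \<le> r \<Longrightarrow> f b \<le> g b" "i \<le> r * Suc n + n"
  shows "blockmap r f n i \<le> blockmap r g n i"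
proof -
  obtain b k where b: "b \<le> r" "k \<le> n" "i = b * Suc n + k" using assms(2) unfolding block_decomp by blast
  show ?thesis
    unfolding b(3) using b(1,2) assms(1)[OF b(1)] by (simp only: blockmap_apply add_le_mono1 mult_le_mono1)
qed

context diagram
begin

lemma sset_map_rho:
  assumes b: "b < c" "c \<le> R"
  shows "sset_map (sd R (nerve GC)) HC (\<lambda>n. rho (R * Suc n + n) n (block b n) n (block c n))"
  unfolding sset_map_def sset_map_axioms_def
proof (intro conjI allI impI simplicial_set_sd simplicial_set_nerve simplicial_set_hocolim)
  note bm = block_mono[OF b(2)] block_mono'[OF b(1)]
  fix \<sigma> n assume "\<sigma> \<in> Sim (sd R (nerve GC)) n"
  then have \<sigma>: "\<sigma> \<in> Sim (nerve GC) (R * Suc n + n)" by simp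
  interpret S: grothendieck_simplex I C "R * Suc n + n" \<sigma> by (rule grothendieck_simplexI[OF \<sigma>])
  show "rho (R * Suc n + n) n (block b n) n (block c n) \<sigma> \<in> Sim HC n"
    unfolding Sim_hocolim by (rule S.rho_in_bisimplices[OF bm])
next
  note bm = block_mono[OF b(2)] block_mono'[OF b(1)]
  fix \<alpha> m n \<sigma> assume \<alpha>: "\<alpha> \<in> mono_maps m n" and "\<sigma> \<in> Sim (sd R (nerve GC)) n"
  then have \<sigma>: "\<sigma> \<in> Sim (nerve GC) (R * Suc n + n)" by simp
  interpret S: grothendieck_simplex I C "R * Suc n + n" \<sigma> by (rule grothendieck_simplexI[OF \<sigma>])
  have "rho (R * Suc m + m) m (block b m) m (block c m) (act (nerve GC) (R * Suc m + m) (R * Suc n + n) (blocks R m n \<alpha>) \<sigma>) =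
      biact m n \<alpha> m \<alpha> (rho (R * Suc n + n) n (block b n) n (block c n) \<sigma>)"
    by (rule S.rho_reindexed[OF bm blocks_mono[OF \<alpha>] bm \<alpha> _ \<alpha>]) (use b in \<open>simp_all only: blocks_block_apply[OF \<alpha>] less_imp_le order_trans[OF less_imp_le]\<close>)
  then show "rho (R * Suc m + m) m (block b m) m (block c m) (act (sd R (nerve GC)) m n \<alpha> \<sigma>) =
      act HC m n \<alpha> (rho (R * Suc n + n) n (block b n) n (block c n) \<sigma>)"
    unfolding act_sd by (simp only: act_hocolim[OF \<alpha> S.rho_in_bisimplices[OF bm]])
qed

text \<open>Block \<open>b\<close> of the result has its fibre vertices in block \<open>f b\<close>
  and its base vertices in block \<open>g b\<close> of \<open>\<sigma>\<close>. The condition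
  \<open>f b \<le> g b\<close> keeps the chain in the triangle of columns, and monotonicity of
  \<open>f\<close> and \<open>g\<close> makes the blocks follow one another.\<close>

definition fan_join where
  "fan_join R r f g n \<sigma> = fan_simplex I C (grothendieck_simplex.base (R * Suc n + n) \<sigma>) (grothendieck_simplex.column C \<sigma>)
     (r * Suc n + n) (blockmap r f n) (blockmap r g n)"

context
  fixes r R :: nat and f g :: "nat \<Rightarrow> nat"
  assumes f: "block_inclusion r R f" and g: "block_inclusion r R g" and fg: "\<And>b. b \<le> r \<Longrightarrow> f b \<le> g b"
begin

lemma blockmap_chain:
  assumes "\<sigma> \<in> Sim (nerve GC) (R * Suc n + n)"
  shows "fan.chain (R * Suc n + n) (\<lambda>j. j) (r * Suc n + n) (blockmap r f n) (blockmap r g n)"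
proof -
  interpret S: grothendieck_simplex I C "R * Suc n + n" \<sigma> by (rule grothendieck_simplexI[OF assms])
  note m = block_inclusion.blockmap_mono[OF f, of n] block_inclusion.blockmap_mono[OF g, of n]
  show ?thesis
    unfolding S.F.chain_def
  proof (intro conjI allI impI)
    show "blockmap r g n k \<le> R * Suc n + n" "blockmap r f n k \<le> blockmap r g n k" if "k \<le> r * Suc n + n" for k
      using mono_mapsD(3)[OF m(2) that] blockmap_le[OF fg that] .
    show "blockmap r f n k \<le> blockmap r f n l" "blockmap r g n k \<le> blockmap r g n l" if "k \<le> l" "l \<le> r * Suc n + n" for k l
      using mono_mapsD(4)[OF m(1) that] mono_mapsD(4)[OF m(2) that] .
  qed
qed

lemma sset_map_fan_join: "sset_map (sd R (nerve GC)) (sd r (nerve GC)) (fan_join R r f g)"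
  unfolding sset_map_def sset_map_axioms_def
proof (intro conjI allI impI simplicial_set_sd simplicial_set_nerve)
  fix \<sigma> n assume "\<sigma> \<in> Sim (sd R (nerve GC)) n"
  then have \<sigma>: "\<sigma> \<in> Sim (nerve GC) (R * Suc n + n)" by simp
  interpret S: grothendieck_simplex I C "R * Suc n + n" \<sigma> by (rule grothendieck_simplexI[OF \<sigma>])
  show "fan_join R r f g n \<sigma> \<in> Sim (sd r (nerve GC)) n"
    unfolding Sim_sd fan_join_def by (rule S.F.fan_simplex_in_nerve[OF blockmap_chain[OF \<sigma>]])
next
  fix \<alpha> m n \<sigma> assume \<alpha>: "\<alpha> \<in> mono_maps m n" and "\<sigma> \<in> Sim (sd R (nerve GC)) n"
  then have \<sigma>: "\<sigma> \<in> Sim (nerve GC) (R * Suc n + n)" by simp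
  interpret S: grothendieck_simplex I C "R * Suc n + n" \<sigma> by (rule grothendieck_simplexI[OF \<sigma>])
  note m = block_inclusion.blockmap_mono[OF f, of m] block_inclusion.blockmap_mono[OF g, of m]
  have "fan_join R r f g m (act (nerve GC) (R * Suc m + m) (R * Suc n + n) (blocks R m n \<alpha>) \<sigma>) =
    fan_simplex I C S.base S.column (r * Suc m + m) (\<lambda>k. blocks R m n \<alpha> (blockmap r f m k)) (\<lambda>k. blocks R m n \<alpha> (blockmap r g m k))"
    unfolding fan_join_def
  proof (rule S.fan_simplex_reindexed[OF blocks_mono[OF \<alpha>]]; intro conjI)
    show "blockmap r g m k \<le> R * Suc m + m" "blockmap r f m k \<le> blockmap r g m k" if "k \<le> r * Suc m + m" for k
      using mono_mapsD(3)[OF m(2) that] blockmap_le[OF fg that] .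
    show "blockmap r f m k \<le> blockmap r f m l" "blockmap r g m k \<le> blockmap r g m l" if "k \<le> l" "l \<le> r * Suc m + m" for k l
      using mono_mapsD(4)[OF m(1) that] mono_mapsD(4)[OF m(2) that] .
  qed
  also have "\<dots> = fan_simplex I C S.base S.column (r * Suc m + m) (\<lambda>k. blockmap r f n (blocks r m n \<alpha> k)) (\<lambda>k. blockmap r g n (blocks r m n \<alpha> k))"
    by (intro fan_simplex_chain_cong block_inclusion.blocks_blockmap[OF f \<alpha>] block_inclusion.blocks_blockmap[OF g \<alpha>])
  also have "\<dots> = act (nerve GC) (r * Suc m + m) (r * Suc n + n) (blocks r m n \<alpha>) (fan_join R r f g n \<sigma>)"
    unfolding fan_join_def by (rule S.F.act_fan_simplex[OF blockmap_chain[OF \<sigma>] blocks_mono[OF \<alpha>], symmetric])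
  finally show "fan_join R r f g m (act (sd R (nerve GC)) m n \<alpha> \<sigma>) = act (sd r (nerve GC)) m n \<alpha> (fan_join R r f g n \<sigma>)"
    unfolding act_sd .
qed

lemma act_block_fan_join:
  assumes \<sigma>: "\<sigma> \<in> Sim (nerve GC) (R * Suc n + n)" and b: "b \<le> r"
  shows "act (nerve GC) n (r * Suc n + n) (block b n) (fan_join R r f g n \<sigma>) =
    fan_simplex I C (grothendieck_simplex.base (R * Suc n + n) \<sigma>) (grothendieck_simplex.column C \<sigma>) n (block (f b) n) (block (g b) n)"
proof -
  interpret S: grothendieck_simplex I C "R * Suc n + n" \<sigma> by (rule grothendieck_simplexI[OF \<sigma>])
  show ?thesis
    unfolding fan_join_def S.F.act_fan_simplex[OF blockmap_chain[OF \<sigma>] block_mono[OF b]]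
    by (intro fan_simplex_chain_cong blockmap_block[OF b])
qed

text \<open>The counterpart of \<open>fan_join\<close> on the homotopy colimit: block
  \<open>b\<close> uses block \<open>f b\<close> in the fibre direction and block \<open>g b\<close>
  in the base direction.\<close>

lemma sset_map_biact_join:
  "sset_map (sd R HC) (sd r HC) (\<lambda>n. biact (r * Suc n + n) (R * Suc n + n) (blockmap r f n) (r * Suc n + n) (blockmap r g n))"
  unfolding sset_map_def sset_map_axioms_def
proof (intro conjI allI impI simplicial_set_sd simplicial_set_hocolim)
  note m = block_inclusion.blockmap_mono[OF f] block_inclusion.blockmap_mono[OF g]
  show "biact (r * Suc n + n) (R * Suc n + n) (blockmap r f n) (r * Suc n + n) (blockmap r g n) s \<in> Sim (sd r HC) n"
    if "s \<in> Sim (sd R HC) n" for s n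
    using biact_closed[OF m] that unfolding Sim_sd Sim_hocolim .
  fix \<alpha> k n s assume \<alpha>: "\<alpha> \<in> mono_maps k n" and "s \<in> Sim (sd R HC) n"
  then have s: "s \<in> bisimplices (R * Suc n + n) (R * Suc n + n)" unfolding Sim_sd Sim_hocolim by simp
  let ?f = "compose {..r * Suc k + k} (blocks R k n \<alpha>) (blockmap r f k)" and ?g = "compose {..r * Suc k + k} (blocks R k n \<alpha>) (blockmap r g k)"
  note bl = blocks_mono[OF \<alpha>]
  have fg: "?f \<in> mono_maps (r * Suc k + k) (R * Suc n + n)" "?g \<in> mono_maps (r * Suc k + k) (R * Suc n + n)"
    by (rule mono_maps_compose[OF m(1) bl], rule mono_maps_compose[OF m(2) bl])
  have ap: "?f i = blocks R k n \<alpha> (blockmap r f k i)" "?g i = blocks R k n \<alpha> (blockmap r g k i)"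
    "?f i = blockmap r f n (blocks r k n \<alpha> i)" "?g i = blockmap r g n (blocks r k n \<alpha> i)" if "i \<le> r * Suc k + k" for i
    using that block_inclusion.blocks_blockmap[OF f \<alpha> that] block_inclusion.blocks_blockmap[OF g \<alpha> that]
    by (simp_all add: compose_def del: mult_Suc_right)
  have "biact (r * Suc k + k) (R * Suc k + k) (blockmap r f k) (r * Suc k + k) (blockmap r g k)
      (biact (R * Suc k + k) (R * Suc n + n) (blocks R k n \<alpha>) (R * Suc k + k) (blocks R k n \<alpha>) s) =
      biact (r * Suc k + k) (R * Suc n + n) ?f (r * Suc k + k) ?g s"
    by (rule biact_comp[OF bl m(1) fg(1) ap(1) bl m(2) fg(2) ap(2) s])
  moreover have "biact (r * Suc k + k) (r * Suc n + n) (blocks r k n \<alpha>) (r * Suc k + k) (blocks r k n \<alpha>)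
      (biact (r * Suc n + n) (R * Suc n + n) (blockmap r f n) (r * Suc n + n) (blockmap r g n) s) =
      biact (r * Suc k + k) (R * Suc n + n) ?f (r * Suc k + k) ?g s"
    by (rule biact_comp[OF m(1) bl fg(1) ap(3) m(2) bl fg(2) ap(4) s])
  ultimately show "biact (r * Suc k + k) (R * Suc k + k) (blockmap r f k) (r * Suc k + k) (blockmap r g k) (act (sd R HC) k n \<alpha> s) =
      act (sd r HC) k n \<alpha> (biact (r * Suc n + n) (R * Suc n + n) (blockmap r f n) (r * Suc n + n) (blockmap r g n) s)"
    unfolding act_sd act_hocolim[OF bl s] act_hocolim[OF bl biact_closed[OF m s]] by simp
qed

lemma act_block_biact_join:
  assumes s: "s \<in> bisimplices (R * Suc n + n) (R * Suc n + n)" and b: "b \<le> r"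
  shows "act HC n (r * Suc n + n) (block b n)
      (biact (r * Suc n + n) (R * Suc n + n) (blockmap r f n) (r * Suc n + n) (blockmap r g n) s) =
    biact n (R * Suc n + n) (block (f b) n) n (block (g b) n) s"
proof -
  note m = block_inclusion.blockmap_mono[OF f, of n] block_inclusion.blockmap_mono[OF g, of n]
  note bl = block_mono[OF b, of n]
  have le: "f b \<le> R" "g b \<le> R" using block_inclusion.f_le[OF f b] block_inclusion.f_le[OF g b] by simp_all
  show ?thesis
    unfolding act_hocolim[OF bl biact_closed[OF m s]]
    by (rule biact_comp[OF m(1) bl block_mono[OF le(1)] _ m(2) bl block_mono[OF le(2)] _ s]) (simp_all only: blockmap_block[OF b])
qed

end

text \<open>In pairs (fibre block, base block) the two inverses are (1, 2) and (0, 1). The chain (0,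
  1), (2, 2) joins \<eta> after the second inverse to the restriction to block 2, and lies in the
  triangle of columns. The chain (0, 0), (1, 2) joins the restriction to block 0 to the first
  inverse after \<eta>, and lies in the square of a bisimplex.\<close>

theorem sset_weak_equivalence_eta: "sset_weak_equivalence HC (nerve GC) eta"
proof (rule sset_weak_equivalence_by_subdivision)
  \<comment> \<open>The three ways of selecting two blocks out of three: without the middle, the
    first or the last one.\<close>
  have f: "block_inclusion 1 2 (\<lambda>b. 2 * b)" "block_inclusion 1 2 Suc" "block_inclusion 1 2 (\<lambda>b. b)"
    by (auto simp: block_inclusion_def)
  have le: "2 * b \<le> Suc b" "b \<le> 2 * b" if "b \<le> 1" for b :: nat using that by auto
  let ?N = "\<lambda>n. 2 * Suc n + n"
  show "sset_map HC (nerve GC) eta" by (rule sset_map_eta)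
  show "sset_map (sd 2 (nerve GC)) HC (\<lambda>n. rho (?N n) n (block 1 n) n (block 2 n))"
    "sset_map (sd 2 (nerve GC)) HC (\<lambda>n. rho (?N n) n (block 0 n) n (block 1 n))"
    by (rule sset_map_rho, simp, simp)+
  show "sset_map (sd 2 (nerve GC)) (sd 1 (nerve GC)) (fan_join 2 1 (\<lambda>b. 2 * b) Suc)"
    by (rule sset_map_fan_join[OF f(1,2) le(1)])
  show "sset_map (sd 2 HC) (sd 1 HC)
      (\<lambda>n. biact (1 * Suc n + n) (?N n) (blockmap 1 (\<lambda>b. b) n) (1 * Suc n + n) (blockmap 1 (\<lambda>b. 2 * b) n))"
    by (rule sset_map_biact_join[OF f(3,1) le(2)])
  fix n
  show "act (nerve GC) n (1 * Suc n + n) (block 0 n) (fan_join 2 1 (\<lambda>b. 2 * b) Suc n \<sigma>) =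
      eta n (rho (?N n) n (block 0 n) n (block 1 n) \<sigma>)"
    and "act (nerve GC) n (1 * Suc n + n) (block 1 n) (fan_join 2 1 (\<lambda>b. 2 * b) Suc n \<sigma>) =
      act (nerve GC) n (?N n) (block 2 n) \<sigma>" if \<sigma>: "\<sigma> \<in> Sim (nerve GC) (?N n)" for \<sigma>
  proof -
    interpret S: grothendieck_simplex I C "?N n" \<sigma> by (rule grothendieck_simplexI[OF \<sigma>])
    have b: "block 1 n \<in> mono_maps n (?N n)" "block 2 n \<in> mono_maps n (?N n)" by (rule block_mono, simp)+
    have b': "block 0 n \<in> mono_maps n (block 1 n 0)" by (rule block_mono') simp
    note a = act_block_fan_join[OF f(1,2) le(1) \<sigma>]
    show "act (nerve GC) n (1 * Suc n + n) (block 0 n) (fan_join 2 1 (\<lambda>b. 2 * b) Suc n \<sigma>) =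
        eta n (rho (?N n) n (block 0 n) n (block 1 n) \<sigma>)"
      using a[of 0] S.eta_rho[OF b(1) b'] by simp
    have "act (nerve GC) n (1 * Suc n + n) (block 1 n) (fan_join 2 1 (\<lambda>b. 2 * b) Suc n \<sigma>) =
        fan_simplex I C S.base S.column n (block 2 n) (block 2 n)"
      using a[of 1] by (simp add: numeral_2_eq_2)
    also have "\<dots> = act (nerve GC) n (?N n) (block 2 n) (fan_simplex I C S.base S.column (?N n) (\<lambda>k. k) (\<lambda>k. k))"
      by (rule S.F.act_fan_simplex[OF _ b(2), symmetric]) (unfold S.F.chain_def, blast intro: le_refl)
    finally show "act (nerve GC) n (1 * Suc n + n) (block 1 n) (fan_join 2 1 (\<lambda>b. 2 * b) Suc n \<sigma>) =
        act (nerve GC) n (?N n) (block 2 n) \<sigma>"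
      unfolding S.fan_simplex_column .
  qed
  show "act HC n (1 * Suc n + n) (block 0 n)
        (biact (1 * Suc n + n) (?N n) (blockmap 1 (\<lambda>b. b) n) (1 * Suc n + n) (blockmap 1 (\<lambda>b. 2 * b) n) s) =
      act HC n (?N n) (block 0 n) s"
    and "act HC n (1 * Suc n + n) (block 1 n)
        (biact (1 * Suc n + n) (?N n) (blockmap 1 (\<lambda>b. b) n) (1 * Suc n + n) (blockmap 1 (\<lambda>b. 2 * b) n) s) =
      rho (?N n) n (block 1 n) n (block 2 n) (eta (?N n) s)" if "s \<in> Sim HC (?N n)" for s
  proof -
    have s: "s \<in> bisimplices (?N n) (?N n)" using that unfolding Sim_hocolim .
    have b: "block 0 n \<in> mono_maps n (?N n)" "block 1 n \<in> mono_maps n (?N n)" "block 2 n \<in> mono_maps n (?N n)"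
      by (rule block_mono, simp)+
    have b': "block 1 n \<in> mono_maps n (block 2 n 0)" by (rule block_mono') simp
    note a = act_block_biact_join[OF f(3,1) le(2) s]
    show "act HC n (1 * Suc n + n) (block 0 n)
        (biact (1 * Suc n + n) (?N n) (blockmap 1 (\<lambda>b. b) n) (1 * Suc n + n) (blockmap 1 (\<lambda>b. 2 * b) n) s) =
      act HC n (?N n) (block 0 n) s"
      unfolding act_hocolim[OF b(1) s] using a[of 0] by simp
    show "act HC n (1 * Suc n + n) (block 1 n)
        (biact (1 * Suc n + n) (?N n) (blockmap 1 (\<lambda>b. b) n) (1 * Suc n + n) (blockmap 1 (\<lambda>b. 2 * b) n) s) =
      rho (?N n) n (block 1 n) n (block 2 n) (eta (?N n) s)"
      unfolding rho_eta[OF s b(3) b' b(2)] using a[of 1] by simp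
  qed
qed

end

section \<open>Naturality\<close>

lemma nerve_map_nerve_map:
  assumes H: "lax_functor A B H" and K: "lax_functor B D K" and F: "F \<in> Sim (nerve A) n"
  shows "nerve_map D K n (nerve_map B H n F) = nerve_map D (comp_lax A D K H) n F"
proof -
  interpret H: lax_functor A B H by fact
  interpret K: lax_functor B D K by fact
  interpret S: lax_simplex A n "Fobj F" "\<lambda>i j. Fmor F (i, j)" "\<lambda>i j k. Fcomp F (i, j) (j, k)" "Funit F"
    by (rule lax_simplex_of_nerve[OF F])
  note h = nerve_map_simps[OF H F]
  have k: "\<forall>u\<in>Mor A. Fdef (comp_lax A D K H) (vone A u) = vone D (Fmor (comp_lax A D K H) u)"
    by (simp add: comp_lax_def compose_def)
  show ?thesis
    unfolding nerve_map_nsimplex[OF h(1) K.Fdef_vone_all] nerve_map_nsimplex[OF F k]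
    by (rule nsimplex_cong)
      (simp_all add: h comp_lax_def compose_def composable_def K.Fdef_vcomp' K.B.vcomp_assoc')
qed

context diagram_map
begin

text \<open>The naturality square of \<open>\<Phi>\<close> commutes strictly as lax functors, so
  both sides are nerve maps of equal composites.\<close>

lemma bicolumn_natural:
  assumes s: "s \<in> C.bisimplices p q" and j: "j \<le> q"
  shows "C'.bicolumn p (hocolim_map (\<lambda>i. nerve_map (CO C' i) (\<Phi> i)) p s) j =
    nerve_map (CO C' (fob (snd s) j)) (\<Phi> (fob (snd s) j)) p (C.bicolumn p s j)"
proof -
  have G: "cat_functor (ordinal q) I (snd s)" and F: "fst s \<in> Sim (nerve (CO C (fob (snd s) 0))) p"
    using s by (auto simp: C.bisimplices_def)
  let ?a = "farr (snd s) (0, j)"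
  note g = cat_functor_ordinalD(1-4)[OF G]
  have a: "?a \<in> Arr I" "acod I ?a = fob (snd s) 0" "adom I ?a = fob (snd s) j" using g j by simp_all
  have \<Phi>: "lax_functor (CO C i) (CO C' i) (\<Phi> i)" if "i \<in> Ob I" for i
    using component[OF that] homomorphism.axioms(1) by blast
  note L = nerve_map_nerve_map[OF \<Phi> C'.lax_functor_CM[OF a(1), unfolded a(2)] F]
  note R = nerve_map_nerve_map[OF C.lax_functor_CM[OF a(1), unfolded a(2)] \<Phi> F]
  have "nerve_map (CO C' (adom I ?a)) (CM C' ?a) p (nerve_map (CO C' (fob (snd s) 0)) (\<Phi> (fob (snd s) 0)) p (fst s)) =
      nerve_map (CO C' (adom I ?a)) (\<Phi> (adom I ?a)) p (nerve_map (CO C (adom I ?a)) (CM C ?a) p (fst s))"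
    using L R naturality[OF a(1)] a g j by simp
  then show ?thesis
    using a by (simp add: C.bicolumn_def C'.bicolumn_def C.pull_def C'.pull_def hocolim_map_def split_beta)
qed

text \<open>Both sides are compared component by component. For composition constraints, the pulled
  back edge in \<open>grothendieck_map\<close> is by the fan condition the edge in the last column,
  where the constraint is that of the single component of \<open>\<Phi>\<close>.\<close>

lemma eta_natural:
  assumes s: "s \<in> C.bisimplices n n"
  shows "nerve_map (grothendieck I C') (grothendieck_map I C \<Phi>) n (C.eta n s) =
    C'.eta n (hocolim_map (\<lambda>i. nerve_map (CO C' i) (\<Phi> i)) n s)"
proof -
  interpret Y: fan I C n "snd s" "\<lambda>_. n" "C.bicolumn n s" by (rule C.bisimplices_fan[OF s])
  have eta: "C.eta n s \<in> Sim (nerve (grothendieck I C)) n" by (rule C.eta_in_nerve[OF s])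
  interpret E: lax_simplex "grothendieck I C" n "Fobj (C.eta n s)" "\<lambda>i j. Fmor (C.eta n s) (i, j)"
    "\<lambda>i j k. Fcomp (C.eta n s) (i, j) (j, k)" "Funit (C.eta n s)" by (rule lax_simplex_of_nerve[OF eta])
  have \<Phi>: "lax_functor (CO C i) (CO C' i) (\<Phi> i)" if "i \<in> Ob I" for i
    using component[OF that] homomorphism.axioms(1) by blast
  note n = nerve_map_simps[OF \<Phi> Y.col]
  \<comment> \<open>This equation is what puts the image simplex into normal form, after which only
    the components remain to be compared.\<close>
  have vone: "\<forall>u\<in>Mor (grothendieck I C). Fdef (grothendieck_map I C \<Phi>) (vone (grothendieck I C) u) =
      vone (grothendieck I C') (Fmor (grothendieck_map I C \<Phi>) u)"
  proof
    fix u assume u: "u \<in> Mor (grothendieck I C)"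
    obtain x f a where e: "u = (x, f, a)" using prod_cases3 by blast
    then have a: "adom I a \<in> Ob I" using u by simp
    interpret lax_functor "CO C (adom I a)" "CO C' (adom I a)" "\<Phi> (adom I a)" by (rule \<Phi>[OF a])
    show "Fdef (grothendieck_map I C \<Phi>) (vone (grothendieck I C) u) =
        vone (grothendieck I C') (Fmor (grothendieck_map I C \<Phi>) u)"
      using u by (simp add: e grothendieck_map_def)
  qed
  have s': "snd (hocolim_map (\<lambda>i. nerve_map (CO C' i) (\<Phi> i)) n s) = snd s"
    by (simp add: hocolim_map_def split_beta)
  show ?thesis
    unfolding nerve_map_nsimplex[OF eta vone]
    unfolding C'.eta_def fan_simplex_def s'
  proof (rule nsimplex_cong, goal_cases)
    case (1 k)
    then show ?case using E.obj[of k] by (simp add: C.eta_simps grothendieck_map_def bicolumn_natural[OF s] n)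
  next
    case (2 k l)
    then show ?case
      using E.mor[of k l] by (simp add: C.eta_simps grothendieck_map_def bicolumn_natural[OF s] n)
  next
    case (3 k l m)
    then have le: "k \<le> m" "l \<le> n" "k \<le> n" by auto
    have "composable (grothendieck I C) (Fmor (C.eta n s) (k, l)) (Fmor (C.eta n s) (l, m))"
      using 3 le by (simp add: composable_def del: C.GC_src C.GC_trg)
    then show ?case
      using 3 le E.comp[of k l m] by (simp add: C.eta_simps grothendieck_map_def bicolumn_natural[OF s] n Y.pull_col_simps)
  next
    case (4 k)
    then show ?case
      using E.unit[of k] E.obj[of k] by (simp add: C.eta_simps grothendieck_map_def bicolumn_natural[OF s] n)
  qed
qed

end

theorem theorem7p3:
  fixes I :: "('i, 'a) small_cat"
  assumes "small_category I"
  shows "\<exists>\<eta> :: ('i, 'a, 'o, 'm, 't) bicat_diagram \<Rightarrow> nat \<Rightarrow>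
           ('i, 'a, (nat, nat \<times> nat, nat \<times> nat, 'o, 'm, 't) lax) hocolim_simplex \<Rightarrow>
           (nat, nat \<times> nat, nat \<times> nat, 'o \<times> 'i, 'o \<times> 'm \<times> 'a, 'o \<times> 't \<times> 'a) lax.
    (\<forall>C. diagram I C \<longrightarrow>
      sset_weak_equivalence (hocolim I (nerve_diagram I C)) (nerve (grothendieck I C)) (\<eta> C)) \<and>
    (\<forall>C C' \<Phi>. diagram_map I C C' \<Phi> \<longrightarrow>
      (\<forall>n. \<forall>s \<in> Sim (hocolim I (nerve_diagram I C)) n.
        nerve_map (grothendieck I C') (grothendieck_map I C \<Phi>) n (\<eta> C n s) =
        \<eta> C' n (hocolim_map (\<lambda>i. nerve_map (CO C' i) (\<Phi> i)) n s)))"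
proof (intro exI[of _ "diagram.eta I"] conjI allI impI ballI)
  \<comment> \<open>The witness \<open>diagram.eta I\<close> is one function of the diagram, given
    by the same formula for every \<open>C\<close>; the naturality half compares its values at
    \<open>C\<close> and \<open>C'\<close>.\<close>
  fix C :: "('i, 'a, 'o, 'm, 't) bicat_diagram"
  assume "diagram I C"
  then show "sset_weak_equivalence (hocolim I (nerve_diagram I C)) (nerve (grothendieck I C)) (diagram.eta I C)"
    by (rule diagram.sset_weak_equivalence_eta)
next
  fix C C' :: "('i, 'a, 'o, 'm, 't) bicat_diagram" and \<Phi> n s
  assume "diagram_map I C C' \<Phi>" and s: "s \<in> Sim (hocolim I (nerve_diagram I C)) n"
  then interpret diagram_map I C C' \<Phi> by simp
  show "nerve_map (grothendieck I C') (grothendieck_map I C \<Phi>) n (diagram.eta I C n s) =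
      diagram.eta I C' n (hocolim_map (\<lambda>i. nerve_map (CO C' i) (\<Phi> i)) n s)"
    using eta_natural s C.Sim_hocolim by simp
qed

end
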